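(* Let $N\ge1$, $k\ge1$ be integers, $1<p<\infty$, $q=p/(p-1)$, $\kappa_0>0$ and $\theta_0\in(0,1]$. Let $\Omega_h$ be a conforming simplicial mesh of $\Omega\subset\mathbb{R}^N$ with $|M_K|\,|M_K^{-1}|\le\kappa_0$ for all $K\in\Omega_h$. Let $\beta$ be an advection field that is constant on each element, $\beta|_K\equiv\beta_K\in\mathbb{R}^N\setminus\{0\}$, with continuous normal component across element interfaces. Suppose that either $k=1$, or $|\beta_K\cdot n_i|\ge\theta_0|\beta_K|$ for every $K\in\Omega_h$ and every facet $F_i$ of $K$. Let $\varPi_K^+,\varPi_K^{++},\varPi_h^{++}$ and $V(K),V^+(K),V^{++}(K)$ be as defined in the context. Then: (a) For every $k\ge1$, $\varPi_K^{++}$ maps $W_q(\partial_\beta,K)$ into $V^{++}(K)$; it satisfies $\langle D_Kw,\varPi_K^{++}v-v\rangle=0$ for all $w\in P_k^\perp(K)$ and $(z,\varPi_K^{++}v-v)_K=0$ for all $z\in P_{k-2}(K)$; and for $c\in P_0(K)$ and $v\in W_q(\partial_\beta,K)$, $$\varPi_K^{++}c=c,\qquad (c,\varPi_K^{++}v-v)_K=0.$$ The global Fortin property holds: $\mathcal b((w,\mu),\varPi_h^{++}v-v)=0$ for all $v\in W_q(\partial_\beta,\Omega_h)$ and all $(w,\mu)\in P_{k-1}(\Omega_h)\times\hat X_h^k$. Moreover, if $k\ge2$ then $\varPi_K^{++}=\varPi_K^+$ and $V^{++}(K)=V^+(K)$, while if $k=1$ and $N\ge2$ then $V^{++}(K)=V(K)\oplus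 P_0(K)\oplus\operatorname{span}\{b\}$. (b) If $k=1$, there is a constant $C=C(N,q,\kappa_0)$ such that for all $K\in\Omega_h$ and $v\in W_q(\partial_\beta,K)$, with $a_K:=h_K/|\beta_K|$, $$\|\varPi_K^{++}v\|_{L_q(K)}\le C\big(\|v\|_{L_q(K)}+a_K\|\beta\cdot\nabla v\|_{L_q(K)}\big),\qquad \|\beta\cdot\nabla\varPi_K^{++}v\|_{L_q(K)}\le C\|\beta\cdot\nabla v\|_{L_q(K)},$$ and, for every choice of per-element weights $\sigma_K\ge a_K$, $$\sigma_K^{-1}\|\varPi_K^{++}v\|_{L_q(K)}+\|\beta\cdot\nabla\varPi_K^{++}v\|_{L_q(K)}\le C\big(\sigma_K^{-1}\|v\|_{L_q(K)}+\|\beta\cdot\nabla v\|_{L_q(K)}\big).$$ (c) For $k\ge1$ there is a constant $C=C(N,k,q,\theta_0,\kappa_0)$, independent of $\theta_0$ when $k=1$, such that $|\!|\!|\varPi_K^{++}v|\!|\!|_{q,K}\le C|\!|\!|v|\!|\!|_{q,K}$ for all $K\in\Omega_h$, $v\in W_q(\partial_\beta,K)$. Consequently $|\!|\!|\varPi_h^{++}v|\!|\!|_{q,\Omega_h}\le C|\!|\!|v|\!|\!|_{q,\Omega_h}$ for all $v\in W_q(\partial_\beta,\Omega_h)$.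
   Context: $\Omega\subset\mathbb{R}^N$ is a Lipschitz polyhedral domain. $\hat K$ is the unit reference $N$-simplex with vertices $\hat a_0,\dots,\hat a_N$. Each element $K\in\Omega_h$, with vertices $a_0,\dots,a_N$, is the image of $\hat K$ under an affine homeomorphism $\Phi_K(\hat x)=M_K\hat x+g_K$ mapping $\hat a_i$ to $a_i$; $h_K=\operatorname{diam}K$. $|\cdot|$ is the Euclidean norm of vectors and the associated matrix norm. $\lambda_0,\dots,\lambda_N$ are the barycentric coordinates of $K$, $F_i$ is the facet of $K$ opposite $a_i$, and $n_i$ is the outward unit normal on $F_i$. All constants $C$ are independent of the mesh and of $\beta$, apart from the listed dependencies. $(\cdot,\cdot)_K$ is the $L_2(K)$ pairing $(f,g)_K=\int_K fg\,dx$. $W_r(\partial_\beta,K)=\{v\in L_r(K):\beta\cdot\nabla v\in L_r(K)\}$ and $W_r(\partial_\beta,\Omega_h)=\prod_{K\in\Omega_h}W_r(\partial_\beta,K)$. For $w\in W_p(\partial_\beta,K)$, $v\in W_q(\partial_\beta,K)$ let $\langle D_Kw,v\rangle=(\beta\cdot\nabla w,v)_K+(w,\beta\cdot\nabla v)_K$. $P_j(K)$ is the space of polynomials of degree at most $j$ on $K$ ($\{0\}$ if $j<0$); $P_j(\Omega_h)=\prod_KP_j(K)$. $\mathring P_j(K)=\{z\in P_j(K):z|_{\partial K}=0\}$, which is $\{0\}$ for $0\le j\le N$; $P_j^\perp(K)$ is the $L_2(K)$-orthogonal complement of $\mathring P_j(K)$ in $P_j(K)$. $S_h^k=P_k(\Omega_h)\cap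 C(\overline\Omega)$; for $z\in S_h^k$, $D_hz$ is the functional on $W_q(\partial_\beta,\Omega_h)$ given by $\langle D_hz,v\rangle=\sum_K\langle D_K(z|_K),v|_K\rangle$; $\hat X_h^k=D_h(S_h^k)$. The bilinear form is $\mathcal b((w,\mu),v)=\langle\mu,v\rangle-\sum_K(w,\beta\cdot\nabla v)_K$. Bubbles: $b=\prod_{j=0}^N\lambda_j$, $b_i=\prod_{j\ne i}\lambda_j$. Signs: $s_i=\operatorname{sgn}(\beta_K\cdot n_i)\in\{-1,0,1\}$, $b_s=\sum_{i=0}^N s_ib_i$. Spaces: $V(K)=b_sP_k^\perp(K)+b\,P_{k-2}(K)$, $V^+(K)=V(K)+P_0(K)$, $V^{++}(K)=V^+(K)+\operatorname{span}\{b\}$. Operators: under the stated hypotheses, for every $v\in W_q(\partial_\beta,K)$ there is a unique $\varPi_Kv\in V(K)$ with $\langle D_Kw,\varPi_Kv-v\rangle=0$ for all $w\in P_k^\perp(K)$ and $(z,\varPi_Kv-v)_K=0$ for all $z\in P_{k-2}(K)$. With $\bar v$ the mean value of $v$ over $K$, $\varPi_K^+v=\bar v+\varPi_K(v-\bar v)$ and $$\varPi_K^{++}v=\varPi_K^+v+\frac{(v-\varPi_K^+v,1)_K}{(b,1)_K}\,b,\qquad(\varPi_h^{++}v)|_K=\varPi_K^{++}(v|_K).$$ Norms: $|\!|\!|v|\!|\!|_{q,K}=\|v\|_{L_q(K)}+\frac{h_K}{|\beta_K|}\|\beta\cdot\nabla v\|_{L_q(K)}$ and $|\!|\!|v|\!|\!|_{q,\Omega_h}^q=\sum_{K}|\!|\!|v|\!|\!|_{q,K}^q$.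 *)

theory Defs
  imports "HOL-Analysis.Analysis"
begin

section \<open>Domains\<close>

text \<open>Near each boundary point, in a coordinate frame whose last axis is the unit vector \<open>e\<close>,
  the domain is the strict epigraph of a Lipschitz function on the hyperplane orthogonal
  to \<open>e\<close>.\<close>

definition lipschitz_domain :: "(real^'n) set \<Rightarrow> bool" where
  "lipschitz_domain \<Omega> \<longleftrightarrow>
     open \<Omega> \<and> connected \<Omega> \<and> bounded \<Omega> \<and> \<Omega> \<noteq> {} \<and>
     (\<forall>x\<in>frontier \<Omega>. \<exists>e r L \<gamma>. norm e = 1 \<and> r > 0 \<and> L-lipschitz_on {y. y \<bullet> e = 0} \<gamma> \<and>
        \<Omega> \<inter> ball x r = {y \<in> ball x r. \<gamma> (y - (y \<bullet> e) *\<^sub>R e) < y \<bullet> e})"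

definition lipschitz_polyhedral_domain :: "(real^'n) set \<Rightarrow> bool" where
  "lipschitz_polyhedral_domain \<Omega> \<longleftrightarrow>
     lipschitz_domain \<Omega> \<and> (\<exists>\<P>. finite \<P> \<and> (\<forall>P\<in>\<P>. polytope P) \<and> closure \<Omega> = \<Union>\<P>)"

section \<open>Simplices and meshes\<close>

text \<open>An element is given by its labelled vertices \<open>a\<^sub>0, \<dots>, a\<^sub>N\<close>, where \<open>N = CARD('n)\<close>. The index
  set is \<open>'n option\<close>: the index \<open>0\<close> is \<open>None\<close> and the indices \<open>1, \<dots>, N\<close> are the \<open>Some i\<close>.\<close>

type_synonym 'n lsimplex = "'n option \<Rightarrow> real^'n"

definition body :: "('n::finite) lsimplex \<Rightarrow> (real^'n) set" where
  "body K = convex hull (range K)"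

definition ref_simplex :: "('n::finite) lsimplex" where
  "ref_simplex i = (case i of None \<Rightarrow> 0 | Some j \<Rightarrow> axis j 1)"

text \<open>The matrix \<open>M\<^sub>K\<close> of the affine map \<open>\<Phi>\<^sub>K\<close>, whose columns are the edge vectors
  \<open>a\<^sub>j - a\<^sub>0\<close>; here \<open>g\<^sub>K = a\<^sub>0\<close>.\<close>

definition elem_matrix :: "('n::finite) lsimplex \<Rightarrow> real^'n^'n" where
  "elem_matrix K = (\<chi> r c. (K (Some c) - K None) $ r)"

definition elem_map :: "('n::finite) lsimplex \<Rightarrow> real^'n \<Rightarrow> real^'n" where
  "elem_map K x = elem_matrix K *v x + K None"

lemma elem_map_ref_simplex: "elem_map K (ref_simplex i) = K i"
proof (cases i)
  case None
  then show ?thesis by (simp add: elem_map_def ref_simplex_def)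
next
  case (Some j)
  then show ?thesis
    by (simp add: elem_map_def ref_simplex_def elem_matrix_def matrix_vector_mult_basis
        column_def vec_eq_iff)
qed

lemma body_eq_image_elem_map: "body K = elem_map K ` body ref_simplex"
proof -
  have "elem_map K ` (convex hull range ref_simplex)
      = (+) (K None) ` ((*v) (elem_matrix K) ` (convex hull range ref_simplex))"
    by (auto simp: elem_map_def image_image add.commute)
  also have "\<dots> = convex hull ((+) (K None) ` ((*v) (elem_matrix K) ` range ref_simplex))"
    by (simp add: convex_hull_linear_image convex_hull_translation)
  also have "(+) (K None) ` ((*v) (elem_matrix K) ` range ref_simplex) = range K"
    by (simp add: image_image add.commute[of "K None"] elem_map_ref_simplex[unfolded elem_map_def])
  finally show ?thesis by (simp add: body_def)
qed

definition matrix_norm :: "real^'n^'n \<Rightarrow> real" where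
  "matrix_norm A = onorm ((*v) A)"

definition elem_diam :: "('n::finite) lsimplex \<Rightarrow> real" where
  "elem_diam K = diameter (body K)"

definition facet :: "('n::finite) lsimplex \<Rightarrow> 'n option \<Rightarrow> (real^'n) set" where
  "facet K i = convex hull (K ` (UNIV - {i}))"

definition outer_normal :: "('n::finite) lsimplex \<Rightarrow> 'n option \<Rightarrow> real^'n" where
  "outer_normal K i = (THE n. norm n = 1 \<and>
     (\<forall>x\<in>facet K i. \<forall>y\<in>facet K i. n \<bullet> (x - y) = 0) \<and> (\<forall>x\<in>facet K i. n \<bullet> (K i - x) < 0))"

text \<open>Barycentric coordinates are defined on the whole space, as affine functions.\<close>

definition bary :: "('n::finite) lsimplex \<Rightarrow> 'n option \<Rightarrow> real^'n \<Rightarrow> real" where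
  "bary K i x = (THE c. (\<Sum>j\<in>UNIV. c j) = 1 \<and> (\<Sum>j\<in>UNIV. c j *\<^sub>R K j) = x) i"

definition conforming_mesh :: "(real^'n) set \<Rightarrow> ('n::finite) lsimplex set \<Rightarrow> bool" where
  "conforming_mesh \<Omega> \<T> \<longleftrightarrow>
     finite \<T> \<and> (\<forall>K\<in>\<T>. invertible (elem_matrix K)) \<and> inj_on body \<T> \<and>
     (\<Union>K\<in>\<T>. body K) = closure \<Omega> \<and>
     (\<forall>K\<in>\<T>. \<forall>L\<in>\<T>. (body K \<inter> body L) face_of body K)"

text \<open>The piecewise constant field is given by its values \<open>\<beta>\<^sub>K\<close>. In a conforming mesh the interfaces
  are the facets shared by two elements.\<close>

definition advection_field :: "('n::finite) lsimplex set \<Rightarrow> ('n lsimplex \<Rightarrow> real^'n) \<Rightarrow> bool" where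
  "advection_field \<T> \<beta> \<longleftrightarrow>
     (\<forall>K\<in>\<T>. \<beta> K \<noteq> 0) \<and>
     (\<forall>K\<in>\<T>. \<forall>L\<in>\<T>. \<forall>i j. facet K i = facet L j \<longrightarrow>
        \<beta> K \<bullet> outer_normal K i = \<beta> L \<bullet> outer_normal K i)"

definition setting ::
  "nat \<Rightarrow> real \<Rightarrow> real \<Rightarrow> (real^'n) set \<Rightarrow> ('n::finite) lsimplex set \<Rightarrow> ('n lsimplex \<Rightarrow> real^'n) \<Rightarrow> bool" where
  "setting k \<kappa>\<^sub>0 \<theta>\<^sub>0 \<Omega> \<T> \<beta> \<longleftrightarrow>
     lipschitz_polyhedral_domain \<Omega> \<and> conforming_mesh \<Omega> \<T> \<and>
     (\<forall>K\<in>\<T>. matrix_norm (elem_matrix K) * matrix_norm (matrix_inv (elem_matrix K)) \<le> \<kappa>\<^sub>0) \<and>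
     advection_field \<T> \<beta> \<and>
     (k = 1 \<or> (\<forall>K\<in>\<T>. \<forall>i. \<bar>\<beta> K \<bullet> outer_normal K i\<bar> \<ge> \<theta>\<^sub>0 * norm (\<beta> K)))"

section \<open>Lebesgue and graph spaces\<close>

text \<open>Elements of \<open>L\<^sub>r(S)\<close> are represented by functions on the whole space; only their values almost
  everywhere on \<open>S\<close> matter.\<close>

definition Lr_space :: "real \<Rightarrow> (real^'n) set \<Rightarrow> (real^'n \<Rightarrow> real) set" where
  "Lr_space r S = {f. f \<in> borel_measurable (lebesgue_on S) \<and>
                      integrable (lebesgue_on S) (\<lambda>x. \<bar>f x\<bar> powr r)}"

definition Lr_norm :: "real \<Rightarrow> (real^'n) set \<Rightarrow> (real^'n \<Rightarrow> real) \<Rightarrow> real" where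
  "Lr_norm r S f = (\<integral>x. \<bar>f x\<bar> powr r \<partial>(lebesgue_on S)) powr (1 / r)"

definition pairing :: "(real^'n) set \<Rightarrow> (real^'n \<Rightarrow> real) \<Rightarrow> (real^'n \<Rightarrow> real) \<Rightarrow> real" where
  "pairing S f g = (\<integral>x. f x * g x \<partial>(lebesgue_on S))"

definition mean :: "(real^'n) set \<Rightarrow> (real^'n \<Rightarrow> real) \<Rightarrow> real" where
  "mean S v = (\<integral>x. v x \<partial>(lebesgue_on S)) / measure lebesgue S"

fun C_diff :: "nat \<Rightarrow> (real^'n \<Rightarrow> real) \<Rightarrow> bool" where
  "C_diff 0 f \<longleftrightarrow> continuous_on UNIV f"
| "C_diff (Suc m) f \<longleftrightarrow> (\<forall>x. f differentiable (at x)) \<and>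
     (\<forall>i. C_diff m (\<lambda>x. frechet_derivative f (at x) (axis i 1)))"

definition test_functions :: "(real^'n) set \<Rightarrow> (real^'n \<Rightarrow> real) set" where
  "test_functions U = {\<phi>. (\<forall>m. C_diff m \<phi>) \<and>
     compact (closure {x. \<phi> x \<noteq> 0}) \<and> closure {x. \<phi> x \<noteq> 0} \<subseteq> U}"

text \<open>\<open>g\<close> is a distributional derivative \<open>b \<cdot> \<nabla>v\<close> on the interior of \<open>S\<close>, for a constant vector \<open>b\<close>.\<close>

definition is_weak_dderiv ::
  "real^'n \<Rightarrow> (real^'n) set \<Rightarrow> (real^'n \<Rightarrow> real) \<Rightarrow> (real^'n \<Rightarrow> real) \<Rightarrow> bool" where
  "is_weak_dderiv b S v g \<longleftrightarrow>
     (\<forall>A. compact A \<and> A \<subseteq> interior S \<longrightarrow> g absolutely_integrable_on A) \<and>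
     (\<forall>\<phi>\<in>test_functions (interior S).
        (\<integral>x. v x * frechet_derivative \<phi> (at x) b \<partial>(lebesgue_on S))
          = - (\<integral>x. g x * \<phi> x \<partial>(lebesgue_on S)))"

text \<open>The weak derivative is unique up to null sets; this picks a representative.\<close>

definition weak_dderiv :: "real^'n \<Rightarrow> (real^'n) set \<Rightarrow> (real^'n \<Rightarrow> real) \<Rightarrow> real^'n \<Rightarrow> real" where
  "weak_dderiv b S v = (SOME g. is_weak_dderiv b S v g)"

definition W_space :: "real \<Rightarrow> real^'n \<Rightarrow> ('n::finite) lsimplex \<Rightarrow> (real^'n \<Rightarrow> real) set" where
  "W_space r b K = {v \<in> Lr_space r (body K). \<exists>g\<in>Lr_space r (body K). is_weak_dderiv b (body K) v g}"

text \<open>Elements of product spaces over the mesh are families indexed by the elements.\<close>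

type_synonym 'n broken = "'n lsimplex \<Rightarrow> real^'n \<Rightarrow> real"

definition W_mesh ::
  "real \<Rightarrow> ('n lsimplex \<Rightarrow> real^'n) \<Rightarrow> ('n::finite) lsimplex set \<Rightarrow> 'n broken set" where
  "W_mesh r \<beta> \<T> = (\<Pi> K\<in>\<T>. W_space r (\<beta> K) K)"

definition D_elem ::
  "real^'n \<Rightarrow> ('n::finite) lsimplex \<Rightarrow> (real^'n \<Rightarrow> real) \<Rightarrow> (real^'n \<Rightarrow> real) \<Rightarrow> real" where
  "D_elem b K w v = pairing (body K) (weak_dderiv b (body K) w) v
                  + pairing (body K) w (weak_dderiv b (body K) v)"

definition W_norm :: "real \<Rightarrow> real^'n \<Rightarrow> ('n::finite) lsimplex \<Rightarrow> (real^'n \<Rightarrow> real) \<Rightarrow> real" where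
  "W_norm q b K v = Lr_norm q (body K) v
     + elem_diam K / norm b * Lr_norm q (body K) (weak_dderiv b (body K) v)"

definition W_mesh_norm ::
  "real \<Rightarrow> ('n lsimplex \<Rightarrow> real^'n) \<Rightarrow> ('n::finite) lsimplex set \<Rightarrow> 'n broken \<Rightarrow> real" where
  "W_mesh_norm q \<beta> \<T> v = (\<Sum>K\<in>\<T>. W_norm q (\<beta> K) K (v K) powr q) powr (1 / q)"

section \<open>Polynomial spaces\<close>

text \<open>Since elements have nonempty interior, a polynomial on an element is identified with its
  unique polynomial extension to the whole space, so \<open>P\<^sub>j(K)\<close> does not mention \<open>K\<close>. The degree is an
  integer, and the index set below is empty if it is negative.\<close>

definition poly_space :: "int \<Rightarrow> (real^'n \<Rightarrow> real) set" where
  "poly_space j = {f. \<exists>c :: ('n \<Rightarrow> nat) \<Rightarrow> real.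
     f = (\<lambda>x. \<Sum>\<alpha> | int (\<Sum>i\<in>UNIV. \<alpha> i) \<le> j. c \<alpha> * (\<Prod>i\<in>UNIV. x $ i ^ \<alpha> i))}"

definition poly_space0 :: "int \<Rightarrow> ('n::finite) lsimplex \<Rightarrow> (real^'n \<Rightarrow> real) set" where
  "poly_space0 j K = {z \<in> poly_space j. \<forall>x\<in>frontier (body K). z x = 0}"

definition poly_perp :: "int \<Rightarrow> ('n::finite) lsimplex \<Rightarrow> (real^'n \<Rightarrow> real) set" where
  "poly_perp j K = {w \<in> poly_space j. \<forall>z\<in>poly_space0 j K. pairing (body K) w z = 0}"

definition poly_mesh :: "int \<Rightarrow> ('n::finite) lsimplex set \<Rightarrow> 'n broken set" where
  "poly_mesh j \<T> = (\<Pi> K\<in>\<T>. poly_space j)"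

definition S_mesh :: "int \<Rightarrow> (real^'n) set \<Rightarrow> ('n::finite) lsimplex set \<Rightarrow> 'n broken set" where
  "S_mesh k \<Omega> \<T> = {z \<in> poly_mesh k \<T>.
     \<exists>u. continuous_on (closure \<Omega>) u \<and> (\<forall>K\<in>\<T>. \<forall>x\<in>body K. z K x = u x)}"

definition D_mesh ::
  "('n lsimplex \<Rightarrow> real^'n) \<Rightarrow> ('n::finite) lsimplex set \<Rightarrow> 'n broken \<Rightarrow> 'n broken \<Rightarrow> real" where
  "D_mesh \<beta> \<T> z v = (\<Sum>K\<in>\<T>. D_elem (\<beta> K) K (z K) (v K))"

definition Xhat ::
  "int \<Rightarrow> (real^'n) set \<Rightarrow> ('n lsimplex \<Rightarrow> real^'n) \<Rightarrow> ('n::finite) lsimplex set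
     \<Rightarrow> ('n broken \<Rightarrow> real) set" where
  "Xhat k \<Omega> \<beta> \<T> = D_mesh \<beta> \<T> ` S_mesh k \<Omega> \<T>"

definition bform ::
  "('n lsimplex \<Rightarrow> real^'n) \<Rightarrow> ('n::finite) lsimplex set
     \<Rightarrow> 'n broken \<times> ('n broken \<Rightarrow> real) \<Rightarrow> 'n broken \<Rightarrow> real" where
  "bform \<beta> \<T> = (\<lambda>(w, \<mu>) v.
     \<mu> v - (\<Sum>K\<in>\<T>. pairing (body K) (w K) (weak_dderiv (\<beta> K) (body K) (v K))))"

section \<open>Bubbles and local test spaces\<close>

definition bubble :: "('n::finite) lsimplex \<Rightarrow> real^'n \<Rightarrow> real" where
  "bubble K x = (\<Prod>j\<in>UNIV. bary K j x)"

definition facet_bubble :: "('n::finite) lsimplex \<Rightarrow> 'n option \<Rightarrow> real^'n \<Rightarrow> real" where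
  "facet_bubble K i x = (\<Prod>j\<in>UNIV - {i}. bary K j x)"

definition sign_bubble :: "real^'n \<Rightarrow> ('n::finite) lsimplex \<Rightarrow> real^'n \<Rightarrow> real" where
  "sign_bubble b K x = (\<Sum>i\<in>UNIV. sgn (b \<bullet> outer_normal K i) * facet_bubble K i x)"

definition span_bubble :: "('n::finite) lsimplex \<Rightarrow> (real^'n \<Rightarrow> real) set" where
  "span_bubble K = {\<lambda>x. t * bubble K x | t. True}"

definition V :: "nat \<Rightarrow> real^'n \<Rightarrow> ('n::finite) lsimplex \<Rightarrow> (real^'n \<Rightarrow> real) set" where
  "V k b K = {\<lambda>x. sign_bubble b K x * w x + bubble K x * z x | w z.
     w \<in> poly_perp (int k) K \<and> z \<in> poly_space (int k - 2)}"

definition Vp :: "nat \<Rightarrow> real^'n \<Rightarrow> ('n::finite) lsimplex \<Rightarrow> (real^'n \<Rightarrow> real) set" where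
  "Vp k b K = {\<lambda>x. u x + c x | u c. u \<in> V k b K \<and> c \<in> poly_space 0}"

definition Vpp :: "nat \<Rightarrow> real^'n \<Rightarrow> ('n::finite) lsimplex \<Rightarrow> (real^'n \<Rightarrow> real) set" where
  "Vpp k b K = {\<lambda>x. u x + t x | u t. u \<in> Vp k b K \<and> t \<in> span_bubble K}"

section \<open>Fortin operators\<close>

definition Pi_elem ::
  "nat \<Rightarrow> real^'n \<Rightarrow> ('n::finite) lsimplex \<Rightarrow> (real^'n \<Rightarrow> real) \<Rightarrow> real^'n \<Rightarrow> real" where
  "Pi_elem k b K v = (THE u. u \<in> V k b K \<and>
     (\<forall>w\<in>poly_perp (int k) K. D_elem b K w (\<lambda>x. u x - v x) = 0) \<and>
     (\<forall>z\<in>poly_space (int k - 2). pairing (body K) z (\<lambda>x. u x - v x) = 0))"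

definition Pip_elem ::
  "nat \<Rightarrow> real^'n \<Rightarrow> ('n::finite) lsimplex \<Rightarrow> (real^'n \<Rightarrow> real) \<Rightarrow> real^'n \<Rightarrow> real" where
  "Pip_elem k b K v =
     (\<lambda>x. mean (body K) v + Pi_elem k b K (\<lambda>y. v y - mean (body K) v) x)"

definition Pipp_elem ::
  "nat \<Rightarrow> real^'n \<Rightarrow> ('n::finite) lsimplex \<Rightarrow> (real^'n \<Rightarrow> real) \<Rightarrow> real^'n \<Rightarrow> real" where
  "Pipp_elem k b K v =
     (\<lambda>x. Pip_elem k b K v x
        + pairing (body K) (\<lambda>y. v y - Pip_elem k b K v y) (\<lambda>_. 1)
            / pairing (body K) (bubble K) (\<lambda>_. 1) * bubble K x)"

definition Pipp_mesh :: "nat \<Rightarrow> (('n::finite) lsimplex \<Rightarrow> real^'n) \<Rightarrow> 'n broken \<Rightarrow> 'n broken" where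
  "Pipp_mesh k \<beta> v = (\<lambda>K. Pipp_elem k (\<beta> K) K (v K))"

end

(*
  All spaces on an element are finite-dimensional, so the operator is found by solving two positive
  definite problems. For u = b_s w + b z and polynomial f, the pairing <D f, u> is the integral over
  K of the derivative of b_s f w along beta, because b vanishes on the boundary. By the divergence
  theorem this is a sum over the facets of |grad lambda_i . beta| times a semidefinite form in the
  traces of f and w. It is definite on the complement of the interior bubbles if no facet is
  characteristic, and for k = 1 always, since two facets carry flux and together contain all vertices.
  Then z is determined by the form (b z', z).

  Surface integrals are avoided: the trace on F_i is extended to K constantly along an edge at a_i,
  and the divergence theorem reduces to the vanishing of integrals of derivatives of polynomials
  that vanish on the facets to which the direction is not tangential. The latter, and the pairing of
  graph space functions with polynomials vanishing on the boundary, follow by smooth cutoffs.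

  For the bounds all polynomials are measured in the maximum norm, data enter through L_1 averages,
  and the constants come from orthonormal bases on the reference simplex; averages of polynomials
  are affine invariant. For k = 1 and v of mean zero, <D f, v> = (f, beta . grad v), which gives the
  bound of the derivative by the derivative alone.
*)

theory Submission
  imports Defs
begin

section \<open>Polynomials\<close>

definition mon :: "('n \<Rightarrow> nat) \<Rightarrow> real^'n \<Rightarrow> real" where
  "mon \<alpha> x = (\<Prod>i\<in>UNIV. x $ i ^ \<alpha> i)"

definition mdeg :: "('n::finite \<Rightarrow> nat) \<Rightarrow> nat" where
  "mdeg \<alpha> = (\<Sum>i\<in>UNIV. \<alpha> i)"

lemma poly_space_iff:
  "f \<in> poly_space j \<longleftrightarrow> (\<exists>c. f = (\<lambda>x. \<Sum>\<alpha> | int (mdeg \<alpha>) \<le> j. c \<alpha> * mon \<alpha> x))"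
  by (simp add: poly_space_def mdeg_def mon_def)

lemma finite_mdeg: "finite {\<alpha> :: 'n::finite \<Rightarrow> nat. int (mdeg \<alpha>) \<le> j}"
proof (rule finite_subset)
  show "{\<alpha> :: 'n \<Rightarrow> nat. int (mdeg \<alpha>) \<le> j} \<subseteq> (\<Pi>\<^sub>E i\<in>UNIV. {..nat j})"
  proof
    fix \<alpha> :: "'n \<Rightarrow> nat" assume "\<alpha> \<in> {\<alpha>. int (mdeg \<alpha>) \<le> j}"
    then have "mdeg \<alpha> \<le> nat j" by auto
    moreover have "\<alpha> i \<le> mdeg \<alpha>" for i unfolding mdeg_def by (rule member_le_sum) auto
    ultimately show "\<alpha> \<in> (\<Pi>\<^sub>E i\<in>UNIV. {..nat j})" by (auto intro: le_trans)
  qed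
  show "finite (\<Pi>\<^sub>E i\<in>(UNIV::'n set). {..nat j})" by (rule finite_PiE) auto
qed

lemma poly_space_zero [simp]: "(\<lambda>x. 0) \<in> poly_space j"
  unfolding poly_space_iff by (rule exI[of _ "\<lambda>_. 0"]) simp

lemma poly_space_add: "f \<in> poly_space j \<Longrightarrow> g \<in> poly_space j \<Longrightarrow> (\<lambda>x. f x + g x) \<in> poly_space j"
proof -
  assume "f \<in> poly_space j" "g \<in> poly_space j"
  then obtain c d where "f = (\<lambda>x. \<Sum>\<alpha> | int (mdeg \<alpha>) \<le> j. c \<alpha> * mon \<alpha> x)"
     "g = (\<lambda>x. \<Sum>\<alpha> | int (mdeg \<alpha>) \<le> j. d \<alpha> * mon \<alpha> x)" unfolding poly_space_iff by blast
  then show ?thesis unfolding poly_space_iff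
    by (intro exI[of _ "\<lambda>\<alpha>. c \<alpha> + d \<alpha>"]) (simp add: sum.distrib distrib_right)
qed

lemma poly_space_cmult: "f \<in> poly_space j \<Longrightarrow> (\<lambda>x. r * f x) \<in> poly_space j"
proof -
  assume "f \<in> poly_space j"
  then obtain c where "f = (\<lambda>x. \<Sum>\<alpha> | int (mdeg \<alpha>) \<le> j. c \<alpha> * mon \<alpha> x)"
    unfolding poly_space_iff by blast
  then show ?thesis unfolding poly_space_iff
    by (intro exI[of _ "\<lambda>\<alpha>. r * c \<alpha>"]) (simp add: sum_distrib_left mult.assoc)
qed

lemma poly_space_uminus: "f \<in> poly_space j \<Longrightarrow> (\<lambda>x. - f x) \<in> poly_space j"
  using poly_space_cmult[of f j "-1"] by simp

lemma poly_space_diff: "f \<in> poly_space j \<Longrightarrow> g \<in> poly_space j \<Longrightarrow> (\<lambda>x. f x - g x) \<in> poly_space j"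
  using poly_space_add[of f j "\<lambda>x. - g x"] poly_space_uminus[of g j] by simp

lemma poly_space_sum:
  "(\<And>i. i \<in> I \<Longrightarrow> f i \<in> poly_space j) \<Longrightarrow> (\<lambda>x. \<Sum>i\<in>I. f i x) \<in> poly_space j"
  by (induction I rule: infinite_finite_induct) (auto intro: poly_space_add)

lemma mon_in_poly_space: 
  fixes \<alpha> :: "'n::finite \<Rightarrow> nat"
  assumes "int (mdeg \<alpha>) \<le> j" shows "mon \<alpha> \<in> poly_space j"
  unfolding poly_space_iff
  using assms by (intro exI[of _ "\<lambda>\<alpha>'. if \<alpha>' = \<alpha> then 1 else 0"] ext)
    (simp add: if_distrib[of "\<lambda>c. c * _"] sum.delta[OF finite_mdeg] cong: if_cong)

lemma poly_space_induct [consumes 1, case_names monomial add cmult zero]: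
  fixes f :: "real^'n::finite \<Rightarrow> real"
  assumes "f \<in> poly_space j"
    and m: "\<And>\<alpha>. int (mdeg \<alpha>) \<le> j \<Longrightarrow> P (mon \<alpha>)"
    and a: "\<And>f g. f \<in> poly_space j \<Longrightarrow> P f \<Longrightarrow> g \<in> poly_space j \<Longrightarrow> P g \<Longrightarrow> P (\<lambda>x. f x + g x)"
    and c: "\<And>r f. f \<in> poly_space j \<Longrightarrow> P f \<Longrightarrow> P (\<lambda>x. r * f x)"
    and z: "P (\<lambda>x. 0)"
  shows "P f"
proof -
  obtain c' where f: "f = (\<lambda>x. \<Sum>\<alpha> | int (mdeg \<alpha>) \<le> j. c' \<alpha> * mon \<alpha> x)"
    using assms(1) unfolding poly_space_iff by blast
  have "P (\<lambda>x. \<Sum>\<alpha>\<in>A. c' \<alpha> * mon \<alpha> x)" if "finite A" "A \<subseteq> {\<alpha>. int (mdeg \<alpha>) \<le> j}" for A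
    using that
  proof (induction A)
    case (insert \<alpha> A)
    have "(\<lambda>x. \<Sum>\<alpha>\<in>A. c' \<alpha> * mon \<alpha> x) \<in> poly_space j"
      using insert by (intro poly_space_sum poly_space_cmult mon_in_poly_space) auto
    moreover have "(\<lambda>x. c' \<alpha> * mon \<alpha> x) \<in> poly_space j"
      using insert by (intro poly_space_cmult mon_in_poly_space) auto
    ultimately have "P (\<lambda>x. (c' \<alpha> * mon \<alpha> x) + (\<Sum>\<alpha>\<in>A. c' \<alpha> * mon \<alpha> x))"
      using insert by (intro a c m mon_in_poly_space) auto
    then show ?case using insert by simp
  qed (use z in simp)
  from this[OF finite_mdeg order_refl] show ?thesis by (simp add: f)
qed

lemma poly_space_mono: 
  assumes "i \<le> j" "f \<in> poly_space i" shows "f \<in> poly_space j"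
  using assms(2,1)
  by (induction rule: poly_space_induct) (auto intro: poly_space_add poly_space_cmult mon_in_poly_space)

lemma poly_space_neg: "j < 0 \<Longrightarrow> f \<in> poly_space j \<longleftrightarrow> f = (\<lambda>x. 0)"
  by (auto simp: poly_space_iff)

lemma mdeg_eq_0: "mdeg \<alpha> = 0 \<longleftrightarrow> \<alpha> = (\<lambda>_. 0)"
  by (auto simp: mdeg_def)

lemma mon_0 [simp]: "mon (\<lambda>_. 0) x = 1"
  by (simp add: mon_def)

lemma poly_space_0: 
  fixes f :: "real^'n::finite \<Rightarrow> real"
  shows "f \<in> poly_space 0 \<longleftrightarrow> (\<exists>c. f = (\<lambda>x. c))"
proof -
  have "{\<alpha> :: 'n \<Rightarrow> nat. int (mdeg \<alpha>) \<le> 0} = {\<lambda>_. 0}" by (auto simp: mdeg_eq_0)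
  then have "f \<in> poly_space 0 \<longleftrightarrow> (\<exists>c :: ('n \<Rightarrow> nat) \<Rightarrow> real. f = (\<lambda>x. c (\<lambda>_. 0)))"
    unfolding poly_space_iff by simp
  also have "\<dots> \<longleftrightarrow> (\<exists>c. f = (\<lambda>x. c))" 
  proof (intro iffI; elim exE)
    fix c assume "f = (\<lambda>x. c)" then show "\<exists>c :: ('n \<Rightarrow> nat) \<Rightarrow> real. f = (\<lambda>x. c (\<lambda>_. 0))"
      by (intro exI[of _ "\<lambda>_. c"]) simp
  qed auto
  finally show ?thesis .
qed

lemma poly_space_const: "0 \<le> j \<Longrightarrow> (\<lambda>x. c) \<in> poly_space j"
  by (rule poly_space_mono[of 0]) (auto simp: poly_space_0)

lemma mon_add: "mon \<alpha> x * mon \<beta> x = mon (\<lambda>i. \<alpha> i + \<beta> i) x"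
  by (simp add: mon_def power_add prod.distrib)

lemma mdeg_add: "mdeg (\<lambda>i. \<alpha> i + \<beta> i) = mdeg \<alpha> + mdeg \<beta>"
  by (simp add: mdeg_def sum.distrib)

lemma poly_space_mult:
  assumes "f \<in> poly_space i" "g \<in> poly_space j"
  shows "(\<lambda>x. f x * g x) \<in> poly_space (i + j)"
  using assms(1)
proof (induction rule: poly_space_induct)
  case (monomial \<alpha>)
  note \<alpha> = monomial
  from assms(2) show ?case
  proof (induction rule: poly_space_induct)
    case (monomial \<beta>)
    then show ?case using \<alpha> by (simp add: mon_add mon_in_poly_space mdeg_add)
  next
    case (add f g) then show ?case by (simp add: distrib_left poly_space_add)
  next
    case (cmult r f) then show ?case using poly_space_cmult[of _ _ r] by (simp add: mult.left_commute)
  qed simp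
next
  case (add f g) then show ?case by (simp add: distrib_right poly_space_add)
next
  case (cmult r f) then show ?case using poly_space_cmult[of _ _ r] by (simp add: mult.assoc)
qed simp

lemma poly_space_prod:
  assumes "\<And>i. i \<in> I \<Longrightarrow> f i \<in> poly_space (d i)"
  shows "(\<lambda>x. \<Prod>i\<in>I. f i x) \<in> poly_space (\<Sum>i\<in>I. d i)"
  using assms
  by (induction I rule: infinite_finite_induct) (auto intro: poly_space_mult poly_space_const)

lemma poly_space_power: "f \<in> poly_space 1 \<Longrightarrow> (\<lambda>x. f x ^ n) \<in> poly_space (int n)"
proof (induction n)
  case (Suc n) then show ?case using poly_space_mult[of f 1 "\<lambda>x. f x ^ n" "int n"] by simp
qed (simp add: poly_space_const)

lemma poly_space_coord: "(\<lambda>x. x $ i) \<in> poly_space 1"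
proof -
  have "(\<lambda>x. x $ i) = mon (\<lambda>j. if j = i then 1 else 0)"
    by (auto simp: mon_def fun_eq_iff if_distrib[of "\<lambda>e. _ ^ e"] cong: if_cong)
  moreover have "mdeg (\<lambda>j. if j = i then 1 else 0) = 1" by (simp add: mdeg_def)
  ultimately show ?thesis by (simp add: mon_in_poly_space)
qed

lemma poly_space_inner: "(\<lambda>x. a \<bullet> x) \<in> poly_space 1"
  unfolding inner_vec_def by (intro poly_space_sum) (simp add: poly_space_cmult poly_space_coord)

lemma poly_space_affine: "(\<lambda>x. a \<bullet> x + c) \<in> poly_space 1"
  by (intro poly_space_add poly_space_inner poly_space_const) simp

lemma poly_space_compose:
  fixes f :: "real^'n::finite \<Rightarrow> real" and g :: "real^'m::finite \<Rightarrow> real^'n"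
  assumes "f \<in> poly_space j" and g: "\<And>i. (\<lambda>x. g x $ i) \<in> poly_space 1"
  shows "(\<lambda>x. f (g x)) \<in> poly_space j"
  using assms(1)
proof (induction rule: poly_space_induct)
  case (monomial \<alpha>)
  have "(\<lambda>x. mon \<alpha> (g x)) \<in> poly_space (\<Sum>i\<in>UNIV. int (\<alpha> i))"
    unfolding mon_def by (intro poly_space_prod poly_space_power g)
  then show ?case using monomial by (auto simp: mdeg_def intro: poly_space_mono)
qed (auto intro: poly_space_add poly_space_cmult)

definition dd :: "real^'n \<Rightarrow> (real^'n \<Rightarrow> real) \<Rightarrow> real^'n::finite \<Rightarrow> real" where
  "dd b f x = frechet_derivative f (at x) b"

lemma dd_eq: "(f has_derivative D) (at x) \<Longrightarrow> dd b f x = D b"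
  by (metis dd_def frechet_derivative_at)

lemma mon_Suc: "mon (\<alpha>(i := Suc (\<alpha> i))) x = x $ i * mon \<alpha> x"
proof -
  have "mon (\<alpha>(i := Suc (\<alpha> i))) x = (\<Prod>j\<in>UNIV. (if j = i then x $ i else 1) * x $ j ^ \<alpha> j)"
    unfolding mon_def by (rule prod.cong) auto
  then show ?thesis by (simp add: prod.distrib mon_def)
qed

lemma mdeg_Suc: "mdeg (\<alpha>(i := Suc (\<alpha> i))) = Suc (mdeg \<alpha>)"
proof -
  have "mdeg (\<alpha>(i := Suc (\<alpha> i))) = (\<Sum>j\<in>UNIV. (if j = i then 1 else 0) + \<alpha> j)"
    unfolding mdeg_def by (rule sum.cong) auto
  then show ?thesis by (simp add: sum.distrib mdeg_def)
qed

lemma mdeg_induct [case_names zero Suc]: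
  fixes \<alpha> :: "'n::finite \<Rightarrow> nat"
  assumes "P (\<lambda>_. 0)" "\<And>\<alpha> i. P \<alpha> \<Longrightarrow> P (\<alpha>(i := Suc (\<alpha> i)))"
  shows "P \<alpha>"
proof (induction "mdeg \<alpha>" arbitrary: \<alpha>)
  case 0 then show ?case using assms(1) by (simp add: mdeg_eq_0)
next
  case (Suc n)
  then obtain i where i: "\<alpha> i \<noteq> 0" by (metis mdeg_eq_0 nat.simps(3))
  define \<beta> where "\<beta> = \<alpha>(i := \<alpha> i - 1)"
  have eq: "\<alpha> = \<beta>(i := Suc (\<beta> i))" using i by (auto simp: \<beta>_def)
  then have "mdeg \<beta> = n" using Suc(2) mdeg_Suc[of \<beta> i] by simp
  then have "P \<beta>" using Suc(1) by simp
  then show ?case using assms(2) eq by metis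
qed

lemma mon_has_derivative:
  "\<exists>D. (\<forall>b. D b \<in> poly_space (int (mdeg \<alpha>) - 1)) \<and> (\<forall>x. (mon \<alpha> has_derivative (\<lambda>b. D b x)) (at x))"
proof (induction \<alpha> rule: mdeg_induct)
  case zero
  have "mon (\<lambda>_. 0) = (\<lambda>x. 1)" by auto
  then show ?case by (intro exI[of _ "\<lambda>_ _. 0"]) auto
next
  case (Suc \<alpha> i)
  then obtain D where D: "\<And>b. D b \<in> poly_space (int (mdeg \<alpha>) - 1)" 
      "\<And>x. (mon \<alpha> has_derivative (\<lambda>b. D b x)) (at x)" by blast
  have eq: "mon (\<alpha>(i := Suc (\<alpha> i))) = (\<lambda>x. x $ i * mon \<alpha> x)" using mon_Suc by blast
  have coord: "((\<lambda>x. x $ i) has_derivative (\<lambda>b. b $ i)) (at x)" for x :: "real^'a"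
    by (intro bounded_linear_imp_has_derivative bounded_linear_vec_nth)
  have "(\<lambda>x. x $ i * D b x + b $ i * mon \<alpha> x) \<in> poly_space (int (mdeg \<alpha>))" for b
    using poly_space_mult[OF poly_space_coord D(1), of i b]
    by (intro poly_space_add poly_space_cmult mon_in_poly_space) auto
  moreover have "((\<lambda>x. x $ i * mon \<alpha> x) has_derivative (\<lambda>b. x $ i * D b x + b $ i * mon \<alpha> x)) (at x)" for x
    by (intro has_derivative_mult coord D)
  ultimately show ?case unfolding eq mdeg_Suc
    by (intro exI[of _ "\<lambda>b x. x $ i * D b x + b $ i * mon \<alpha> x"]) simp
qed

lemma poly_has_derivative:
  fixes f :: "real^'n::finite \<Rightarrow> real"
  assumes "f \<in> poly_space j"
  shows "\<exists>D. (\<forall>b. D b \<in> poly_space (j - 1)) \<and> (\<forall>x. (f has_derivative (\<lambda>b. D b x)) (at x))"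
  using assms
proof (induction rule: poly_space_induct)
  case (monomial \<alpha>)
  then show ?case using mon_has_derivative[of \<alpha>] poly_space_mono[of "int (mdeg \<alpha>) - 1" "j - 1"] by fastforce
next
  case (add f g)
  then obtain D E where "\<And>b. D b \<in> poly_space (j - 1)" "\<And>x. (f has_derivative (\<lambda>b. D b x)) (at x)"
    "\<And>b. E b \<in> poly_space (j - 1)" "\<And>x. (g has_derivative (\<lambda>b. E b x)) (at x)" by blast
  then show ?case by (intro exI[of _ "\<lambda>b x. D b x + E b x"]) (auto intro: poly_space_add has_derivative_add)
next
  case (cmult r f)
  then obtain D where "\<And>b. D b \<in> poly_space (j - 1)" "\<And>x. (f has_derivative (\<lambda>b. D b x)) (at x)" by blast
  then show ?case by (intro exI[of _ "\<lambda>b x. r * D b x"]) (auto intro: poly_space_cmult has_derivative_mult_right)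
next
  case zero
  show ?case by (intro exI[of _ "\<lambda>_ _. 0"]) auto
qed

definition polyf :: "(real^'n::finite \<Rightarrow> real) \<Rightarrow> bool" where
  "polyf f \<longleftrightarrow> (\<exists>j. f \<in> poly_space j)"

lemma polyfI: "f \<in> poly_space j \<Longrightarrow> polyf f" by (auto simp: polyf_def)

lemma poly_space_common:
  assumes "polyf f" "polyf g" obtains j where "f \<in> poly_space j" "g \<in> poly_space j"
proof -
  obtain i j where "f \<in> poly_space i" "g \<in> poly_space j" using assms by (auto simp: polyf_def)
  then show ?thesis using that[of "max i j"] poly_space_mono[of i "max i j" f] poly_space_mono[of j "max i j" g] by simp
qed

lemma polyf_const [intro, simp]: "polyf (\<lambda>x. c)" using poly_space_const[of 0 c] by (rule polyfI) simp
lemma polyf_add [intro]: "polyf f \<Longrightarrow> polyf g \<Longrightarrow> polyf (\<lambda>x. f x + g x)"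
  by (erule (1) poly_space_common) (auto intro: polyfI poly_space_add)
lemma polyf_diff [intro]: "polyf f \<Longrightarrow> polyf g \<Longrightarrow> polyf (\<lambda>x. f x - g x)"
  by (erule (1) poly_space_common) (auto intro: polyfI poly_space_diff)
lemma polyf_mult [intro]: "polyf f \<Longrightarrow> polyf g \<Longrightarrow> polyf (\<lambda>x. f x * g x)"
  unfolding polyf_def using poly_space_mult by blast
lemma polyf_sum [intro]: "(\<And>i. i \<in> I \<Longrightarrow> polyf (f i)) \<Longrightarrow> polyf (\<lambda>x. \<Sum>i\<in>I. f i x)"
  by (induction I rule: infinite_finite_induct) auto
lemma polyf_prod [intro]: "(\<And>i. i \<in> I \<Longrightarrow> polyf (f i)) \<Longrightarrow> polyf (\<lambda>x. \<Prod>i\<in>I. f i x)"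
  by (induction I rule: infinite_finite_induct) auto
lemma polyf_power [intro]: "polyf f \<Longrightarrow> polyf (\<lambda>x. f x ^ n)"
  by (induction n) auto

lemma dd_has_derivative: 
  assumes "polyf f" shows "(f has_derivative (\<lambda>b. dd b f x)) (at x)"
proof -
  obtain D where D: "(f has_derivative (\<lambda>b. D b x)) (at x)"
    using assms poly_has_derivative unfolding polyf_def by blast
  then show ?thesis using dd_eq[OF D] by simp
qed

lemma poly_space_dd: "f \<in> poly_space j \<Longrightarrow> dd b f \<in> poly_space (j - 1)"
proof -
  assume "f \<in> poly_space j"
  then obtain D where D: "\<And>b. D b \<in> poly_space (j - 1)" "\<And>x. (f has_derivative (\<lambda>b. D b x)) (at x)"
    using poly_has_derivative by blast
  have "dd b f = D b" using dd_eq[OF D(2)] by auto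
  then show ?thesis using D by simp
qed

lemma polyf_dd [intro]: "polyf f \<Longrightarrow> polyf (dd b f)"
  by (meson polyf_def poly_space_dd)

lemma polyf_continuous: "polyf f \<Longrightarrow> continuous_on S f"
  by (meson dd_has_derivative has_derivative_continuous continuous_at_imp_continuous_on)

lemma dd_add: "polyf f \<Longrightarrow> polyf g \<Longrightarrow> dd b (\<lambda>x. f x + g x) x = dd b f x + dd b g x"
  by (rule dd_eq) (intro has_derivative_add dd_has_derivative)
lemma dd_diff: "polyf f \<Longrightarrow> polyf g \<Longrightarrow> dd b (\<lambda>x. f x - g x) x = dd b f x - dd b g x"
  by (rule dd_eq) (intro has_derivative_diff dd_has_derivative)
lemma dd_mult: "polyf f \<Longrightarrow> polyf g \<Longrightarrow> dd b (\<lambda>x. f x * g x) x = f x * dd b g x + dd b f x * g x"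
  by (rule dd_eq) (intro has_derivative_mult dd_has_derivative)
lemma dd_cmult: "polyf f \<Longrightarrow> dd b (\<lambda>x. r * f x) x = r * dd b f x"
  by (rule dd_eq) (intro has_derivative_mult_right dd_has_derivative)
lemma dd_const [simp]: "dd b (\<lambda>x. c) x = 0"
  by (rule dd_eq) (rule has_derivative_const)
lemma dd_sum: "(\<And>i. i \<in> I \<Longrightarrow> polyf (f i)) \<Longrightarrow> dd b (\<lambda>x. \<Sum>i\<in>I. f i x) x = (\<Sum>i\<in>I. dd b (f i) x)"
  by (rule dd_eq) (intro has_derivative_sum dd_has_derivative)
lemma dd_linear: 
  assumes "polyf f" shows "dd (a *\<^sub>R b + b') f x = a * dd b f x + dd b' f x"
proof -
  interpret linear "\<lambda>b. dd b f x" using dd_has_derivative[OF assms] has_derivative_linear by blast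
  show ?thesis by (simp add: add scale)
qed
lemma dd_affine [simp]: "dd b (\<lambda>x. a \<bullet> x + c) x = a \<bullet> b"
  by (rule dd_eq) (auto intro!: derivative_eq_intros)

lemma poly_line:
  fixes f :: "real^'n::finite \<Rightarrow> real"
  assumes "f \<in> poly_space j"
  shows "\<exists>P::real poly. \<forall>t. f (x + t *\<^sub>R d) = poly P t"
  using assms
proof (induction rule: poly_space_induct)
  case (monomial \<alpha>)
  show ?case 
    by (intro exI[of _ "\<Prod>i\<in>UNIV. [:x $ i, d $ i:] ^ \<alpha> i"]) (simp add: mon_def poly_prod)
next
  case (add f g)
  then obtain P Q where "\<forall>t. f (x + t *\<^sub>R d) = poly P t" "\<forall>t. g (x + t *\<^sub>R d) = poly Q t" by blast
  then show ?case by (intro exI[of _ "P + Q"]) simp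
next
  case (cmult r f)
  then obtain P where "\<forall>t. f (x + t *\<^sub>R d) = poly P t" by blast
  then show ?case by (intro exI[of _ "smult r P"]) simp
next
  case zero show ?case by (intro exI[of _ 0]) simp
qed

lemma polyf_zero_open:
  fixes f :: "real^'n::finite \<Rightarrow> real"
  assumes "polyf f" "open U" "U \<noteq> {}" and 0: "\<And>x. x \<in> U \<Longrightarrow> f x = 0"
  shows "f = (\<lambda>x. 0)"
proof
  fix y
  obtain x where x: "x \<in> U" using assms(3) by blast
  then obtain e where e: "e > 0" "ball x e \<subseteq> U" using assms(2) open_contains_ball by blast
  obtain P where P: "\<And>t. f (x + t *\<^sub>R (y - x)) = poly P t"
    using assms(1) poly_line[of f] unfolding polyf_def by metis
  define s where "s = e / (norm (y - x) + 1)"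
  have s: "s > 0" using e by (simp add: s_def add_nonneg_pos)
  have "poly P t = 0" if "t \<in> {0<..<s}" for t
  proof -
    have "t * norm (y - x) \<le> t * (norm (y - x) + 1)" using that by (intro mult_left_mono) auto
    also have "\<dots> < s * (norm (y - x) + 1)" using that by (intro mult_strict_right_mono) (auto simp: add_nonneg_pos)
    also have "\<dots> = e" unfolding s_def using norm_ge_zero[of "y - x"] by (simp add: add_nonneg_eq_0_iff)
    finally have "dist x (x + t *\<^sub>R (y - x)) < e" using that by (simp add: dist_norm)
    then have "x + t *\<^sub>R (y - x) \<in> U" using e by auto
    then show ?thesis using 0 P by metis
  qed
  then have "{0<..<s} \<subseteq> {t. poly P t = 0}" by auto
  then have "P = 0" using poly_roots_finite[of P] infinite_Ioo[of 0 s] s finite_subset by blast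
  then show "f y = 0" using P[of 1] by simp
qed

section \<open>Smooth cutoffs\<close>

lemma C_diff_Suc_dd:
  "C_diff (Suc m) f \<longleftrightarrow> (\<forall>x. f differentiable (at x)) \<and> (\<forall>i. C_diff m (dd (axis i 1) f))"
  by (simp add: dd_def[abs_def])

lemma C_diff_imp_continuous: "C_diff m f \<Longrightarrow> continuous_on S f"
proof -
  assume a: "C_diff m f"
  have "continuous_on UNIV f"
  proof (cases m)
    case 0 then show ?thesis using a by simp
  next
    case (Suc n)
    then show ?thesis using a differentiable_imp_continuous_within
      by (intro continuous_at_imp_continuous_on) auto
  qed
  then show ?thesis using continuous_on_subset by blast
qed

lemma C_diff_Suc_imp: "C_diff (Suc m) f \<Longrightarrow> C_diff m f"
proof (induction m arbitrary: f)
  case 0 then show ?case using C_diff_imp_continuous[of "Suc 0" f UNIV] by auto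
next
  case (Suc m)
  then have "\<forall>x. f differentiable (at x)" "\<forall>i. C_diff (Suc m) (dd (axis i 1) f)"
    using C_diff_Suc_dd[of "Suc m" f] by blast+
  with Suc.IH show ?case unfolding C_diff_Suc_dd[of m f] by blast
qed

lemma dd_add': "f differentiable (at x) \<Longrightarrow> g differentiable (at x) \<Longrightarrow>
   dd b (\<lambda>x. f x + g x) x = dd b f x + dd b g x"
  by (auto simp: dd_def frechet_derivative_works intro!: dd_eq[unfolded dd_def] has_derivative_add)

lemma dd_mult': "f differentiable (at x) \<Longrightarrow> g differentiable (at x) \<Longrightarrow>
   dd b (\<lambda>x. f x * g x) x = f x * dd b g x + dd b f x * g x"
  by (auto simp: dd_def frechet_derivative_works intro!: dd_eq[unfolded dd_def] has_derivative_mult)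

lemma C_diff_add: "C_diff m f \<Longrightarrow> C_diff m g \<Longrightarrow> C_diff m (\<lambda>x. f x + g x)"
proof (induction m arbitrary: f g)
  case 0 then show ?case by (simp add: continuous_on_add)
next
  case (Suc m)
  then have d: "\<And>x. f differentiable (at x)" "\<And>x. g differentiable (at x)" 
    and c: "\<And>i. C_diff m (dd (axis i 1) f)" "\<And>i. C_diff m (dd (axis i 1) g)" 
    unfolding C_diff_Suc_dd by blast+
  have "dd b (\<lambda>x. f x + g x) = (\<lambda>x. dd b f x + dd b g x)" for b using dd_add' d by blast
  then show ?case unfolding C_diff_Suc_dd using Suc.IH c d by (simp add: differentiable_add)
qed

lemma C_diff_mult: "C_diff m f \<Longrightarrow> C_diff m g \<Longrightarrow> C_diff m (\<lambda>x. f x * g x)"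
proof (induction m arbitrary: f g)
  case 0 then show ?case by (simp add: continuous_on_mult)
next
  case (Suc m)
  then have d: "\<And>x. f differentiable (at x)" "\<And>x. g differentiable (at x)" 
    and c: "\<And>i. C_diff m (dd (axis i 1) f)" "\<And>i. C_diff m (dd (axis i 1) g)" 
    unfolding C_diff_Suc_dd by blast+
  have cc: "C_diff m f" "C_diff m g" using Suc.prems C_diff_Suc_imp by blast+
  have "dd b (\<lambda>x. f x * g x) = (\<lambda>x. f x * dd b g x + dd b f x * g x)" for b using dd_mult' d by blast
  then show ?case unfolding C_diff_Suc_dd 
    using Suc.IH[OF cc(1) c(2)] Suc.IH[OF c(1) cc(2)] d by (simp add: differentiable_mult C_diff_add)
qed

lemma C_diff_polyf: "polyf f \<Longrightarrow> C_diff m f"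
proof (induction m arbitrary: f)
  case 0 then show ?case by (simp add: polyf_continuous)
next
  case (Suc m)
  then show ?case unfolding C_diff_Suc_dd using dd_has_derivative by (blast intro: differentiableI)
qed

lemma C_diff_prod: "(\<And>i. i \<in> I \<Longrightarrow> C_diff m (f i)) \<Longrightarrow> C_diff m (\<lambda>x. \<Prod>i\<in>I. f i x)"
  by (induction I rule: infinite_finite_induct) (auto intro: C_diff_mult C_diff_polyf)

definition cutoff :: "nat \<Rightarrow> real \<Rightarrow> real \<Rightarrow> real" where
  "cutoff n \<eta> s = (if s > 0 then exp (- \<eta> / s) / s ^ n else 0)"

lemma cutoff_tendsto_0: "\<eta> > 0 \<Longrightarrow> (cutoff n \<eta> \<longlongrightarrow> 0) (at_right 0)"
proof -
  assume \<eta>: "\<eta> > 0"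
  have fl: "filterlim (\<lambda>s. \<eta> * inverse s) at_top (at_right 0)"
    by (rule filterlim_tendsto_pos_mult_at_top[OF tendsto_const \<eta> filterlim_inverse_at_top_right])
  have "((\<lambda>s. (\<eta> * inverse s) ^ n / exp (\<eta> * inverse s)) \<longlongrightarrow> 0) (at_right 0)"
    by (rule filterlim_compose[OF tendsto_power_div_exp_0 fl])
  then have "((\<lambda>s. (\<eta> * inverse s) ^ n / exp (\<eta> * inverse s) / \<eta> ^ n) \<longlongrightarrow> 0 / \<eta> ^ n) (at_right 0)"
    by (rule tendsto_divide[OF _ tendsto_const]) (use \<eta> in simp)
  then have "((\<lambda>s. (\<eta> * inverse s) ^ n / exp (\<eta> * inverse s) / \<eta> ^ n) \<longlongrightarrow> 0) (at_right 0)" by simp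
  then show ?thesis
    by (rule Lim_transform_eventually)
      (use \<eta> in \<open>auto simp: eventually_at_filter cutoff_def exp_minus field_simps power_mult_distrib\<close>)
qed

lemma cutoff_has_derivative:
  assumes "\<eta> > 0"
  shows "(cutoff n \<eta> has_real_derivative (\<eta> * cutoff (n + 2) \<eta> s - real n * cutoff (n + 1) \<eta> s)) (at s)"
proof -
  consider "s > 0" | "s < 0" | "s = 0" by linarith
  then show ?thesis
  proof cases
    case 1
    have "((\<lambda>s. exp (- \<eta> / s) / s ^ n) has_real_derivative
       (\<eta> * cutoff (n + 2) \<eta> s - real n * cutoff (n + 1) \<eta> s)) (at s)"
      using 1 power_minus_mult[of n s] 
      by (cases "n = 0") (auto intro!: derivative_eq_intros simp: cutoff_def field_simps power2_eq_square)
    then show ?thesis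
      by (rule has_field_derivative_transform_within_open[of _ _ _ "{0<..}"]) (use 1 in \<open>auto simp: cutoff_def\<close>)
  next
    case 2
    have "((\<lambda>s. 0) has_real_derivative (\<eta> * cutoff (n + 2) \<eta> s - real n * cutoff (n + 1) \<eta> s)) (at s)"
      using 2 by (simp add: cutoff_def)
    then show ?thesis
      by (rule has_field_derivative_transform_within_open[of _ _ _ "{..<0}"]) (use 2 in \<open>auto simp: cutoff_def\<close>)
  next
    case 3
    have "((\<lambda>h. cutoff n \<eta> h / h) \<longlongrightarrow> 0) (at_right 0)"
      by (rule Lim_transform_eventually[OF cutoff_tendsto_0[OF assms, of "n + 1"]])
        (auto simp: eventually_at_filter cutoff_def)
    moreover have "((\<lambda>h. cutoff n \<eta> h / h) \<longlongrightarrow> 0) (at_left 0)"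
      by (rule Lim_transform_eventually[of "\<lambda>_. 0"]) (auto simp: eventually_at_filter cutoff_def)
    ultimately have "((\<lambda>h. cutoff n \<eta> h / h) \<longlongrightarrow> 0) (at 0)" by (simp add: filterlim_split_at)
    then show ?thesis using 3 by (simp add: DERIV_def cutoff_def)
  qed
qed

lemma cutoff_affine_has_derivative:
  assumes "\<eta> > 0"
  shows "((\<lambda>x. cutoff n \<eta> (a \<bullet> x + c)) has_derivative
    (\<lambda>b. (\<eta> * cutoff (n + 2) \<eta> (a \<bullet> x + c) - real n * cutoff (n + 1) \<eta> (a \<bullet> x + c)) * (a \<bullet> b))) (at x)"
proof -
  have "((\<lambda>x. a \<bullet> x + c) has_derivative (\<lambda>b. a \<bullet> b)) (at x)"
    by (auto intro!: derivative_eq_intros)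
  from has_derivative_compose[OF this cutoff_has_derivative[OF assms, unfolded has_field_derivative_def]]
  show ?thesis by simp
qed

lemma dd_cutoff_affine:
  assumes "\<eta> > 0"
  shows "dd b (\<lambda>x. cutoff n \<eta> (a \<bullet> x + c)) x =
    (\<eta> * cutoff (n + 2) \<eta> (a \<bullet> x + c) - real n * cutoff (n + 1) \<eta> (a \<bullet> x + c)) * (a \<bullet> b)"
  by (rule dd_eq[OF cutoff_affine_has_derivative[OF assms]])

lemma C_diff_cutoff_affine:
  assumes \<eta>: "\<eta> > 0"
  shows "C_diff m (\<lambda>x. cutoff n \<eta> (a \<bullet> x + c))"
proof (induction m arbitrary: n)
  case 0
  have "continuous_on UNIV (\<lambda>x. cutoff n \<eta> (a \<bullet> x + c))"
    by (intro continuous_at_imp_continuous_on ballI has_derivative_continuous[OF cutoff_affine_has_derivative[OF \<eta>]])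
  then show ?case by simp
next
  case (Suc m)
  have "C_diff m (\<lambda>x. (\<eta> * (a \<bullet> b)) * cutoff (n + 2) \<eta> (a \<bullet> x + c) + (- real n * (a \<bullet> b)) * cutoff (n + 1) \<eta> (a \<bullet> x + c))" for b
    by (intro C_diff_add C_diff_mult Suc.IH C_diff_polyf polyf_const)
  moreover have "dd b (\<lambda>x. cutoff n \<eta> (a \<bullet> x + c)) = 
     (\<lambda>x. (\<eta> * (a \<bullet> b)) * cutoff (n + 2) \<eta> (a \<bullet> x + c) + (- real n * (a \<bullet> b)) * cutoff (n + 1) \<eta> (a \<bullet> x + c))" for b
    by (rule ext, subst dd_cutoff_affine[OF \<eta>]) (simp add: algebra_simps)
  moreover have "(\<lambda>x. cutoff n \<eta> (a \<bullet> x + c)) differentiable (at x)" for x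
    by (rule differentiableI[OF cutoff_affine_has_derivative[OF \<eta>]])
  ultimately show ?case unfolding C_diff_Suc_dd by simp
qed

lemma cutoff0_bounds: "\<eta> > 0 \<Longrightarrow> 0 \<le> cutoff 0 \<eta> s" "\<eta> > 0 \<Longrightarrow> cutoff 0 \<eta> s \<le> 1"
  by (auto simp: cutoff_def)

section \<open>Integration against test functions\<close>

lemma continuous_on_dd:
  assumes "C_diff 1 \<phi>" shows "continuous_on UNIV (dd b \<phi>)" "\<phi> differentiable (at x)"
    "dd b \<phi> x = (\<Sum>i\<in>UNIV. b $ i * dd (axis i 1) \<phi> x)"
    "(\<phi> has_derivative (\<lambda>b. dd b \<phi> x)) (at x within S)"
proof -
  have d: "\<phi> differentiable (at x)" for x using assms by simp
  have h: "(\<phi> has_derivative (\<lambda>b. dd b \<phi> x)) (at x)" for x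
    using d[of x] unfolding frechet_derivative_works dd_def .
  then show "(\<phi> has_derivative (\<lambda>b. dd b \<phi> x)) (at x within S)" by (rule has_derivative_at_withinI)
  have e: "dd b \<phi> x = (\<Sum>i\<in>UNIV. b $ i * dd (axis i 1) \<phi> x)" for x
  proof -
    interpret linear "\<lambda>b. dd b \<phi> x" using h has_derivative_linear by blast
    have "dd b \<phi> x = dd (\<Sum>i\<in>UNIV. b $ i *\<^sub>R axis i 1) \<phi> x" 
      using basis_expansion[of b] by (simp add: scalar_mult_eq_scaleR)
    then show ?thesis by (simp add: sum scale)
  qed
  have "continuous_on UNIV (dd (axis i 1) \<phi>)" for i using assms by (simp add: dd_def[abs_def])
  then show "continuous_on UNIV (dd b \<phi>)" unfolding e[abs_def] by (intro continuous_intros)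
  show "\<phi> differentiable (at x)" "dd b \<phi> x = (\<Sum>i\<in>UNIV. b $ i * dd (axis i 1) \<phi> x)"
    using d e by blast+
qed

lemma dd_support: 
  assumes "x \<notin> closure {x. \<phi> x \<noteq> 0}" shows "dd b \<phi> x = 0"
proof -
  have "((\<lambda>x. 0) has_derivative (\<lambda>b. 0)) (at x)" by simp
  then have "(\<phi> has_derivative (\<lambda>b. 0)) (at x)"
    by (rule has_derivative_transform_within_open[of _ _ _ _ "- closure {x. \<phi> x \<noteq> 0}"])
      (use assms closure_subset[of "{x. \<phi> x \<noteq> 0}"] in auto)
  then show ?thesis by (rule dd_eq)
qed

lemma compact_support_bounded:
  fixes f :: "real^'n::finite \<Rightarrow> real"
  assumes "continuous_on UNIV f" "compact A" "\<And>x. x \<notin> A \<Longrightarrow> f x = 0"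
  obtains B where "B \<ge> 0" "\<And>x. \<bar>f x\<bar> \<le> B"
proof -
  have "compact (f ` A)" using assms compact_continuous_image continuous_on_subset by blast
  then obtain B where "\<And>x. x \<in> A \<Longrightarrow> \<bar>f x\<bar> \<le> B" using compact_imp_bounded[of "f ` A"]
    by (auto simp: bounded_iff)
  then have "\<bar>f x\<bar> \<le> max B 0" for x using assms(3)[of x] by (cases "x \<in> A") force+
  then show ?thesis using that[of "max B 0"] by simp
qed

lemma integral_dd_eq_0:
  fixes \<phi> :: "real^'n::finite \<Rightarrow> real"
  assumes C1: "C_diff 1 \<phi>" and comp: "compact (closure {x. \<phi> x \<noteq> 0})"
  shows "(\<integral>x. dd b \<phi> x \<partial>lborel) = 0"
proof -
  let ?A = "closure {x. \<phi> x \<noteq> 0}"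
  have c\<phi>: "continuous_on UNIV \<phi>" using C_diff_imp_continuous[OF C1] .
  have \<phi>0: "\<phi> x = 0" if "x \<notin> ?A" for x using that closure_subset[of "{x. \<phi> x \<noteq> 0}"] by auto
  have int_cs: "integrable lborel f" if "continuous_on UNIV f" "\<And>x. x \<notin> ?A \<Longrightarrow> f x = 0" for f :: "real^'n \<Rightarrow> real"
  proof -
    have "integrable lborel (\<lambda>x. indicator ?A x *\<^sub>R f x)"
      using borel_integrable_compact[OF comp, of f] that(1) continuous_on_subset[of UNIV f ?A] by simp
    moreover have "(\<lambda>x. indicator ?A x *\<^sub>R f x) = f" using that by (auto simp: indicator_def fun_eq_iff)
    ultimately show ?thesis by simp
  qed
  have "\<exists>B\<ge>0. \<forall>x. \<bar>dd (axis i 1) \<phi> x\<bar> \<le> B" for i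
    by (rule compact_support_bounded[OF continuous_on_dd(1)[OF C1] comp dd_support, of "axis i 1"]) blast+
  then obtain B where B0: "\<And>i. B i \<ge> 0" and B: "\<And>i x. \<bar>dd (axis i 1) \<phi> x\<bar> \<le> B i" by metis
  define L where "L = (\<Sum>i\<in>UNIV. B i)"
  have L0: "L \<ge> 0" unfolding L_def by (intro sum_nonneg B0)
  have lip: "\<bar>\<phi> x - \<phi> y\<bar> \<le> L * norm (x - y)" for x y
  proof -
    have "norm (\<phi> x - \<phi> y) \<le> L * norm (x - y)"
    proof (rule differentiable_bound[OF convex_UNIV])
      show "(\<phi> has_derivative (\<lambda>b. dd b \<phi> x)) (at x within UNIV)" for x
        by (rule continuous_on_dd(4)[OF C1])
      show "onorm (\<lambda>b. dd b \<phi> x) \<le> L" for x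
      proof (rule onorm_le)
        fix b
        have "norm (dd b \<phi> x) \<le> (\<Sum>i\<in>UNIV. \<bar>b $ i * dd (axis i 1) \<phi> x\<bar>)"
          unfolding continuous_on_dd(3)[OF C1, of b] by (simp add: sum_abs)
        also have "\<dots> \<le> (\<Sum>i\<in>UNIV. norm b * B i)"
          unfolding abs_mult by (intro sum_mono mult_mono B component_le_norm_cart) auto
        finally show "norm (dd b \<phi> x) \<le> L * norm b" by (simp add: L_def sum_distrib_left mult.commute)
      qed
    qed auto
    then show ?thesis by simp
  qed
  obtain R where R: "\<And>x. x \<in> ?A \<Longrightarrow> norm x \<le> R" using compact_imp_bounded[OF comp] by (auto simp: bounded_iff)
  define f where "f n x = real (Suc n) * (\<phi> (x + (1 / real (Suc n)) *\<^sub>R b) - \<phi> x)" for n x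
  have mf: "f n \<in> borel_measurable borel" for n
    unfolding f_def by (intro borel_measurable_continuous_onI continuous_intros continuous_on_compose2[OF c\<phi>]) auto
  have I0: "(\<integral>x. f n x \<partial>lborel) = 0" for n
  proof -
    let ?c = "(1 / real (Suc n)) *\<^sub>R b"
    have m: "\<phi> \<in> borel_measurable borel" using c\<phi> by (rule borel_measurable_continuous_onI)
    have i1: "integrable lborel \<phi>" using int_cs c\<phi> \<phi>0 by blast
    have "(\<integral>x. \<phi> x \<partial>lborel) = (\<integral>x. \<phi> x \<partial>(distr lborel borel ((+) ?c)))" by (simp only: lborel_distr_plus)
    also have "\<dots> = (\<integral>x. \<phi> (?c + x) \<partial>lborel)" using m by (subst integral_distr) auto
    finally have e: "(\<integral>x. \<phi> (x + ?c) \<partial>lborel) = (\<integral>x. \<phi> x \<partial>lborel)" by (simp add: add.commute)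
    have "integrable (distr lborel borel ((+) ?c)) \<phi>" using i1 by (simp only: lborel_distr_plus)
    then have i2: "integrable lborel (\<lambda>x. \<phi> (x + ?c))" using m by (subst (asm) integrable_distr_eq) (auto simp: add.commute)
    have "(\<integral>x. f n x \<partial>lborel) = real (Suc n) * ((\<integral>x. \<phi> (x + ?c) \<partial>lborel) - (\<integral>x. \<phi> x \<partial>lborel))"
      unfolding f_def by (simp only: integral_mult_right_zero Bochner_Integration.integral_diff[OF i2 i1])
    then show ?thesis using e by simp
  qed
  have "(\<lambda>n. \<integral>x. f n x \<partial>lborel) \<longlonglongrightarrow> (\<integral>x. dd b \<phi> x \<partial>lborel)"
  proof (rule integral_dominated_convergence[where w = "\<lambda>x. indicator (cball 0 (R + norm b)) x *\<^sub>R (L * norm b)"])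
    show "dd b \<phi> \<in> borel_measurable lborel" using continuous_on_dd(1)[OF C1] by (simp add: borel_measurable_continuous_onI)
    show "f n \<in> borel_measurable lborel" for n using mf by simp
    show "integrable lborel (\<lambda>x. indicator (cball 0 (R + norm b)) x *\<^sub>R (L * norm b))"
      by (rule borel_integrable_compact) auto
    show "AE x in lborel. (\<lambda>n. f n x) \<longlonglongrightarrow> dd b \<phi> x"
    proof (rule AE_I2)
      fix x
      have "(\<phi> has_derivative (\<lambda>b. dd b \<phi> x)) (at x)"
        by (rule continuous_on_dd(4)[OF C1])
      then have h: "(\<phi> has_derivative (\<lambda>b. dd b \<phi> x)) (at (x + 0 *\<^sub>R b))" by simp
      have "((\<lambda>t. x + t *\<^sub>R b) has_derivative (\<lambda>t. t *\<^sub>R b)) (at 0)" by (auto intro!: derivative_eq_intros)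
      from has_derivative_compose[OF this h]
      have "((\<lambda>t. \<phi> (x + t *\<^sub>R b)) has_derivative (\<lambda>t. dd (t *\<^sub>R b) \<phi> x)) (at 0)" .
      moreover have "(\<lambda>t. dd (t *\<^sub>R b) \<phi> x) = (\<lambda>t. t * dd b \<phi> x)"
        using linear_scale[OF has_derivative_linear[OF h]] by simp
      ultimately have "((\<lambda>t. \<phi> (x + t *\<^sub>R b)) has_real_derivative dd b \<phi> x) (at 0)"
        by (simp add: has_field_derivative_def mult_commute_abs)
      then have lim: "((\<lambda>h. (\<phi> (x + h *\<^sub>R b) - \<phi> x) / h) \<longlongrightarrow> dd b \<phi> x) (at 0)"
        by (simp add: DERIV_def)
      have "filterlim (\<lambda>n. 1 / real (Suc n)) (at 0) sequentially"
        unfolding filterlim_at using LIMSEQ_inverse_real_of_nat by (simp add: inverse_eq_divide)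
      from filterlim_compose[OF lim this]
      show "(\<lambda>n. f n x) \<longlonglongrightarrow> dd b \<phi> x" by (simp add: f_def mult.commute)
    qed
    show "AE x in lborel. norm (f n x) \<le> indicator (cball 0 (R + norm b)) x *\<^sub>R (L * norm b)" for n
    proof (rule AE_I2)
      fix x
      let ?c = "(1 / real (Suc n)) *\<^sub>R b"
      show "norm (f n x) \<le> indicator (cball 0 (R + norm b)) x *\<^sub>R (L * norm b)"
      proof (cases "x \<in> cball 0 (R + norm b)")
        case True
        have "norm (f n x) = real (Suc n) * \<bar>\<phi> (x + ?c) - \<phi> x\<bar>" by (simp add: f_def abs_mult)
        also have "\<dots> \<le> real (Suc n) * (L * norm ?c)" using lip[of "x + ?c" x] by (intro mult_left_mono) auto
        also have "\<dots> = L * norm b" by (simp add: divide_simps)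
        finally show ?thesis using True by simp
      next
        case False
        have "norm ?c \<le> norm b" using mult_right_mono[of "1 / real (Suc n)" 1 "norm b"] by simp
        moreover have "norm x \<le> norm (x + ?c) + norm ?c" using norm_triangle_ineq4[of "x + ?c" ?c] by simp
        moreover have "norm x > R + norm b" using False by simp
        ultimately have "norm (x + ?c) > R" "norm x > R" using norm_ge_zero[of b] by linarith+
        then have "\<phi> (x + ?c) = 0" "\<phi> x = 0" using R[of x] R[of "x + ?c"] \<phi>0[of x] \<phi>0[of "x + ?c"] by linarith+
        then show ?thesis using L0 by (simp add: f_def)
      qed
    qed
  qed
  then show ?thesis by (simp add: I0 LIMSEQ_const_iff)
qed

section \<open>The weak directional derivative\<close>

lemma integrable_bounded_mult:
  fixes f v :: "'a \<Rightarrow> real"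
  assumes "integrable M v" "f \<in> borel_measurable M" "\<And>x. x \<in> space M \<Longrightarrow> \<bar>f x\<bar> \<le> B"
  shows "integrable M (\<lambda>x. f x * v x)"
proof (rule Bochner_Integration.integrable_bound)
  show "integrable M (\<lambda>x. B * \<bar>v x\<bar>)" using assms(1) by simp
  show "(\<lambda>x. f x * v x) \<in> borel_measurable M" using assms by measurable
  show "AE x in M. norm (f x * v x) \<le> norm (B * \<bar>v x\<bar>)"
  proof (rule AE_I2)
    fix x assume "x \<in> space M"
    then have "\<bar>f x\<bar> \<le> \<bar>B\<bar>" using assms(3) by force
    then show "norm (f x * v x) \<le> norm (B * \<bar>v x\<bar>)" by (simp add: abs_mult mult_right_mono)
  qed
qed

lemma test_functionsD:
  assumes "\<phi> \<in> test_functions U"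
  shows "C_diff m \<phi>" "compact (closure {x. \<phi> x \<noteq> 0})" "closure {x. \<phi> x \<noteq> 0} \<subseteq> U"
    "continuous_on S \<phi>" "x \<notin> closure {x. \<phi> x \<noteq> 0} \<Longrightarrow> \<phi> x = 0" "x \<notin> U \<Longrightarrow> \<phi> x = 0"
    "x \<notin> U \<Longrightarrow> dd b \<phi> x = 0"
proof -
  show "C_diff m \<phi>" "compact (closure {x. \<phi> x \<noteq> 0})" and c: "closure {x. \<phi> x \<noteq> 0} \<subseteq> U"
    using assms by (auto simp: test_functions_def)
  show "continuous_on S \<phi>" using assms C_diff_imp_continuous[of 0 \<phi>] by (auto simp: test_functions_def)
  show "\<phi> x = 0" if "x \<notin> closure {x. \<phi> x \<noteq> 0}" for x using that closure_subset[of "{x. \<phi> x \<noteq> 0}"] by auto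
  then show "x \<notin> U \<Longrightarrow> \<phi> x = 0" using c by blast
  show "x \<notin> U \<Longrightarrow> dd b \<phi> x = 0" using c dd_support[of x \<phi> b] by blast
qed

lemma compact_closed_subset:
  assumes "compact A" "closed B" "B \<subseteq> A" shows "compact B"
  using compact_Int_closed[OF assms(1,2)] assms(3) by (simp add: Int_absorb1)

lemma test_functionsI:
  assumes "\<And>m. C_diff m \<phi>" "compact A" "A \<subseteq> U" "\<And>x. x \<notin> A \<Longrightarrow> \<phi> x = 0"
  shows "\<phi> \<in> test_functions U"
proof -
  have "closure {x. \<phi> x \<noteq> 0} \<subseteq> A" using assms by (intro closure_minimal) (auto simp: compact_imp_closed)
  then have "compact (closure {x. \<phi> x \<noteq> 0})" 
    by (rule compact_closed_subset[OF assms(2) closed_closure])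
  then show ?thesis using assms \<open>closure _ \<subseteq> A\<close> by (auto simp: test_functions_def)
qed

lemma integral_lebesgue_on_support:
  fixes f :: "real^'n::finite \<Rightarrow> real"
  assumes "S \<in> sets lebesgue" "\<And>x. x \<notin> S \<Longrightarrow> f x = 0"
  shows "(\<integral>x. f x \<partial>(lebesgue_on S)) = (\<integral>x. f x \<partial>lebesgue)"
    "integrable (lebesgue_on S) f \<longleftrightarrow> integrable lebesgue f"
proof -
  have "(\<lambda>x. indicator S x *\<^sub>R f x) = f" using assms(2) by (auto simp: fun_eq_iff indicator_def)
  then show "(\<integral>x. f x \<partial>(lebesgue_on S)) = (\<integral>x. f x \<partial>lebesgue)"
    "integrable (lebesgue_on S) f \<longleftrightarrow> integrable lebesgue f" 
    using assms(1) by (simp_all add: integral_restrict_space integrable_restrict_space)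
qed

lemma integrable_test_mult:
  fixes g :: "real^'n::finite \<Rightarrow> real"
  assumes "\<phi> \<in> test_functions (interior S)" "S \<in> sets lebesgue" 
    "\<And>A. compact A \<Longrightarrow> A \<subseteq> interior S \<Longrightarrow> g absolutely_integrable_on A"
  shows "integrable (lebesgue_on S) (\<lambda>x. g x * \<phi> x)"
proof -
  let ?A = "closure {x. \<phi> x \<noteq> 0}"
  note t = test_functionsD[OF assms(1)]
  obtain B where B: "\<And>x. \<bar>\<phi> x\<bar> \<le> B" using compact_support_bounded[OF t(4) t(2) t(5)] by blast
  have m: "\<phi> \<in> borel_measurable lebesgue"
    using continuous_imp_measurable_on_sets_lebesgue[OF t(4), of UNIV] by (simp add: lebesgue_on_UNIV_eq)
  have "g absolutely_integrable_on ?A" by (rule assms(3)[OF t(2,3)])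
  then have "integrable lebesgue (\<lambda>x. indicator ?A x *\<^sub>R g x)" by (simp add: set_integrable_def)
  from integrable_bounded_mult[OF this m, of B]
  have i: "integrable lebesgue (\<lambda>x. \<phi> x * (indicator ?A x *\<^sub>R g x))" using B by blast
  have e: "\<phi> x * (indicator ?A x *\<^sub>R g x) = g x * \<phi> x" for x
    using t(5)[of x] by (cases "x \<in> ?A") simp_all
  have z: "g x * \<phi> x = 0" if "x \<notin> S" for x using t(6)[of x] that interior_subset[of S] by auto
  show ?thesis using i z unfolding e by (subst integral_lebesgue_on_support(2)[OF assms(2)]) auto
qed

definition box_cutoff :: "real \<Rightarrow> real^'n \<Rightarrow> real^'n \<Rightarrow> real^'n::finite \<Rightarrow> real" where
  "box_cutoff \<eta> a b x = (\<Prod>i\<in>UNIV. cutoff 0 \<eta> (axis i 1 \<bullet> x + (- a $ i)) * cutoff 0 \<eta> ((- axis i 1) \<bullet> x + b $ i))"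

lemma mem_box_vec: "x \<in> box a b \<longleftrightarrow> (\<forall>i. a $ i < x $ i \<and> x $ i < b $ i)"
  for x :: "real^'n::finite" by (rule mem_box_cart)

lemma box_cutoff_support: 
  assumes "x \<notin> box a b" shows "box_cutoff \<eta> a b x = 0"
proof -
  obtain i where "\<not> (a $ i < x $ i \<and> x $ i < b $ i)" using assms mem_box_vec by blast
  then have "cutoff 0 \<eta> (axis i 1 \<bullet> x + (- a $ i)) * cutoff 0 \<eta> ((- axis i 1) \<bullet> x + b $ i) = 0"
    by (auto simp: cutoff_def inner_axis')
  then show ?thesis unfolding box_cutoff_def by (meson finite_class.finite_UNIV prod_zero UNIV_I)
qed

lemma box_cutoff_test:
  assumes "\<eta> > 0" "cbox a b \<subseteq> U" shows "box_cutoff \<eta> a b \<in> test_functions U"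
proof (rule test_functionsI[of _ "cbox a b"])
  show "C_diff m (box_cutoff \<eta> a b)" for m
    unfolding box_cutoff_def[abs_def] by (intro C_diff_prod C_diff_mult C_diff_cutoff_affine assms(1))
  show "box_cutoff \<eta> a b x = 0" if "x \<notin> cbox a b" for x
    using that box_subset_cbox by (intro box_cutoff_support) blast
qed (use assms in auto)

lemma box_cutoff_bounds: 
  assumes "\<eta> > 0" shows "\<bar>box_cutoff \<eta> a b x\<bar> \<le> 1"
proof -
  have "0 \<le> box_cutoff \<eta> a b x" unfolding box_cutoff_def 
    by (intro prod_nonneg mult_nonneg_nonneg cutoff0_bounds ballI assms)
  moreover have "box_cutoff \<eta> a b x \<le> 1" unfolding box_cutoff_def 
    by (intro prod_le_1 conjI mult_nonneg_nonneg cutoff0_bounds mult_le_one assms)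
  ultimately show ?thesis by simp
qed

lemma cutoff0_tendsto_1:
  assumes "s > 0" shows "(\<lambda>n. cutoff 0 (1 / real (Suc n)) s) \<longlonglongrightarrow> 1"
proof -
  have "(\<lambda>n. exp (- (1 / real (Suc n)) / s)) \<longlonglongrightarrow> exp (- 0 / s)"
    using LIMSEQ_inverse_real_of_nat
    by (intro tendsto_exp tendsto_divide tendsto_minus tendsto_const) (use assms in \<open>simp_all add: inverse_eq_divide\<close>)
  then show ?thesis using assms by (simp add: cutoff_def)
qed

lemma box_cutoff_tendsto:
  "(\<lambda>n. box_cutoff (1 / real (Suc n)) a b x) \<longlonglongrightarrow> indicator (box a b) x"
proof (cases "x \<in> box a b")
  case True
  have "(\<lambda>n. box_cutoff (1 / real (Suc n)) a b x) \<longlonglongrightarrow> (\<Prod>i\<in>(UNIV::'a set). 1 * 1)"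
    unfolding box_cutoff_def
    by (intro tendsto_prod tendsto_mult cutoff0_tendsto_1) (use True in \<open>auto simp: mem_box_vec inner_axis'\<close>)
  then show ?thesis using True by simp
next
  case False
  then show ?thesis by (simp add: box_cutoff_support)
qed

lemma integral_cbox_eq_0_if_weakly_0:
  fixes h :: "real^'n::finite \<Rightarrow> real"
  assumes S: "S \<in> sets lebesgue" and U: "U \<subseteq> S" "cbox a b \<subseteq> U"
    and h: "h absolutely_integrable_on cbox a b"
    and 0: "\<And>\<phi>. \<phi> \<in> test_functions U \<Longrightarrow> (\<integral>x. h x * \<phi> x \<partial>(lebesgue_on S)) = 0"
  shows "integral (cbox a b) h = 0"
proof -
  let ?H = "\<lambda>x. indicator (cbox a b) x *\<^sub>R h x"
  let ?\<phi> = "\<lambda>n. box_cutoff (1 / real (Suc n)) a b"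
  have H: "integrable lebesgue ?H" using h by (simp add: set_integrable_def)
  have t: "?\<phi> n \<in> test_functions U" for n by (rule box_cutoff_test[OF _ U(2)]) simp
  have z: "(\<integral>x. ?\<phi> n x * ?H x \<partial>lebesgue) = 0" for n
  proof -
    have "h x * ?\<phi> n x = 0" if "x \<notin> S" for x using test_functionsD(6)[OF t, of x n] U(1) that by auto
    then have "(\<integral>x. h x * ?\<phi> n x \<partial>(lebesgue_on S)) = (\<integral>x. h x * ?\<phi> n x \<partial>lebesgue)"
      by (intro integral_lebesgue_on_support S)
    also have "\<dots> = (\<integral>x. ?\<phi> n x * ?H x \<partial>lebesgue)"
    proof (rule Bochner_Integration.integral_cong[OF refl])
      fix x show "h x * ?\<phi> n x = ?\<phi> n x * ?H x"
      proof (cases "x \<in> box a b")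
        case True
        then have "x \<in> cbox a b" using box_subset_cbox by blast
        then show ?thesis by simp
      next
        case False
        show ?thesis unfolding box_cutoff_support[OF False] by simp
      qed
    qed
    finally show ?thesis by (simp only: 0[OF t])
  qed
  have m: "?\<phi> n \<in> borel_measurable lebesgue" for n
    using continuous_imp_measurable_on_sets_lebesgue[OF test_functionsD(4)[OF t], of UNIV] by (simp add: lebesgue_on_UNIV_eq)
  have "(\<lambda>n. \<integral>x. ?\<phi> n x * ?H x \<partial>lebesgue) \<longlonglongrightarrow> (\<integral>x. indicator (box a b) x * ?H x \<partial>lebesgue)"
  proof (rule integral_dominated_convergence[where w = "\<lambda>x. \<bar>?H x\<bar>"])
    show "integrable lebesgue (\<lambda>x. \<bar>?H x\<bar>)" using H by (rule integrable_abs)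
    have mH: "?H \<in> borel_measurable lebesgue" using H by (rule borel_measurable_integrable)
    have mb: "(indicator (box a b) :: real^'n \<Rightarrow> real) \<in> borel_measurable lebesgue"
      by (rule borel_measurable_indicator) (simp add: borel_open)
    show "(\<lambda>x. indicator (box a b) x * ?H x) \<in> borel_measurable lebesgue"
      by (rule borel_measurable_times[OF mb mH])
    show "(\<lambda>x. ?\<phi> n x * ?H x) \<in> borel_measurable lebesgue" for n
      by (rule borel_measurable_times[OF m mH])
    show "AE x in lebesgue. (\<lambda>n. ?\<phi> n x * ?H x) \<longlonglongrightarrow> indicator (box a b) x * ?H x"
      by (intro AE_I2 tendsto_mult box_cutoff_tendsto tendsto_const)
    show "AE x in lebesgue. norm (?\<phi> n x * ?H x) \<le> \<bar>?H x\<bar>" for n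
    proof (rule AE_I2)
      fix x
      show "norm (?\<phi> n x * ?H x) \<le> \<bar>?H x\<bar>" 
        unfolding real_norm_def abs_mult[of "?\<phi> n x"] by (rule mult_left_le_one_le) (auto intro: box_cutoff_bounds)
    qed
  qed
  then have "(\<integral>x. indicator (box a b) x * ?H x \<partial>lebesgue) = 0" 
    unfolding z by (metis LIMSEQ_const_iff)
  moreover have "indicator (box a b) x * ?H x = indicator (box a b) x *\<^sub>R h x" for x
    using subsetD[OF box_subset_cbox, of x a b] by (cases "x \<in> box a b") (simp_all only: indicator_simps, simp_all)
  ultimately have "(LINT x:box a b|lebesgue. h x) = 0" unfolding set_lebesgue_integral_def by (simp only:)
  moreover have "h absolutely_integrable_on box a b"
    using h by (rule set_integrable_subset) (auto simp: box_subset_cbox)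
  ultimately have "integral (box a b) h = 0" using set_lebesgue_integral_eq_integral(2) by metis
  then show ?thesis by (simp add: integral_open_interval)
qed

text \<open>The cutoffs converge to the indicator functions of boxes, so all integrals of \<open>h\<close> over boxes
  vanish, and Lebesgue differentiation applies.\<close>

lemma weakly_0_imp_AE_0:
  fixes h :: "real^'n::finite \<Rightarrow> real"
  assumes S: "S \<in> sets lebesgue" and U: "open U" "U \<subseteq> S"
    and h: "\<And>A. compact A \<Longrightarrow> A \<subseteq> U \<Longrightarrow> h absolutely_integrable_on A"
    and 0: "\<And>\<phi>. \<phi> \<in> test_functions U \<Longrightarrow> (\<integral>x. h x * \<phi> x \<partial>(lebesgue_on S)) = 0"
  shows "negligible {x \<in> U. h x \<noteq> 0}"
proof -
  have neg: "negligible {x \<in> cbox a b. h x \<noteq> 0}" if ab: "cbox a b \<subseteq> U" for a b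
  proof -
    define f where "f x = (if x \<in> cbox a b then h x else 0)" for x
    have int: "(f has_integral 0) (cbox c d)" for c d
    proof -
      obtain u v where uv: "cbox a b \<inter> cbox c d = cbox u v" using Int_interval by blast
      have sub: "cbox u v \<subseteq> U" using uv ab by blast
      have "h absolutely_integrable_on cbox u v" by (rule h) (use sub in auto)
      then have "(h has_integral 0) (cbox u v)"
        using integral_cbox_eq_0_if_weakly_0[OF S U(2) sub _ 0] 
        by (metis absolutely_integrable_on_def has_integral_integrable_integral)
      then show ?thesis unfolding f_def[abs_def] uv[symmetric]
        by (simp add: has_integral_restrict_Int Int_commute)
    qed
    then have "f integrable_on cbox c d" for c d by blast
    from integrable_ccontinuous_explicit[OF this]
    obtain N where N: "negligible N" and lim: "\<And>x e. \<lbrakk>x \<notin> N; 0 < e\<rbrakk> \<Longrightarrow>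
        \<exists>d>0. \<forall>h. 0 < h \<and> h < d \<longrightarrow> norm(integral (cbox x (x + h *\<^sub>R One)) f /\<^sub>R h ^ DIM(real^'n) - f x) < e"
      by metis
    have "f x = 0" if xN: "x \<notin> N" for x
    proof (rule ccontr)
      assume "f x \<noteq> 0"
      then obtain d where d: "d > 0" "\<forall>h. 0 < h \<and> h < d \<longrightarrow> norm(integral (cbox x (x + h *\<^sub>R One)) f /\<^sub>R h ^ DIM(real^'n) - f x) < \<bar>f x\<bar>"
        using lim[OF xN, of "\<bar>f x\<bar>"] by auto
      then have "norm(integral (cbox x (x + (d/2) *\<^sub>R One)) f /\<^sub>R (d/2) ^ DIM(real^'n) - f x) < \<bar>f x\<bar>" by auto
      then show False using integral_unique[OF int] by simp
    qed
    then have "{x \<in> cbox a b. h x \<noteq> 0} \<subseteq> N" unfolding f_def by (metis (mono_tags, lifting) mem_Collect_eq subsetI)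
    then show ?thesis using N negligible_subset by blast
  qed
  obtain \<D> where D: "countable \<D>" "\<And>X. X \<in> \<D> \<Longrightarrow> X \<subseteq> U" "\<And>X. X \<in> \<D> \<Longrightarrow> \<exists>a b. X = cbox a b" "\<Union>\<D> = U"
    using open_countable_Union_open_cbox[OF U(1)] by (metis PowD subsetD)
  have "negligible (\<Union>X\<in>\<D>. {x \<in> X. h x \<noteq> 0})"
  proof (rule negligible_countable_Union)
    show "countable ((\<lambda>X. {x \<in> X. h x \<noteq> 0}) ` \<D>)" using D(1) by simp
    fix Y assume "Y \<in> (\<lambda>X. {x \<in> X. h x \<noteq> 0}) ` \<D>"
    then obtain X where "X \<in> \<D>" "Y = {x \<in> X. h x \<noteq> 0}" by blast
    then show "negligible Y" using D(2,3) neg by metis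
  qed
  moreover have "(\<Union>X\<in>\<D>. {x \<in> X. h x \<noteq> 0}) = {x \<in> U. h x \<noteq> 0}" using D(4) by blast
  ultimately show ?thesis by simp
qed

lemma is_weak_dderiv_iff: "is_weak_dderiv b S v g \<longleftrightarrow>
     (\<forall>A. compact A \<and> A \<subseteq> interior S \<longrightarrow> g absolutely_integrable_on A) \<and>
     (\<forall>\<phi>\<in>test_functions (interior S).
        (\<integral>x. v x * dd b \<phi> x \<partial>(lebesgue_on S)) = - (\<integral>x. g x * \<phi> x \<partial>(lebesgue_on S)))"
  by (simp add: is_weak_dderiv_def dd_def)

lemma weak_dderiv_unique_AE:
  fixes v :: "real^'n::finite \<Rightarrow> real"
  assumes S: "S \<in> sets lebesgue" "negligible (frontier S)"
    and g: "is_weak_dderiv b S v g" "is_weak_dderiv b S v g'"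
  shows "AE x in lebesgue_on S. g x = g' x"
proof -
  let ?h = "\<lambda>x. g x - g' x"
  have a: "g absolutely_integrable_on A" "g' absolutely_integrable_on A" if "compact A" "A \<subseteq> interior S" for A
    using g that by (auto simp: is_weak_dderiv_iff)
  have "negligible {x \<in> interior S. ?h x \<noteq> 0}"
  proof (rule weakly_0_imp_AE_0[OF S(1)])
    show "open (interior S)" "interior S \<subseteq> S" by (auto simp: interior_subset)
    show "?h absolutely_integrable_on A" if "compact A" "A \<subseteq> interior S" for A
      using a[OF that] by (rule set_integral_diff(1))
    fix \<phi> assume \<phi>: "\<phi> \<in> test_functions (interior S)"
    have "(\<integral>x. ?h x * \<phi> x \<partial>(lebesgue_on S)) = (\<integral>x. g x * \<phi> x \<partial>(lebesgue_on S)) - (\<integral>x. g' x * \<phi> x \<partial>(lebesgue_on S))"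
      unfolding left_diff_distrib by (intro Bochner_Integration.integral_diff integrable_test_mult[OF \<phi> S(1)] a)
    then show "(\<integral>x. ?h x * \<phi> x \<partial>(lebesgue_on S)) = 0" using g \<phi> unfolding is_weak_dderiv_iff by force
  qed
  then have "negligible ({x \<in> interior S. ?h x \<noteq> 0} \<union> frontier S)" using S(2) by (rule negligible_Un)
  then have "({x \<in> interior S. ?h x \<noteq> 0} \<union> frontier S) \<in> null_sets lebesgue" by (simp add: negligible_iff_null_sets)
  then have "AE x in lebesgue. x \<in> S \<longrightarrow> g x = g' x"
    by (rule AE_I') (auto simp: frontier_def closure_def interior_def)
  then show ?thesis using S(1) by (subst AE_restrict_space_iff) auto
qed

lemma is_weak_dderiv_weak_dderiv:
  "is_weak_dderiv b S v g \<Longrightarrow> is_weak_dderiv b S v (weak_dderiv b S v)"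
  unfolding weak_dderiv_def by (rule someI[of "is_weak_dderiv b S v"])

lemma absolutely_integrable_continuous_compact:
  fixes f :: "real^'n::finite \<Rightarrow> real"
  assumes "continuous_on UNIV f" "compact A" shows "f absolutely_integrable_on A"
proof -
  have c: "continuous_on A f" using assms(1) continuous_on_subset by blast
  have "integrable lborel (\<lambda>x. indicator A x *\<^sub>R f x)" by (rule borel_integrable_compact[OF assms(2) c])
  then show ?thesis unfolding set_integrable_def
    by (simp add: integrable_completion borel_measurable_integrable)
qed

lemma is_weak_dderiv_polyf:
  fixes f :: "real^'n::finite \<Rightarrow> real"
  assumes f: "polyf f" and S: "S \<in> sets lebesgue"
  shows "is_weak_dderiv b S f (dd b f)"
  unfolding is_weak_dderiv_iff
proof (intro conjI allI impI ballI)
  show "dd b f absolutely_integrable_on A" if "compact A \<and> A \<subseteq> interior S" for A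
    using that by (intro absolutely_integrable_continuous_compact polyf_continuous polyf_dd f) auto
  fix \<phi> assume \<phi>: "\<phi> \<in> test_functions (interior S)"
  note t = test_functionsD[OF \<phi>]
  let ?A = "closure {x. \<phi> x \<noteq> 0}"
  have C1: "C_diff 1 \<phi>" using t by blast
  have d\<phi>: "\<phi> differentiable (at x)" "f differentiable (at x)" for x 
    using C1 dd_has_derivative[OF f] by (auto intro: differentiableI)
  have sub: "closure {x. f x * \<phi> x \<noteq> 0} \<subseteq> ?A" by (rule closure_mono) auto
  have "C_diff 1 (\<lambda>x. f x * \<phi> x)" using C_diff_mult[OF C_diff_polyf[OF f] C1] .
  moreover have "compact (closure {x. f x * \<phi> x \<noteq> 0})"
    by (rule compact_closed_subset[OF t(2) closed_closure sub])
  ultimately have "(\<integral>x. dd b (\<lambda>x. f x * \<phi> x) x \<partial>lborel) = 0" by (intro integral_dd_eq_0)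
  moreover have eq: "dd b (\<lambda>x. f x * \<phi> x) = (\<lambda>x. f x * dd b \<phi> x + dd b f x * \<phi> x)"
    using dd_mult'[OF d\<phi>(2) d\<phi>(1)] by blast
  moreover have "continuous_on UNIV (\<lambda>x. f x * dd b \<phi> x + dd b f x * \<phi> x)"
    by (intro continuous_intros polyf_continuous polyf_dd f t(4) continuous_on_dd[OF C1])
  ultimately have "(\<integral>x. f x * dd b \<phi> x + dd b f x * \<phi> x \<partial>lebesgue) = 0"
    by (subst integral_completion) (auto simp: borel_measurable_continuous_onI)
  moreover have z: "f x * dd b \<phi> x + dd b f x * \<phi> x = 0" if "x \<notin> S" for x
  proof -
    have "x \<notin> interior S" using that interior_subset by blast
    then show ?thesis using t(6)[of x] t(7)[of x b] by simp
  qed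
  ultimately have 1: "(\<integral>x. f x * dd b \<phi> x + dd b f x * \<phi> x \<partial>(lebesgue_on S)) = 0"
    by (subst integral_lebesgue_on_support[OF S]) blast+
  have i: "integrable (lebesgue_on S) (\<lambda>x. u x * w x)" if "continuous_on UNIV u" "continuous_on UNIV w" "\<And>x. x \<notin> ?A \<Longrightarrow> w x = 0" for u w :: "real^'n \<Rightarrow> real"
  proof -
    have "(\<lambda>x. u x * w x) absolutely_integrable_on ?A"
      by (intro absolutely_integrable_continuous_compact t continuous_intros that)
    then have "integrable lebesgue (\<lambda>x. indicator ?A x *\<^sub>R (u x * w x))" by (simp add: set_integrable_def)
    moreover have "indicator ?A x *\<^sub>R (u x * w x) = u x * w x" for x
      using that(3)[of x] by (cases "x \<in> ?A") simp_all
    moreover have "u x * w x = 0" if "x \<notin> S" for x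
      using \<open>\<And>x. x \<notin> ?A \<Longrightarrow> w x = 0\<close>[of x] that t(3) interior_subset[of S] by auto
    ultimately show ?thesis
      by (subst integral_lebesgue_on_support[OF S]) (simp_all only:)
  qed
  have "(\<integral>x. f x * dd b \<phi> x \<partial>(lebesgue_on S)) + (\<integral>x. dd b f x * \<phi> x \<partial>(lebesgue_on S)) = 0"
    unfolding 1[symmetric]
    by (intro Bochner_Integration.integral_add[symmetric] i polyf_continuous polyf_dd f t(4,5) 
        continuous_on_dd[OF C1] dd_support) auto
  then show "(\<integral>x. f x * dd b \<phi> x \<partial>(lebesgue_on S)) = - (\<integral>x. dd b f x * \<phi> x \<partial>(lebesgue_on S))" by simp
qed

lemma integrable_mult_dd_test:
  fixes v :: "real^'n::finite \<Rightarrow> real"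
  assumes S: "S \<in> sets lebesgue" and v: "integrable (lebesgue_on S) v" and \<phi>: "\<phi> \<in> test_functions U"
  shows "integrable (lebesgue_on S) (\<lambda>x. v x * dd b \<phi> x)"
proof -
  note t = test_functionsD[OF \<phi>]
  have c: "continuous_on UNIV (dd b \<phi>)" by (rule continuous_on_dd) (rule t)
  obtain B where B: "\<And>x. \<bar>dd b \<phi> x\<bar> \<le> B"
    using compact_support_bounded[OF c t(2) dd_support] by blast
  have "integrable (lebesgue_on S) (\<lambda>x. dd b \<phi> x * v x)"
    using c continuous_on_subset B by (intro integrable_bounded_mult v continuous_imp_measurable_on_sets_lebesgue S) auto
  then show ?thesis by (simp add: mult.commute)
qed

lemma is_weak_dderiv_lincomb:
  fixes v :: "real^'n::finite \<Rightarrow> real"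
  assumes S: "S \<in> sets lebesgue" and i: "integrable (lebesgue_on S) v" "integrable (lebesgue_on S) v'"
    and w: "is_weak_dderiv b S v g" "is_weak_dderiv b S v' g'"
  shows "is_weak_dderiv b S (\<lambda>x. v x + r * v' x) (\<lambda>x. g x + r * g' x)"
  unfolding is_weak_dderiv_iff
proof (intro conjI allI impI ballI)
  have a: "g absolutely_integrable_on A" "g' absolutely_integrable_on A" if "compact A" "A \<subseteq> interior S" for A
    using w that by (auto simp: is_weak_dderiv_iff)
  then show "(\<lambda>x. g x + r * g' x) absolutely_integrable_on A" if "compact A \<and> A \<subseteq> interior S" for A
    using that by (intro set_integral_add(1) set_integrable_mult_right) auto
  fix \<phi> assume \<phi>: "\<phi> \<in> test_functions (interior S)"
  have 1: "(\<integral>x. (v x + r * v' x) * dd b \<phi> x \<partial>(lebesgue_on S)) 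
     = (\<integral>x. v x * dd b \<phi> x \<partial>(lebesgue_on S)) + r * (\<integral>x. v' x * dd b \<phi> x \<partial>(lebesgue_on S))"
    unfolding distrib_right mult.assoc
    by (simp add: Bochner_Integration.integral_add integrable_mult_dd_test[OF S _ \<phi>] i)
  have 2: "(\<integral>x. (g x + r * g' x) * \<phi> x \<partial>(lebesgue_on S)) 
     = (\<integral>x. g x * \<phi> x \<partial>(lebesgue_on S)) + r * (\<integral>x. g' x * \<phi> x \<partial>(lebesgue_on S))"
    unfolding distrib_right mult.assoc
    by (simp add: Bochner_Integration.integral_add integrable_test_mult[OF \<phi> S] a)
  show "(\<integral>x. (v x + r * v' x) * dd b \<phi> x \<partial>(lebesgue_on S)) = - (\<integral>x. (g x + r * g' x) * \<phi> x \<partial>(lebesgue_on S))"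
    unfolding 1 2 using w \<phi> by (simp add: is_weak_dderiv_iff algebra_simps)
qed

section \<open>Geometry of a nondegenerate simplex\<close>

lemma sum_option: "(\<Sum>i\<in>(UNIV :: 'n::finite option set). f i) = f None + (\<Sum>j\<in>UNIV. f (Some j))"
  by (simp add: UNIV_option_conv sum.reindex)

definition other :: "'n option \<Rightarrow> 'n option" where
  "other i = (if i = None then Some undefined else None)"

lemma other_neq [simp]: "other i \<noteq> i" "i \<noteq> other i"
  by (auto simp: other_def)

definition ref_grad :: "'n::finite option \<Rightarrow> real^'n" where
  "ref_grad i = (case i of None \<Rightarrow> (\<chi> j. -1) | Some j \<Rightarrow> axis j 1)"

definition ref_offset :: "'n::finite option \<Rightarrow> real" where
  "ref_offset i = (if i = None then 1 else 0)"

lemma ref_grad_inner: "ref_grad i \<bullet> y = (case i of None \<Rightarrow> - (\<Sum>j\<in>UNIV. y $ j) | Some j \<Rightarrow> y $ j)"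
  by (cases i) (simp_all add: ref_grad_def inner_axis' inner_vec_def[of "\<chi> j. - 1"] sum_negf)

lemma ref_bary_vertex: "ref_grad i \<bullet> ref_simplex j + ref_offset i = (if i = j then 1 else 0)"
  by (auto simp: ref_grad_inner ref_offset_def ref_simplex_def axis_def split: option.splits)

definition grad_bary :: "'n::finite lsimplex \<Rightarrow> 'n option \<Rightarrow> real^'n" where
  "grad_bary K i = transpose (matrix_inv (elem_matrix K)) *v ref_grad i"

lemma grad_bary_inner: "grad_bary K i \<bullet> x = ref_grad i \<bullet> (matrix_inv (elem_matrix K) *v x)"
  unfolding grad_bary_def by (metis dot_lmul_matrix inner_commute transpose_matrix_vector transpose_transpose)

definition elem_inv :: "'n::finite lsimplex \<Rightarrow> real^'n \<Rightarrow> real^'n" where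
  "elem_inv K x = matrix_inv (elem_matrix K) *v (x - K None)"

definition bary_offset :: "'n::finite lsimplex \<Rightarrow> 'n option \<Rightarrow> real" where
  "bary_offset K i = ref_offset i - grad_bary K i \<bullet> K None"

lemma ref_bary_elem_inv: "grad_bary K i \<bullet> x + bary_offset K i = ref_grad i \<bullet> elem_inv K x + ref_offset i"
  by (simp add: bary_offset_def grad_bary_inner elem_inv_def matrix_vector_mult_diff_distrib inner_diff_right)

locale nondegenerate_simplex =
  fixes K :: "'n::finite lsimplex"
  assumes inv: "invertible (elem_matrix K)"
begin

lemma matrix_inv_elem: 
  "elem_matrix K ** matrix_inv (elem_matrix K) = mat 1" "matrix_inv (elem_matrix K) ** elem_matrix K = mat 1"
proof -
  have "elem_matrix K ** matrix_inv (elem_matrix K) = mat 1 \<and> matrix_inv (elem_matrix K) ** elem_matrix K = mat 1"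
    unfolding matrix_inv_def by (rule someI_ex) (use inv in \<open>simp add: invertible_def\<close>)
  then show "elem_matrix K ** matrix_inv (elem_matrix K) = mat 1" 
    "matrix_inv (elem_matrix K) ** elem_matrix K = mat 1" by blast+
qed

lemma elem_inv_map [simp]: "elem_inv K (elem_map K y) = y"
  using matrix_inv_elem(2) by (simp add: elem_inv_def elem_map_def matrix_vector_mul_assoc)

lemma elem_map_inv [simp]: "elem_map K (elem_inv K x) = x"
  using matrix_inv_elem(1) by (simp add: elem_inv_def elem_map_def matrix_vector_mul_assoc)

lemma grad_bary_vertex: "grad_bary K i \<bullet> K j + bary_offset K i = (if i = j then 1 else 0)"
  using ref_bary_vertex[of i j] elem_inv_map[of "ref_simplex j"] unfolding ref_bary_elem_inv elem_map_ref_simplex by simp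

lemma grad_bary_expand: 
  "(\<Sum>i\<in>UNIV. (grad_bary K i \<bullet> x + bary_offset K i)) = 1"
  "(\<Sum>i\<in>UNIV. (grad_bary K i \<bullet> x + bary_offset K i) *\<^sub>R K i) = x"
proof -
  define y where "y = elem_inv K x"
  have x: "x = elem_matrix K *v y + K None" unfolding y_def using elem_map_inv[of x] by (simp add: elem_map_def)
  have M: "elem_matrix K *v y = (\<Sum>j\<in>UNIV. y $ j *\<^sub>R (K (Some j) - K None))"
    by (simp add: vec_eq_iff matrix_vector_mult_def elem_matrix_def mult.commute)
  show "(\<Sum>i\<in>UNIV. (grad_bary K i \<bullet> x + bary_offset K i)) = 1"
    unfolding ref_bary_elem_inv y_def[symmetric] by (simp add: sum_option ref_grad_inner ref_offset_def)
  show "(\<Sum>i\<in>UNIV. (grad_bary K i \<bullet> x + bary_offset K i) *\<^sub>R K i) = x"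
    unfolding ref_bary_elem_inv y_def[symmetric] 
    by (simp add: sum_option ref_grad_inner ref_offset_def x M scaleR_diff_right sum_subtractf
        scaleR_add_left scaleR_left.sum[symmetric])
qed

lemma bary_eq: "bary K i x = grad_bary K i \<bullet> x + bary_offset K i"
proof -
  let ?l = "\<lambda>i. grad_bary K i \<bullet> x + bary_offset K i"
  have "(THE c. (\<Sum>j\<in>UNIV. c j) = 1 \<and> (\<Sum>j\<in>UNIV. c j *\<^sub>R K j) = x) = ?l"
  proof (rule the_equality)
    show "(\<Sum>j\<in>UNIV. ?l j) = 1 \<and> (\<Sum>j\<in>UNIV. ?l j *\<^sub>R K j) = x" using grad_bary_expand by blast
    fix c assume c: "(\<Sum>j\<in>UNIV. c j) = 1 \<and> (\<Sum>j\<in>UNIV. c j *\<^sub>R K j) = x"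
    show "c = ?l"
    proof
      fix i
      have "?l i = grad_bary K i \<bullet> (\<Sum>j\<in>UNIV. c j *\<^sub>R K j) + (\<Sum>j\<in>UNIV. c j) * bary_offset K i" using c by simp
      also have "\<dots> = (\<Sum>j\<in>UNIV. c j * (grad_bary K i \<bullet> K j + bary_offset K i))"
        by (simp add: inner_sum_right sum_distrib_right sum.distrib distrib_left)
      also have "\<dots> = c i" unfolding grad_bary_vertex by (simp add: if_distrib cong: if_cong)
      finally show "c i = ?l i" by simp
    qed
  qed
  then show ?thesis by (simp add: bary_def)
qed

lemma bary_fun_eq: "bary K i = (\<lambda>x. grad_bary K i \<bullet> x + bary_offset K i)"
  using bary_eq by blast

lemma bary_vertex: "bary K i (K j) = (if i = j then 1 else 0)"
  using grad_bary_vertex by (simp add: bary_eq)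

lemma bary_sum: "(\<Sum>i\<in>UNIV. bary K i x) = 1"
  using grad_bary_expand by (simp add: bary_eq)

lemma bary_expand: "(\<Sum>i\<in>UNIV. bary K i x *\<^sub>R K i) = x"
  using grad_bary_expand by (simp add: bary_eq)

lemma bary_poly_space: "bary K i \<in> poly_space 1"
  unfolding bary_fun_eq by (rule poly_space_affine)

lemma bary_polyf [intro, simp]: "polyf (bary K i)"
  using bary_poly_space by (rule polyfI)

lemma dd_bary [simp]: "dd b (bary K i) x = grad_bary K i \<bullet> b"
  unfolding bary_fun_eq by simp

lemma bary_add: "bary K i (x + b) = bary K i x + grad_bary K i \<bullet> b"
  by (simp add: bary_eq inner_add_right)

lemma grad_bary_sum: "(\<Sum>i\<in>UNIV. grad_bary K i \<bullet> b) = 0"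
  using bary_sum[of "0 + b"] bary_sum[of 0] unfolding bary_add by (simp add: sum.distrib)

lemma grad_bary_sum_vertices: "(\<Sum>i\<in>UNIV. (grad_bary K i \<bullet> b) *\<^sub>R K i) = b"
  using bary_expand[of "0 + b"] bary_expand[of 0] unfolding bary_add 
  by (simp add: sum.distrib scaleR_add_left)

lemma grad_bary_edge: "grad_bary K i \<bullet> (K j - K l) = (if i = j then 1 else 0) - (if i = l then 1 else 0)"
  using grad_bary_vertex[of i j] grad_bary_vertex[of i l] by (auto simp: inner_diff_right split: if_splits)

lemma grad_bary_nonzero: "grad_bary K i \<noteq> 0"
  using grad_bary_edge[of i i "other i"] by auto

lemma body_iff: "x \<in> body K \<longleftrightarrow> (\<forall>i. 0 \<le> bary K i x)"
proof
  have "convex {x. \<forall>i. 0 \<le> bary K i x}"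
  proof -
    have "{x. 0 \<le> bary K i x} = {x. grad_bary K i \<bullet> x \<ge> - bary_offset K i}" for i
      unfolding bary_eq by (intro Collect_cong) linarith
    then have "convex {x. 0 \<le> bary K i x}" for i by (simp only: convex_halfspace_ge)
    then have "convex (\<Inter>i\<in>UNIV. {x. 0 \<le> bary K i x})" by (intro convex_INT)
    moreover have "(\<Inter>i\<in>UNIV. {x. 0 \<le> bary K i x}) = {x. \<forall>i. 0 \<le> bary K i x}" by blast
    ultimately show ?thesis by simp
  qed
  then have "body K \<subseteq> {x. \<forall>i. 0 \<le> bary K i x}"
    unfolding body_def by (intro hull_minimal) (auto simp: bary_vertex)
  then show "x \<in> body K \<Longrightarrow> \<forall>i. 0 \<le> bary K i x" by blast
  assume a: "\<forall>i. 0 \<le> bary K i x"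
  have "(\<Sum>i\<in>UNIV. bary K i x *\<^sub>R K i) \<in> convex hull range K"
    by (rule convex_sum[OF finite_class.finite_UNIV convex_convex_hull bary_sum]) (use a in \<open>auto intro: hull_inc\<close>)
  then show "x \<in> body K" by (simp add: bary_expand body_def)
qed

lemma bary_le_1: "x \<in> body K \<Longrightarrow> bary K i x \<le> 1"
  using bary_sum[of x] member_le_sum[of i UNIV "\<lambda>i. bary K i x"] body_iff by auto

lemma bary_continuous: "continuous_on S (bary K i)"
  by (simp add: polyf_continuous)

lemma interior_body_iff: "x \<in> interior (body K) \<longleftrightarrow> (\<forall>i. 0 < bary K i x)"
proof
  have "{x. \<forall>i. 0 < bary K i x} = (\<Inter>i\<in>UNIV. {x. 0 < bary K i x})" by auto
  then have "open {x. \<forall>i. 0 < bary K i x}"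
    using open_INT[of UNIV "\<lambda>i. {x. 0 < bary K i x}"] open_Collect_less[OF continuous_on_const bary_continuous] by simp
  moreover have "{x. \<forall>i. 0 < bary K i x} \<subseteq> body K" by (auto simp: body_iff less_imp_le)
  ultimately show "\<forall>i. 0 < bary K i x \<Longrightarrow> x \<in> interior (body K)" using interior_maximal by blast
  assume "x \<in> interior (body K)"
  then obtain e where e: "e > 0" "ball x e \<subseteq> body K" by (meson mem_interior)
  show "\<forall>i. 0 < bary K i x"
  proof
    fix i
    define d where "d = K (other i) - K i"
    have d: "grad_bary K i \<bullet> d = -1" unfolding d_def by (simp add: grad_bary_edge)
    define t where "t = (e / 2) / (norm d + 1)"
    have nz: "norm d + 1 \<noteq> 0" using norm_ge_zero[of d] by linarith
    have t: "t > 0" using e by (simp add: t_def add_nonneg_pos)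
    have "t * norm d \<le> t * (norm d + 1)" using t by simp
    also have "\<dots> = e / 2" unfolding t_def using nz nonzero_eq_divide_eq[of "norm d + 1" "(e / 2) / (norm d + 1)" "e / 2"] by blast
    also have "\<dots> < e" using e by simp
    finally have "x + t *\<^sub>R d \<in> ball x e" using t by (simp add: dist_norm)
    then have "0 \<le> bary K i (x + t *\<^sub>R d)" using e body_iff by blast
    then show "0 < bary K i x" using t d by (simp add: bary_add)
  qed
qed

lemma compact_body: "compact (body K)"
  unfolding body_def by (simp add: finite_imp_compact_convex_hull)

lemma convex_body: "convex (body K)"
  by (simp add: body_def)

lemma closed_body: "closed (body K)"
  using compact_body by (rule compact_imp_closed)

lemma body_lmeasurable: "body K \<in> lmeasurable"
  using compact_body by (rule lmeasurable_compact)

lemma body_lebesgue [simp]: "body K \<in> sets lebesgue"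
  using body_lmeasurable by (rule fmeasurableD)

lemma negligible_frontier_body: "negligible (frontier (body K))"
  using convex_body by (rule negligible_convex_frontier)

lemma frontier_body_iff: "x \<in> frontier (body K) \<longleftrightarrow> x \<in> body K \<and> (\<exists>i. bary K i x = 0)"
proof -
  have "x \<in> frontier (body K) \<longleftrightarrow> x \<in> body K \<and> \<not> (\<forall>i. 0 < bary K i x)"
    by (simp add: frontier_def closure_closed[OF closed_body] interior_body_iff)
  then show ?thesis unfolding body_iff by (metis order_less_le)
qed

lemma interior_body_nonempty: "interior (body K) \<noteq> {}"
proof -
  let ?c = "1 / real CARD('n option)"
  define x where "x = (\<Sum>i\<in>UNIV. ?c *\<^sub>R K i)"
  have "(\<Sum>i\<in>(UNIV :: 'n option set). ?c) = 1" by simp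
  then have "bary K j x = (\<Sum>i\<in>UNIV. ?c * bary K j (K i))" for j
    unfolding x_def bary_eq
    by (simp add: inner_sum_right distrib_left sum.distrib)
  then have "bary K j x = ?c" for j by (simp add: bary_vertex if_distrib cong: if_cong)
  then have "x \<in> interior (body K)" by (simp add: interior_body_iff)
  then show ?thesis by blast
qed

lemma measure_body_pos: "0 < measure lebesgue (body K)"
proof -
  have "\<not> negligible (body K)" 
    using interior_body_nonempty open_not_negligible[OF open_interior] negligible_subset interior_subset by metis
  then have "measure lebesgue (body K) \<noteq> 0" using body_lmeasurable negligible_iff_measure by blast
  then show ?thesis by (metis measure_nonneg order_less_le)
qed

lemma bary_facet: "x \<in> facet K i \<Longrightarrow> bary K i x = 0"
proof -
  have "facet K i \<subseteq> {x. grad_bary K i \<bullet> x = - bary_offset K i}"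
    unfolding facet_def
  proof (rule hull_minimal)
    show "K ` (UNIV - {i}) \<subseteq> {x. grad_bary K i \<bullet> x = - bary_offset K i}"
    proof
      fix x assume "x \<in> K ` (UNIV - {i})"
      then obtain j where "x = K j" "j \<noteq> i" by blast
      then show "x \<in> {x. grad_bary K i \<bullet> x = - bary_offset K i}" using grad_bary_vertex[of i j] by simp
    qed
  qed (rule convex_hyperplane)
  then show "x \<in> facet K i \<Longrightarrow> bary K i x = 0" by (auto simp: bary_eq)
qed

lemma vertex_in_facet: "j \<noteq> i \<Longrightarrow> K j \<in> facet K i"
  unfolding facet_def by (intro hull_inc) auto

lemma outer_normal_eq: "outer_normal K i = (- 1 / norm (grad_bary K i)) *\<^sub>R grad_bary K i"
  unfolding outer_normal_def
proof (rule the_equality)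
  let ?g = "grad_bary K i" and ?F = "facet K i"
  have g0: "norm ?g > 0" using grad_bary_nonzero by simp
  have F: "?g \<bullet> x = - bary_offset K i" if "x \<in> ?F" for x using bary_facet[OF that] by (simp add: bary_eq)
  have Ki: "?g \<bullet> K i = 1 - bary_offset K i" using grad_bary_vertex[of i i] by simp
  show "norm ((- 1 / norm ?g) *\<^sub>R ?g) = 1 \<and> (\<forall>x\<in>?F. \<forall>y\<in>?F. ((- 1 / norm ?g) *\<^sub>R ?g) \<bullet> (x - y) = 0) \<and>
     (\<forall>x\<in>?F. ((- 1 / norm ?g) *\<^sub>R ?g) \<bullet> (K i - x) < 0)"
    using g0 by (auto simp: inner_diff_right F Ki field_simps)
  fix n assume n: "norm n = 1 \<and> (\<forall>x\<in>?F. \<forall>y\<in>?F. n \<bullet> (x - y) = 0) \<and> (\<forall>x\<in>?F. n \<bullet> (K i - x) < 0)"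
  let ?l = "other i"
  define c where "c = n \<bullet> (K i - K ?l)"
  have c: "c < 0" using n vertex_in_facet[of ?l i] by (simp add: c_def)
  have nK: "n \<bullet> K j = n \<bullet> K ?l + (if j = i then c else 0)" for j
  proof (cases "j = i")
    case False
    then have "n \<bullet> (K j - K ?l) = 0" using n vertex_in_facet[of j i] vertex_in_facet[of ?l i] by simp
    then show ?thesis using False by (simp add: inner_diff_right)
  qed (simp add: c_def inner_diff_right)
  have "n \<bullet> y = (c *\<^sub>R ?g) \<bullet> y" for y
  proof -
    have "n \<bullet> y = n \<bullet> (\<Sum>j\<in>UNIV. (grad_bary K j \<bullet> y) *\<^sub>R K j)" by (simp add: grad_bary_sum_vertices)
    also have "\<dots> = (\<Sum>j\<in>UNIV. (grad_bary K j \<bullet> y) * (n \<bullet> K ?l + (if j = i then c else 0)))"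
      unfolding inner_sum_right inner_scaleR_right by (intro sum.cong refl arg_cong2[where f = "(*)"] nK)
    also have "\<dots> = (\<Sum>j\<in>UNIV. grad_bary K j \<bullet> y) * (n \<bullet> K ?l) + (\<Sum>j\<in>UNIV. if j = i then (grad_bary K j \<bullet> y) * c else 0)"
      unfolding distrib_left sum.distrib sum_distrib_right by (simp add: if_distrib cong: if_cong)
    finally show ?thesis by (simp add: grad_bary_sum mult.commute)
  qed
  then have nc: "n = c *\<^sub>R ?g" by (metis vector_eq_rdot)
  then have "\<bar>c\<bar> * norm ?g = 1" using n by simp
  then have "c = - 1 / norm ?g" using c g0 by (simp add: field_simps)
  then show "n = (- 1 / norm ?g) *\<^sub>R ?g" using nc by simp
qed

lemma inner_outer_normal: "b \<bullet> outer_normal K i = - (grad_bary K i \<bullet> b) / norm (grad_bary K i)"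
  by (simp add: outer_normal_eq inner_commute)

lemma sgn_outer_normal: "sgn (b \<bullet> outer_normal K i) = - sgn (grad_bary K i \<bullet> b)"
proof -
  have "norm (grad_bary K i) > 0" using grad_bary_nonzero by simp
  then show ?thesis unfolding inner_outer_normal by (simp only: sgn_divide sgn_minus) (simp add: sgn_if)
qed

end

section \<open>Integration by parts on a simplex\<close>

lemma polyf_lipschitz:
  fixes f :: "real^'n::finite \<Rightarrow> real"
  assumes f: "polyf f" and A: "compact A" "convex A"
  obtains L where "L \<ge> 0" "\<And>x y. x \<in> A \<Longrightarrow> y \<in> A \<Longrightarrow> \<bar>f x - f y\<bar> \<le> L * norm (x - y)"
proof -
  have "\<exists>B. \<forall>x\<in>A. \<bar>dd (axis i 1) f x\<bar> \<le> B" for i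
  proof -
    have "compact (dd (axis i 1) f ` A)"
      by (intro compact_continuous_image polyf_continuous polyf_dd f A)
    then have "bounded (dd (axis i 1) f ` A)" by (rule compact_imp_bounded)
    then show ?thesis unfolding bounded_iff by (simp add: ball_simps)
  qed
  then obtain B where B: "\<And>i x. x \<in> A \<Longrightarrow> \<bar>dd (axis i 1) f x\<bar> \<le> B i" by metis
  define L where "L = (\<Sum>i\<in>UNIV. \<bar>B i\<bar>)"
  have L0: "L \<ge> 0" unfolding L_def by (intro sum_nonneg) auto
  have C1: "C_diff 1 f" using f by (rule C_diff_polyf)
  have "norm (f x - f y) \<le> L * norm (x - y)" if xy: "x \<in> A" "y \<in> A" for x y
  proof (rule differentiable_bound[OF A(2) _ _ xy])
    show "(f has_derivative (\<lambda>b. dd b f x)) (at x within A)" for x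
      by (rule continuous_on_dd(4)[OF C1])
    show "onorm (\<lambda>b. dd b f x) \<le> L" if x: "x \<in> A" for x
    proof (rule onorm_le)
      fix b
      have "norm (dd b f x) \<le> (\<Sum>i\<in>UNIV. \<bar>b $ i * dd (axis i 1) f x\<bar>)"
        unfolding continuous_on_dd(3)[OF C1, of b] by (simp add: sum_abs)
      also have "\<dots> \<le> (\<Sum>i\<in>UNIV. norm b * \<bar>B i\<bar>)"
        unfolding abs_mult 
      proof (intro sum_mono mult_mono component_le_norm_cart)
        show "\<bar>dd (axis i 1) f x\<bar> \<le> \<bar>B i\<bar>" for i using B[OF x, of i] by linarith
      qed auto
      finally show "norm (dd b f x) \<le> L * norm b" by (simp add: L_def sum_distrib_left mult.commute)
    qed
  qed
  then show ?thesis using that[OF L0] by simp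
qed

lemma exp_quadratic_bound: 
  fixes u :: real assumes "u \<ge> 0" shows "(u + u\<^sup>2) * exp (- u) \<le> 2"
proof -
  have "1 + u + u\<^sup>2 / 2 \<le> exp u" using assms by (rule exp_lower_Taylor_quadratic)
  then have "u + u\<^sup>2 \<le> 2 * exp u" using assms by simp
  then show ?thesis by (simp add: exp_minus field_simps)
qed

lemma cutoff2_bound:
  assumes "\<eta> > 0" shows "\<eta> * cutoff 2 \<eta> s * (s + \<eta>) \<le> 2"
proof (cases "s > 0")
  case True
  have "\<eta> * cutoff 2 \<eta> s * (s + \<eta>) = (\<eta> / s + (\<eta> / s)\<^sup>2) * exp (- (\<eta> / s))"
    using True by (simp add: cutoff_def field_simps power2_eq_square)
  also have "\<dots> \<le> 2" using assms True by (intro exp_quadratic_bound) auto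
  finally show ?thesis .
qed (simp add: cutoff_def)

lemma cutoff_nonneg: "0 \<le> cutoff n \<eta> s"
  by (simp add: cutoff_def)

context nondegenerate_simplex
begin

abbreviation IK :: "(real^'n \<Rightarrow> real) \<Rightarrow> real" where
  "IK f \<equiv> integral\<^sup>L (lebesgue_on (body K)) f"

lemma integrable_continuous_body: 
  assumes "continuous_on UNIV (f :: real^'n \<Rightarrow> real)" shows "integrable (lebesgue_on (body K)) f"
  using absolutely_integrable_continuous_compact[OF assms compact_body]
  by (simp add: set_integrable_eq)

lemma integrable_polyf [simp]: "polyf f \<Longrightarrow> integrable (lebesgue_on (body K)) f"
  by (intro integrable_continuous_body polyf_continuous)

lemma polyf_bounded_body:
  assumes "polyf f" obtains B where "B \<ge> 0" "\<And>x. x \<in> body K \<Longrightarrow> \<bar>f x\<bar> \<le> B"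
proof -
  have "compact (f ` body K)" by (intro compact_continuous_image polyf_continuous assms compact_body)
  then have "bounded (f ` body K)" by (rule compact_imp_bounded)
  then obtain B where "\<forall>x\<in>body K. \<bar>f x\<bar> \<le> B" by (auto simp: bounded_iff)
  then show ?thesis using that[of "\<bar>B\<bar>"] by force
qed

lemma polyf_measurable_body: "polyf f \<Longrightarrow> f \<in> borel_measurable (lebesgue_on (body K))"
  using integrable_polyf by (rule borel_measurable_integrable)

lemma integrable_polyf_mult:
  assumes "polyf f" "integrable (lebesgue_on (body K)) v" shows "integrable (lebesgue_on (body K)) (\<lambda>x. f x * v x)"
proof -
  obtain B where "\<And>x. x \<in> body K \<Longrightarrow> \<bar>f x\<bar> \<le> B" using polyf_bounded_body[OF assms(1)] by blast
  then show ?thesis by (intro integrable_bounded_mult[OF assms(2) polyf_measurable_body[OF assms(1)], of B]) simp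
qed

lemma AE_interior_body: "AE x in lebesgue_on (body K). x \<in> interior (body K)"
proof -
  have "frontier (body K) \<in> null_sets lebesgue" using negligible_frontier_body by (simp add: negligible_iff_null_sets)
  then have "AE x in lebesgue. x \<in> body K \<longrightarrow> x \<in> interior (body K)"
    by (rule AE_I') (auto simp: frontier_def closure_closed[OF closed_body])
  then show ?thesis by (subst AE_restrict_space_iff) auto
qed

lemma bary_bound_if_zero_on_facet:
  assumes z: "polyf z" "\<And>x. x \<in> body K \<Longrightarrow> bary K j x = 0 \<Longrightarrow> z x = 0"
  obtains C where "C \<ge> 0" "\<And>x. x \<in> body K \<Longrightarrow> \<bar>z x\<bar> \<le> C * bary K j x"
proof -
  obtain L where L: "L \<ge> 0" "\<And>x y. x \<in> body K \<Longrightarrow> y \<in> body K \<Longrightarrow> \<bar>z x - z y\<bar> \<le> L * norm (x - y)"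
    using polyf_lipschitz[OF z(1) compact_body convex_body] by blast
  define d where "d = K (other j) - K j"
  have "\<bar>z x\<bar> \<le> (L * norm d) * bary K j x" if x: "x \<in> body K" for x
  proof -
    have x0: "\<And>i. 0 \<le> bary K i x" using x body_iff by blast
    define y where "y = x + bary K j x *\<^sub>R d"
    have b: "bary K i y = bary K i x + bary K j x * ((if i = other j then 1 else 0) - (if i = j then 1 else 0))" for i
      by (simp add: y_def bary_add d_def grad_bary_edge)
    have y: "y \<in> body K" using x0 unfolding body_iff b by auto
    have "bary K j y = 0" by (simp add: b)
    then have "z y = 0" using z(2) y by blast
    then have "\<bar>z x\<bar> \<le> L * norm (x - y)" using L(2)[OF x y] by simp
    also have "x - y = - (bary K j x *\<^sub>R d)" by (simp add: y_def)
    also have "L * norm \<dots> = (L * norm d) * bary K j x" using x0 by simp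
    finally show ?thesis .
  qed
  then show ?thesis using that[of "L * norm d"] L(1) by simp
qed

definition inner_cutoff :: "real \<Rightarrow> real^'n \<Rightarrow> real" where
  "inner_cutoff \<eta> x = (\<Prod>j\<in>UNIV. cutoff 0 \<eta> (bary K j x - \<eta>))"

lemma inner_cutoff_bounds: "\<eta> > 0 \<Longrightarrow> 0 \<le> inner_cutoff \<eta> x" "\<eta> > 0 \<Longrightarrow> inner_cutoff \<eta> x \<le> 1"
  unfolding inner_cutoff_def by (auto intro!: prod_nonneg prod_le_1 cutoff0_bounds)

lemma bary_cutoff_has_derivative:
  assumes "\<eta> > 0"
  shows "((\<lambda>x. cutoff 0 \<eta> (bary K j x - \<eta>)) has_derivative
     (\<lambda>b. \<eta> * cutoff 2 \<eta> (bary K j x - \<eta>) * (grad_bary K j \<bullet> b))) (at x)"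
  using cutoff_affine_has_derivative[OF assms, of 0 "grad_bary K j" "bary_offset K j - \<eta>" x]
  by (simp add: bary_eq add_diff_eq numeral_2_eq_2)

lemma inner_cutoff_has_derivative:
  assumes "\<eta> > 0"
  shows "(inner_cutoff \<eta> has_derivative (\<lambda>b. \<Sum>j\<in>UNIV. \<eta> * cutoff 2 \<eta> (bary K j x - \<eta>) * (grad_bary K j \<bullet> b) *
     (\<Prod>m\<in>UNIV - {j}. cutoff 0 \<eta> (bary K m x - \<eta>)))) (at x)"
  unfolding inner_cutoff_def[abs_def]
  by (rule has_derivative_prod) (rule bary_cutoff_has_derivative[OF assms])

lemma inner_cutoff_test:
  assumes "\<eta> > 0" and z: "polyf z"
  shows "(\<lambda>x. z x * inner_cutoff \<eta> x) \<in> test_functions (interior (body K))"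
proof (rule test_functionsI[of _ "{x \<in> body K. \<forall>j. \<eta> \<le> bary K j x}"])
  have "C_diff m (\<lambda>x. cutoff 0 \<eta> (bary K j x - \<eta>))" for m j
    using C_diff_cutoff_affine[OF assms(1), of m 0 "grad_bary K j" "bary_offset K j - \<eta>"] 
    by (simp add: bary_eq add_diff_eq)
  then show "C_diff m (\<lambda>x. z x * inner_cutoff \<eta> x)" for m
    unfolding inner_cutoff_def by (intro C_diff_mult[OF C_diff_polyf[OF z]] C_diff_prod)
  have "{x \<in> body K. \<forall>j. \<eta> \<le> bary K j x} = body K \<inter> (\<Inter>j\<in>UNIV. {x. \<eta> \<le> bary K j x})" by auto
  moreover have "closed (\<Inter>j\<in>UNIV. {x. \<eta> \<le> bary K j x})"
    by (intro closed_INT ballI closed_Collect_le continuous_on_const bary_continuous)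
  ultimately show "compact {x \<in> body K. \<forall>j. \<eta> \<le> bary K j x}"
    using compact_Int_closed[OF compact_body] by simp
  show "{x \<in> body K. \<forall>j. \<eta> \<le> bary K j x} \<subseteq> interior (body K)"
  proof
    fix x assume "x \<in> {x \<in> body K. \<forall>j. \<eta> \<le> bary K j x}"
    then have "0 < bary K j x" for j using assms(1) less_le_trans[of 0 \<eta> "bary K j x"] by simp
    then show "x \<in> interior (body K)" by (simp add: interior_body_iff)
  qed
  fix x assume "x \<notin> {x \<in> body K. \<forall>j. \<eta> \<le> bary K j x}"
  then consider "x \<notin> body K" | j where "\<not> \<eta> \<le> bary K j x" by blast
  then obtain j where "bary K j x < \<eta>"
  proof cases
    case 1
    then obtain j where "\<not> 0 \<le> bary K j x" using body_iff by blast
    then have "bary K j x < \<eta>" using assms(1) by linarith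
    then show ?thesis by (rule that)
  next
    case (2 j)
    then show ?thesis using that[of j] by linarith
  qed
  then have "cutoff 0 \<eta> (bary K j x - \<eta>) = 0" by (simp add: cutoff_def)
  then have "inner_cutoff \<eta> x = 0" unfolding inner_cutoff_def by (intro prod_zero) auto
  then show "z x * inner_cutoff \<eta> x = 0" by simp
qed

lemma inner_cutoff_tendsto:
  assumes "x \<in> interior (body K)" shows "(\<lambda>n. inner_cutoff (1 / real (Suc n)) x) \<longlonglongrightarrow> 1"
proof -
  have e0: "(\<lambda>n. 1 / real (Suc n)) \<longlonglongrightarrow> 0" using LIMSEQ_inverse_real_of_nat by (simp add: inverse_eq_divide)
  have "(\<lambda>n. cutoff 0 (1 / real (Suc n)) (bary K j x - 1 / real (Suc n))) \<longlonglongrightarrow> 1" for j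
  proof -
    have l: "bary K j x > 0" using assms interior_body_iff by blast
    have "(\<lambda>n. exp (- (1 / real (Suc n)) / (bary K j x - 1 / real (Suc n)))) \<longlonglongrightarrow> exp (- 0 / (bary K j x - 0))"
      by (intro tendsto_exp tendsto_divide tendsto_minus tendsto_diff tendsto_const e0) (use l in simp)
    then have "(\<lambda>n. exp (- (1 / real (Suc n)) / (bary K j x - 1 / real (Suc n)))) \<longlonglongrightarrow> 1" by simp
    moreover have "\<forall>\<^sub>F n in sequentially. exp (- (1 / real (Suc n)) / (bary K j x - 1 / real (Suc n))) 
       = cutoff 0 (1 / real (Suc n)) (bary K j x - 1 / real (Suc n))"
      using order_tendstoD(2)[OF e0 l] by eventually_elim (simp add: cutoff_def)
    ultimately show ?thesis by (rule Lim_transform_eventually)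
  qed
  then have "(\<lambda>n. inner_cutoff (1 / real (Suc n)) x) \<longlonglongrightarrow> (\<Prod>j\<in>(UNIV :: 'n option set). 1)"
    unfolding inner_cutoff_def by (intro tendsto_prod)
  then show ?thesis by simp
qed

lemma dd_inner_cutoff_tendsto:
  assumes "x \<in> interior (body K)" shows "(\<lambda>n. dd e (inner_cutoff (1 / real (Suc n))) x) \<longlonglongrightarrow> 0"
proof -
  have e0: "(\<lambda>n. 1 / real (Suc n)) \<longlonglongrightarrow> 0" using LIMSEQ_inverse_real_of_nat by (simp add: inverse_eq_divide)
  have t: "(\<lambda>n. 1 / real (Suc n) * cutoff 2 (1 / real (Suc n)) (bary K j x - 1 / real (Suc n)) * (grad_bary K j \<bullet> e) *
     (\<Prod>m\<in>UNIV - {j}. cutoff 0 (1 / real (Suc n)) (bary K m x - 1 / real (Suc n)))) \<longlonglongrightarrow> 0" for j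
  proof (rule Lim_null_comparison)
    have l: "bary K j x > 0" using assms interior_body_iff by blast
    have "(\<lambda>n. 1 / real (Suc n) * (1 / (bary K j x / 2)\<^sup>2) * \<bar>grad_bary K j \<bullet> e\<bar>) \<longlonglongrightarrow> 0 * (1 / (bary K j x / 2)\<^sup>2) * \<bar>grad_bary K j \<bullet> e\<bar>"
      by (intro tendsto_mult e0 tendsto_const)
    then show "(\<lambda>n. 1 / real (Suc n) * (1 / (bary K j x / 2)\<^sup>2) * \<bar>grad_bary K j \<bullet> e\<bar>) \<longlonglongrightarrow> 0" by simp
    have "bary K j x / 2 > 0" using l by simp
    from order_tendstoD(2)[OF e0 this]
    show "\<forall>\<^sub>F n in sequentially. norm (1 / real (Suc n) * cutoff 2 (1 / real (Suc n)) (bary K j x - 1 / real (Suc n)) * (grad_bary K j \<bullet> e) *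
       (\<Prod>m\<in>UNIV - {j}. cutoff 0 (1 / real (Suc n)) (bary K m x - 1 / real (Suc n))))
       \<le> 1 / real (Suc n) * (1 / (bary K j x / 2)\<^sup>2) * \<bar>grad_bary K j \<bullet> e\<bar>"
    proof eventually_elim
      fix n assume n: "1 / real (Suc n) < bary K j x / 2"
      let ?\<eta> = "1 / real (Suc n)" and ?P = "\<Prod>m\<in>UNIV - {j}. cutoff 0 (1 / real (Suc n)) (bary K m x - 1 / real (Suc n))"
      have \<eta>: "?\<eta> > 0" by simp
      have s: "bary K j x - ?\<eta> > bary K j x / 2" using n by linarith
      then have "(bary K j x / 2)\<^sup>2 \<le> (bary K j x - ?\<eta>)\<^sup>2" using l by (intro power_mono) auto
      then have c: "cutoff 2 ?\<eta> (bary K j x - ?\<eta>) \<le> 1 / (bary K j x / 2)\<^sup>2"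
        unfolding cutoff_def using s l by (auto intro!: frac_le)
      have P: "0 \<le> ?P" "?P \<le> 1" by (intro prod_nonneg ballI cutoff0_bounds \<eta> prod_le_1 conjI)+
      have "norm (?\<eta> * cutoff 2 ?\<eta> (bary K j x - ?\<eta>) * (grad_bary K j \<bullet> e) * ?P)
         = ?\<eta> * cutoff 2 ?\<eta> (bary K j x - ?\<eta>) * \<bar>grad_bary K j \<bullet> e\<bar> * ?P"
        using P cutoff_nonneg[of 2 ?\<eta> "bary K j x - ?\<eta>"] \<eta> unfolding real_norm_def abs_mult by simp
      also have "\<dots> \<le> ?\<eta> * (1 / (bary K j x / 2)\<^sup>2) * \<bar>grad_bary K j \<bullet> e\<bar> * 1"
        using P c \<eta> cutoff_nonneg by (intro mult_mono) auto
      finally show "norm (?\<eta> * cutoff 2 ?\<eta> (bary K j x - ?\<eta>) * (grad_bary K j \<bullet> e) * ?P)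
         \<le> ?\<eta> * (1 / (bary K j x / 2)\<^sup>2) * \<bar>grad_bary K j \<bullet> e\<bar>" by simp
    qed
  qed
  have "dd e (inner_cutoff (1 / real (Suc n))) x = (\<Sum>j\<in>UNIV. 1 / real (Suc n) * cutoff 2 (1 / real (Suc n)) (bary K j x - 1 / real (Suc n)) * (grad_bary K j \<bullet> e) *
     (\<Prod>m\<in>UNIV - {j}. cutoff 0 (1 / real (Suc n)) (bary K m x - 1 / real (Suc n))))" for n
    by (rule dd_eq[OF inner_cutoff_has_derivative]) simp
  then show ?thesis using tendsto_sum[of UNIV, OF t] by simp
qed

text \<open>The derivative of the cutoff blows up at \<open>F\<^sub>j\<close>, but there \<open>\<bar>z\<bar> \<le> C \<lambda>\<^sub>j\<close> compensates, unless
  \<open>e\<close> is tangential to \<open>F\<^sub>j\<close>.\<close>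

lemma mult_dd_inner_cutoff_bounded:
  assumes z: "polyf z" 
    and vanish: "\<And>j. grad_bary K j \<bullet> e = 0 \<or> (\<forall>x\<in>body K. bary K j x = 0 \<longrightarrow> z x = 0)"
  obtains B where "B \<ge> 0" "\<And>x \<eta>. x \<in> body K \<Longrightarrow> \<eta> > 0 \<Longrightarrow> \<bar>z x * dd e (inner_cutoff \<eta>) x\<bar> \<le> B"
proof -
  have "\<exists>C\<ge>0. grad_bary K j \<bullet> e = 0 \<or> (\<forall>x\<in>body K. \<bar>z x\<bar> \<le> C * bary K j x)" for j
  proof (cases "grad_bary K j \<bullet> e = 0")
    case False
    then obtain C where "C \<ge> 0" "\<And>x. x \<in> body K \<Longrightarrow> \<bar>z x\<bar> \<le> C * bary K j x"
      using bary_bound_if_zero_on_facet[OF z, of j] vanish by blast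
    then show ?thesis by blast
  qed auto
  then obtain C where C0: "\<And>j. C j \<ge> 0" 
    and C: "\<And>j. grad_bary K j \<bullet> e = 0 \<or> (\<forall>x\<in>body K. \<bar>z x\<bar> \<le> C j * bary K j x)" by metis
  define B where "B = (\<Sum>j\<in>UNIV. 2 * C j * \<bar>grad_bary K j \<bullet> e\<bar>)"
  have B0: "B \<ge> 0" unfolding B_def by (intro sum_nonneg mult_nonneg_nonneg C0) auto
  have "\<bar>z x * dd e (inner_cutoff \<eta>) x\<bar> \<le> B" if x: "x \<in> body K" and \<eta>: "\<eta> > 0" for x \<eta>
  proof -
    let ?P = "\<lambda>j. \<Prod>m\<in>UNIV - {j}. cutoff 0 \<eta> (bary K m x - \<eta>)"
    let ?c = "\<lambda>j. \<eta> * cutoff 2 \<eta> (bary K j x - \<eta>)"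
    have "z x * dd e (inner_cutoff \<eta>) x = (\<Sum>j\<in>UNIV. z x * (?c j * (grad_bary K j \<bullet> e) * ?P j))"
      unfolding dd_eq[OF inner_cutoff_has_derivative[OF \<eta>]] by (simp add: sum_distrib_left)
    also have "\<bar>\<dots>\<bar> \<le> (\<Sum>j\<in>UNIV. \<bar>z x * (?c j * (grad_bary K j \<bullet> e) * ?P j)\<bar>)" by (rule sum_abs)
    also have "\<dots> \<le> B" unfolding B_def
    proof (rule sum_mono)
      fix j
      have P: "0 \<le> ?P j" "?P j \<le> 1" by (intro prod_nonneg ballI cutoff0_bounds \<eta> prod_le_1 conjI)+
      have c0: "0 \<le> ?c j" using \<eta> cutoff_nonneg by simp
      show "\<bar>z x * (?c j * (grad_bary K j \<bullet> e) * ?P j)\<bar> \<le> 2 * C j * \<bar>grad_bary K j \<bullet> e\<bar>"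
      proof (cases "grad_bary K j \<bullet> e = 0")
        case False
        then have zC: "\<bar>z x\<bar> \<le> C j * bary K j x" using C x by blast
        have "\<bar>z x\<bar> * ?c j \<le> (C j * bary K j x) * ?c j" using zC c0 by (rule mult_right_mono)
        also have "\<dots> = C j * (\<eta> * cutoff 2 \<eta> (bary K j x - \<eta>) * (bary K j x - \<eta> + \<eta>))" by simp
        also have "\<dots> \<le> C j * 2" using C0 cutoff2_bound[OF \<eta>] by (rule mult_left_mono[rotated])
        finally have 1: "\<bar>z x\<bar> * ?c j \<le> 2 * C j" by simp
        have "\<bar>z x * (?c j * (grad_bary K j \<bullet> e) * ?P j)\<bar> = (\<bar>z x\<bar> * ?c j) * \<bar>grad_bary K j \<bullet> e\<bar> * ?P j"
          unfolding abs_mult[of "z x"] abs_mult[of _ "?P j"] abs_mult[of "?c j"] using P(1) c0 by simp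
        also have "\<dots> \<le> (2 * C j) * \<bar>grad_bary K j \<bullet> e\<bar> * 1"
          by (intro mult_mono[OF mult_right_mono[OF 1 abs_ge_zero] P(2) _ P(1)]) (use C0[of j] in simp)
        finally show ?thesis by simp
      qed simp
    qed
    finally show ?thesis .
  qed
  then show ?thesis using that[OF B0] by blast
qed

theorem integration_by_parts:
  assumes z: "polyf z" 
    and vanish: "\<And>j. grad_bary K j \<bullet> e = 0 \<or> (\<forall>x\<in>body K. bary K j x = 0 \<longrightarrow> z x = 0)"
    and v: "integrable (lebesgue_on (body K)) v" "integrable (lebesgue_on (body K)) g"
    and w: "is_weak_dderiv e (body K) v g"
  shows "IK (\<lambda>x. dd e z x * v x) + IK (\<lambda>x. z x * g x) = 0"
proof -
  let ?M = "lebesgue_on (body K)"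
  let ?\<eta> = "\<lambda>n. 1 / real (Suc n)"
  let ?\<chi> = "\<lambda>n. inner_cutoff (?\<eta> n)"
  have \<eta>: "?\<eta> n > 0" for n by simp
  obtain B where B: "B \<ge> 0" "\<And>x \<eta>. x \<in> body K \<Longrightarrow> \<eta> > 0 \<Longrightarrow> \<bar>z x * dd e (inner_cutoff \<eta>) x\<bar> \<le> B"
    using mult_dd_inner_cutoff_bounded[OF z vanish] by blast
  obtain Z where Z: "\<And>x. x \<in> body K \<Longrightarrow> \<bar>z x\<bar> \<le> Z" using polyf_bounded_body[OF z] by blast
  obtain Y where Y: "Y \<ge> 0" "\<And>x. x \<in> body K \<Longrightarrow> \<bar>dd e z x\<bar> \<le> Y" using polyf_bounded_body[OF polyf_dd[OF z]] by blast
  have sp: "space ?M = body K" by (simp add: space_restrict_space)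
  define \<phi> where "\<phi> n x = z x * ?\<chi> n x" for n x
  have t: "\<phi> n \<in> test_functions (interior (body K))" for n
    unfolding \<phi>_def[abs_def] by (rule inner_cutoff_test[OF \<eta> z])
  have d\<phi>: "dd e (\<phi> n) x = z x * dd e (?\<chi> n) x + dd e z x * ?\<chi> n x" for n x
    unfolding \<phi>_def[abs_def]
    by (intro dd_mult' differentiableI[OF dd_has_derivative[OF z]] differentiableI[OF inner_cutoff_has_derivative[OF \<eta>]])
  have m\<phi>: "\<phi> n \<in> borel_measurable ?M" "dd e (\<phi> n) \<in> borel_measurable ?M" for n
  proof -
    show "\<phi> n \<in> borel_measurable ?M"
      by (rule continuous_imp_measurable_on_sets_lebesgue[OF test_functionsD(4)[OF t] body_lebesgue])
    have "continuous_on UNIV (dd e (\<phi> n))" by (rule continuous_on_dd(1)[OF test_functionsD(1)[OF t]])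
    then have "continuous_on (body K) (dd e (\<phi> n))" by (rule continuous_on_subset) simp
    then show "dd e (\<phi> n) \<in> borel_measurable ?M"
      by (rule continuous_imp_measurable_on_sets_lebesgue[OF _ body_lebesgue])
  qed
  have mv: "v \<in> borel_measurable ?M" "g \<in> borel_measurable ?M" using v by (auto dest: borel_measurable_integrable)
  have l1: "(\<lambda>n. IK (\<lambda>x. dd e (\<phi> n) x * v x)) \<longlonglongrightarrow> IK (\<lambda>x. dd e z x * v x)"
  proof (rule integral_dominated_convergence[where w = "\<lambda>x. (B + Y) * \<bar>v x\<bar>"])
    show "(\<lambda>x. dd e z x * v x) \<in> borel_measurable ?M" 
      by (rule borel_measurable_times[OF polyf_measurable_body[OF polyf_dd[OF z]] mv(1)])
    show "(\<lambda>x. dd e (\<phi> n) x * v x) \<in> borel_measurable ?M" for n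
      by (rule borel_measurable_times[OF m\<phi>(2) mv(1)])
    show "integrable ?M (\<lambda>x. (B + Y) * \<bar>v x\<bar>)" using v(1) by simp
    show "AE x in ?M. (\<lambda>n. dd e (\<phi> n) x * v x) \<longlonglongrightarrow> dd e z x * v x"
      using AE_interior_body
    proof eventually_elim
      fix x assume x: "x \<in> interior (body K)"
      have "(\<lambda>n. (z x * dd e (?\<chi> n) x + dd e z x * ?\<chi> n x) * v x) \<longlonglongrightarrow> (z x * 0 + dd e z x * 1) * v x"
        by (intro tendsto_mult tendsto_add tendsto_const inner_cutoff_tendsto[OF x] dd_inner_cutoff_tendsto[OF x])
      then show "(\<lambda>n. dd e (\<phi> n) x * v x) \<longlonglongrightarrow> dd e z x * v x" by (simp add: d\<phi>)
    qed
    show "AE x in ?M. norm (dd e (\<phi> n) x * v x) \<le> (B + Y) * \<bar>v x\<bar>" for n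
    proof (rule AE_I2)
      fix x assume "x \<in> space ?M"
      then have x: "x \<in> body K" using sp by simp
      have "\<bar>dd e z x * ?\<chi> n x\<bar> \<le> Y * 1" unfolding abs_mult
        using inner_cutoff_bounds[OF \<eta>, of n x] Y x by (intro mult_mono) auto
      then have "\<bar>dd e (\<phi> n) x\<bar> \<le> B + Y" unfolding d\<phi> using B(2)[OF x \<eta>, of n] by linarith
      then show "norm (dd e (\<phi> n) x * v x) \<le> (B + Y) * \<bar>v x\<bar>" 
        unfolding real_norm_def abs_mult by (rule mult_right_mono) simp
    qed
  qed
  have l2: "(\<lambda>n. IK (\<lambda>x. \<phi> n x * g x)) \<longlonglongrightarrow> IK (\<lambda>x. z x * g x)"
  proof (rule integral_dominated_convergence[where w = "\<lambda>x. Z * \<bar>g x\<bar>"])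
    show "(\<lambda>x. z x * g x) \<in> borel_measurable ?M" 
      by (rule borel_measurable_times[OF polyf_measurable_body[OF z] mv(2)])
    show "(\<lambda>x. \<phi> n x * g x) \<in> borel_measurable ?M" for n
      by (rule borel_measurable_times[OF m\<phi>(1) mv(2)])
    show "integrable ?M (\<lambda>x. Z * \<bar>g x\<bar>)" using v(2) by simp
    show "AE x in ?M. (\<lambda>n. \<phi> n x * g x) \<longlonglongrightarrow> z x * g x"
      using AE_interior_body
    proof eventually_elim
      fix x assume x: "x \<in> interior (body K)"
      have "(\<lambda>n. (z x * ?\<chi> n x) * g x) \<longlonglongrightarrow> (z x * 1) * g x"
        by (intro tendsto_mult tendsto_const inner_cutoff_tendsto[OF x])
      then show "(\<lambda>n. \<phi> n x * g x) \<longlonglongrightarrow> z x * g x" by (simp add: \<phi>_def)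
    qed
    show "AE x in ?M. norm (\<phi> n x * g x) \<le> Z * \<bar>g x\<bar>" for n
    proof (rule AE_I2)
      fix x assume "x \<in> space ?M"
      then have x: "x \<in> body K" using sp by simp
      have "\<bar>\<phi> n x\<bar> \<le> Z * 1" unfolding \<phi>_def abs_mult
        using inner_cutoff_bounds[OF \<eta>, of n x] Z[OF x] by (intro mult_mono) auto
      then show "norm (\<phi> n x * g x) \<le> Z * \<bar>g x\<bar>" 
        unfolding real_norm_def abs_mult by (intro mult_right_mono) auto
    qed
  qed
  have 0: "IK (\<lambda>x. dd e (\<phi> n) x * v x) + IK (\<lambda>x. \<phi> n x * g x) = 0" for n
  proof -
    have "IK (\<lambda>x. v x * dd e (\<phi> n) x) = - IK (\<lambda>x. g x * \<phi> n x)"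
      using w t[of n] unfolding is_weak_dderiv_iff by blast
    then show ?thesis by (simp add: mult.commute)
  qed
  have "(\<lambda>n::nat. 0) \<longlonglongrightarrow> IK (\<lambda>x. dd e z x * v x) + IK (\<lambda>x. z x * g x)"
    using tendsto_add[OF l1 l2] unfolding 0 .
  then show ?thesis by (metis LIMSEQ_const_iff)
qed

corollary integral_dd_polyf_eq_0:
  assumes z: "polyf z" 
    and vanish: "\<And>j. grad_bary K j \<bullet> e = 0 \<or> (\<forall>x\<in>body K. bary K j x = 0 \<longrightarrow> z x = 0)"
  shows "IK (dd e z) = 0"
proof -
  have "dd e (\<lambda>x. 1 :: real) = (\<lambda>x. 0)" by auto
  then have "is_weak_dderiv e (body K) (\<lambda>x. 1) (\<lambda>x. 0)" 
    using is_weak_dderiv_polyf[OF polyf_const[of 1] body_lebesgue, of e] by simp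
  then have "IK (\<lambda>x. dd e z x * 1) + IK (\<lambda>x. z x * 0) = 0"
    by (intro integration_by_parts[OF z vanish] integrable_polyf) auto
  then show ?thesis by simp
qed

end

section \<open>Orthonormal bases of finite-dimensional function spaces\<close>

locale inner_function_space =
  fixes S :: "('a \<Rightarrow> real) set" and Q :: "('a \<Rightarrow> real) \<Rightarrow> ('a \<Rightarrow> real) \<Rightarrow> real"
  assumes zero: "(\<lambda>x. 0) \<in> S"
    and comb: "\<And>f g r. f \<in> S \<Longrightarrow> g \<in> S \<Longrightarrow> (\<lambda>x. f x + r * g x) \<in> S"
    and sym: "\<And>f g. f \<in> S \<Longrightarrow> g \<in> S \<Longrightarrow> Q f g = Q g f"
    and lin: "\<And>f g h r. f \<in> S \<Longrightarrow> g \<in> S \<Longrightarrow> h \<in> S \<Longrightarrow> Q (\<lambda>x. f x + r * g x) h = Q f h + r * Q g h"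
    and pos: "\<And>f. f \<in> S \<Longrightarrow> f \<noteq> (\<lambda>x. 0) \<Longrightarrow> Q f f > 0"
begin

lemma Q_zero: "h \<in> S \<Longrightarrow> Q (\<lambda>x. 0) h = 0"
  using lin[OF zero zero, of h 1] by simp

lemma sum_mem: "finite F \<Longrightarrow> F \<subseteq> S \<Longrightarrow> (\<lambda>x. \<Sum>g\<in>F. a g * g x) \<in> S"
proof (induction F rule: finite_induct)
  case (insert g F)
  then show ?case using comb[of "\<lambda>x. \<Sum>g\<in>F. a g * g x" g "a g"] by (simp add: add.commute)
qed (simp add: zero)

lemma Q_sum: "finite F \<Longrightarrow> F \<subseteq> S \<Longrightarrow> h \<in> S \<Longrightarrow> Q (\<lambda>x. \<Sum>g\<in>F. a g * g x) h = (\<Sum>g\<in>F. a g * Q g h)"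
proof (induction F rule: finite_induct)
  case (insert g F)
  then show ?case using lin[of "\<lambda>x. \<Sum>g\<in>F. a g * g x" g h "a g"] sum_mem[of F a] by (simp add: add.commute)
qed (simp add: Q_zero)

definition orthonormal :: "('a \<Rightarrow> real) set \<Rightarrow> bool" where
  "orthonormal F \<longleftrightarrow> finite F \<and> F \<subseteq> S \<and> (\<forall>f\<in>F. \<forall>g\<in>F. Q f g = (if f = g then 1 else 0))"

lemma orthonormal_coeff:
  assumes "orthonormal F" "h \<in> F" shows "Q (\<lambda>x. \<Sum>g\<in>F. a g * g x) h = a h"
proof -
  have F: "finite F" "F \<subseteq> S" using assms by (auto simp: orthonormal_def)
  have "Q (\<lambda>x. \<Sum>g\<in>F. a g * g x) h = (\<Sum>g\<in>F. a g * Q g h)" using Q_sum[OF F] assms F by blast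
  also have "\<dots> = (\<Sum>g\<in>F. if g = h then a g else 0)"
    using assms by (intro sum.cong) (auto simp: orthonormal_def)
  finally show ?thesis using F assms by simp
qed

lemma orthonormal_norm:
  assumes "orthonormal F" shows "Q (\<lambda>x. \<Sum>g\<in>F. a g * g x) (\<lambda>x. \<Sum>g\<in>F. a g * g x) = (\<Sum>g\<in>F. (a g)\<^sup>2)"
proof -
  have F: "finite F" "F \<subseteq> S" using assms by (auto simp: orthonormal_def)
  let ?f = "\<lambda>x. \<Sum>g\<in>F. a g * g x"
  have fS: "?f \<in> S" by (rule sum_mem[OF F])
  have "Q ?f ?f = (\<Sum>g\<in>F. a g * Q g ?f)" by (rule Q_sum[OF F fS])
  also have "\<dots> = (\<Sum>g\<in>F. a g * a g)"
  proof (rule sum.cong[OF refl])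
    fix g assume g: "g \<in> F"
    then have "Q g ?f = Q ?f g" using F fS by (intro sym) auto
    then show "a g * Q g ?f = a g * a g" using orthonormal_coeff[OF assms g, of a] by simp
  qed
  finally show ?thesis by (simp add: power2_eq_square)
qed

lemma orthonormal_extend:
  assumes F: "orthonormal F" and s: "s \<in> S" "\<And>a. s \<noteq> (\<lambda>x. \<Sum>g\<in>F. a g * g x)"
  obtains u c a where "orthonormal (insert u F)" "u \<notin> F" "s = (\<lambda>x. c * u x + (\<Sum>g\<in>F. a g * g x))"
proof -
  have FF: "finite F" "F \<subseteq> S" using F by (auto simp: orthonormal_def)
  define p where "p = (\<lambda>x. \<Sum>g\<in>F. Q s g * g x)"
  define s' where "s' = (\<lambda>x. s x + (-1) * p x)"
  have p: "p \<in> S" unfolding p_def by (rule sum_mem[OF FF])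
  have s': "s' \<in> S" unfolding s'_def by (rule comb[OF s(1) p])
  have "s' \<noteq> (\<lambda>x. 0)"
  proof
    assume "s' = (\<lambda>x. 0)"
    then have "s = p" by (auto simp: s'_def fun_eq_iff)
    then show False using s(2) p_def by blast
  qed
  then have n: "Q s' s' > 0" using pos s' by blast
  have orth: "Q s' g = 0" if "g \<in> F" for g
  proof -
    have "Q p g = Q s g" unfolding p_def by (rule orthonormal_coeff[OF F that])
    then show ?thesis unfolding s'_def using lin[OF s(1) p, of g "-1"] that FF by auto
  qed
  define r where "r = 1 / sqrt (Q s' s')"
  define u where "u = (\<lambda>x. 0 + r * s' x)"
  have u: "u \<in> S" unfolding u_def by (rule comb[OF zero s'])
  have Qu: "Q u h = r * Q s' h" if "h \<in> S" for h
    unfolding u_def using lin[OF zero s' that] Q_zero[OF that] by simp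
  have "Q u u = r * (r * Q s' s')" using Qu[OF u] Qu[OF s'] sym[OF s' u] by simp
  then have uu: "Q u u = 1" using n by (simp add: r_def)
  have ug: "Q u g = 0" "Q g u = 0" if "g \<in> F" for g
    using Qu[of g] orth[OF that] sym[OF u, of g] that FF by auto
  have "u \<notin> F" using uu ug by fastforce
  moreover have "orthonormal (insert u F)"
    using F u uu ug \<open>u \<notin> F\<close> unfolding orthonormal_def by auto
  moreover have "s = (\<lambda>x. sqrt (Q s' s') * u x + (\<Sum>g\<in>F. Q s g * g x))"
    using n by (auto simp: u_def r_def s'_def p_def fun_eq_iff)
  ultimately show ?thesis using that by blast
qed

end

lemma inner_function_space_subset:
  assumes "inner_function_space S Q" "S' \<subseteq> S" "(\<lambda>x. 0) \<in> S'" 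
    "\<And>f g r. f \<in> S' \<Longrightarrow> g \<in> S' \<Longrightarrow> (\<lambda>x. f x + r * g x) \<in> S'"
  shows "inner_function_space S' Q"
proof -
  interpret inner_function_space S Q by (rule assms(1))
  show ?thesis
  proof
    show "Q f g = Q g f" if "f \<in> S'" "g \<in> S'" for f g using that assms(2) by (intro sym) auto
    show "Q (\<lambda>x. f x + r * g x) h = Q f h + r * Q g h" if "f \<in> S'" "g \<in> S'" "h \<in> S'" for f g h r
      using that assms(2) by (intro lin) auto
    show "Q f f > 0" if "f \<in> S'" "f \<noteq> (\<lambda>x. 0)" for f using that assms(2) pos by auto
  qed (use assms in auto)
qed

lemma orthonormal_basis_exists:
  fixes S :: "('a \<Rightarrow> real) set" and e :: "'i \<Rightarrow> 'a \<Rightarrow> real"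
  assumes "inner_function_space S Q" "finite I" "\<And>f. f \<in> S \<Longrightarrow> \<exists>c. f = (\<lambda>x. \<Sum>i\<in>I. c i * e i x)"
  shows "\<exists>F. inner_function_space.orthonormal S Q F \<and> (\<forall>f\<in>S. \<exists>a. f = (\<lambda>x. \<Sum>g\<in>F. a g * g x))"
  using assms(2,1,3)
proof (induction I arbitrary: S rule: finite_induct)
  case empty
  then interpret inner_function_space S Q by simp
  have "orthonormal {}" by (simp add: orthonormal_def)
  moreover have "f = (\<lambda>x. 0)" if "f \<in> S" for f using empty(2)[OF that] by simp
  ultimately show ?case by (intro exI[of _ "{}"]) simp
next
  case (insert i I)
  interpret inner_function_space S Q by (rule insert.prems)
  define S' where "S' = {f \<in> S. \<exists>c. f = (\<lambda>x. \<Sum>i\<in>I. c i * e i x)}"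
  have comb': "(\<lambda>x. f x + r * g x) \<in> S'" if fg: "f \<in> S'" "g \<in> S'" for f g r
  proof -
    obtain c d where cd: "f = (\<lambda>x. \<Sum>i\<in>I. c i * e i x)" "g = (\<lambda>x. \<Sum>i\<in>I. d i * e i x)" using fg unfolding S'_def by blast
    have "f x + r * g x = (\<Sum>i\<in>I. (c i + r * d i) * e i x)" for x
      unfolding fun_cong[OF cd(1)] fun_cong[OF cd(2)] sum_distrib_left sum.distrib[symmetric]
      by (intro sum.cong) (auto simp: algebra_simps)
    then have "(\<lambda>x. f x + r * g x) = (\<lambda>x. \<Sum>i\<in>I. (c i + r * d i) * e i x)" by blast
    moreover have "(\<lambda>x. f x + r * g x) \<in> S" using fg comb[of f g r] unfolding S'_def by blast
    ultimately show ?thesis unfolding S'_def mem_Collect_eq by (intro conjI exI[of _ "\<lambda>i. c i + r * d i"])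
  qed
  have "(\<lambda>x. 0) \<in> S'" unfolding S'_def using zero by (auto intro: exI[of _ "\<lambda>_. 0"])
  then have ifs: "inner_function_space S' Q"
    using comb' by (intro inner_function_space_subset[OF insert.prems(1)]) (auto simp: S'_def)
  interpret S': inner_function_space S' Q by (rule ifs)
  obtain F where F: "S'.orthonormal F" "\<forall>f\<in>S'. \<exists>a. f = (\<lambda>x. \<Sum>g\<in>F. a g * g x)"
    using insert.IH[OF ifs] unfolding S'_def by blast
  have FS: "orthonormal F" using F(1) unfolding S'.orthonormal_def orthonormal_def by (auto simp: S'_def)
  show ?case
  proof (cases "S \<subseteq> S'")
    case True
    then show ?thesis using FS F(2) by blast
  next
    case False
    then obtain s where s: "s \<in> S" "s \<notin> S'" by blast
    have "s \<noteq> (\<lambda>x. \<Sum>g\<in>F. a g * g x)" for a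
      using S'.sum_mem[of F a] F(1) s(2) unfolding S'.orthonormal_def by auto
    then obtain u c a where u: "orthonormal (insert u F)" "u \<notin> F" and sa: "s = (\<lambda>x. c * u x + (\<Sum>g\<in>F. a g * g x))"
      using orthonormal_extend[OF FS s(1)] by blast
    obtain d where d: "s = (\<lambda>x. \<Sum>j\<in>insert i I. d j * e j x)" using insert.prems(2)[OF s(1)] by blast
    then have sd: "s x = d i * e i x + (\<Sum>j\<in>I. d j * e j x)" for x using insert.hyps by simp
    have di: "d i \<noteq> 0"
    proof
      assume "d i = 0"
      then have "s = (\<lambda>x. \<Sum>j\<in>I. d j * e j x)" using sd by auto
      then have "s \<in> S'" unfolding S'_def mem_Collect_eq using s(1) by (intro conjI exI[of _ d])
      then show False using s(2) by blast
    qed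
    have finF: "finite F" using FS by (simp add: orthonormal_def)
    have "\<exists>b. f = (\<lambda>x. \<Sum>g\<in>insert u F. b g * g x)" if f: "f \<in> S" for f
    proof -
      obtain d' where "f = (\<lambda>x. \<Sum>j\<in>insert i I. d' j * e j x)" using insert.prems(2)[OF f] by blast
      then have fd: "f x = d' i * e i x + (\<Sum>j\<in>I. d' j * e j x)" for x using insert.hyps by simp
      define t where "t = d' i / d i"
      have "(\<lambda>x. f x + (-t) * s x) = (\<lambda>x. \<Sum>j\<in>I. (d' j - t * d j) * e j x)"
      proof
        fix x
        have "f x + (-t) * s x = (\<Sum>j\<in>I. d' j * e j x) - t * (\<Sum>j\<in>I. d j * e j x)"
          using di unfolding fd sd by (simp add: t_def field_simps)
        then show "f x + (-t) * s x = (\<Sum>j\<in>I. (d' j - t * d j) * e j x)"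
          by (simp add: sum_subtractf sum_distrib_left left_diff_distrib mult.assoc)
      qed
      then have "(\<lambda>x. f x + (-t) * s x) \<in> S'" unfolding S'_def mem_Collect_eq 
        using comb[OF f s(1)] by (intro conjI exI[of _ "\<lambda>j. d' j - t * d j"])
      from bspec[OF F(2) this] obtain b where b: "(\<lambda>x. f x + (-t) * s x) = (\<lambda>x. \<Sum>g\<in>F. b g * g x)" ..
      have "f x = (\<Sum>g\<in>insert u F. (if g = u then t * c else b g + t * a g) * g x)" for x
      proof -
        have "f x = t * s x + (\<Sum>g\<in>F. b g * g x)" using fun_cong[OF b, of x] by simp
        also have "\<dots> = t * c * u x + (\<Sum>g\<in>F. (b g + t * a g) * g x)"
          by (simp add: sa sum.distrib sum_distrib_left algebra_simps)
        also have "(\<Sum>g\<in>F. (b g + t * a g) * g x) = (\<Sum>g\<in>F. (if g = u then t * c else b g + t * a g) * g x)"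
          using u(2) by (intro sum.cong) auto
        finally show ?thesis using u(2) finF by simp
      qed
      then show ?thesis by (intro exI[of _ "\<lambda>g. if g = u then t * c else b g + t * a g"]) (rule ext)
    qed
    then show ?thesis using u(1) by blast
  qed
qed

lemma poly_space_spanned: 
  "f \<in> poly_space j \<Longrightarrow> \<exists>c. f = (\<lambda>x. \<Sum>\<alpha>\<in>{\<alpha>. int (mdeg \<alpha>) \<le> j}. c \<alpha> * mon \<alpha> x)"
  by (simp add: poly_space_iff)

lemma orthonormal_basis_poly:
  fixes S :: "(real^'n::finite \<Rightarrow> real) set"
  assumes "inner_function_space S Q" "S \<subseteq> poly_space j"
  obtains F where "finite F" "F \<subseteq> S" "\<And>f g. f \<in> F \<Longrightarrow> g \<in> F \<Longrightarrow> Q f g = (if f = g then 1 else 0)"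
    "\<And>f. f \<in> S \<Longrightarrow> f = (\<lambda>x. \<Sum>g\<in>F. Q f g * g x)" "\<And>f. f \<in> S \<Longrightarrow> Q f f = (\<Sum>g\<in>F. (Q f g)\<^sup>2)"
proof -
  interpret inner_function_space S Q by (rule assms(1))
  have sp: "\<exists>c. f = (\<lambda>x. \<Sum>\<alpha>\<in>{\<alpha>. int (mdeg \<alpha>) \<le> j}. c \<alpha> * mon \<alpha> x)" if "f \<in> S" for f
    by (rule poly_space_spanned) (use that assms(2) in blast)
  have "\<exists>F. orthonormal F \<and> (\<forall>f\<in>S. \<exists>a. f = (\<lambda>x. \<Sum>g\<in>F. a g * g x))"
    by (rule orthonormal_basis_exists[OF assms(1) finite_mdeg sp])
  then obtain F where F': "orthonormal F \<and> (\<forall>f\<in>S. \<exists>a. f = (\<lambda>x. \<Sum>g\<in>F. a g * g x))" ..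
  note F = conjunct1[OF F'] conjunct2[OF F']
  have a: "f = (\<lambda>x. \<Sum>g\<in>F. Q f g * g x)" "Q f f = (\<Sum>g\<in>F. (Q f g)\<^sup>2)" if fS: "f \<in> S" for f
  proof -
    obtain a where a: "f = (\<lambda>x. \<Sum>g\<in>F. a g * g x)" using bspec[OF F(2) fS] ..
    have Qa: "Q f g = a g" if "g \<in> F" for g unfolding a by (rule orthonormal_coeff[OF F(1) that])
    have "(\<lambda>x. \<Sum>g\<in>F. Q f g * g x) = (\<lambda>x. \<Sum>g\<in>F. a g * g x)"
      by (intro ext sum.cong refl) (simp add: Qa)
    then show "f = (\<lambda>x. \<Sum>g\<in>F. Q f g * g x)" using a by simp
    have "(\<Sum>g\<in>F. (Q f g)\<^sup>2) = (\<Sum>g\<in>F. (a g)\<^sup>2)" by (intro sum.cong refl) (simp add: Qa)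
    then show "Q f f = (\<Sum>g\<in>F. (Q f g)\<^sup>2)" using orthonormal_norm[OF F(1), of a] unfolding a[symmetric] by simp
  qed
  show ?thesis 
  proof (rule that[of F])
    show "finite F" "F \<subseteq> S" "\<And>f g. f \<in> F \<Longrightarrow> g \<in> F \<Longrightarrow> Q f g = (if f = g then 1 else 0)"
      using F(1) unfolding orthonormal_def by blast+
  qed (fact a)+
qed

lemma poly_riesz:
  fixes S :: "(real^'n::finite \<Rightarrow> real) set"
  assumes "inner_function_space S Q" "S \<subseteq> poly_space j"
    and l: "\<And>f g r. f \<in> S \<Longrightarrow> g \<in> S \<Longrightarrow> l (\<lambda>x. f x + r * g x) = l f + r * l g"
  shows "\<exists>w\<in>S. \<forall>f\<in>S. Q f w = l f"
proof -
  interpret inner_function_space S Q by (rule assms(1))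
  obtain F where F: "finite F" "F \<subseteq> S" "\<And>f. f \<in> S \<Longrightarrow> f = (\<lambda>x. \<Sum>g\<in>F. Q f g * g x)"
    by (rule orthonormal_basis_poly[OF assms(1,2)]) blast
  have l0: "l (\<lambda>x. 0) = 0" using l[OF zero zero, of 1] by simp
  have lsum: "l (\<lambda>x. \<Sum>g\<in>G. a g * g x) = (\<Sum>g\<in>G. a g * l g)" if "finite G" "G \<subseteq> S" for G a
    using that
  proof (induction G rule: finite_induct)
    case (insert g G)
    then show ?case using l[of "\<lambda>x. \<Sum>g\<in>G. a g * g x" g "a g"] sum_mem[of G a] by (simp add: add.commute)
  qed (simp add: l0)
  define w where "w = (\<lambda>x. \<Sum>g\<in>F. l g * g x)"
  have w: "w \<in> S" unfolding w_def by (rule sum_mem[OF F(1,2)])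
  have "Q f w = l f" if f: "f \<in> S" for f
  proof -
    have "Q f w = Q w f" by (rule sym[OF f w])
    also have "\<dots> = (\<Sum>g\<in>F. l g * Q g f)" unfolding w_def by (rule Q_sum[OF F(1,2) f])
    also have "\<dots> = (\<Sum>g\<in>F. Q f g * l g)" using F(2) sym[OF f] by (intro sum.cong refl) (auto simp: mult.commute)
    also have "\<dots> = l (\<lambda>x. \<Sum>g\<in>F. Q f g * g x)" by (rule lsum[OF F(1,2), symmetric])
    finally show ?thesis using F(3)[OF f] by simp
  qed
  then show ?thesis using w by blast
qed

section \<open>The facet forms\<close>

lemma poly_space_1_affine:
  fixes f :: "real^'n::finite \<Rightarrow> real"
  assumes "f \<in> poly_space 1" obtains a c where "f = (\<lambda>x. a \<bullet> x + c)"
proof -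
  have "\<exists>a c. f = (\<lambda>x. a \<bullet> x + c)"
    using assms
  proof (induction rule: poly_space_induct)
    case (monomial \<alpha>)
    show ?case
    proof (cases "mdeg \<alpha> = 0")
      case True
      then show ?thesis by (intro exI[of _ 0] exI[of _ 1]) (auto simp: mdeg_eq_0)
    next
      case False
      then obtain i where i: "\<alpha> i \<noteq> 0" by (metis mdeg_eq_0)
      define \<beta> where "\<beta> = \<alpha>(i := \<alpha> i - 1)"
      have eq: "\<alpha> = \<beta>(i := Suc (\<beta> i))" using i by (auto simp: \<beta>_def)
      then have "mdeg \<beta> = 0" using monomial mdeg_Suc[of \<beta> i] by simp
      then have "\<beta> = (\<lambda>_. 0)" by (simp add: mdeg_eq_0)
      then have "mon \<alpha> x = x $ i" for x using mon_Suc[of \<beta> i x] unfolding eq[symmetric] by simp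
      then have "mon \<alpha> = (\<lambda>x. x $ i)" by blast
      then show ?thesis by (intro exI[of _ "axis i 1"] exI[of _ 0]) (simp add: inner_axis')
    qed
  next
    case (add f g)
    then obtain a c a' c' where "f = (\<lambda>x. a \<bullet> x + c)" "g = (\<lambda>x. a' \<bullet> x + c')" by blast
    then show ?case by (intro exI[of _ "a + a'"] exI[of _ "c + c'"]) (simp add: inner_add_left algebra_simps)
  next
    case (cmult r f)
    then obtain a c where "f = (\<lambda>x. a \<bullet> x + c)" by blast
    then show ?case by (intro exI[of _ "r *\<^sub>R a"] exI[of _ "r * c"]) (simp add: algebra_simps)
  next
    case zero
    show ?case by (intro exI[of _ 0]) simp
  qed
  then show ?thesis using that by blast
qed

context nondegenerate_simplex
begin

lemma IK_add: "polyf f \<Longrightarrow> polyf g \<Longrightarrow> IK (\<lambda>x. f x + g x) = IK f + IK g"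
  by (intro Bochner_Integration.integral_add integrable_polyf)

lemma IK_diff: "polyf f \<Longrightarrow> polyf g \<Longrightarrow> IK (\<lambda>x. f x - g x) = IK f - IK g"
  by (intro Bochner_Integration.integral_diff integrable_polyf)

lemma IK_sum: "(\<And>i. i \<in> I \<Longrightarrow> polyf (f i)) \<Longrightarrow> IK (\<lambda>x. \<Sum>i\<in>I. f i x) = (\<Sum>i\<in>I. IK (f i))"
  by (intro Bochner_Integration.integral_sum integrable_polyf)

lemma IK_nonneg_eq_0:
  assumes f: "polyf f" "\<And>x. x \<in> body K \<Longrightarrow> 0 \<le> f x" "IK f = 0"
  shows "f = (\<lambda>x. 0)"
proof -
  have "AE x in lebesgue_on (body K). 0 \<le> f x" using f(2) by (intro AE_I2) (simp add: space_restrict_space)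
  then have "AE x in lebesgue_on (body K). f x = 0"
    using integral_nonneg_eq_0_iff_AE[OF integrable_polyf[OF f(1)]] f(3) by simp
  then have "AE x in lebesgue. x \<in> body K \<longrightarrow> f x = 0" by (subst (asm) AE_restrict_space_iff) auto
  then obtain N where N: "N \<in> null_sets lebesgue" "{x. \<not> (x \<in> body K \<longrightarrow> f x = 0)} \<subseteq> N"
    unfolding eventually_ae_filter by auto
  let ?U = "interior (body K) \<inter> {x. f x \<noteq> 0}"
  have "open {x. f x \<noteq> 0}" by (intro open_Collect_neq polyf_continuous f(1) continuous_on_const)
  then have "open ?U" by auto
  moreover have "?U \<subseteq> N" using N(2) interior_subset by auto
  then have "negligible ?U" using N(1) negligible_iff_null_sets negligible_subset by blast
  ultimately have U: "?U = {}" using open_not_negligible by blast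
  show ?thesis 
  proof (rule polyf_zero_open[OF f(1) open_interior interior_body_nonempty])
    fix x assume "x \<in> interior (body K)"
    then show "f x = 0" using U by auto
  qed
qed

lemma IK_mult_self_eq_0: 
  assumes "polyf f" "IK (\<lambda>x. f x * f x) = 0" shows "f = (\<lambda>x. 0)"
proof
  fix x
  have "(\<lambda>x. f x * f x) = (\<lambda>x. 0)" by (rule IK_nonneg_eq_0) (use assms in auto)
  from fun_cong[OF this, of x] show "f x = 0" by simp
qed

lemma dd_prod_bary: 
  "dd e (\<lambda>x. \<Prod>m\<in>A. bary K m x) x = (\<Sum>m\<in>A. (grad_bary K m \<bullet> e) * (\<Prod>l\<in>A - {m}. bary K l x))"
proof -
  have "(bary K m has_derivative (\<lambda>e. grad_bary K m \<bullet> e)) (at x)" for m x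
    using dd_has_derivative[OF bary_polyf, of m x] by simp
  then show ?thesis by (intro dd_eq has_derivative_prod)
qed

lemma bubble_polyf [intro, simp]: "polyf (bubble K)"
  unfolding bubble_def[abs_def] by (intro polyf_prod bary_polyf)

lemma facet_bubble_polyf [intro, simp]: "polyf (facet_bubble K i)"
  unfolding facet_bubble_def[abs_def] by (intro polyf_prod bary_polyf)

lemma sign_bubble_polyf [intro, simp]: "polyf (sign_bubble b K)"
  unfolding sign_bubble_def[abs_def] by (intro polyf_sum polyf_mult polyf_const facet_bubble_polyf)

lemma bubble_zero: "bary K j x = 0 \<Longrightarrow> bubble K x = 0"
  unfolding bubble_def by (intro prod_zero) auto

lemma facet_bubble_zero: "bary K j x = 0 \<Longrightarrow> j \<noteq> i \<Longrightarrow> facet_bubble K i x = 0"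
  unfolding facet_bubble_def by (intro prod_zero) auto

definition edge :: "'n option \<Rightarrow> real^'n" where "edge i = K (other i) - K i"

definition facet_proj :: "'n option \<Rightarrow> real^'n \<Rightarrow> real^'n" where
  "facet_proj i x = x + bary K i x *\<^sub>R edge i"

definition edge_bubble :: "'n option \<Rightarrow> real^'n \<Rightarrow> real" where
  "edge_bubble i x = (\<Prod>m\<in>UNIV - {i, other i}. bary K m x)"

text \<open>This replaces the boundary integral of \<open>b\<^sub>i f g\<close> over \<open>F\<^sub>i\<close>, up to a positive factor; see
  \<open>integral_dd_facet_bubble\<close>.\<close>

definition facet_form :: "'n option \<Rightarrow> (real^'n \<Rightarrow> real) \<Rightarrow> (real^'n \<Rightarrow> real) \<Rightarrow> real" where
  "facet_form i f g = IK (\<lambda>x. edge_bubble i x * (f (facet_proj i x) * g (facet_proj i x)))"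

lemma grad_bary_edge_vec: "grad_bary K j \<bullet> edge i = (if j = other i then 1 else 0) - (if j = i then 1 else 0)"
  by (simp add: edge_def grad_bary_edge)

lemma edge_bubble_polyf [intro, simp]: "polyf (edge_bubble i)"
  unfolding edge_bubble_def[abs_def] by (intro polyf_prod bary_polyf)

lemma facet_proj_coord: "(\<lambda>x. facet_proj i x $ m) \<in> poly_space 1"
proof -
  have eq: "facet_proj i x $ m = x $ m + edge i $ m * bary K i x" for x by (simp add: facet_proj_def)
  show ?thesis unfolding eq by (intro poly_space_add poly_space_coord poly_space_cmult bary_poly_space)
qed

lemma poly_space_facet_proj: "f \<in> poly_space j \<Longrightarrow> (\<lambda>x. f (facet_proj i x)) \<in> poly_space j"
  by (rule poly_space_compose[OF _ facet_proj_coord])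

lemma polyf_facet_proj [intro]: "polyf f \<Longrightarrow> polyf (\<lambda>x. f (facet_proj i x))"
  unfolding polyf_def by (elim exE) (rule exI, erule poly_space_facet_proj)

lemma facet_proj_id: "bary K i x = 0 \<Longrightarrow> facet_proj i x = x"
  by (simp add: facet_proj_def)

lemma dd_edge_facet_proj:
  assumes "polyf f" shows "dd (edge i) (\<lambda>x. f (facet_proj i x)) x = 0"
proof -
  have "(bary K i has_derivative (\<lambda>h. grad_bary K i \<bullet> h)) (at x)"
    using dd_has_derivative[OF bary_polyf, of i x] by simp
  then have "((\<lambda>x. facet_proj i x) has_derivative (\<lambda>h. h + (grad_bary K i \<bullet> h) *\<^sub>R edge i)) (at x)"
    unfolding facet_proj_def by (intro has_derivative_add has_derivative_ident has_derivative_scaleR_left)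
  from has_derivative_compose[OF this dd_has_derivative[OF assms]]
  have "dd (edge i) (\<lambda>x. f (facet_proj i x)) x = dd (edge i + (grad_bary K i \<bullet> edge i) *\<^sub>R edge i) f (facet_proj i x)"
    by (rule dd_eq)
  also have "edge i + (grad_bary K i \<bullet> edge i) *\<^sub>R edge i = 0" by (simp add: grad_bary_edge_vec)
  also have "dd 0 f (facet_proj i x) = 0"
    using has_derivative_linear[OF dd_has_derivative[OF assms]] by (rule linear_0)
  finally show ?thesis .
qed

lemma dd_edge_facet_bubble: "dd (edge i) (facet_bubble K i) x = edge_bubble i x"
proof -
  have "dd (edge i) (facet_bubble K i) x 
     = (\<Sum>m\<in>UNIV - {i}. (grad_bary K m \<bullet> edge i) * (\<Prod>l\<in>UNIV - {i} - {m}. bary K l x))"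
    unfolding facet_bubble_def[abs_def] by (rule dd_prod_bary)
  also have "\<dots> = (\<Sum>m\<in>UNIV - {i}. if m = other i then (\<Prod>l\<in>UNIV - {i} - {m}. bary K l x) else 0)"
    by (intro sum.cong) (auto simp: grad_bary_edge_vec)
  also have "\<dots> = (\<Prod>l\<in>UNIV - {i} - {other i}. bary K l x)"
    by (simp add: sum.delta)
  also have "UNIV - {i} - {other i} = UNIV - {i, other i}" by auto
  finally show ?thesis by (simp add: edge_bubble_def)
qed

text \<open>Replacing \<open>f g\<close> by its projection changes the integrand only by a function vanishing on the
  whole boundary, and \<open>b + (\<nabla>\<lambda>\<^sub>i \<cdot> b) (a\<^sub>l - a\<^sub>i)\<close> is tangential to \<open>F\<^sub>i\<close>.\<close>

lemma integral_dd_facet_bubble: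
  assumes f: "polyf f" and g: "polyf g"
  shows "IK (dd b (\<lambda>x. facet_bubble K i x * (f x * g x))) = - (grad_bary K i \<bullet> b) * facet_form i f g"
proof -
  define P where "P = (\<lambda>x. f (facet_proj i x) * g (facet_proj i x))"
  let ?h = "\<lambda>x. facet_bubble K i x * P x"
  let ?c = "grad_bary K i \<bullet> b"
  have P: "polyf P" unfolding P_def by (intro polyf_mult polyf_facet_proj f g)
  have h: "polyf ?h" by (intro polyf_mult P facet_bubble_polyf)
  have fg: "polyf (\<lambda>x. facet_bubble K i x * (f x * g x))" by (intro polyf_mult f g facet_bubble_polyf)
  have dP: "dd (edge i) P x = 0" for x
    unfolding P_def by (subst dd_mult) (auto simp: dd_edge_facet_proj f g)
  have "IK (dd b (\<lambda>x. facet_bubble K i x * (f x * g x) - ?h x)) = 0"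
  proof (rule integral_dd_polyf_eq_0)
    show "polyf (\<lambda>x. facet_bubble K i x * (f x * g x) - ?h x)" by (intro polyf_diff fg h)
    have "facet_bubble K i x * (f x * g x) - ?h x = 0" if "bary K j x = 0" for j x
      using that facet_bubble_zero[of j x i] facet_proj_id[of i x] by (cases "j = i") (auto simp: P_def)
    then show "grad_bary K j \<bullet> b = 0 \<or> (\<forall>x\<in>body K. bary K j x = 0 \<longrightarrow> facet_bubble K i x * (f x * g x) - ?h x = 0)" for j
      by blast
  qed
  moreover have "dd b (\<lambda>x. facet_bubble K i x * (f x * g x) - ?h x) = (\<lambda>x. dd b (\<lambda>x. facet_bubble K i x * (f x * g x)) x - dd b ?h x)"
    by (intro ext dd_diff fg h)
  ultimately have 1: "IK (dd b (\<lambda>x. facet_bubble K i x * (f x * g x))) = IK (dd b ?h)"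
    using IK_diff[OF polyf_dd[OF fg, of b] polyf_dd[OF h, of b]] by simp
  have "IK (dd (?c *\<^sub>R edge i + b) ?h) = 0"
  proof (rule integral_dd_polyf_eq_0[OF h])
    fix j
    show "grad_bary K j \<bullet> (?c *\<^sub>R edge i + b) = 0 \<or> (\<forall>x\<in>body K. bary K j x = 0 \<longrightarrow> ?h x = 0)"
      using facet_bubble_zero[of j _ i] by (cases "j = i") (auto simp: inner_add_right grad_bary_edge_vec)
  qed
  moreover have "dd (?c *\<^sub>R edge i + b) ?h = (\<lambda>x. ?c * dd (edge i) ?h x + dd b ?h x)"
    by (intro ext dd_linear h)
  moreover have "IK (\<lambda>x. ?c * dd (edge i) ?h x + dd b ?h x) = ?c * IK (dd (edge i) ?h) + IK (dd b ?h)"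
    using IK_add[OF polyf_mult[OF polyf_const polyf_dd[OF h]] polyf_dd[OF h]] by simp
  moreover have "dd (edge i) ?h = (\<lambda>x. edge_bubble i x * P x)"
    by (rule ext, subst dd_mult[OF facet_bubble_polyf P]) (simp add: dP dd_edge_facet_bubble)
  ultimately show ?thesis using 1 by (simp add: facet_form_def P_def)
qed

definition boundary_form :: "('n option \<Rightarrow> real) \<Rightarrow> (real^'n \<Rightarrow> real) \<Rightarrow> (real^'n \<Rightarrow> real) \<Rightarrow> real" where
  "boundary_form a f g = (\<Sum>i\<in>UNIV. a i * facet_form i f g)"

definition flux :: "real^'n \<Rightarrow> 'n option \<Rightarrow> real" where
  "flux b i = \<bar>grad_bary K i \<bullet> b\<bar>"

lemma integral_dd_sign_bubble:
  assumes f: "polyf f" and g: "polyf g"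
  shows "IK (dd b (\<lambda>x. sign_bubble b K x * (f x * g x))) = boundary_form (flux b) f g"
proof -
  let ?h = "\<lambda>i x. - sgn (grad_bary K i \<bullet> b) * (facet_bubble K i x * (f x * g x))"
  have p: "polyf (\<lambda>x. facet_bubble K i x * (f x * g x))" for i by (intro polyf_mult f g facet_bubble_polyf)
  have "(\<lambda>x. sign_bubble b K x * (f x * g x)) = (\<lambda>x. \<Sum>i\<in>UNIV. ?h i x)"
    by (simp add: sign_bubble_def sgn_outer_normal sum_distrib_right mult.assoc)
  then have "dd b (\<lambda>x. sign_bubble b K x * (f x * g x)) = (\<lambda>x. \<Sum>i\<in>UNIV. dd b (?h i) x)"
    by (simp only:) (intro ext dd_sum polyf_mult[OF polyf_const] p)
  then have "IK (dd b (\<lambda>x. sign_bubble b K x * (f x * g x))) = IK (\<lambda>x. \<Sum>i\<in>UNIV. dd b (?h i) x)" 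
    by (rule arg_cong)
  also have "\<dots> = (\<Sum>i\<in>UNIV. IK (dd b (?h i)))"
    by (intro IK_sum polyf_dd polyf_mult[OF polyf_const] p)
  also have "\<dots> = (\<Sum>i\<in>UNIV. \<bar>grad_bary K i \<bullet> b\<bar> * facet_form i f g)"
  proof (rule sum.cong[OF refl])
    fix i
    have "dd b (?h i) = (\<lambda>x. - sgn (grad_bary K i \<bullet> b) * dd b (\<lambda>x. facet_bubble K i x * (f x * g x)) x)"
      by (intro ext dd_cmult p)
    then have "IK (dd b (?h i)) = - sgn (grad_bary K i \<bullet> b) * IK (dd b (\<lambda>x. facet_bubble K i x * (f x * g x)))" by simp
    then have "IK (dd b (?h i)) = - sgn (grad_bary K i \<bullet> b) * (- (grad_bary K i \<bullet> b) * facet_form i f g)"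
      unfolding integral_dd_facet_bubble[OF f g] .
    then show "IK (dd b (?h i)) = \<bar>grad_bary K i \<bullet> b\<bar> * facet_form i f g"
      by (simp add: abs_sgn mult.commute mult.left_commute)
  qed
  finally show ?thesis by (simp add: boundary_form_def flux_def)
qed

lemma integral_dd_bubble:
  assumes "polyf f" shows "IK (dd b (\<lambda>x. bubble K x * f x)) = 0"
  by (rule integral_dd_polyf_eq_0) (use assms bubble_zero in auto)

lemma edge_bubble_nonneg: "x \<in> body K \<Longrightarrow> 0 \<le> edge_bubble i x"
  unfolding edge_bubble_def by (intro prod_nonneg) (auto simp: body_iff)

lemma facet_form_nonneg: "0 \<le> facet_form i f f"
  unfolding facet_form_def
  by (rule Bochner_Integration.integral_nonneg) (auto simp: space_restrict_space edge_bubble_nonneg)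

lemma facet_form_commute: "facet_form i f g = facet_form i g f"
  by (simp add: facet_form_def mult.commute)

lemma facet_form_linear:
  assumes "polyf f" "polyf g" "polyf h"
  shows "facet_form i (\<lambda>x. f x + r * g x) h = facet_form i f h + r * facet_form i g h"
proof -
  have "IK (\<lambda>x. edge_bubble i x * (f (facet_proj i x) * h (facet_proj i x)) + r * (edge_bubble i x * (g (facet_proj i x) * h (facet_proj i x))))
    = facet_form i f h + IK (\<lambda>x. r * (edge_bubble i x * (g (facet_proj i x) * h (facet_proj i x))))"
    unfolding facet_form_def
    by (intro IK_add polyf_mult polyf_const edge_bubble_polyf polyf_facet_proj assms)
  then show ?thesis by (simp add: facet_form_def algebra_simps)
qed

lemma facet_form_eq_0:
  assumes f: "polyf f" and "facet_form i f f = 0" and x: "bary K i x = 0"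
  shows "f x = 0"
proof -
  let ?W = "\<lambda>x. f (facet_proj i x)"
  have W: "polyf ?W" using f by (rule polyf_facet_proj)
  have 0: "(\<lambda>x. edge_bubble i x * (?W x * ?W x)) = (\<lambda>x. 0)"
  proof (rule IK_nonneg_eq_0)
    show "polyf (\<lambda>x. edge_bubble i x * (?W x * ?W x))" by (intro polyf_mult edge_bubble_polyf W)
    show "IK (\<lambda>x. edge_bubble i x * (?W x * ?W x)) = 0" using assms(2) unfolding facet_form_def .
    show "0 \<le> edge_bubble i x * (?W x * ?W x)" if "x \<in> body K" for x
      using edge_bubble_nonneg[OF that] by simp
  qed
  have "?W = (\<lambda>x. 0)"
  proof (rule polyf_zero_open[OF W open_interior interior_body_nonempty])
    fix y assume "y \<in> interior (body K)"
    then have "edge_bubble i y > 0" unfolding edge_bubble_def by (intro prod_pos) (auto simp: interior_body_iff)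
    then show "?W y = 0" using fun_cong[OF 0, of y] by simp
  qed
  from fun_cong[OF this, of x] show ?thesis using facet_proj_id[OF x] by simp
qed

lemma boundary_form_nonneg: "(\<And>i. 0 \<le> a i) \<Longrightarrow> 0 \<le> boundary_form a f f"
  unfolding boundary_form_def by (intro sum_nonneg mult_nonneg_nonneg facet_form_nonneg)

lemma boundary_form_commute: "boundary_form a f g = boundary_form a g f"
  unfolding boundary_form_def using facet_form_commute by simp

lemma boundary_form_linear:
  assumes "polyf f" "polyf g" "polyf h"
  shows "boundary_form a (\<lambda>x. f x + r * g x) h = boundary_form a f h + r * boundary_form a g h"
  unfolding boundary_form_def facet_form_linear[OF assms]
  by (simp add: distrib_left sum.distrib sum_distrib_left mult.left_commute)

lemma boundary_form_eq_0:
  assumes f: "polyf f" and a: "\<And>i. 0 \<le> a i" and "boundary_form a f f = 0" "a i > 0" "bary K i x = 0"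
  shows "f x = 0"
proof -
  have "\<forall>i\<in>UNIV. a i * facet_form i f f = 0"
    using assms(3) unfolding boundary_form_def
    by (subst (asm) sum_nonneg_eq_0_iff) (auto intro: mult_nonneg_nonneg facet_form_nonneg a)
  then have "a i * facet_form i f f = 0" by blast
  then have "facet_form i f f = 0" using assms(4) by simp
  then show ?thesis using facet_form_eq_0[OF f] assms(5) by blast
qed

lemma affine_vertices: 
  assumes "f \<in> poly_space 1" "\<And>i. f (K i) = 0" shows "f = (\<lambda>x. 0)"
proof
  fix x
  obtain a c where f: "f = (\<lambda>x. a \<bullet> x + c)" using poly_space_1_affine[OF assms(1)] .
  have "f x = a \<bullet> (\<Sum>i\<in>UNIV. bary K i x *\<^sub>R K i) + c * (\<Sum>i\<in>UNIV. bary K i x)" 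
    by (simp add: f bary_expand bary_sum)
  also have "\<dots> = (\<Sum>i\<in>UNIV. bary K i x * f (K i))"
    by (simp add: f inner_sum_right sum_distrib_left sum.distrib algebra_simps)
  finally show "f x = 0" using assms(2) by simp
qed

lemma affine_two_facets:
  assumes "f \<in> poly_space 1" "i \<noteq> j" "\<And>x. bary K i x = 0 \<Longrightarrow> f x = 0" "\<And>x. bary K j x = 0 \<Longrightarrow> f x = 0"
  shows "f = (\<lambda>x. 0)"
proof (rule affine_vertices[OF assms(1)])
  fix m
  have "bary K i (K m) = 0 \<or> bary K j (K m) = 0" using assms(2) by (auto simp: bary_vertex)
  then show "f (K m) = 0" using assms(3,4) by blast
qed

lemma two_active:
  assumes "b \<noteq> 0" obtains i j where "i \<noteq> j" "grad_bary K i \<bullet> b \<noteq> 0" "grad_bary K j \<bullet> b \<noteq> 0"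
proof -
  have "\<exists>i. grad_bary K i \<bullet> b \<noteq> 0"
  proof (rule ccontr)
    assume "\<not> ?thesis"
    then have "b = 0" using grad_bary_sum_vertices[of b] by simp
    then show False using assms by simp
  qed
  then obtain i where i: "grad_bary K i \<bullet> b \<noteq> 0" by blast
  have "\<exists>j. j \<noteq> i \<and> grad_bary K j \<bullet> b \<noteq> 0"
  proof (rule ccontr)
    assume "\<not> ?thesis"
    then have "(\<Sum>j\<in>UNIV. grad_bary K j \<bullet> b) = (\<Sum>j\<in>UNIV. if j = i then grad_bary K i \<bullet> b else 0)"
      by (intro sum.cong) auto
    then show False using i grad_bary_sum[of b] by simp
  qed
  then show ?thesis using that i by blast
qed

definition admissible :: "nat \<Rightarrow> ('n option \<Rightarrow> real) \<Rightarrow> bool" where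
  "admissible k a \<longleftrightarrow> (\<forall>i. 0 \<le> a i) \<and> (\<exists>i j. i \<noteq> j \<and> 0 < a i \<and> 0 < a j) \<and> (k = 1 \<or> (\<forall>i. 0 < a i))"

lemma admissible_flux:
  assumes "b \<noteq> 0" "k = 1 \<or> (\<forall>i. grad_bary K i \<bullet> b \<noteq> 0)" shows "admissible k (flux b)"
proof -
  obtain i j where "i \<noteq> j" "grad_bary K i \<bullet> b \<noteq> 0" "grad_bary K j \<bullet> b \<noteq> 0" using two_active[OF assms(1)] .
  then show ?thesis using assms(2) unfolding admissible_def flux_def by auto
qed

lemma pairing_eq_IK: "pairing (body K) f g = IK (\<lambda>x. f x * g x)"
  by (simp add: pairing_def)

lemma boundary_form_definite:
  assumes "admissible k a" "f \<in> poly_perp (int k) K" "boundary_form a f f = 0"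
  shows "f = (\<lambda>x. 0)"
proof -
  have f: "f \<in> poly_space (int k)" "polyf f" using assms(2) by (auto simp: poly_perp_def intro: polyfI)
  have z: "f x = 0" if "0 < a i" "bary K i x = 0" for i x
    using boundary_form_eq_0[OF f(2) _ assms(3) that] assms(1) by (simp add: admissible_def)
  show ?thesis
  proof (cases "k = 1")
    case True
    obtain i j where "i \<noteq> j" "0 < a i" "0 < a j"
      using assms(1) by (auto simp: admissible_def)
    then show ?thesis using affine_two_facets[of f i j] f(1) z True by simp
  next
    case False
    then have "\<forall>x\<in>frontier (body K). f x = 0" using z assms(1) by (auto simp: admissible_def frontier_body_iff)
    then have "f \<in> poly_space0 (int k) K" using f(1) by (simp add: poly_space0_def)
    then have "IK (\<lambda>x. f x * f x) = 0" using assms(2) by (auto simp: poly_perp_def pairing_eq_IK)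
    then show ?thesis by (rule IK_mult_self_eq_0[OF f(2)])
  qed
qed

lemma bubble_pos: "x \<in> interior (body K) \<Longrightarrow> 0 < bubble K x"
  unfolding bubble_def by (intro prod_pos) (auto simp: interior_body_iff)

lemma bubble_nonneg: "x \<in> body K \<Longrightarrow> 0 \<le> bubble K x"
  unfolding bubble_def by (intro prod_nonneg) (auto simp: body_iff)

lemma bubble_form_definite:
  assumes z: "polyf z" "IK (\<lambda>x. bubble K x * (z x * z x)) = 0" shows "z = (\<lambda>x. 0)"
proof -
  have 0: "(\<lambda>x. bubble K x * (z x * z x)) = (\<lambda>x. 0)"
  proof (rule IK_nonneg_eq_0)
    show "polyf (\<lambda>x. bubble K x * (z x * z x))" by (intro polyf_mult bubble_polyf z(1))
    show "0 \<le> bubble K x * (z x * z x)" if "x \<in> body K" for x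
      using bubble_nonneg[OF that] by simp
  qed (fact z(2))
  show ?thesis
  proof (rule polyf_zero_open[OF z(1) open_interior interior_body_nonempty])
    fix y assume "y \<in> interior (body K)"
    then have "bubble K y > 0" by (rule bubble_pos)
    then show "z y = 0" using fun_cong[OF 0, of y] by simp
  qed
qed

lemma bubble_form_nonneg: "0 \<le> IK (\<lambda>x. bubble K x * (z x * z x))"
  by (rule Bochner_Integration.integral_nonneg) (auto simp: space_restrict_space bubble_nonneg)

lemma bubble_form_linear:
  assumes "polyf f" "polyf g" "polyf h"
  shows "IK (\<lambda>x. bubble K x * ((f x + r * g x) * h x)) = IK (\<lambda>x. bubble K x * (f x * h x)) + r * IK (\<lambda>x. bubble K x * (g x * h x))"
proof -
  have "IK (\<lambda>x. bubble K x * (f x * h x) + r * (bubble K x * (g x * h x)))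
    = IK (\<lambda>x. bubble K x * (f x * h x)) + IK (\<lambda>x. r * (bubble K x * (g x * h x)))"
    by (intro IK_add polyf_mult polyf_const bubble_polyf assms)
  then show ?thesis by (simp add: algebra_simps)
qed

lemma poly_perp_polyf: "w \<in> poly_perp j K \<Longrightarrow> polyf w"
  by (auto simp: poly_perp_def intro: polyfI)

lemma poly_perp_zero: "(\<lambda>x. 0) \<in> poly_perp j K"
  by (simp add: poly_perp_def pairing_eq_IK)

lemma poly_perp_comb:
  assumes "f \<in> poly_perp j K" "g \<in> poly_perp j K" shows "(\<lambda>x. f x + r * g x) \<in> poly_perp j K"
  unfolding poly_perp_def
proof (intro CollectI conjI ballI)
  show "(\<lambda>x. f x + r * g x) \<in> poly_space j" 
    using assms by (intro poly_space_add poly_space_cmult) (auto simp: poly_perp_def)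
  fix z assume z: "z \<in> poly_space0 j K"
  then have pz: "polyf z" by (auto simp: poly_space0_def intro: polyfI)
  have "IK (\<lambda>x. f x * z x + r * (g x * z x)) = IK (\<lambda>x. f x * z x) + IK (\<lambda>x. r * (g x * z x))"
    using assms[THEN poly_perp_polyf] pz by (intro IK_add polyf_mult polyf_const)
  then have "IK (\<lambda>x. f x * z x + r * (g x * z x)) = 0" using assms z by (auto simp: poly_perp_def pairing_eq_IK)
  then show "pairing (body K) (\<lambda>x. f x + r * g x) z = 0" unfolding pairing_eq_IK by (simp add: algebra_simps)
qed

lemma boundary_form_space:
  assumes "admissible k a" shows "inner_function_space (poly_perp (int k) K) (boundary_form a)"
proof
  show "0 < boundary_form a f f" if "f \<in> poly_perp (int k) K" "f \<noteq> (\<lambda>x. 0)" for f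
  proof -
    have "0 \<le> boundary_form a f f" using assms by (intro boundary_form_nonneg) (simp add: admissible_def)
    then show ?thesis using boundary_form_definite[OF assms that(1)] that(2) by linarith
  qed
qed (auto intro: poly_perp_zero poly_perp_comb boundary_form_commute boundary_form_linear poly_perp_polyf)

lemma bubble_form_space:
  "inner_function_space (poly_space j) (\<lambda>f g. IK (\<lambda>x. bubble K x * (f x * g x)))"
proof
  show "0 < IK (\<lambda>x. bubble K x * (f x * f x))" if "f \<in> poly_space j" "f \<noteq> (\<lambda>x. 0)" for f
    using bubble_form_definite[OF polyfI[OF that(1)]] that(2) bubble_form_nonneg[of f] by linarith
  show "IK (\<lambda>x. bubble K x * ((f x + r * g x) * h x)) = IK (\<lambda>x. bubble K x * (f x * h x)) + r * IK (\<lambda>x. bubble K x * (g x * h x))"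
    if "f \<in> poly_space j" "g \<in> poly_space j" "h \<in> poly_space j" for f g h r
    using that by (intro bubble_form_linear) (auto intro: polyfI)
qed (auto intro: poly_space_add poly_space_cmult simp: mult.commute)

end

section \<open>Affine invariance of averages of polynomials\<close>

definition bary_mon :: "'n::finite lsimplex \<Rightarrow> ('n option \<Rightarrow> nat) \<Rightarrow> real^'n \<Rightarrow> real" where
  "bary_mon K \<beta> x = (\<Prod>i\<in>UNIV. bary K i x ^ \<beta> i)"

lemma bary_mon_Suc: "bary_mon K (\<beta>(i := Suc (\<beta> i))) x = bary K i x * bary_mon K \<beta> x"
proof -
  have "bary_mon K (\<beta>(i := Suc (\<beta> i))) x = (\<Prod>j\<in>UNIV. (if j = i then bary K i x else 1) * bary K j x ^ \<beta> j)"
    unfolding bary_mon_def by (rule prod.cong) auto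
  then show ?thesis by (simp add: prod.distrib bary_mon_def)
qed

context nondegenerate_simplex
begin

lemma bary_mon_polyf [intro, simp]: "polyf (bary_mon K \<beta>)"
  unfolding bary_mon_def[abs_def] by (intro polyf_prod polyf_power bary_polyf)

lemma dd_bary_power: "dd e (\<lambda>x. bary K i x ^ n) x = real n * (grad_bary K i \<bullet> e) * bary K i x ^ (n - 1)"
proof -
  have "(bary K i has_derivative (\<lambda>e. grad_bary K i \<bullet> e)) (at x)"
    using dd_has_derivative[OF bary_polyf, of i x] by simp
  from has_derivative_power[OF this, of n] show ?thesis by (intro dd_eq) 
qed

lemma moment_exchange:
  assumes jl: "j \<noteq> l"
  shows "real (Suc (\<beta> j)) * IK (\<lambda>x. bary K l x * bary_mon K \<beta> x) = real (Suc (\<beta> l)) * IK (\<lambda>x. bary K j x * bary_mon K \<beta> x)"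
proof -
  let ?e = "K j - K l"
  define R where "R = (\<lambda>x. \<Prod>m\<in>UNIV - {j, l}. bary K m x ^ \<beta> m)"
  let ?p = "\<lambda>x. bary K j x ^ Suc (\<beta> j)" and ?q = "\<lambda>x. bary K l x ^ Suc (\<beta> l)"
  let ?h = "\<lambda>x. ?p x * (?q x * R x)"
  have mon: "bary_mon K \<beta> x = bary K j x ^ \<beta> j * (bary K l x ^ \<beta> l * R x)" for x
  proof -
    have "(UNIV :: 'n option set) = insert j (insert l (UNIV - {j, l}))" by auto
    then have "bary_mon K \<beta> x = (\<Prod>m\<in>insert j (insert l (UNIV - {j, l})). bary K m x ^ \<beta> m)"
      unfolding bary_mon_def by simp
    then show ?thesis using jl by (simp add: R_def)
  qed
  have pR: "polyf R" unfolding R_def by (intro polyf_prod polyf_power bary_polyf)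
  have pp: "polyf ?p" "polyf ?q" by (intro polyf_power bary_polyf)+
  have pqR: "polyf (\<lambda>x. ?q x * R x)" by (intro polyf_mult pR pp)
  have h: "polyf ?h" by (intro polyf_mult pp pqR)
  have dR: "dd ?e R x = 0" for x
  proof -
    have "((\<lambda>x. bary K m x ^ \<beta> m) has_derivative (\<lambda>e. dd e (\<lambda>x. bary K m x ^ \<beta> m) x)) (at x)" for m x
      by (intro dd_has_derivative polyf_power bary_polyf)
    then have "dd ?e R x = (\<Sum>m\<in>UNIV - {j, l}. dd ?e (\<lambda>x. bary K m x ^ \<beta> m) x * (\<Prod>i\<in>UNIV - {j, l} - {m}. bary K i x ^ \<beta> i))"
      unfolding R_def by (intro dd_eq has_derivative_prod)
    also have "\<dots> = 0" by (intro sum.neutral) (auto simp: dd_bary_power grad_bary_edge)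
    finally show ?thesis .
  qed
  have dp: "dd ?e ?p x = real (Suc (\<beta> j)) * bary K j x ^ \<beta> j" for x
    unfolding dd_bary_power using jl by (simp add: grad_bary_edge)
  have dq: "dd ?e ?q x = - real (Suc (\<beta> l)) * bary K l x ^ \<beta> l" for x
    unfolding dd_bary_power using jl by (simp add: grad_bary_edge)
  have dh: "dd ?e ?h x = real (Suc (\<beta> j)) * (bary K l x * bary_mon K \<beta> x) - real (Suc (\<beta> l)) * (bary K j x * bary_mon K \<beta> x)" for x
  proof -
    have "dd ?e ?h x = ?p x * dd ?e (\<lambda>x. ?q x * R x) x + dd ?e ?p x * (?q x * R x)" by (rule dd_mult[OF pp(1) pqR])
    also have "dd ?e (\<lambda>x. ?q x * R x) x = ?q x * dd ?e R x + dd ?e ?q x * R x" by (rule dd_mult[OF pp(2) pR])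
    finally show ?thesis unfolding dR dp dq mon by (simp add: algebra_simps)
  qed
  have "IK (dd ?e ?h) = 0"
  proof (rule integral_dd_polyf_eq_0[OF h])
    fix m show "grad_bary K m \<bullet> ?e = 0 \<or> (\<forall>x\<in>body K. bary K m x = 0 \<longrightarrow> ?h x = 0)"
      by (cases "m = j"; cases "m = l") (auto simp: grad_bary_edge)
  qed
  moreover have "IK (\<lambda>x. real (Suc (\<beta> j)) * (bary K l x * bary_mon K \<beta> x) - real (Suc (\<beta> l)) * (bary K j x * bary_mon K \<beta> x))
    = IK (\<lambda>x. real (Suc (\<beta> j)) * (bary K l x * bary_mon K \<beta> x)) - IK (\<lambda>x. real (Suc (\<beta> l)) * (bary K j x * bary_mon K \<beta> x))"
    by (intro IK_diff polyf_mult polyf_const bary_polyf bary_mon_polyf)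
  moreover have "dd ?e ?h = (\<lambda>x. real (Suc (\<beta> j)) * (bary K l x * bary_mon K \<beta> x) - real (Suc (\<beta> l)) * (bary K j x * bary_mon K \<beta> x))"
    using dh by (rule ext)
  ultimately have "IK (\<lambda>x. real (Suc (\<beta> j)) * (bary K l x * bary_mon K \<beta> x)) - IK (\<lambda>x. real (Suc (\<beta> l)) * (bary K j x * bary_mon K \<beta> x)) = 0"
    by (simp only:)
  then show ?thesis by simp
qed

lemma moment_recursion:
  "real (\<Sum>l\<in>UNIV. Suc (\<beta> l)) * IK (\<lambda>x. bary K j x * bary_mon K \<beta> x) = real (Suc (\<beta> j)) * IK (bary_mon K \<beta>)"
proof -
  have "IK (bary_mon K \<beta>) = IK (\<lambda>x. \<Sum>l\<in>UNIV. bary K l x * bary_mon K \<beta> x)"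
    unfolding sum_distrib_right[symmetric] bary_sum by simp
  also have "\<dots> = (\<Sum>l\<in>UNIV. IK (\<lambda>x. bary K l x * bary_mon K \<beta> x))"
    by (intro IK_sum polyf_mult bary_polyf bary_mon_polyf)
  finally have "real (Suc (\<beta> j)) * IK (bary_mon K \<beta>) = (\<Sum>l\<in>UNIV. real (Suc (\<beta> j)) * IK (\<lambda>x. bary K l x * bary_mon K \<beta> x))"
    by (simp only: sum_distrib_left)
  also have "\<dots> = (\<Sum>l\<in>UNIV. real (Suc (\<beta> l)) * IK (\<lambda>x. bary K j x * bary_mon K \<beta> x))"
    using moment_exchange[of j] by (intro sum.cong refl) metis
  finally show ?thesis by (simp only: of_nat_sum sum_distrib_right)
qed

abbreviation vol :: real where "vol \<equiv> measure lebesgue (body K)"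

lemma vol_pos [simp]: "0 < vol" "vol \<noteq> 0" "0 \<le> vol"
  using measure_body_pos by auto

lemma IK_const: "IK (\<lambda>x. c) = c * vol"
proof -
  have "measure (lebesgue_on (body K)) (space (lebesgue_on (body K))) = vol"
    by (simp add: space_restrict_space measure_restrict_space)
  then show ?thesis by simp
qed

end

text \<open>The recursion determines all averages of monomials in the barycentric coordinates, so they are
  the same on all simplices. The change of variables theorem of the library is not available here,
  as it requires a well-ordered index type.\<close>

lemma moments_affine_invariant:
  fixes K L :: "'n::finite lsimplex"
  assumes "nondegenerate_simplex K" "nondegenerate_simplex L"
  shows "measure lebesgue (body L) * integral\<^sup>L (lebesgue_on (body K)) (bary_mon K \<beta>) 
    = measure lebesgue (body K) * integral\<^sup>L (lebesgue_on (body L)) (bary_mon L \<beta>)"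
proof -
  interpret K: nondegenerate_simplex K by (rule assms(1))
  interpret L: nondegenerate_simplex L by (rule assms(2))
  show ?thesis
  proof (induction \<beta> rule: mdeg_induct)
    case zero
    have "bary_mon K (\<lambda>_. 0) = (\<lambda>x. 1)" "bary_mon L (\<lambda>_. 0) = (\<lambda>x. 1)" by (auto simp: bary_mon_def)
    then show ?case using K.IK_const[of 1] L.IK_const[of 1] by (simp add: mult.commute)
  next
    case (Suc \<beta> i)
    let ?s = "real (\<Sum>l\<in>UNIV. Suc (\<beta> l))"
    have "?s > 0" unfolding of_nat_sum by (intro sum_pos) auto
    have fe: "bary_mon K (\<beta>(i := Suc (\<beta> i))) = (\<lambda>x. bary K i x * bary_mon K \<beta> x)" 
      "bary_mon L (\<beta>(i := Suc (\<beta> i))) = (\<lambda>x. bary L i x * bary_mon L \<beta> x)"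
      by (simp_all add: fun_eq_iff bary_mon_Suc)
    have "?s * (L.vol * K.IK (\<lambda>x. bary K i x * bary_mon K \<beta> x)) = ?s * (K.vol * L.IK (\<lambda>x. bary L i x * bary_mon L \<beta> x))"
      using K.moment_recursion[of \<beta> i] L.moment_recursion[of \<beta> i] Suc.IH by (simp only: mult.left_commute) 
    then show ?case unfolding fe using \<open>?s > 0\<close> by simp
  qed
qed

lemma ref_elem_matrix: "elem_matrix (ref_simplex :: 'n::finite lsimplex) = mat 1"
  by (simp add: elem_matrix_def ref_simplex_def mat_def vec_eq_iff axis_def)

lemma ref_nondegenerate: "nondegenerate_simplex (ref_simplex :: 'n::finite lsimplex)"
  by unfold_locales (auto simp: ref_elem_matrix invertible_def intro!: exI[of _ "mat 1"])

lemma elem_map_ref [simp]: "elem_map ref_simplex x = x"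
  by (simp add: elem_map_def ref_elem_matrix ref_simplex_def)

lemma elem_inv_ref [simp]: "elem_inv ref_simplex x = x"
  using nondegenerate_simplex.elem_inv_map[OF ref_nondegenerate, of x] by simp

context nondegenerate_simplex
begin

lemma bary_eq_ref: "bary K i x = ref_grad i \<bullet> elem_inv K x + ref_offset i"
  by (simp add: bary_eq ref_bary_elem_inv)

lemma elem_inv_coord: "elem_inv K x $ i = bary K (Some i) x"
  by (simp add: bary_eq_ref ref_grad_inner ref_offset_def)

end

context nondegenerate_simplex
begin

interpretation ref: nondegenerate_simplex "ref_simplex :: 'n lsimplex"
  by (rule ref_nondegenerate)

lemma bary_elem_map [simp]: "bary K i (elem_map K y) = bary ref_simplex i y"
  by (simp add: bary_eq_ref ref.bary_eq_ref)

lemma bary_ref_elem_inv: "bary ref_simplex i (elem_inv K x) = bary K i x"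
  by (simp add: bary_eq_ref ref.bary_eq_ref)

lemma elem_map_body_iff: "elem_map K y \<in> body K \<longleftrightarrow> y \<in> body ref_simplex"
  by (simp add: body_iff ref.body_iff)

lemma elem_inv_body_iff: "elem_inv K x \<in> body ref_simplex \<longleftrightarrow> x \<in> body K"
  by (simp add: body_iff ref.body_iff bary_ref_elem_inv)

lemma poly_space_elem_inv: "f \<in> poly_space j \<Longrightarrow> (\<lambda>x. f (elem_inv K x)) \<in> poly_space j"
  by (rule poly_space_compose) (simp_all only: elem_inv_coord bary_poly_space)

lemma poly_space_elem_map: "f \<in> poly_space j \<Longrightarrow> (\<lambda>x. f (elem_map K x)) \<in> poly_space j"
proof (rule poly_space_compose)
  fix i
  have "(\<lambda>x. elem_map K x $ i) = (\<lambda>x. elem_matrix K $ i \<bullet> x + K None $ i)"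
    by (simp add: elem_map_def matrix_vector_mul_component)
  then show "(\<lambda>x. elem_map K x $ i) \<in> poly_space 1" by (simp only: poly_space_affine)
qed

lemma polyf_elem_map: "polyf f \<Longrightarrow> polyf (\<lambda>x. f (elem_map K x))"
  unfolding polyf_def by (elim exE) (rule exI, erule poly_space_elem_map)

lemma average_elem_inv:
  assumes "f \<in> poly_space j" 
  shows "ref.vol * IK (\<lambda>x. f (elem_inv K x)) = vol * ref.IK f"
  using assms
proof (induction rule: poly_space_induct)
  case (monomial \<alpha>)
  have e: "mon \<alpha> (elem_inv L x) = bary_mon L (case_option 0 \<alpha>) x" if "nondegenerate_simplex L" for L x
  proof -
    interpret L: nondegenerate_simplex L by (rule that)
    show ?thesis unfolding mon_def bary_mon_def
      by (simp add: UNIV_option_conv prod.reindex L.elem_inv_coord)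
  qed
  have "nondegenerate_simplex K" ..
  from e[OF this] e[OF ref_nondegenerate] moments_affine_invariant[OF this ref_nondegenerate, of "case_option 0 \<alpha>"]
  show ?case by (simp add: eta_contract_eq)
next
  case (add f g)
  then have "polyf (\<lambda>x. f (elem_inv K x))" "polyf (\<lambda>x. g (elem_inv K x))" "polyf f" "polyf g"
    using poly_space_elem_inv polyfI by blast+
  then show ?case using add IK_add ref.IK_add by (simp add: distrib_left)
next
  case (cmult r f)
  then show ?case by (simp add: mult.left_commute)
qed simp

lemma IK_elem_map:
  assumes "polyf f" shows "IK f = vol / ref.vol * ref.IK (\<lambda>y. f (elem_map K y))"
proof -
  obtain j where "f \<in> poly_space j" using assms by (auto simp: polyf_def)
  then have "ref.vol * IK (\<lambda>x. f (elem_map K (elem_inv K x))) = vol * ref.IK (\<lambda>y. f (elem_map K y))"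
    by (intro average_elem_inv poly_space_elem_map)
  then show ?thesis by (simp add: field_simps)
qed

lemma elem_map_edge: "elem_map K (y + t *\<^sub>R ref.edge i) = elem_map K y + t *\<^sub>R edge i"
proof -
  have "edge i = elem_map K (ref_simplex (other i)) - elem_map K (ref_simplex i)"
    by (simp only: edge_def elem_map_ref_simplex)
  also have "\<dots> = elem_matrix K *v ref.edge i" 
    unfolding elem_map_def ref.edge_def by (simp only: matrix_vector_mult_diff_distrib add_diff_cancel_right)
  finally have e: "elem_matrix K *v ref.edge i = edge i" by (rule HOL.sym)
  show ?thesis unfolding elem_map_def
    by (simp only: matrix_vector_right_distrib matrix_vector_mult_scaleR e add.assoc add.commute[of "K None"])
qed

lemma facet_form_elem_map:
  assumes "polyf f" "polyf g"
  shows "facet_form i f g = vol / ref.vol * ref.facet_form i (\<lambda>y. f (elem_map K y)) (\<lambda>y. g (elem_map K y))"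
proof -
  have p: "polyf (\<lambda>x. edge_bubble i x * (f (facet_proj i x) * g (facet_proj i x)))"
    by (intro polyf_mult edge_bubble_polyf polyf_facet_proj assms)
  have "facet_proj i (elem_map K y) = elem_map K (ref.facet_proj i y)" for y
    by (simp add: facet_proj_def ref.facet_proj_def elem_map_edge)
  moreover have "edge_bubble i (elem_map K y) = ref.edge_bubble i y" for y
    by (simp add: edge_bubble_def ref.edge_bubble_def)
  ultimately show ?thesis unfolding facet_form_def ref.facet_form_def IK_elem_map[OF p] by (simp only:)
qed

lemma boundary_form_elem_map:
  assumes "polyf f" "polyf g"
  shows "boundary_form a f g = vol / ref.vol * ref.boundary_form a (\<lambda>y. f (elem_map K y)) (\<lambda>y. g (elem_map K y))"
  unfolding boundary_form_def ref.boundary_form_def facet_form_elem_map[OF assms]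
  by (simp only: sum_distrib_left mult.left_commute)

lemma bubble_elem_map [simp]: "bubble K (elem_map K y) = bubble ref_simplex y"
  by (simp add: bubble_def)

lemma poly_perp_elem_map:
  assumes w: "w \<in> poly_perp j K" shows "(\<lambda>y. w (elem_map K y)) \<in> poly_perp j ref_simplex"
  unfolding poly_perp_def
proof (intro CollectI conjI ballI)
  show "(\<lambda>y. w (elem_map K y)) \<in> poly_space j" using w by (intro poly_space_elem_map) (simp add: poly_perp_def)
  fix z assume z: "z \<in> poly_space0 j (ref_simplex :: 'n lsimplex)"
  then have zj: "z \<in> poly_space j" by (simp add: poly_space0_def)
  let ?z = "\<lambda>x. z (elem_inv K x)"
  have "?z x = 0" if "x \<in> frontier (body K)" for x
  proof -
    have "elem_inv K x \<in> frontier (body ref_simplex)"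
      using that by (simp add: frontier_body_iff ref.frontier_body_iff elem_inv_body_iff bary_ref_elem_inv)
    then show ?thesis using z by (simp add: poly_space0_def)
  qed
  then have "?z \<in> poly_space0 j K" using poly_space_elem_inv[OF zj] by (simp add: poly_space0_def)
  then have "IK (\<lambda>x. w x * ?z x) = 0" using w by (simp add: poly_perp_def pairing_eq_IK)
  moreover have "IK (\<lambda>x. w x * ?z x) = vol / ref.vol * ref.IK (\<lambda>y. w (elem_map K y) * ?z (elem_map K y))"
    by (rule IK_elem_map) (intro polyf_mult poly_perp_polyf[OF w] polyfI[OF poly_space_elem_inv[OF zj]])
  ultimately show "pairing (body ref_simplex) (\<lambda>y. w (elem_map K y)) z = 0" by (simp add: ref.pairing_eq_IK)
qed

end

section \<open>Norm equivalences with affine-invariant constants\<close>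

lemma lebesgue_on_measurable_AE_cong:
  fixes f g :: "real^'n::finite \<Rightarrow> real"
  assumes S: "S \<in> sets lebesgue" and f: "f \<in> borel_measurable (lebesgue_on S)" and ae: "AE x in lebesgue_on S. f x = g x"
  shows "g \<in> borel_measurable (lebesgue_on S)"
proof -
  have "AE x in lebesgue. x \<in> S \<longrightarrow> f x = g x" using ae S by (subst (asm) AE_restrict_space_iff) auto
  then have ae': "AE x in lebesgue. indicator S x *\<^sub>R f x = indicator S x *\<^sub>R g x"
    by eventually_elim (auto simp: indicator_def)
  have "(\<lambda>x. indicator S x *\<^sub>R f x) \<in> borel_measurable lebesgue"
    using f S borel_measurable_restrict_space_iff[of S lebesgue f] by (simp add: mult.commute)
  then have "(\<lambda>x. indicator S x *\<^sub>R g x) \<in> borel_measurable lebesgue"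
    using ae' by (rule borel_measurable_AE)
  then show ?thesis using S borel_measurable_restrict_space_iff[of S lebesgue g] by (simp add: mult.commute)
qed

context nondegenerate_simplex
begin

lemma square_bounded_by_form:
  assumes "inner_function_space S Q" "S \<subseteq> poly_space j"
  shows "\<exists>C\<ge>0. \<forall>f\<in>S. \<forall>x\<in>body K. (f x)\<^sup>2 \<le> C * Q f f"
proof -
  obtain F where F: "finite F" "F \<subseteq> S" "\<And>f. f \<in> S \<Longrightarrow> f = (\<lambda>x. \<Sum>g\<in>F. Q f g * g x)"
      "\<And>f. f \<in> S \<Longrightarrow> Q f f = (\<Sum>g\<in>F. (Q f g)\<^sup>2)"
    by (rule orthonormal_basis_poly[OF assms]) blast
  have "\<exists>B\<ge>0. \<forall>x\<in>body K. \<bar>g x\<bar> \<le> B" if "g \<in> F" for g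
    by (rule polyf_bounded_body[of g]) (use that F(2) assms(2) in \<open>auto intro: polyfI\<close>)
  then obtain B where B: "\<And>g x. g \<in> F \<Longrightarrow> x \<in> body K \<Longrightarrow> \<bar>g x\<bar> \<le> B g" by metis
  let ?C = "\<Sum>g\<in>F. (B g)\<^sup>2"
  have "(f x)\<^sup>2 \<le> ?C * Q f f" if f: "f \<in> S" and x: "x \<in> body K" for f x
  proof -
    have "(f x)\<^sup>2 = (\<Sum>g\<in>F. Q f g * g x)\<^sup>2" using fun_cong[OF F(3)[OF f], of x] by simp
    also have "\<dots> \<le> (\<Sum>g\<in>F. (Q f g)\<^sup>2) * (\<Sum>g\<in>F. (g x)\<^sup>2)" by (rule Cauchy_Schwarz_ineq_sum)
    also have "\<dots> \<le> (\<Sum>g\<in>F. (Q f g)\<^sup>2) * ?C"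
    proof (intro mult_left_mono sum_mono sum_nonneg zero_le_power2)
      fix g assume "g \<in> F"
      then have "\<bar>g x\<bar> \<le> \<bar>B g\<bar>" using B x by force
      then show "(g x)\<^sup>2 \<le> (B g)\<^sup>2" by (rule power2_le_iff_abs_le[THEN iffD2, OF abs_ge_zero, unfolded power2_abs])
    qed
    finally show ?thesis using F(4)[OF f] by (simp add: mult.commute)
  qed
  then show ?thesis by (intro exI[of _ ?C]) (auto intro: sum_nonneg)
qed

lemma IK_mono: "polyf f \<Longrightarrow> polyf g \<Longrightarrow> (\<And>x. x \<in> body K \<Longrightarrow> f x \<le> g x) \<Longrightarrow> IK f \<le> IK g"
  by (rule integral_mono) (auto simp: space_restrict_space)

lemma L2_space: "inner_function_space (poly_space j) (\<lambda>f g. IK (\<lambda>x. f x * g x))"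
proof
  show "0 < IK (\<lambda>x. f x * f x)" if "f \<in> poly_space j" "f \<noteq> (\<lambda>x. 0)" for f
  proof -
    have "0 \<le> IK (\<lambda>x. f x * f x)" by (rule Bochner_Integration.integral_nonneg) simp
    then show ?thesis using IK_mult_self_eq_0[OF polyfI[OF that(1)]] that(2) by linarith
  qed
  show "IK (\<lambda>x. (f x + r * g x) * h x) = IK (\<lambda>x. f x * h x) + r * IK (\<lambda>x. g x * h x)"
    if "f \<in> poly_space j" "g \<in> poly_space j" "h \<in> poly_space j" for f g h r
  proof -
    have "polyf f" "polyf g" "polyf h" using that by (auto intro: polyfI)
    then have "IK (\<lambda>x. f x * h x + r * (g x * h x)) = IK (\<lambda>x. f x * h x) + IK (\<lambda>x. r * (g x * h x))"
      by (intro IK_add polyf_mult polyf_const)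
    then show ?thesis by (simp add: algebra_simps)
  qed
qed (auto intro: poly_space_add poly_space_cmult simp: mult.commute)

lemma dd_bound_by_sup:
  "\<exists>C\<ge>0. \<forall>f\<in>poly_space j. \<forall>M. (\<forall>x\<in>body K. \<bar>f x\<bar> \<le> M) \<longrightarrow> (\<forall>c. \<forall>x\<in>body K. \<bar>dd c f x\<bar> \<le> C * norm c * M)"
proof -
  let ?Q = "\<lambda>f g. IK (\<lambda>x. f x * g x)"
  obtain F where F: "finite F" "F \<subseteq> poly_space j" "\<And>f. f \<in> poly_space j \<Longrightarrow> f = (\<lambda>x. \<Sum>g\<in>F. ?Q f g * g x)"
    by (rule orthonormal_basis_poly[OF L2_space order_refl]) blast
  have Fp: "polyf g" if "g \<in> F" for g using that F(2) by (auto intro: polyfI)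
  have "\<exists>B\<ge>0. \<forall>x\<in>body K. \<bar>g x\<bar> \<le> B" if "g \<in> F" for g
    by (rule polyf_bounded_body[OF Fp[OF that]]) blast
  then obtain B where B: "\<And>g. g \<in> F \<Longrightarrow> B g \<ge> 0" "\<And>g x. g \<in> F \<Longrightarrow> x \<in> body K \<Longrightarrow> \<bar>g x\<bar> \<le> B g" by metis
  have "\<exists>D\<ge>0. \<forall>x\<in>body K. \<bar>dd (axis i 1) g x\<bar> \<le> D" if "g \<in> F" for g i
    by (rule polyf_bounded_body[OF polyf_dd[OF Fp[OF that]]]) blast
  then obtain D where D: "\<And>g i. g \<in> F \<Longrightarrow> D g i \<ge> 0" "\<And>g i x. g \<in> F \<Longrightarrow> x \<in> body K \<Longrightarrow> \<bar>dd (axis i 1) g x\<bar> \<le> D g i" by metis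
  define E where "E g = (\<Sum>i\<in>UNIV. D g i)" for g
  have E: "0 \<le> E g" "\<bar>dd c g x\<bar> \<le> norm c * E g" if g: "g \<in> F" and x: "x \<in> body K" for g c x
  proof -
    show "0 \<le> E g" unfolding E_def by (intro sum_nonneg D g)
    have C1: "C_diff 1 g" using Fp[OF g] by (rule C_diff_polyf)
    have "\<bar>dd c g x\<bar> \<le> (\<Sum>i\<in>UNIV. \<bar>c $ i * dd (axis i 1) g x\<bar>)"
      unfolding continuous_on_dd(3)[OF C1, of c] by (rule sum_abs)
    also have "\<dots> \<le> (\<Sum>i\<in>UNIV. norm c * D g i)"
      unfolding abs_mult by (intro sum_mono mult_mono component_le_norm_cart D g x) auto
    finally show "\<bar>dd c g x\<bar> \<le> norm c * E g" by (simp add: E_def sum_distrib_left)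
  qed
  define C where "C = (\<Sum>g\<in>F. B g * vol * E g)"
  obtain x0 where x0: "x0 \<in> body K" using interior_body_nonempty interior_subset by blast
  have C0: "C \<ge> 0" unfolding C_def by (intro sum_nonneg mult_nonneg_nonneg B E(1)[OF _ x0] vol_pos)
  have "\<bar>dd c f x\<bar> \<le> C * norm c * M" if f: "f \<in> poly_space j" and M: "\<And>x. x \<in> body K \<Longrightarrow> \<bar>f x\<bar> \<le> M" and x: "x \<in> body K" for f M c x
  proof -
    have pf: "polyf f" using f by (rule polyfI)
    have M0: "0 \<le> M" using M[OF x] by linarith
    have Qb: "\<bar>?Q f g\<bar> \<le> M * B g * vol" if g: "g \<in> F" for g
    proof -
      have pfg: "polyf (\<lambda>x. f x * g x)" by (intro polyf_mult pf Fp g)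
      have b: "\<bar>f x * g x\<bar> \<le> M * B g" if "x \<in> body K" for x
        unfolding abs_mult using M0 by (intro mult_mono M B g that) auto
      have "?Q f g \<le> IK (\<lambda>x. M * B g)" 
        by (rule IK_mono[OF pfg polyf_const]) (use b abs_le_D1 in blast)
      moreover have "IK (\<lambda>x. - (M * B g)) \<le> ?Q f g"
        by (rule IK_mono[OF polyf_const pfg]) (use b abs_le_D2 minus_le_iff in blast)
      ultimately show ?thesis unfolding IK_const by simp
    qed
    have "dd c f x = dd c (\<lambda>x. \<Sum>g\<in>F. ?Q f g * g x) x" using F(3)[OF f] by simp
    also have "\<dots> = (\<Sum>g\<in>F. dd c (\<lambda>x. ?Q f g * g x) x)" by (intro dd_sum polyf_mult polyf_const Fp)
    also have "\<dots> = (\<Sum>g\<in>F. ?Q f g * dd c g x)" by (intro sum.cong refl dd_cmult Fp)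
    finally have "\<bar>dd c f x\<bar> \<le> (\<Sum>g\<in>F. \<bar>?Q f g * dd c g x\<bar>)" by (simp add: sum_abs)
    also have "\<dots> \<le> (\<Sum>g\<in>F. (M * B g * vol) * (norm c * E g))"
      unfolding abs_mult using M0 B by (intro sum_mono mult_mono Qb E(2) x) auto
    also have "\<dots> = C * norm c * M" unfolding C_def sum_distrib_right by (intro sum.cong) auto
    finally show ?thesis .
  qed
  then show ?thesis using C0 by blast
qed

lemma boundary_form_mono:
  assumes "\<And>i. a i \<le> a' i" shows "boundary_form a f f \<le> boundary_form a' f f"
  unfolding boundary_form_def by (intro sum_mono mult_right_mono assms facet_form_nonneg)

lemma boundary_form_scale: "boundary_form (\<lambda>i. t * a i) f g = t * boundary_form a f g"
  unfolding boundary_form_def by (simp add: sum_distrib_left mult.assoc)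

lemma dd_elem_inv:
  assumes "polyf f" shows "dd c f x = dd (matrix_inv (elem_matrix K) *v c) (\<lambda>y. f (elem_map K y)) (elem_inv K x)"
proof -
  have "(elem_inv K has_derivative (\<lambda>c. matrix_inv (elem_matrix K) *v c)) (at x)"
    unfolding elem_inv_def[abs_def] matrix_vector_mult_diff_distrib
    by (auto intro!: derivative_eq_intros bounded_linear.has_derivative[OF matrix_vector_mul_bounded_linear])
  from has_derivative_compose[OF this dd_has_derivative[OF polyf_elem_map[OF assms]]]
  have "dd c (\<lambda>x. f (elem_map K (elem_inv K x))) x = dd (matrix_inv (elem_matrix K) *v c) (\<lambda>y. f (elem_map K y)) (elem_inv K x)"
    by (rule dd_eq)
  then show ?thesis by simp
qed

end

lemma dd_bound_uniform:
  "\<exists>C\<ge>0. \<forall>(K :: 'n::finite lsimplex). nondegenerate_simplex K \<longrightarrow> (\<forall>f\<in>poly_space j. \<forall>M. (\<forall>x\<in>body K. \<bar>f x\<bar> \<le> M) \<longrightarrow> 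
     (\<forall>c. \<forall>x\<in>body K. \<bar>dd c f x\<bar> \<le> C * norm (matrix_inv (elem_matrix K) *v c) * M))"
proof -
  obtain C where C: "C \<ge> 0" "\<And>f M c x. f \<in> poly_space j \<Longrightarrow> (\<forall>x\<in>body ref_simplex. \<bar>f x\<bar> \<le> M) \<Longrightarrow> 
     x \<in> body (ref_simplex :: 'n lsimplex) \<Longrightarrow> \<bar>dd c f x\<bar> \<le> C * norm c * M"
    using nondegenerate_simplex.dd_bound_by_sup[OF ref_nondegenerate, of j] by metis
  have "\<bar>dd c f x\<bar> \<le> C * norm (matrix_inv (elem_matrix K) *v c) * M"
    if K: "nondegenerate_simplex K" and f: "f \<in> poly_space j" and M: "\<forall>x\<in>body K. \<bar>f x\<bar> \<le> M" and x: "x \<in> body K" for K :: "'n lsimplex" and f M c x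
  proof -
    interpret nondegenerate_simplex K by (rule K)
    show ?thesis unfolding dd_elem_inv[OF polyfI[OF f]]
      by (rule C(2)) (use f M x in \<open>auto intro: poly_space_elem_map simp: elem_map_body_iff elem_inv_body_iff\<close>)
  qed
  then show ?thesis using C(1) by blast
qed

lemma boundary_form_bound_weights:
  fixes a :: "'n::finite option \<Rightarrow> real"
  assumes "nondegenerate_simplex.admissible k a"
  shows "\<exists>C\<ge>0. \<forall>(K :: 'n lsimplex). nondegenerate_simplex K \<longrightarrow> (\<forall>f\<in>poly_perp (int k) K. \<forall>x\<in>body K.
    (f x)\<^sup>2 * measure lebesgue (body K) \<le> C * nondegenerate_simplex.boundary_form K a f f)"
proof -
  interpret ref: nondegenerate_simplex "ref_simplex :: 'n lsimplex" by (rule ref_nondegenerate)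
  obtain C where C: "C \<ge> 0" "\<And>f x. f \<in> poly_perp (int k) ref_simplex \<Longrightarrow> x \<in> body (ref_simplex :: 'n lsimplex) \<Longrightarrow> (f x)\<^sup>2 \<le> C * ref.boundary_form a f f"
    using ref.square_bounded_by_form[OF ref.boundary_form_space[OF assms], of "int k"] unfolding poly_perp_def by blast
  have "(f x)\<^sup>2 * measure lebesgue (body K) \<le> (C * ref.vol) * nondegenerate_simplex.boundary_form K a f f"
    if K: "nondegenerate_simplex K" and f: "f \<in> poly_perp (int k) K" and x: "x \<in> body K" for K :: "'n lsimplex" and f x
  proof -
    interpret nondegenerate_simplex K by (rule K)
    have p: "polyf f" using poly_perp_polyf f by blast
    have "(f (elem_map K (elem_inv K x)))\<^sup>2 \<le> C * ref.boundary_form a (\<lambda>y. f (elem_map K y)) (\<lambda>y. f (elem_map K y))"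
      by (rule C(2)[OF poly_perp_elem_map[OF f]]) (use x in \<open>simp add: elem_inv_body_iff\<close>)
    then have "(f x)\<^sup>2 * vol \<le> C * ref.boundary_form a (\<lambda>y. f (elem_map K y)) (\<lambda>y. f (elem_map K y)) * vol"
      by (intro mult_right_mono) auto
    also have "\<dots> = (C * ref.vol) * boundary_form a f f"
      unfolding boundary_form_elem_map[OF p p] by simp
    finally show ?thesis .
  qed
  then show ?thesis using C(1) ref.vol_pos by (intro exI[of _ "C * ref.vol"]) auto
qed

lemma boundary_form_bound_uniform:
  assumes "1 \<le> k"
  shows "\<exists>C\<ge>0. \<forall>(K :: 'n::finite lsimplex) a t. nondegenerate_simplex K \<longrightarrow> 0 < t \<longrightarrow> (\<forall>i. 0 \<le> a i) \<longrightarrow>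
     (if k = 1 then \<exists>i j. i \<noteq> j \<and> t \<le> a i \<and> t \<le> a j else \<forall>i. t \<le> a i) \<longrightarrow>
     (\<forall>f\<in>poly_perp (int k) K. \<forall>x\<in>body K.
       (f x)\<^sup>2 * measure lebesgue (body K) * t \<le> C * nondegenerate_simplex.boundary_form K a f f)"
proof -
  have main: "(f x)\<^sup>2 * measure lebesgue (body K) * t \<le> C * nondegenerate_simplex.boundary_form K a f f"
    if K: "nondegenerate_simplex K" and t: "0 < t" and a: "\<And>i. t * a' i \<le> a i" and C: "C \<ge> 0" 
      and b: "(f x)\<^sup>2 * measure lebesgue (body K) \<le> C * nondegenerate_simplex.boundary_form K a' f f"
    for K :: "'n lsimplex" and t a' a C f x
  proof -
    interpret nondegenerate_simplex K by (rule K)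
    have "(f x)\<^sup>2 * vol * t \<le> (C * boundary_form a' f f) * t" using b t by (intro mult_right_mono) auto
    also have "\<dots> = C * boundary_form (\<lambda>i. t * a' i) f f" by (simp add: boundary_form_scale)
    also have "\<dots> \<le> C * boundary_form a f f" by (intro mult_left_mono boundary_form_mono a C)
    finally show ?thesis .
  qed
  show ?thesis
  proof (cases "k = 1")
    case False
    have "nondegenerate_simplex.admissible k (\<lambda>i :: 'n option. 1)"
      unfolding nondegenerate_simplex.admissible_def[OF ref_nondegenerate] using other_neq(1)[of None] by auto
    from boundary_form_bound_weights[OF this]
    obtain C where C: "C \<ge> 0" "\<And>(K :: 'n lsimplex) f x. nondegenerate_simplex K \<Longrightarrow> f \<in> poly_perp (int k) K \<Longrightarrow> x \<in> body K \<Longrightarrow>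
       (f x)\<^sup>2 * measure lebesgue (body K) \<le> C * nondegenerate_simplex.boundary_form K (\<lambda>i. 1) f f" by blast
    show ?thesis using False
      by (intro exI[of _ C] conjI allI impI ballI C(1) main[OF _ _ _ C(1) C(2)]) auto
  next
    case True
    let ?a = "\<lambda>(i, j) m. if m = i \<or> m = j then 1 else (0 :: real)"
    define bd where "bd p C \<longleftrightarrow> 0 \<le> C \<and> (fst p \<noteq> snd p \<longrightarrow> (\<forall>(K :: 'n lsimplex). nondegenerate_simplex K \<longrightarrow> 
       (\<forall>f\<in>poly_perp (int k) K. \<forall>x\<in>body K.
       (f x)\<^sup>2 * measure lebesgue (body K) \<le> C * nondegenerate_simplex.boundary_form K (?a p) f f)))" 
      for p :: "'n option \<times> 'n option" and C :: real
    have "\<exists>C. bd p C" for p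
    proof (cases "fst p = snd p")
      case False
      then have "nondegenerate_simplex.admissible k (?a p)"
        unfolding nondegenerate_simplex.admissible_def[OF ref_nondegenerate] using True
        by (intro conjI allI exI[of _ "fst p"] exI[of _ "snd p"] disjI1) (auto simp: case_prod_beta)
      from boundary_form_bound_weights[OF this] show ?thesis unfolding bd_def by blast
    next
      case True
      then show ?thesis unfolding bd_def by (intro exI[of _ 0]) simp
    qed
    then obtain C where bdC: "\<And>p. bd p (C p)" by metis
    have C0: "\<And>p. C p \<ge> 0" using bdC unfolding bd_def by blast
    have C: "(f x)\<^sup>2 * measure lebesgue (body K) \<le> C p * nondegenerate_simplex.boundary_form K (?a p) f f"
      if "fst p \<noteq> snd p" "nondegenerate_simplex K" "f \<in> poly_perp (int k) K" "x \<in> body K" for p K f x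
      using bdC[of p] that unfolding bd_def by blast
    define CC where "CC = (\<Sum>p\<in>UNIV. C p)"
    have CC: "C p \<le> CC" for p unfolding CC_def by (rule member_le_sum) (auto simp: C0)
    have CC0: "CC \<ge> 0" unfolding CC_def by (intro sum_nonneg C0)
    show ?thesis
    proof (intro exI[of _ CC] conjI allI impI ballI CC0)
      fix K :: "'n lsimplex" and a :: "'n option \<Rightarrow> real" and t f x
      assume K: "nondegenerate_simplex K" and t: "0 < t" and a0: "\<forall>i. 0 \<le> a i"
        and "if k = 1 then \<exists>i j. i \<noteq> j \<and> t \<le> a i \<and> t \<le> a j else \<forall>i. t \<le> a i"
        and f: "f \<in> poly_perp (int k) K" and x: "x \<in> body K"
      then obtain i j where ij: "i \<noteq> j" "t \<le> a i" "t \<le> a j" using True by auto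
      show "(f x)\<^sup>2 * measure lebesgue (body K) * t \<le> CC * nondegenerate_simplex.boundary_form K a f f"
      proof (rule main[OF K t, of "?a (i, j)"])
        show "t * ?a (i, j) m \<le> a m" for m using ij a0 by auto
        have "(f x)\<^sup>2 * measure lebesgue (body K) \<le> C (i, j) * nondegenerate_simplex.boundary_form K (?a (i, j)) f f"
          using ij by (intro C K f x) auto
        also have "\<dots> \<le> CC * nondegenerate_simplex.boundary_form K (?a (i, j)) f f"
          by (intro mult_right_mono CC nondegenerate_simplex.boundary_form_nonneg[OF K]) auto
        finally show "(f x)\<^sup>2 * measure lebesgue (body K) \<le> CC * nondegenerate_simplex.boundary_form K (?a (i, j)) f f" .
      qed (rule CC0)
    qed
  qed
qed

lemma bubble_form_bound_uniform:
  "\<exists>C\<ge>0. \<forall>(K :: 'n::finite lsimplex). nondegenerate_simplex K \<longrightarrow> (\<forall>z\<in>poly_space j. \<forall>x\<in>body K.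
    (z x)\<^sup>2 * measure lebesgue (body K) \<le> C * integral\<^sup>L (lebesgue_on (body K)) (\<lambda>x. bubble K x * (z x * z x)))"
proof -
  interpret ref: nondegenerate_simplex "ref_simplex :: 'n lsimplex" by (rule ref_nondegenerate)
  obtain C where C: "C \<ge> 0" "\<And>z x. z \<in> poly_space j \<Longrightarrow> x \<in> body (ref_simplex :: 'n lsimplex) \<Longrightarrow> 
     (z x)\<^sup>2 \<le> C * ref.IK (\<lambda>x. bubble ref_simplex x * (z x * z x))"
    using ref.square_bounded_by_form[OF ref.bubble_form_space order_refl] by blast
  have "(z x)\<^sup>2 * measure lebesgue (body K) \<le> (C * ref.vol) * integral\<^sup>L (lebesgue_on (body K)) (\<lambda>x. bubble K x * (z x * z x))"
    if K: "nondegenerate_simplex K" and z: "z \<in> poly_space j" and x: "x \<in> body K" for K :: "'n lsimplex" and z x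
  proof -
    interpret nondegenerate_simplex K by (rule K)
    have p: "polyf (\<lambda>x. bubble K x * (z x * z x))" using polyfI[OF z] by (intro polyf_mult bubble_polyf)
    let ?I = "ref.IK (\<lambda>y. bubble ref_simplex y * (z (elem_map K y) * z (elem_map K y)))"
    have "(z (elem_map K (elem_inv K x)))\<^sup>2 \<le> C * ?I"
      by (rule C(2)[OF poly_space_elem_map[OF z]]) (use x in \<open>simp add: elem_inv_body_iff\<close>)
    then have "(z x)\<^sup>2 * vol \<le> C * ?I * vol" by (intro mult_right_mono) auto
    also have "\<dots> = (C * ref.vol) * IK (\<lambda>x. bubble K x * (z x * z x))"
      unfolding IK_elem_map[OF p] by simp
    finally show ?thesis .
  qed
  then show ?thesis using C(1) ref.vol_pos by (intro exI[of _ "C * ref.vol"]) auto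
qed

section \<open>Existence and uniqueness of the local projection\<close>

context nondegenerate_simplex
begin

definition graph_fun :: "real^'n \<Rightarrow> (real^'n \<Rightarrow> real) \<Rightarrow> (real^'n \<Rightarrow> real) \<Rightarrow> bool" where
  "graph_fun b v g \<longleftrightarrow> integrable (lebesgue_on (body K)) v \<and> integrable (lebesgue_on (body K)) g \<and>
     is_weak_dderiv b (body K) v g"

definition graph_pairing :: "real^'n \<Rightarrow> (real^'n \<Rightarrow> real) \<Rightarrow> (real^'n \<Rightarrow> real) \<Rightarrow> (real^'n \<Rightarrow> real) \<Rightarrow> real" where
  "graph_pairing b f v g = IK (\<lambda>x. dd b f x * v x) + IK (\<lambda>x. f x * g x)"

lemma graph_fun_polyf: "polyf f \<Longrightarrow> graph_fun b f (dd b f)"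
  by (simp add: graph_fun_def is_weak_dderiv_polyf polyf_dd)

lemma graph_fun_lincomb:
  assumes "graph_fun b v g" "graph_fun b v' g'"
  shows "graph_fun b (\<lambda>x. v x + r * v' x) (\<lambda>x. g x + r * g' x)"
  using assms unfolding graph_fun_def by (auto intro!: is_weak_dderiv_lincomb)

lemma graph_fun_shift:
  assumes "graph_fun b v g" shows "graph_fun b (\<lambda>x. v x - c) g"
proof -
  have "graph_fun b (\<lambda>x. v x + (- c) * 1) (\<lambda>x. g x + (- c) * dd b (\<lambda>x. 1) x)"
    by (intro graph_fun_lincomb assms graph_fun_polyf) simp
  then show ?thesis by simp
qed

lemma weak_dderiv_AE:
  assumes "is_weak_dderiv b (body K) v g" shows "AE x in lebesgue_on (body K). g x = weak_dderiv b (body K) v x"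
  by (rule weak_dderiv_unique_AE[OF body_lebesgue negligible_frontier_body assms is_weak_dderiv_weak_dderiv[OF assms]])

lemma weak_dderiv_measurable:
  assumes "is_weak_dderiv b (body K) v g" "g \<in> borel_measurable (lebesgue_on (body K))"
  shows "weak_dderiv b (body K) v \<in> borel_measurable (lebesgue_on (body K))"
  by (rule lebesgue_on_measurable_AE_cong[OF body_lebesgue assms(2) weak_dderiv_AE[OF assms(1)]])

lemma pairing_weak_dderiv:
  assumes f: "polyf f" and v: "graph_fun b v g"
  shows "pairing (body K) f (weak_dderiv b (body K) v) = IK (\<lambda>x. f x * g x)"
    and "pairing (body K) (weak_dderiv b (body K) f) v = IK (\<lambda>x. dd b f x * v x)"
proof -
  have wf: "is_weak_dderiv b (body K) f (dd b f)" by (rule is_weak_dderiv_polyf[OF f body_lebesgue])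
  have wv: "is_weak_dderiv b (body K) v g" and iv: "integrable (lebesgue_on (body K)) v" "integrable (lebesgue_on (body K)) g"
    using v by (auto simp: graph_fun_def)
  note m = polyf_measurable_body[OF f] polyf_measurable_body[OF polyf_dd[OF f]] iv[THEN borel_measurable_integrable]
  show "pairing (body K) (weak_dderiv b (body K) f) v = IK (\<lambda>x. dd b f x * v x)"
    unfolding pairing_def
  proof (rule integral_cong_AE)
    show "AE x in lebesgue_on (body K). weak_dderiv b (body K) f x * v x = dd b f x * v x"
      using weak_dderiv_AE[OF wf] by eventually_elim simp
    show "(\<lambda>x. weak_dderiv b (body K) f x * v x) \<in> borel_measurable (lebesgue_on (body K))"
      by (rule borel_measurable_times[OF weak_dderiv_measurable[OF wf m(2)] m(3)])
    show "(\<lambda>x. dd b f x * v x) \<in> borel_measurable (lebesgue_on (body K))"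
      by (rule borel_measurable_times[OF m(2) m(3)])
  qed
  show "pairing (body K) f (weak_dderiv b (body K) v) = IK (\<lambda>x. f x * g x)"
    unfolding pairing_def
  proof (rule integral_cong_AE)
    show "AE x in lebesgue_on (body K). f x * weak_dderiv b (body K) v x = f x * g x"
      using weak_dderiv_AE[OF wv] by eventually_elim simp
    show "(\<lambda>x. f x * weak_dderiv b (body K) v x) \<in> borel_measurable (lebesgue_on (body K))"
      by (rule borel_measurable_times[OF m(1) weak_dderiv_measurable[OF wv m(4)]])
    show "(\<lambda>x. f x * g x) \<in> borel_measurable (lebesgue_on (body K))"
      by (rule borel_measurable_times[OF m(1) m(4)])
  qed
qed

lemma D_elem_eq:
  assumes "polyf f" "graph_fun b v g" shows "D_elem b K f v = graph_pairing b f v g"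
  by (simp add: D_elem_def graph_pairing_def pairing_weak_dderiv[OF assms])

lemma IK_mult_lincomb:
  assumes "polyf f" "integrable (lebesgue_on (body K)) v" "integrable (lebesgue_on (body K)) v'"
  shows "IK (\<lambda>x. f x * (v x + r * v' x)) = IK (\<lambda>x. f x * v x) + r * IK (\<lambda>x. f x * v' x)"
proof -
  have "IK (\<lambda>x. f x * v x + r * (f x * v' x)) = IK (\<lambda>x. f x * v x) + IK (\<lambda>x. r * (f x * v' x))"
    by (intro Bochner_Integration.integral_add integrable_mult_right integrable_polyf_mult assms)
  then show ?thesis by (simp add: algebra_simps)
qed

lemma IK_lincomb_mult:
  assumes "polyf f" "polyf f'" "integrable (lebesgue_on (body K)) v"
  shows "IK (\<lambda>x. (f x + r * f' x) * v x) = IK (\<lambda>x. f x * v x) + r * IK (\<lambda>x. f' x * v x)"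
proof -
  have "IK (\<lambda>x. f x * v x + r * (f' x * v x)) = IK (\<lambda>x. f x * v x) + IK (\<lambda>x. r * (f' x * v x))"
    by (intro Bochner_Integration.integral_add integrable_mult_right integrable_polyf_mult assms)
  then show ?thesis by (simp add: algebra_simps)
qed

lemma graph_pairing_lincomb_left:
  assumes f: "polyf f" "polyf f'" and v: "integrable (lebesgue_on (body K)) v" "integrable (lebesgue_on (body K)) g"
  shows "graph_pairing b (\<lambda>x. f x + r * f' x) v g = graph_pairing b f v g + r * graph_pairing b f' v g"
proof -
  have "dd b (\<lambda>x. f x + r * f' x) x = dd b f x + r * dd b f' x" for x
    using dd_add[OF f(1) polyf_mult[OF polyf_const f(2)], of b r x] dd_cmult[OF f(2), of b r x] by simp
  then have "IK (\<lambda>x. dd b (\<lambda>x. f x + r * f' x) x * v x) = IK (\<lambda>x. dd b f x * v x) + r * IK (\<lambda>x. dd b f' x * v x)"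
    using IK_lincomb_mult[OF polyf_dd[OF f(1), of b] polyf_dd[OF f(2), of b] v(1), of r] by simp
  then show ?thesis using IK_lincomb_mult[OF f v(2), of r] by (simp add: graph_pairing_def algebra_simps)
qed

lemma graph_pairing_lincomb_right:
  assumes f: "polyf f" and v: "graph_fun b v g" "graph_fun b v' g'"
  shows "graph_pairing b f (\<lambda>x. v x + r * v' x) (\<lambda>x. g x + r * g' x) = graph_pairing b f v g + r * graph_pairing b f v' g'"
  using IK_mult_lincomb[OF f, of g g' r] IK_mult_lincomb[OF polyf_dd[OF f, of b], of v v' r] v
  unfolding graph_pairing_def graph_fun_def by (simp add: algebra_simps)

lemma graph_pairing_polyf:
  assumes "polyf f" "polyf u" shows "graph_pairing b f u (dd b u) = IK (dd b (\<lambda>x. f x * u x))"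
proof -
  have "dd b (\<lambda>x. f x * u x) = (\<lambda>x. dd b f x * u x + f x * dd b u x)"
    using dd_mult[OF assms, of b] by (auto simp: fun_eq_iff)
  then show ?thesis unfolding graph_pairing_def using assms
    by (simp add: IK_add[OF polyf_mult polyf_mult] polyf_dd)
qed

definition test_fun :: "real^'n \<Rightarrow> (real^'n \<Rightarrow> real) \<Rightarrow> (real^'n \<Rightarrow> real) \<Rightarrow> real^'n \<Rightarrow> real" where
  "test_fun b w z = (\<lambda>x. sign_bubble b K x * w x + bubble K x * z x)"

lemma test_fun_polyf: "polyf w \<Longrightarrow> polyf z \<Longrightarrow> polyf (test_fun b w z)"
  unfolding test_fun_def by (intro polyf_add polyf_mult sign_bubble_polyf bubble_polyf)

lemma V_iff: "u \<in> V k b K \<longleftrightarrow> (\<exists>w z. u = test_fun b w z \<and> w \<in> poly_perp (int k) K \<and> z \<in> poly_space (int k - 2))"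
  by (auto simp: V_def test_fun_def)

lemma graph_pairing_test_fun:
  assumes f: "polyf f" and w: "polyf w" and z: "polyf z"
  shows "graph_pairing b f (test_fun b w z) (dd b (test_fun b w z)) = boundary_form (flux b) f w"
proof -
  let ?A = "\<lambda>x. sign_bubble b K x * (f x * w x)" and ?B = "\<lambda>x. bubble K x * (f x * z x)"
  have p: "polyf ?A" "polyf ?B" by (intro polyf_mult sign_bubble_polyf bubble_polyf f w z)+
  have "(\<lambda>x. f x * test_fun b w z x) = (\<lambda>x. ?A x + ?B x)"
    by (rule ext) (simp add: test_fun_def algebra_simps)
  moreover have "dd b (\<lambda>x. ?A x + ?B x) = (\<lambda>x. dd b ?A x + dd b ?B x)" by (intro ext dd_add p)
  moreover have "IK (\<lambda>x. dd b ?A x + dd b ?B x) = IK (dd b ?A) + IK (dd b ?B)"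
    by (intro IK_add polyf_dd p)
  ultimately show ?thesis
    unfolding graph_pairing_polyf[OF f test_fun_polyf[OF w z]]
    using integral_dd_sign_bubble[OF f w, of b] integral_dd_bubble[OF polyf_mult[OF f z], of b] by simp
qed

definition local_solution where
  "local_solution k b v g w z \<longleftrightarrow> w \<in> poly_perp (int k) K \<and> z \<in> poly_space (int k - 2) \<and>
     (\<forall>f\<in>poly_perp (int k) K. boundary_form (flux b) f w = graph_pairing b f v g) \<and>
     (\<forall>f\<in>poly_space (int k - 2). IK (\<lambda>x. f x * test_fun b w z x) = IK (\<lambda>x. f x * v x))"

lemma local_solutionD:
  assumes "local_solution k b v g w z"
  shows "w \<in> poly_perp (int k) K" "z \<in> poly_space (int k - 2)"
    "f \<in> poly_perp (int k) K \<Longrightarrow> boundary_form (flux b) f w = graph_pairing b f v g"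
    "f \<in> poly_space (int k - 2) \<Longrightarrow> IK (\<lambda>x. f x * test_fun b w z x) = IK (\<lambda>x. f x * v x)"
  using assms by (simp_all add: local_solution_def)

lemma IK_test_fun:
  assumes "polyf f" "polyf w" "polyf z"
  shows "IK (\<lambda>x. f x * test_fun b w z x) = IK (\<lambda>x. f x * (sign_bubble b K x * w x)) + IK (\<lambda>x. bubble K x * (f x * z x))"
proof -
  have "IK (\<lambda>x. f x * (sign_bubble b K x * w x) + bubble K x * (f x * z x)) = IK (\<lambda>x. f x * (sign_bubble b K x * w x)) + IK (\<lambda>x. bubble K x * (f x * z x))"
    by (intro IK_add polyf_mult sign_bubble_polyf bubble_polyf assms)
  then show ?thesis by (simp add: test_fun_def algebra_simps)
qed

lemma local_solution_exists:
  assumes adm: "admissible k (flux b)" and v: "integrable (lebesgue_on (body K)) v" "integrable (lebesgue_on (body K)) g"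
  shows "\<exists>w z. local_solution k b v g w z"
proof -
  have "\<exists>w\<in>poly_perp (int k) K. \<forall>f\<in>poly_perp (int k) K. boundary_form (flux b) f w = graph_pairing b f v g"
    by (rule poly_riesz[OF boundary_form_space[OF adm], of "int k"])
      (auto simp: poly_perp_def intro: graph_pairing_lincomb_left v polyfI)
  then obtain w where w: "w \<in> poly_perp (int k) K" "\<forall>f\<in>poly_perp (int k) K. boundary_form (flux b) f w = graph_pairing b f v g" by blast
  have pw: "polyf w" using w(1) by (rule poly_perp_polyf)
  let ?l = "\<lambda>f. IK (\<lambda>x. f x * v x) - IK (\<lambda>x. f x * (sign_bubble b K x * w x))"
  have "\<exists>z\<in>poly_space (int k - 2). \<forall>f\<in>poly_space (int k - 2). IK (\<lambda>x. bubble K x * (f x * z x)) = ?l f"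
  proof (rule poly_riesz[OF bubble_form_space order_refl])
    fix f f' :: "real^'n \<Rightarrow> real" and r :: real assume "f \<in> poly_space (int k - 2)" "f' \<in> poly_space (int k - 2)"
    then have p: "polyf f" "polyf f'" by (auto intro: polyfI)
    have i: "integrable (lebesgue_on (body K)) (\<lambda>x. sign_bubble b K x * w x)"
      by (intro integrable_polyf polyf_mult sign_bubble_polyf pw)
    show "?l (\<lambda>x. f x + r * f' x) = ?l f + r * ?l f'"
      unfolding IK_lincomb_mult[OF p v(1)] IK_lincomb_mult[OF p i] by (simp add: algebra_simps)
  qed
  then obtain z where z: "z \<in> poly_space (int k - 2)" "\<forall>f\<in>poly_space (int k - 2). IK (\<lambda>x. bubble K x * (f x * z x)) = ?l f" by blast
  have "IK (\<lambda>x. f x * test_fun b w z x) = IK (\<lambda>x. f x * v x)" if f: "f \<in> poly_space (int k - 2)" for f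
    using z(2) f IK_test_fun[OF polyfI[OF f] pw polyfI[OF z(1)], of b] by simp
  then show ?thesis using w z(1) unfolding local_solution_def by blast
qed

lemma local_solution_unique:
  assumes adm: "admissible k (flux b)" and s: "local_solution k b v g w z" "local_solution k b v g w' z'"
  shows "w = w'" "z = z'"
proof -
  have w: "w \<in> poly_perp (int k) K" "w' \<in> poly_perp (int k) K" and z: "z \<in> poly_space (int k - 2)" "z' \<in> poly_space (int k - 2)"
    using s by (auto simp: local_solution_def)
  note p = poly_perp_polyf[OF w(1)] poly_perp_polyf[OF w(2)] polyfI[OF z(1)] polyfI[OF z(2)]
  let ?d = "\<lambda>x. w x + (-1) * w' x"
  have d: "?d \<in> poly_perp (int k) K" by (rule poly_perp_comb[OF w])
  have "boundary_form (flux b) w ?d = boundary_form (flux b) w' ?d + boundary_form (flux b) ?d ?d"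
    using boundary_form_linear[OF p(1,2) poly_perp_polyf[OF d], of "flux b" "-1"] by simp
  moreover have "boundary_form (flux b) ?d w = boundary_form (flux b) ?d w'"
  proof -
    have "boundary_form (flux b) ?d w = graph_pairing b ?d v g" "boundary_form (flux b) ?d w' = graph_pairing b ?d v g"
      using s d unfolding local_solution_def by blast+
    then show ?thesis by (simp only:)
  qed
  ultimately have "boundary_form (flux b) ?d ?d = 0" using boundary_form_commute[of "flux b" ?d w] boundary_form_commute[of "flux b" ?d w'] by linarith
  from boundary_form_definite[OF adm d this] show ww: "w = w'" by (auto simp: fun_eq_iff)
  let ?e = "\<lambda>x. z x + (-1) * z' x"
  have e: "?e \<in> poly_space (int k - 2)" using z by (intro poly_space_add poly_space_cmult)
  have pe: "polyf ?e" using e by (rule polyfI)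
  have "IK (\<lambda>x. ?e x * test_fun b w z x) = IK (\<lambda>x. ?e x * v x)" "IK (\<lambda>x. ?e x * test_fun b w' z' x) = IK (\<lambda>x. ?e x * v x)"
    by (rule local_solutionD(4)[OF s(1) e], rule local_solutionD(4)[OF s(2) e])
  then have "IK (\<lambda>x. ?e x * test_fun b w z x) = IK (\<lambda>x. ?e x * test_fun b w z' x)"
    unfolding ww by (simp only:)
  then have "IK (\<lambda>x. bubble K x * (?e x * z x)) = IK (\<lambda>x. bubble K x * (?e x * z' x))"
    unfolding IK_test_fun[OF pe p(1,3)] IK_test_fun[OF pe p(1,4)] by simp
  then have "IK (\<lambda>x. bubble K x * (z x * ?e x)) = IK (\<lambda>x. bubble K x * (z' x * ?e x))"
    by (simp add: mult.commute)
  then have "IK (\<lambda>x. bubble K x * (?e x * ?e x)) = 0"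
    using bubble_form_linear[OF p(3,4) pe, of "-1"] by simp
  from bubble_form_definite[OF pe this] show "z = z'" by (auto simp: fun_eq_iff)
qed

lemma local_conditions_iff:
  assumes v: "graph_fun b v g" and w: "w \<in> poly_perp (int k) K" and z: "z \<in> poly_space (int k - 2)"
  shows "(\<forall>f\<in>poly_perp (int k) K. D_elem b K f (\<lambda>x. test_fun b w z x - v x) = 0) \<and>
     (\<forall>f\<in>poly_space (int k - 2). pairing (body K) f (\<lambda>x. test_fun b w z x - v x) = 0) \<longleftrightarrow> local_solution k b v g w z"
proof -
  let ?u = "test_fun b w z"
  have pu: "polyf ?u" by (intro test_fun_polyf poly_perp_polyf[OF w] polyfI[OF z])
  note gu = graph_fun_polyf[OF pu, of b]
  have e: "(\<lambda>x. ?u x - v x) = (\<lambda>x. ?u x + (-1) * v x)" by simp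
  have iv: "integrable (lebesgue_on (body K)) v" "integrable (lebesgue_on (body K)) ?u" using v gu by (auto simp: graph_fun_def)
  have 1: "D_elem b K f (\<lambda>x. ?u x - v x) = boundary_form (flux b) f w - graph_pairing b f v g" if "f \<in> poly_perp (int k) K" for f
    unfolding e D_elem_eq[OF poly_perp_polyf[OF that] graph_fun_lincomb[OF gu v]]
      graph_pairing_lincomb_right[OF poly_perp_polyf[OF that] gu v]
      graph_pairing_test_fun[OF poly_perp_polyf[OF that] poly_perp_polyf[OF w] polyfI[OF z]] by simp
  have 2: "pairing (body K) f (\<lambda>x. ?u x - v x) = IK (\<lambda>x. f x * ?u x) - IK (\<lambda>x. f x * v x)" if "f \<in> poly_space (int k - 2)" for f
    unfolding e pairing_eq_IK IK_mult_lincomb[OF polyfI[OF that] iv(2,1)] by simp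
  have "(\<forall>f\<in>poly_perp (int k) K. D_elem b K f (\<lambda>x. ?u x - v x) = 0) \<longleftrightarrow>
     (\<forall>f\<in>poly_perp (int k) K. boundary_form (flux b) f w = graph_pairing b f v g)"
    by (intro ball_cong refl) (simp only: 1 right_minus_eq)
  moreover have "(\<forall>f\<in>poly_space (int k - 2). pairing (body K) f (\<lambda>x. ?u x - v x) = 0) \<longleftrightarrow>
     (\<forall>f\<in>poly_space (int k - 2). IK (\<lambda>x. f x * ?u x) = IK (\<lambda>x. f x * v x))"
    by (intro ball_cong refl) (simp only: 2 right_minus_eq)
  ultimately show ?thesis unfolding local_solution_def using w z by (simp only: simp_thms)
qed

lemma Pi_elem_eq:
  assumes adm: "admissible k (flux b)" and v: "graph_fun b v g" and s: "local_solution k b v g w z"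
  shows "Pi_elem k b K v = test_fun b w z"
  unfolding Pi_elem_def
proof (rule the_equality)
  have wz: "w \<in> poly_perp (int k) K" "z \<in> poly_space (int k - 2)" using s by (auto simp: local_solution_def)
  show "test_fun b w z \<in> V k b K \<and>
    (\<forall>f\<in>poly_perp (int k) K. D_elem b K f (\<lambda>x. test_fun b w z x - v x) = 0) \<and>
    (\<forall>f\<in>poly_space (int k - 2). pairing (body K) f (\<lambda>x. test_fun b w z x - v x) = 0)"
    using local_conditions_iff[OF v wz] s V_iff wz by blast
  fix u assume u: "u \<in> V k b K \<and> (\<forall>f\<in>poly_perp (int k) K. D_elem b K f (\<lambda>x. u x - v x) = 0) \<and>
    (\<forall>f\<in>poly_space (int k - 2). pairing (body K) f (\<lambda>x. u x - v x) = 0)"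
  then obtain w' z' where wz': "u = test_fun b w' z'" "w' \<in> poly_perp (int k) K" "z' \<in> poly_space (int k - 2)"
    using V_iff by blast
  then have "local_solution k b v g w' z'" using local_conditions_iff[OF v wz'(2,3)] u by blast
  then show "u = test_fun b w z" using local_solution_unique[OF adm _ s] wz'(1) by blast
qed

end

section \<open>Properties of the Fortin operator on one element\<close>

context nondegenerate_simplex
begin

lemma mean_eq: "mean (body K) v = IK v / vol"
  by (simp add: mean_def)

lemma IK_shift:
  assumes "integrable (lebesgue_on (body K)) v" shows "IK (\<lambda>x. v x - c) = IK v - c * vol"
  using Bochner_Integration.integral_diff[OF assms integrable_polyf[OF polyf_const]] IK_const by simp

lemma IK_minus_mean:
  assumes "integrable (lebesgue_on (body K)) v" shows "IK (\<lambda>x. v x - mean (body K) v) = 0"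
  by (simp add: IK_shift[OF assms] mean_eq)

lemma IK_bubble_pos: "0 < IK (bubble K)"
proof -
  have "0 \<le> IK (bubble K)" by (rule Bochner_Integration.integral_nonneg) (auto simp: space_restrict_space bubble_nonneg)
  moreover have "IK (bubble K) \<noteq> 0"
  proof
    assume "IK (bubble K) = 0"
    then have 0: "bubble K = (\<lambda>x. 0)" by (intro IK_nonneg_eq_0) (auto simp: bubble_nonneg)
    obtain x where "x \<in> interior (body K)" using interior_body_nonempty by blast
    from bubble_pos[OF this] show False using 0 by simp
  qed
  ultimately show ?thesis by linarith
qed

definition correction :: "nat \<Rightarrow> real^'n \<Rightarrow> (real^'n \<Rightarrow> real) \<Rightarrow> real" where
  "correction k b v = IK (\<lambda>x. v x - Pip_elem k b K v x) / IK (bubble K)"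

lemma Pipp_elem_eq: "Pipp_elem k b K v = (\<lambda>x. Pip_elem k b K v x + correction k b v * bubble K x)"
  by (simp add: Pipp_elem_def correction_def pairing_eq_IK)

lemma Pip_elem_shift: "Pip_elem k b K v x = mean (body K) v + Pi_elem k b K (\<lambda>y. v y - mean (body K) v) x"
  by (simp add: Pip_elem_def)

lemma Pi_elem_solution:
  assumes adm: "admissible k (flux b)" and v: "graph_fun b v g"
  obtains w z where "local_solution k b v g w z" "Pi_elem k b K v = test_fun b w z"
proof -
  obtain w z where "local_solution k b v g w z" using local_solution_exists[OF adm, of v g] v by (auto simp: graph_fun_def)
  then show ?thesis using that Pi_elem_eq[OF adm v] by blast
qed

lemma test_fun_bubble: "test_fun b (\<lambda>x. 0) (\<lambda>x. 1) = bubble K"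
  by (simp add: test_fun_def)

lemma graph_pairing_bubble:
  assumes "polyf f" shows "graph_pairing b f (bubble K) (dd b (bubble K)) = 0"
proof -
  have "boundary_form (flux b) f (\<lambda>x. 0) = 0" 
    using boundary_form_linear[OF polyf_const polyf_const assms, of "flux b" 0 1 0] boundary_form_commute[of "flux b" f "\<lambda>x. 0"] by simp
  then show ?thesis using graph_pairing_test_fun[OF assms polyf_const polyf_const, of b 0 1] unfolding test_fun_bubble by simp
qed

lemma fortin_element:
  assumes adm: "admissible k (flux b)" and v: "graph_fun b v g"
  shows "Pip_elem k b K v \<in> Vp k b K" "Pipp_elem k b K v \<in> Vpp k b K" "polyf (Pipp_elem k b K v)"
    "\<And>f. f \<in> poly_perp (int k) K \<Longrightarrow> D_elem b K f (\<lambda>x. Pipp_elem k b K v x - v x) = 0"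
    "\<And>z. z \<in> poly_space (int k - 2) \<Longrightarrow> pairing (body K) z (\<lambda>x. Pipp_elem k b K v x - v x) = 0"
    "\<And>c. c \<in> poly_space 0 \<Longrightarrow> pairing (body K) c (\<lambda>x. Pipp_elem k b K v x - v x) = 0"
    "2 \<le> k \<Longrightarrow> Pipp_elem k b K v = Pip_elem k b K v"
proof -
  define m where "m = mean (body K) v"
  define t where "t = correction k b v"
  let ?v0 = "\<lambda>y. v y - m"
  have v0: "graph_fun b ?v0 g" by (rule graph_fun_shift[OF v])
  obtain w z where s: "local_solution k b ?v0 g w z" and Pi: "Pi_elem k b K ?v0 = test_fun b w z"
    using Pi_elem_solution[OF adm v0] .
  let ?u = "test_fun b w z"
  have w: "w \<in> poly_perp (int k) K" "polyf w" and z: "z \<in> poly_space (int k - 2)" "polyf z"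
    using local_solutionD[OF s] by (auto intro: polyfI poly_perp_polyf)
  have pu: "polyf ?u" by (rule test_fun_polyf[OF w(2) z(2)])
  have Pip: "Pip_elem k b K v = (\<lambda>x. m + ?u x)" by (rule ext) (simp add: Pip_elem_shift m_def[symmetric] Pi)
  have Pipp: "Pipp_elem k b K v = (\<lambda>x. m + ?u x + t * bubble K x)" by (simp add: Pipp_elem_eq Pip t_def)
  have iv: "integrable (lebesgue_on (body K)) v" using v by (simp add: graph_fun_def)
  have iv0: "integrable (lebesgue_on (body K)) ?v0" using v0 by (simp add: graph_fun_def)
  show Vp: "Pip_elem k b K v \<in> Vp k b K"
    unfolding Vp_def Pip using w(1) z(1) V_iff by (intro CollectI exI[of _ ?u] exI[of _ "\<lambda>x. m"]) (auto simp: poly_space_0)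
  show "Pipp_elem k b K v \<in> Vpp k b K"
    unfolding Vpp_def Pipp_elem_eq span_bubble_def using Vp 
    by (intro CollectI exI[of _ "Pip_elem k b K v"] exI[of _ "\<lambda>x. correction k b v * bubble K x"]) auto
  show "polyf (Pipp_elem k b K v)" unfolding Pipp by (intro polyf_add polyf_mult polyf_const bubble_polyf pu)
  have diff: "(\<lambda>x. Pipp_elem k b K v x - v x) = (\<lambda>x. (?u x + (-1) * ?v0 x) + t * bubble K x)"
    by (rule ext) (simp add: Pipp)
  have gu: "graph_fun b ?u (dd b ?u)" by (rule graph_fun_polyf[OF pu])
  have gb: "graph_fun b (bubble K) (dd b (bubble K))" by (rule graph_fun_polyf[OF bubble_polyf])
  note g1 = graph_fun_lincomb[OF gu v0, of "-1"]
  note g2 = graph_fun_lincomb[OF g1 gb, of t]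
  show "D_elem b K f (\<lambda>x. Pipp_elem k b K v x - v x) = 0" if f: "f \<in> poly_perp (int k) K" for f
  proof -
    have pf: "polyf f" using f by (rule poly_perp_polyf)
    show ?thesis
      unfolding diff D_elem_eq[OF pf g2] graph_pairing_lincomb_right[OF pf g1 gb] graph_pairing_lincomb_right[OF pf gu v0]
        graph_pairing_bubble[OF pf] graph_pairing_test_fun[OF pf w(2) z(2)] local_solutionD(3)[OF s f] by simp
  qed
  have i1: "integrable (lebesgue_on (body K)) (\<lambda>x. ?u x + (-1) * ?v0 x)" using g1 by (simp only: graph_fun_def)
  have I: "IK (\<lambda>x. f x * (Pipp_elem k b K v x - v x)) = (IK (\<lambda>x. f x * ?u x) - IK (\<lambda>x. f x * ?v0 x)) + t * IK (\<lambda>x. f x * bubble K x)" if "polyf f" for f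
  proof -
    have "IK (\<lambda>x. f x * (Pipp_elem k b K v x - v x)) = IK (\<lambda>x. f x * ((?u x + (-1) * ?v0 x) + t * bubble K x))"
      by (rule arg_cong[where f = IK]) (rule ext, simp add: Pipp algebra_simps)
    also have "\<dots> = (IK (\<lambda>x. f x * ?u x) + (-1) * IK (\<lambda>x. f x * ?v0 x)) + t * IK (\<lambda>x. f x * bubble K x)"
      unfolding IK_mult_lincomb[OF that i1 integrable_polyf[OF bubble_polyf]] IK_mult_lincomb[OF that integrable_polyf[OF pu] iv0] ..
    finally show ?thesis by simp
  qed
  have tb: "t * IK (bubble K) = - (IK ?u - IK ?v0)"
  proof -
    have "IK (\<lambda>x. v x - Pip_elem k b K v x) = IK (\<lambda>x. ?v0 x - ?u x)" by (simp add: Pip algebra_simps)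
    also have "\<dots> = IK ?v0 - IK ?u" by (rule Bochner_Integration.integral_diff[OF iv0 integrable_polyf[OF pu]])
    finally show ?thesis using IK_bubble_pos by (simp add: t_def correction_def)
  qed
  show t0: "Pipp_elem k b K v = Pip_elem k b K v" if "2 \<le> k"
  proof -
    have "(\<lambda>x. 1) \<in> poly_space (int k - 2)" using that by (intro poly_space_const) simp
    from local_solutionD(4)[OF s this] have "IK ?u = IK ?v0" by simp
    then have "t = 0" using tb IK_bubble_pos by simp
    then show ?thesis by (simp add: Pipp Pip)
  qed
  show "pairing (body K) f (\<lambda>x. Pipp_elem k b K v x - v x) = 0" if f: "f \<in> poly_space (int k - 2)" for f
  proof (cases "2 \<le> k")
    case True
    have "(\<lambda>x. 1) \<in> poly_space (int k - 2)" using True by (intro poly_space_const) simp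
    from local_solutionD(4)[OF s this] have "IK ?u = IK ?v0" by simp
    then have "t = 0" using tb IK_bubble_pos by simp
    then show ?thesis unfolding pairing_eq_IK I[OF polyfI[OF f]] local_solutionD(4)[OF s f] by simp
  next
    case False
    then have "f = (\<lambda>x. 0)" using f poly_space_neg[of "int k - 2" f] by simp
    then show ?thesis by (simp add: pairing_eq_IK)
  qed
  show "pairing (body K) c (\<lambda>x. Pipp_elem k b K v x - v x) = 0" if "c \<in> poly_space 0" for c
  proof -
    obtain r where c: "c = (\<lambda>x. r)" using \<open>c \<in> poly_space 0\<close> poly_space_0 by blast
    have "IK (\<lambda>x. 1 * (Pipp_elem k b K v x - v x)) = 0" unfolding I[OF polyf_const] using tb by simp
    then show ?thesis unfolding pairing_eq_IK c by simp
  qed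
qed

lemma Pipp_elem_const:
  assumes adm: "admissible k (flux b)" and "c \<in> poly_space 0" shows "Pipp_elem k b K c = c"
proof -
  obtain r where c: "c = (\<lambda>x. r)" using assms(2) poly_space_0 by blast
  have m: "mean (body K) c = r" unfolding mean_eq c IK_const by simp
  have bf0: "boundary_form (flux b) f (\<lambda>x. 0) = 0" if "polyf f" for f
    using boundary_form_linear[OF polyf_const polyf_const that, of "flux b" 0 1 0] boundary_form_commute[of "flux b" f "\<lambda>x. 0"] by simp
  have tf: "test_fun b (\<lambda>x. 0) (\<lambda>x. 0) = (\<lambda>x. 0)" by (simp add: test_fun_def)
  have d0: "dd b (\<lambda>x. 0) = (\<lambda>x. 0)" by auto
  have s: "local_solution k b (\<lambda>x. 0) (\<lambda>x. 0) (\<lambda>x. 0) (\<lambda>x. 0)"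
    unfolding local_solution_def tf using bf0 poly_perp_polyf by (auto simp: poly_perp_zero graph_pairing_def)
  have "graph_fun b (\<lambda>x. 0) (\<lambda>x. 0)" using graph_fun_polyf[OF polyf_const[of 0], of b] unfolding d0 .
  from Pi_elem_eq[OF adm this s] have "Pi_elem k b K (\<lambda>x. 0) = (\<lambda>x. 0)" by (simp only: tf)
  then have "Pip_elem k b K c = c" by (auto simp: fun_eq_iff Pip_elem_shift m) (simp_all add: c)
  moreover from this have "correction k b c = 0" by (simp add: correction_def)
  ultimately show ?thesis by (simp add: Pipp_elem_eq)
qed

lemma Vpp_eq_Vp:
  assumes "2 \<le> k" shows "Vpp k b K = Vp k b K"
proof
  have V0: "(\<lambda>x. u x + t * bubble K x) \<in> V k b K" if uV: "u \<in> V k b K" for u t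
  proof -
    obtain w z where wz: "u = test_fun b w z" "w \<in> poly_perp (int k) K" "z \<in> poly_space (int k - 2)" using uV V_iff by blast
    have "(\<lambda>x. u x + t * bubble K x) = test_fun b w (\<lambda>x. z x + t)" by (simp add: wz(1) test_fun_def algebra_simps)
    moreover have "(\<lambda>x. z x + t) \<in> poly_space (int k - 2)" using assms wz(3) by (intro poly_space_add poly_space_const) auto
    ultimately show ?thesis using V_iff wz(2) by blast
  qed
  show "Vpp k b K \<subseteq> Vp k b K"
  proof
    fix f assume "f \<in> Vpp k b K"
    then obtain u c t where f: "f = (\<lambda>x. (u x + c x) + t * bubble K x)" "u \<in> V k b K" "c \<in> poly_space 0"
      unfolding Vpp_def Vp_def span_bubble_def by blast
    then have "f = (\<lambda>x. (u x + t * bubble K x) + c x)" by (simp add: algebra_simps)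
    then show "f \<in> Vp k b K" unfolding Vp_def using V0[OF f(2), of t] f(3) 
      by (intro CollectI exI[of _ "\<lambda>x. u x + t * bubble K x"] exI[of _ c] conjI)
  qed
  show "Vp k b K \<subseteq> Vpp k b K"
  proof
    fix f assume f: "f \<in> Vp k b K"
    have "(\<lambda>x. 0) \<in> span_bubble K" unfolding span_bubble_def by (intro CollectI exI[of _ 0]) simp
    then show "f \<in> Vpp k b K" unfolding Vpp_def using f by (intro CollectI exI[of _ f] exI[of _ "\<lambda>x. 0"]) simp
  qed
qed

lemma facet_bubble_vertex:
  assumes "2 \<le> CARD('n)" shows "facet_bubble K i (K j) = 0"
proof -
  have "card {i, j} \<le> 2" by (cases "i = j") auto
  moreover have "card (UNIV :: 'n option set) = CARD('n) + 1" by simp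
  ultimately have "card {i, j} < card (UNIV :: 'n option set)" using assms by linarith
  then have "{i, j} \<noteq> (UNIV :: 'n option set)" by (metis less_irrefl)
  then obtain m where "m \<noteq> i" "m \<noteq> j" by blast
  then show ?thesis using facet_bubble_zero[of m "K j" i] by (simp add: bary_vertex)
qed

lemma facet_bubble_pos:
  assumes "\<And>j. j \<noteq> i \<Longrightarrow> 0 < bary K j x" shows "0 < facet_bubble K i x"
  unfolding facet_bubble_def by (intro prod_pos) (use assms in auto)

lemma sign_bubble_on_facet:
  assumes "bary K i x = 0"
  shows "sign_bubble b K x = - sgn (grad_bary K i \<bullet> b) * facet_bubble K i x"
proof -
  have "sign_bubble b K x = (\<Sum>j\<in>UNIV. if j = i then - sgn (grad_bary K i \<bullet> b) * facet_bubble K i x else 0)"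
    unfolding sign_bubble_def sgn_outer_normal
    using facet_bubble_zero[OF assms] by (intro sum.cong) auto
  then show ?thesis by simp
qed

lemma sign_bubble_mult_eq_0:
  assumes b: "b \<noteq> 0" and w: "w \<in> poly_space 1" and 0: "\<And>x. sign_bubble b K x * w x + t * bubble K x = 0"
  shows "w = (\<lambda>x. 0)" "t = 0"
proof -
  have pw: "polyf w" using w by (rule polyfI)
  have z: "w x = 0" if i: "grad_bary K i \<bullet> b \<noteq> 0" and x: "bary K i x = 0" for i x
  proof -
    let ?W = "\<lambda>x. w (facet_proj i x)"
    have pW: "polyf ?W" using pw by (rule polyf_facet_proj)
    have "?W = (\<lambda>x. 0)"
    proof (rule polyf_zero_open[OF pW open_interior interior_body_nonempty])
      fix y assume y: "y \<in> interior (body K)"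
      then have yp: "0 < bary K j y" for j by (simp add: interior_body_iff)
      have bp: "bary K j (facet_proj i y) = bary K j y + bary K i y * ((if j = other i then 1 else 0) - (if j = i then 1 else 0))" for j
        by (simp add: facet_proj_def bary_add grad_bary_edge_vec)
      have i0: "bary K i (facet_proj i y) = 0" by (simp add: bp)
      have "0 < bary K j (facet_proj i y)" if "j \<noteq> i" for j unfolding bp using yp[of j] yp[of i] that by auto
      then have "0 < facet_bubble K i (facet_proj i y)" by (rule facet_bubble_pos)
      then have "sign_bubble b K (facet_proj i y) \<noteq> 0" using i by (simp add: sign_bubble_on_facet[OF i0] sgn_zero_iff)
      then show "?W y = 0" using 0[of "facet_proj i y"] bubble_zero[OF i0] by simp
    qed
    from fun_cong[OF this, of x] show ?thesis using facet_proj_id[OF x] by simp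
  qed
  obtain i j where ij: "i \<noteq> j" "grad_bary K i \<bullet> b \<noteq> 0" "grad_bary K j \<bullet> b \<noteq> 0" using two_active[OF b] .
  show w0: "w = (\<lambda>x. 0)" using affine_two_facets[OF w ij(1)] z ij(2,3) by blast
  obtain y where "y \<in> interior (body K)" using interior_body_nonempty by blast
  from bubble_pos[OF this] show "t = 0" using 0[of y] w0 by simp
qed

lemma Vpp_direct_sum:
  assumes b: "b \<noteq> 0" and N: "2 \<le> CARD('n)"
  shows "bij_betw (\<lambda>(u, c, t). \<lambda>x. u x + c x + t x) (V 1 b K \<times> poly_space 0 \<times> span_bubble K) (Vpp 1 b K)"
  unfolding bij_betw_def
proof
  have Vz: "\<exists>w\<in>poly_space 1. u = (\<lambda>x. sign_bubble b K x * w x)" if uV: "u \<in> V 1 b K" for u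
  proof -
    obtain w z where wz: "u = test_fun b w z" "w \<in> poly_perp 1 K" "z \<in> poly_space (int 1 - 2)" using uV V_iff[of u 1 b] by auto
    then have "z = (\<lambda>x. 0)" using poly_space_neg[of "int 1 - 2" z] by simp
    then show ?thesis using wz by (auto simp: test_fun_def poly_perp_def)
  qed
  show "inj_on (\<lambda>(u, c, t). \<lambda>x. u x + c x + t x) (V 1 b K \<times> poly_space 0 \<times> span_bubble K)"
  proof (rule inj_onI)
    fix p p'
    assume p: "p \<in> V 1 b K \<times> poly_space 0 \<times> span_bubble K" "p' \<in> V 1 b K \<times> poly_space 0 \<times> span_bubble K"
      and eqp: "(case p of (u, c, t) \<Rightarrow> \<lambda>x. u x + c x + t x) = (case p' of (u, c, t) \<Rightarrow> \<lambda>x. u x + c x + t x)"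
    obtain u c t u' c' t' where pu: "p = (u, c, t)" "p' = (u', c', t')" by (cases p, cases p')
    have u: "u \<in> V 1 b K" "u' \<in> V 1 b K" and c: "c \<in> poly_space 0" "c' \<in> poly_space 0" 
      and t: "t \<in> span_bubble K" "t' \<in> span_bubble K" and eq: "(\<lambda>x. u x + c x + t x) = (\<lambda>x. u' x + c' x + t' x)"
      using p eqp by (simp_all add: pu)
    obtain w w' where w: "w \<in> poly_space 1" "w' \<in> poly_space 1" and uw: "u = (\<lambda>x. sign_bubble b K x * w x)" "u' = (\<lambda>x. sign_bubble b K x * w' x)"
      using Vz u by blast
    obtain r r' where r: "c = (\<lambda>x. r)" "c' = (\<lambda>x. r')" using c poly_space_0 by metis
    obtain s s' where s: "t = (\<lambda>x. s * bubble K x)" "t' = (\<lambda>x. s' * bubble K x)" using t unfolding span_bubble_def by blast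
    have E: "sign_bubble b K x * w x + r + s * bubble K x = sign_bubble b K x * w' x + r' + s' * bubble K x" for x
      using fun_cong[OF eq, of x] by (simp add: uw r s)
    have "sign_bubble b K (K None) = 0" unfolding sign_bubble_def by (intro sum.neutral) (simp add: facet_bubble_vertex[OF N])
    moreover have "bubble K (K None) = 0" by (rule bubble_zero[of "Some undefined"]) (simp add: bary_vertex)
    ultimately have rr: "r = r'" using E[of "K None"] by simp
    let ?d = "\<lambda>x. w x - w' x"
    have d: "?d \<in> poly_space 1" using w by (rule poly_space_diff)
    have Ed: "sign_bubble b K x * ?d x + (s - s') * bubble K x = 0" for x using E[of x] rr by (simp add: algebra_simps)
    have "?d = (\<lambda>x. 0)" "s - s' = 0" by (rule sign_bubble_mult_eq_0[OF b d Ed])+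
    then have "w = w'" "s = s'" by (auto simp: fun_eq_iff)
    then show "p = p'" using rr by (simp add: pu uw r s)
  qed
  show "(\<lambda>(u, c, t). \<lambda>x. u x + c x + t x) ` (V 1 b K \<times> poly_space 0 \<times> span_bubble K) = Vpp 1 b K" (is "?l = ?r")
  proof
    show "?l \<subseteq> ?r"
    proof
      fix f assume "f \<in> ?l"
      then obtain u c t where f: "f = (\<lambda>x. (u x + c x) + t x)" "u \<in> V 1 b K" "c \<in> poly_space 0" "t \<in> span_bubble K" by auto
      have "(\<lambda>x. u x + c x) \<in> Vp 1 b K" unfolding Vp_def using f(2,3) by (intro CollectI exI[of _ u] exI[of _ c]) simp
      then show "f \<in> Vpp 1 b K" unfolding Vpp_def using f(1,4) by (intro CollectI exI[of _ "\<lambda>x. u x + c x"] exI[of _ t]) simp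
    qed
    show "?r \<subseteq> ?l"
    proof
      fix f assume "f \<in> Vpp 1 b K"
      then obtain u c t where f: "f = (\<lambda>x. (u x + c x) + t x)" "u \<in> V 1 b K" "c \<in> poly_space 0" "t \<in> span_bubble K"
        unfolding Vpp_def Vp_def by blast
      then show "f \<in> ?l" by (intro image_eqI[of _ _ "(u, c, t)"]) auto
    qed
  qed
qed

end

section \<open>Stability\<close>

context nondegenerate_simplex
begin

lemma facet_bubble_bounds:
  assumes "x \<in> body K" shows "0 \<le> facet_bubble K i x" "facet_bubble K i x \<le> 1"
  unfolding facet_bubble_def using assms bary_le_1 by (auto intro!: prod_nonneg prod_le_1 simp: body_iff)

lemma bubble_le_1: "x \<in> body K \<Longrightarrow> bubble K x \<le> 1"
  unfolding bubble_def using bary_le_1 by (auto intro!: prod_le_1 simp: body_iff)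

lemma sign_bubble_bound: 
  assumes "x \<in> body K" shows "\<bar>sign_bubble b K x\<bar> \<le> real CARD('n option)"
proof -
  have "\<bar>sign_bubble b K x\<bar> \<le> (\<Sum>i\<in>UNIV. \<bar>sgn (b \<bullet> outer_normal K i) * facet_bubble K i x\<bar>)"
    unfolding sign_bubble_def by (rule sum_abs)
  also have "\<dots> \<le> (\<Sum>i\<in>(UNIV :: 'n option set). 1)"
  proof (rule sum_mono)
    fix i
    have "\<bar>sgn (b \<bullet> outer_normal K i)\<bar> * \<bar>facet_bubble K i x\<bar> \<le> 1 * 1"
      using facet_bubble_bounds[OF assms, of i] by (intro mult_mono) (auto simp: sgn_if)
    then show "\<bar>sgn (b \<bullet> outer_normal K i) * facet_bubble K i x\<bar> \<le> 1" by (simp add: abs_mult)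
  qed
  also have "\<dots> = real CARD('n option)" by simp
  finally show ?thesis .
qed

lemma bubble_poly_space: "bubble K \<in> poly_space (int CARD('n) + 1)"
  unfolding bubble_def[abs_def] using poly_space_prod[of UNIV "bary K" "\<lambda>_. 1"] bary_poly_space by (simp add: add.commute)

lemma facet_bubble_poly_space: "facet_bubble K i \<in> poly_space (int CARD('n))"
  unfolding facet_bubble_def[abs_def] using poly_space_prod[of "UNIV - {i}" "bary K" "\<lambda>_. 1"] bary_poly_space by simp

lemma sign_bubble_poly_space: "sign_bubble b K \<in> poly_space (int CARD('n))"
  unfolding sign_bubble_def[abs_def] by (intro poly_space_sum poly_space_cmult facet_bubble_poly_space)

lemma test_fun_poly_space:
  assumes "w \<in> poly_space (int k)" "z \<in> poly_space (int k - 2)"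
  shows "test_fun b w z \<in> poly_space (int CARD('n) + int k)"
proof -
  have "(\<lambda>x. bubble K x * z x) \<in> poly_space (int CARD('n) + 1 + (int k - 2))"
    by (rule poly_space_mult[OF bubble_poly_space assms(2)])
  then have "(\<lambda>x. bubble K x * z x) \<in> poly_space (int CARD('n) + int k)" by (rule poly_space_mono[rotated]) simp
  then show ?thesis unfolding test_fun_def
    by (rule poly_space_add[OF poly_space_mult[OF sign_bubble_poly_space assms(1)]])
qed

lemma abs_IK_mult_le:
  assumes f: "polyf f" "\<And>x. x \<in> body K \<Longrightarrow> \<bar>f x\<bar> \<le> S" and v: "integrable (lebesgue_on (body K)) v"
  shows "\<bar>IK (\<lambda>x. f x * v x)\<bar> \<le> S * IK (\<lambda>x. \<bar>v x\<bar>)"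
proof -
  have i: "integrable (lebesgue_on (body K)) (\<lambda>x. f x * v x)" by (rule integrable_polyf_mult[OF f(1) v])
  have "\<bar>IK (\<lambda>x. f x * v x)\<bar> \<le> IK (\<lambda>x. \<bar>f x * v x\<bar>)" by (rule integral_abs_bound)
  also have "\<dots> \<le> IK (\<lambda>x. S * \<bar>v x\<bar>)"
  proof (rule integral_mono)
    show "integrable (lebesgue_on (body K)) (\<lambda>x. \<bar>f x * v x\<bar>)" using i by (rule integrable_abs)
    show "integrable (lebesgue_on (body K)) (\<lambda>x. S * \<bar>v x\<bar>)" using v by simp
    show "\<bar>f x * v x\<bar> \<le> S * \<bar>v x\<bar>" if "x \<in> space (lebesgue_on (body K))" for x
      unfolding abs_mult using f(2)[of x] that by (intro mult_right_mono) (auto simp: space_restrict_space)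
  qed
  finally show ?thesis by simp
qed

lemma IK_abs_const: 
  assumes "polyf f" "\<And>x. x \<in> body K \<Longrightarrow> \<bar>f x\<bar> \<le> S" shows "\<bar>IK f\<bar> \<le> S * vol"
  using abs_IK_mult_le[OF assms integrable_polyf[OF polyf_const[of 1]]] IK_const[of 1] by simp

lemma attains_sup_abs:
  assumes "polyf f" obtains x0 where "x0 \<in> body K" "\<And>x. x \<in> body K \<Longrightarrow> \<bar>f x\<bar> \<le> \<bar>f x0\<bar>"
proof -
  have "body K \<noteq> {}" using interior_body_nonempty interior_subset by blast
  then have "\<exists>x\<in>body K. \<forall>y\<in>body K. \<bar>f y\<bar> \<le> \<bar>f x\<bar>"
    by (intro continuous_attains_sup compact_body continuous_on_rabs polyf_continuous assms)
  then show ?thesis using that by blast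
qed

end

lemma boundary_sup_bound:
  assumes "1 \<le> k"
  shows "\<exists>C\<ge>0. \<forall>(K :: 'n::finite lsimplex) a t w R. nondegenerate_simplex K \<longrightarrow> 0 < t \<longrightarrow> (\<forall>i. 0 \<le> a i) \<longrightarrow>
     (if k = 1 then \<exists>i j. i \<noteq> j \<and> t \<le> a i \<and> t \<le> a j else \<forall>i. t \<le> a i) \<longrightarrow>
     w \<in> poly_perp (int k) K \<longrightarrow> 0 \<le> R \<longrightarrow>
     (\<forall>S\<ge>0. (\<forall>x\<in>body K. \<bar>w x\<bar> \<le> S) \<longrightarrow> nondegenerate_simplex.boundary_form K a w w \<le> S * R) \<longrightarrow>
     (\<forall>x\<in>body K. \<bar>w x\<bar> * (measure lebesgue (body K) * t) \<le> C * R)"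
proof -
  obtain C where C: "C \<ge> 0" "\<And>(K :: 'n lsimplex) a t f x. nondegenerate_simplex K \<Longrightarrow> 0 < t \<Longrightarrow> (\<forall>i. 0 \<le> a i) \<Longrightarrow>
     (if k = 1 then \<exists>i j. i \<noteq> j \<and> t \<le> a i \<and> t \<le> a j else \<forall>i. t \<le> a i) \<Longrightarrow> f \<in> poly_perp (int k) K \<Longrightarrow> x \<in> body K \<Longrightarrow>
       (f x)\<^sup>2 * measure lebesgue (body K) * t \<le> C * nondegenerate_simplex.boundary_form K a f f"
    using boundary_form_bound_uniform[OF assms] by blast
  have "\<bar>w x\<bar> * (measure lebesgue (body K) * t) \<le> C * R"
    if K: "nondegenerate_simplex K" and t: "0 < t" and a: "\<forall>i. 0 \<le> a i" 
      "if k = 1 then \<exists>i j. i \<noteq> j \<and> t \<le> a i \<and> t \<le> a j else \<forall>i. t \<le> a i" and w: "w \<in> poly_perp (int k) K" and R: "0 \<le> R"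
      and bd: "\<forall>S\<ge>0. (\<forall>x\<in>body K. \<bar>w x\<bar> \<le> S) \<longrightarrow> nondegenerate_simplex.boundary_form K a w w \<le> S * R" and x: "x \<in> body K"
    for K :: "'n lsimplex" and a t w R x
  proof -
    interpret nondegenerate_simplex K by (rule K)
    obtain x0 where x0: "x0 \<in> body K" "\<And>x. x \<in> body K \<Longrightarrow> \<bar>w x\<bar> \<le> \<bar>w x0\<bar>"
      using attains_sup_abs[OF poly_perp_polyf[OF w]] by blast
    let ?S = "\<bar>w x0\<bar>"
    have "?S * (?S * (vol * t)) = (w x0)\<^sup>2 * vol * t" by (simp add: power2_eq_square)
    also have "\<dots> \<le> C * boundary_form a w w" by (rule C(2)[OF K t a w x0(1)])
    also have "\<dots> \<le> C * (?S * R)" using bd x0(2) C(1) by (intro mult_left_mono) auto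
    finally have 1: "?S * (?S * (vol * t)) \<le> ?S * (C * R)" by (simp add: mult.left_commute)
    have "?S * (vol * t) \<le> C * R"
    proof (cases "?S = 0")
      case True then show ?thesis using C(1) R by simp
    next
      case False then show ?thesis using 1 by simp
    qed
    moreover have "\<bar>w x\<bar> * (vol * t) \<le> ?S * (vol * t)" using x0(2)[OF x] t by (intro mult_right_mono) auto
    ultimately show ?thesis by linarith
  qed
  then show ?thesis using C(1) by blast
qed

lemma bubble_sup_bound:
  "\<exists>C\<ge>0. \<forall>(K :: 'n::finite lsimplex) z R. nondegenerate_simplex K \<longrightarrow> z \<in> poly_space j \<longrightarrow> 0 \<le> R \<longrightarrow>
     (\<forall>S\<ge>0. (\<forall>x\<in>body K. \<bar>z x\<bar> \<le> S) \<longrightarrow> integral\<^sup>L (lebesgue_on (body K)) (\<lambda>x. bubble K x * (z x * z x)) \<le> S * R) \<longrightarrow>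
     (\<forall>x\<in>body K. \<bar>z x\<bar> * measure lebesgue (body K) \<le> C * R)"
proof -
  obtain C where C: "C \<ge> 0" "\<And>(K :: 'n lsimplex) z x. nondegenerate_simplex K \<Longrightarrow> z \<in> poly_space j \<Longrightarrow> x \<in> body K \<Longrightarrow>
    (z x)\<^sup>2 * measure lebesgue (body K) \<le> C * integral\<^sup>L (lebesgue_on (body K)) (\<lambda>x. bubble K x * (z x * z x))"
    using bubble_form_bound_uniform[of j] by blast
  have "\<bar>z x\<bar> * measure lebesgue (body K) \<le> C * R"
    if K: "nondegenerate_simplex K" and z: "z \<in> poly_space j" and R: "0 \<le> R"
      and bd: "\<forall>S\<ge>0. (\<forall>x\<in>body K. \<bar>z x\<bar> \<le> S) \<longrightarrow> integral\<^sup>L (lebesgue_on (body K)) (\<lambda>x. bubble K x * (z x * z x)) \<le> S * R" 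
      and x: "x \<in> body K"
    for K :: "'n lsimplex" and z R x
  proof -
    interpret nondegenerate_simplex K by (rule K)
    obtain x0 where x0: "x0 \<in> body K" "\<And>x. x \<in> body K \<Longrightarrow> \<bar>z x\<bar> \<le> \<bar>z x0\<bar>"
      using attains_sup_abs[OF polyfI[OF z]] by blast
    let ?S = "\<bar>z x0\<bar>"
    have "?S * (?S * vol) = (z x0)\<^sup>2 * vol" by (simp add: power2_eq_square)
    also have "\<dots> \<le> C * IK (\<lambda>x. bubble K x * (z x * z x))" by (rule C(2)[OF K z x0(1)])
    also have "\<dots> \<le> C * (?S * R)" using bd x0(2) C(1) by (intro mult_left_mono) auto
    finally have 1: "?S * (?S * vol) \<le> ?S * (C * R)" by (simp add: mult.left_commute)
    have "?S * vol \<le> C * R"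
    proof (cases "?S = 0")
      case True then show ?thesis using C(1) R by simp
    next
      case False then show ?thesis using 1 by simp
    qed
    moreover have "\<bar>z x\<bar> * vol \<le> ?S * vol" using x0(2)[OF x] by (intro mult_right_mono) auto
    ultimately show ?thesis by linarith
  qed
  then show ?thesis using C(1) by blast
qed

lemma bubble_average: 
  "\<exists>\<beta>\<^sub>0>0. \<forall>(K :: 'n::finite lsimplex). nondegenerate_simplex K \<longrightarrow> 
     integral\<^sup>L (lebesgue_on (body K)) (bubble K) = \<beta>\<^sub>0 * measure lebesgue (body K)"
proof -
  interpret ref: nondegenerate_simplex "ref_simplex :: 'n lsimplex" by (rule ref_nondegenerate)
  have "integral\<^sup>L (lebesgue_on (body K)) (bubble K) = (ref.IK (bubble ref_simplex) / ref.vol) * measure lebesgue (body K)"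
    if K: "nondegenerate_simplex K" for K :: "'n lsimplex"
    using nondegenerate_simplex.IK_elem_map[OF K nondegenerate_simplex.bubble_polyf[OF K]]
    by (simp add: nondegenerate_simplex.bubble_elem_map[OF K])
  moreover have "ref.IK (bubble ref_simplex) / ref.vol > 0" using ref.IK_bubble_pos by simp
  ultimately show ?thesis by blast
qed

locale stability_constants = nondegenerate_simplex K for K :: "'n::finite lsimplex" +
  fixes k :: nat and C\<^sub>d C\<^sub>w C\<^sub>z \<beta>\<^sub>0 :: real
  assumes k: "1 \<le> k" and nonneg: "0 \<le> C\<^sub>d" "0 \<le> C\<^sub>w" "0 \<le> C\<^sub>z" "0 < \<beta>\<^sub>0"
    and dd_bound: "\<And>f M c x. f \<in> poly_space (int CARD('n) + int k) \<Longrightarrow> (\<And>x. x \<in> body K \<Longrightarrow> \<bar>f x\<bar> \<le> M) \<Longrightarrow> 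
      x \<in> body K \<Longrightarrow> \<bar>dd c f x\<bar> \<le> C\<^sub>d * norm (matrix_inv (elem_matrix K) *v c) * M"
    and w_bound: "\<And>a t w R x. 0 < t \<Longrightarrow> (\<And>i. 0 \<le> a i) \<Longrightarrow>
      (if k = 1 then \<exists>i j. i \<noteq> j \<and> t \<le> a i \<and> t \<le> a j else \<forall>i. t \<le> a i) \<Longrightarrow> w \<in> poly_perp (int k) K \<Longrightarrow> 0 \<le> R \<Longrightarrow>
      (\<And>S. 0 \<le> S \<Longrightarrow> (\<And>x. x \<in> body K \<Longrightarrow> \<bar>w x\<bar> \<le> S) \<Longrightarrow> boundary_form a w w \<le> S * R) \<Longrightarrow>
      x \<in> body K \<Longrightarrow> \<bar>w x\<bar> * (vol * t) \<le> C\<^sub>w * R"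
    and z_bound: "\<And>z R x. z \<in> poly_space (int k - 2) \<Longrightarrow> 0 \<le> R \<Longrightarrow>
      (\<And>S. 0 \<le> S \<Longrightarrow> (\<And>x. x \<in> body K \<Longrightarrow> \<bar>z x\<bar> \<le> S) \<Longrightarrow> IK (\<lambda>x. bubble K x * (z x * z x)) \<le> S * R) \<Longrightarrow>
      x \<in> body K \<Longrightarrow> \<bar>z x\<bar> * vol \<le> C\<^sub>z * R"
    and IK_bubble: "IK (bubble K) = \<beta>\<^sub>0 * vol"

lemma stability_constants_exist:
  assumes k: "1 \<le> k"
  shows "\<exists>C\<^sub>d C\<^sub>w C\<^sub>z \<beta>\<^sub>0. \<forall>(K :: 'n::finite lsimplex). nondegenerate_simplex K \<longrightarrow> stability_constants K k C\<^sub>d C\<^sub>w C\<^sub>z \<beta>\<^sub>0"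
proof -
  obtain C\<^sub>d where Cd: "C\<^sub>d \<ge> 0" "\<And>(K :: 'n lsimplex) f M c x. nondegenerate_simplex K \<Longrightarrow> f \<in> poly_space (int CARD('n) + int k) \<Longrightarrow> 
     (\<forall>x\<in>body K. \<bar>f x\<bar> \<le> M) \<Longrightarrow> x \<in> body K \<Longrightarrow> \<bar>dd c f x\<bar> \<le> C\<^sub>d * norm (matrix_inv (elem_matrix K) *v c) * M"
    using dd_bound_uniform[of "int CARD('n) + int k"] by blast
  obtain C\<^sub>w where Cw: "C\<^sub>w \<ge> 0" "\<forall>(K :: 'n lsimplex) a t w R. nondegenerate_simplex K \<longrightarrow> 0 < t \<longrightarrow> (\<forall>i. 0 \<le> a i) \<longrightarrow>
     (if k = 1 then \<exists>i j. i \<noteq> j \<and> t \<le> a i \<and> t \<le> a j else \<forall>i. t \<le> a i) \<longrightarrow>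
     w \<in> poly_perp (int k) K \<longrightarrow> 0 \<le> R \<longrightarrow>
     (\<forall>S\<ge>0. (\<forall>x\<in>body K. \<bar>w x\<bar> \<le> S) \<longrightarrow> nondegenerate_simplex.boundary_form K a w w \<le> S * R) \<longrightarrow>
     (\<forall>x\<in>body K. \<bar>w x\<bar> * (measure lebesgue (body K) * t) \<le> C\<^sub>w * R)"
    using boundary_sup_bound[OF k] by (elim exE conjE)
  obtain C\<^sub>z where Cz: "C\<^sub>z \<ge> 0" "\<forall>(K :: 'n::finite lsimplex) z R. nondegenerate_simplex K \<longrightarrow> z \<in> poly_space (int k - 2) \<longrightarrow> 0 \<le> R \<longrightarrow>
     (\<forall>S\<ge>0. (\<forall>x\<in>body K. \<bar>z x\<bar> \<le> S) \<longrightarrow> integral\<^sup>L (lebesgue_on (body K)) (\<lambda>x. bubble K x * (z x * z x)) \<le> S * R) \<longrightarrow>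
     (\<forall>x\<in>body K. \<bar>z x\<bar> * measure lebesgue (body K) \<le> C\<^sub>z * R)"
    using bubble_sup_bound[of "int k - 2"] by (elim exE conjE)
  obtain \<beta>\<^sub>0 where beta: "\<beta>\<^sub>0 > 0" "\<forall>(K :: 'n lsimplex). nondegenerate_simplex K \<longrightarrow> 
     integral\<^sup>L (lebesgue_on (body K)) (bubble K) = \<beta>\<^sub>0 * measure lebesgue (body K)"
    using bubble_average by (elim exE conjE)
  have "stability_constants K k C\<^sub>d C\<^sub>w C\<^sub>z \<beta>\<^sub>0" if K: "nondegenerate_simplex K" for K :: "'n lsimplex"
  proof -
    interpret nondegenerate_simplex K by (rule K)
    show ?thesis
    proof (unfold_locales, goal_cases)
      case 1 show ?case by (rule k)
    next
      case 2 show ?case by (rule Cd(1))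
    next
      case 3 show ?case by (rule Cw(1))
    next
      case 4 show ?case by (rule Cz(1))
    next
      case 5 show ?case by (rule beta(1))
    next
      case (6 f M c x) then show ?case by (intro Cd(2)[OF K]) auto
    next
      case (7 a t w R x)
      have a: "\<forall>i. 0 \<le> a i" and S: "\<forall>S\<ge>0. (\<forall>x\<in>body K. \<bar>w x\<bar> \<le> S) \<longrightarrow> boundary_form a w w \<le> S * R" using 7 by blast+
      from Cw(2)[rule_format, OF K 7(1) _ 7(3,4,5) _ 7(7)] a S show ?case by blast
    next
      case (8 z R x)
      have S: "\<forall>S\<ge>0. (\<forall>x\<in>body K. \<bar>z x\<bar> \<le> S) \<longrightarrow> IK (\<lambda>x. bubble K x * (z x * z x)) \<le> S * R" using 8 by blast
      from Cz(2)[rule_format, OF K 8(1,2) _ 8(4)] S show ?case by blast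
    next
      case 9 show ?case using beta(2) K by blast
    qed
  qed
  then show ?thesis by blast
qed

context stability_constants
begin

definition wind :: "real^'n \<Rightarrow> real" where "wind b = norm (matrix_inv (elem_matrix K) *v b)"

definition flux_bounded :: "real \<Rightarrow> real^'n \<Rightarrow> bool" where
  "flux_bounded \<tau> b \<longleftrightarrow> 0 < \<tau> \<and> \<tau> \<le> 1 \<and> 0 < wind b \<and>
     (if k = 1 then \<exists>i j. i \<noteq> j \<and> \<tau> * wind b \<le> flux b i \<and> \<tau> * wind b \<le> flux b j else \<forall>i. \<tau> * wind b \<le> flux b i)"

definition size1 :: "(real^'n \<Rightarrow> real) \<Rightarrow> real" where "size1 v = IK (\<lambda>x. \<bar>v x\<bar>)"

lemma size1_nonneg [simp]: "0 \<le> size1 v"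
  unfolding size1_def by (rule Bochner_Integration.integral_nonneg) simp

lemma flux_nonneg: "0 \<le> flux b i" by (simp add: flux_def)

lemma admissible_if_flux_bounded: 
  assumes "flux_bounded \<tau> b" shows "admissible k (flux b)"
proof -
  have p: "0 < \<tau> * wind b" using assms by (simp add: flux_bounded_def)
  show ?thesis
  proof (cases "k = 1")
    case True
    then obtain i j where "i \<noteq> j" "\<tau> * wind b \<le> flux b i" "\<tau> * wind b \<le> flux b j" using assms[unfolded flux_bounded_def] by auto
    then have "i \<noteq> j \<and> 0 < flux b i \<and> 0 < flux b j" using p by linarith
    then have "\<exists>i j. i \<noteq> j \<and> 0 < flux b i \<and> 0 < flux b j" by blast
    then show ?thesis unfolding admissible_def by (intro conjI allI flux_nonneg disjI1 True)
  next
    case False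
    then have h: "\<forall>i. \<tau> * wind b \<le> flux b i" using assms[unfolded flux_bounded_def] by auto
    have f: "0 < flux b i" for i using p spec[OF h, of i] by (rule less_le_trans)
    have "other None \<noteq> None \<and> 0 < flux b (other None) \<and> 0 < flux b None" by (intro conjI other_neq f)
    then have "\<exists>i j. i \<noteq> j \<and> 0 < flux b i \<and> 0 < flux b j" by (intro exI)
    then show ?thesis unfolding admissible_def by (intro conjI allI flux_nonneg disjI2 f)
  qed
qed

lemma w_estimate:
  assumes \<tau>: "flux_bounded \<tau> b" and s: "local_solution k b v g w z" and R: "0 \<le> R"
    and gp: "\<And>S. 0 \<le> S \<Longrightarrow> (\<And>x. x \<in> body K \<Longrightarrow> \<bar>w x\<bar> \<le> S) \<Longrightarrow> graph_pairing b w v g \<le> S * (wind b * R)"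
    and x: "x \<in> body K"
  shows "\<bar>w x\<bar> * (\<tau> * vol) \<le> C\<^sub>w * R"
proof -
  have B: "0 < wind b" and t: "0 < \<tau> * wind b" using \<tau> by (auto simp: flux_bounded_def)
  have w: "w \<in> poly_perp (int k) K" by (rule local_solutionD(1)[OF s])
  have "\<bar>w x\<bar> * (vol * (\<tau> * wind b)) \<le> C\<^sub>w * (wind b * R)"
  proof (rule w_bound[OF t flux_nonneg _ w _ _ x])
    show "if k = 1 then \<exists>i j. i \<noteq> j \<and> \<tau> * wind b \<le> flux b i \<and> \<tau> * wind b \<le> flux b j else \<forall>i. \<tau> * wind b \<le> flux b i"
      using \<tau>[unfolded flux_bounded_def] by (elim conjE)
    show "0 \<le> wind b * R" using B R by simp
    show "boundary_form (flux b) w w \<le> S * (wind b * R)" if "0 \<le> S" "\<And>x. x \<in> body K \<Longrightarrow> \<bar>w x\<bar> \<le> S" for S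
      using gp[OF that] local_solutionD(3)[OF s w] by simp
  qed
  then have "(\<bar>w x\<bar> * (\<tau> * vol)) * wind b \<le> (C\<^sub>w * R) * wind b" by (simp only: ac_simps)
  then show ?thesis using B by (rule mult_right_le_imp_le)
qed

lemma graph_pairing_bound:
  assumes v: "graph_fun b v g" and w: "w \<in> poly_space (int k)" and S: "\<And>x. x \<in> body K \<Longrightarrow> \<bar>w x\<bar> \<le> S"
  shows "IK (\<lambda>x. dd b w x * v x) \<le> S * (wind b * (C\<^sub>d * size1 v))" "IK (\<lambda>x. w x * g x) \<le> S * size1 g"
proof -
  have iv: "integrable (lebesgue_on (body K)) v" "integrable (lebesgue_on (body K)) g" using v by (auto simp: graph_fun_def)
  have pw: "polyf w" using w by (rule polyfI)
  have w': "w \<in> poly_space (int CARD('n) + int k)" using w by (rule poly_space_mono[rotated]) simp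
  have "\<bar>IK (\<lambda>x. dd b w x * v x)\<bar> \<le> (C\<^sub>d * wind b * S) * size1 v"
    unfolding size1_def by (rule abs_IK_mult_le[OF polyf_dd[OF pw] _ iv(1)]) (use dd_bound[OF w' S] in \<open>auto simp: wind_def\<close>)
  then show "IK (\<lambda>x. dd b w x * v x) \<le> S * (wind b * (C\<^sub>d * size1 v))" by (simp add: algebra_simps)
  have "\<bar>IK (\<lambda>x. w x * g x)\<bar> \<le> S * size1 g"
    unfolding size1_def by (rule abs_IK_mult_le[OF pw S iv(2)])
  then show "IK (\<lambda>x. w x * g x) \<le> S * size1 g" by simp
qed

lemma w_estimate_general:
  assumes \<tau>: "flux_bounded \<tau> b" and v: "graph_fun b v g" and s: "local_solution k b v g w z" and x: "x \<in> body K"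
  shows "\<bar>w x\<bar> * (\<tau> * vol) \<le> C\<^sub>w * (C\<^sub>d * size1 v + size1 g / wind b)"
proof (rule w_estimate[OF \<tau> s _ _ x])
  have B: "0 < wind b" using \<tau> by (auto simp: flux_bounded_def)
  show "0 \<le> C\<^sub>d * size1 v + size1 g / wind b" using B nonneg by simp
  fix S assume S: "\<And>x. x \<in> body K \<Longrightarrow> \<bar>w x\<bar> \<le> S"
  have "w \<in> poly_space (int k)" using local_solutionD(1)[OF s] by (simp add: poly_perp_def)
  from graph_pairing_bound[OF v this S]
  have "graph_pairing b w v g \<le> S * (wind b * (C\<^sub>d * size1 v)) + S * size1 g" unfolding graph_pairing_def by linarith
  also have "\<dots> = S * (wind b * (C\<^sub>d * size1 v + size1 g / wind b))" using B by (simp add: field_simps)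
  finally show "graph_pairing b w v g \<le> S * (wind b * (C\<^sub>d * size1 v + size1 g / wind b))" .
qed

text \<open>For \<open>k = 1\<close> the derivative of \<open>w\<close> is constant, so only \<open>g\<close> enters if \<open>v\<close> has mean zero.\<close>

lemma w_estimate_mean_zero:
  assumes k1: "k = 1" and \<tau>: "flux_bounded \<tau> b" and v: "graph_fun b v g" "IK v = 0" and s: "local_solution k b v g w z" and x: "x \<in> body K"
  shows "\<bar>w x\<bar> * (\<tau> * vol) \<le> C\<^sub>w * (size1 g / wind b)"
proof (rule w_estimate[OF \<tau> s _ _ x])
  have B: "0 < wind b" using \<tau> by (auto simp: flux_bounded_def)
  show "0 \<le> size1 g / wind b" using B by simp
  fix S assume S: "\<And>x. x \<in> body K \<Longrightarrow> \<bar>w x\<bar> \<le> S"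
  have w: "w \<in> poly_space (int k)" using local_solutionD(1)[OF s] by (simp add: poly_perp_def)
  obtain r where r: "dd b w = (\<lambda>x. r)" using poly_space_dd[OF w, of b] k1 poly_space_0 by auto
  have "IK (\<lambda>x. dd b w x * v x) = 0" using v(2) by (simp add: r)
  then have "graph_pairing b w v g \<le> S * size1 g" 
    unfolding graph_pairing_def using graph_pairing_bound(2)[OF v(1) w S] by linarith
  then show "graph_pairing b w v g \<le> S * (wind b * (size1 g / wind b))" using B by simp
qed

lemma z_estimate:
  assumes s: "local_solution k b v g w z" and iv: "integrable (lebesgue_on (body K)) v" 
    and W: "\<And>x. x \<in> body K \<Longrightarrow> \<bar>w x\<bar> \<le> W" "0 \<le> W" and x: "x \<in> body K"
  shows "\<bar>z x\<bar> * vol \<le> C\<^sub>z * (size1 v + real CARD('n option) * W * vol)"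
proof (rule z_bound[OF local_solutionD(2)[OF s] _ _ x])
  have z: "z \<in> poly_space (int k - 2)" by (rule local_solutionD(2)[OF s])
  have pz: "polyf z" using z by (rule polyfI)
  have pw: "polyf w" using local_solutionD(1)[OF s] by (rule poly_perp_polyf)
  show "0 \<le> size1 v + real CARD('n option) * W * vol" using W(2) by (intro add_nonneg_nonneg mult_nonneg_nonneg) auto
  fix S assume S: "0 \<le> S" "\<And>x. x \<in> body K \<Longrightarrow> \<bar>z x\<bar> \<le> S"
  have "IK (\<lambda>x. bubble K x * (z x * z x)) = IK (\<lambda>x. z x * v x) - IK (\<lambda>x. z x * (sign_bubble b K x * w x))"
    using local_solutionD(4)[OF s z] IK_test_fun[OF pz pw pz, of b] by simp
  moreover have "\<bar>IK (\<lambda>x. z x * v x)\<bar> \<le> S * size1 v" unfolding size1_def by (rule abs_IK_mult_le[OF pz S(2) iv])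
  moreover have "\<bar>IK (\<lambda>x. z x * (sign_bubble b K x * w x))\<bar> \<le> (S * (real CARD('n option) * W)) * vol"
  proof (rule IK_abs_const)
    show "polyf (\<lambda>x. z x * (sign_bubble b K x * w x))" by (intro polyf_mult pz pw sign_bubble_polyf)
    show "\<bar>z x * (sign_bubble b K x * w x)\<bar> \<le> S * (real CARD('n option) * W)" if "x \<in> body K" for x
      unfolding abs_mult by (intro mult_mono S W sign_bubble_bound that) (use S W in auto)
  qed
  moreover have "S * size1 v + (S * (real CARD('n option) * W)) * vol = S * (size1 v + real CARD('n option) * W * vol)"
    by (simp add: algebra_simps)
  ultimately show "IK (\<lambda>x. bubble K x * (z x * z x)) \<le> S * (size1 v + real CARD('n option) * W * vol)"
    by linarith
qed

definition C\<^sub>u :: real where "C\<^sub>u = real CARD('n option) * C\<^sub>w * (C\<^sub>d + 1) + C\<^sub>z * (1 + real CARD('n option) * C\<^sub>w * (C\<^sub>d + 1))"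

lemma C\<^sub>u_nonneg: "0 \<le> C\<^sub>u"
  unfolding C\<^sub>u_def using nonneg by simp

lemma C\<^sub>u_ge: "real CARD('n option) * C\<^sub>w \<le> C\<^sub>u"
proof -
  have "real CARD('n option) * C\<^sub>w * 1 \<le> real CARD('n option) * C\<^sub>w * (C\<^sub>d + 1)" using nonneg by (intro mult_left_mono) auto
  moreover have "0 \<le> C\<^sub>z * (1 + real CARD('n option) * C\<^sub>w * (C\<^sub>d + 1))" using nonneg by simp
  ultimately show ?thesis unfolding C\<^sub>u_def by linarith
qed

lemma test_fun_estimate:
  assumes \<tau>: "flux_bounded \<tau> b" and v: "graph_fun b v g" and s: "local_solution k b v g w z" and x: "x \<in> body K"
  shows "\<bar>test_fun b w z x\<bar> * (\<tau> * vol) \<le> C\<^sub>u * (size1 v + size1 g / wind b)"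
proof -
  have B: "0 < wind b" and \<tau>0: "0 < \<tau>" "\<tau> \<le> 1" using \<tau> by (auto simp: flux_bounded_def)
  have iv: "integrable (lebesgue_on (body K)) v" using v by (simp add: graph_fun_def)
  let ?n = "real CARD('n option)"
  define Z where "Z = size1 v + size1 g / wind b"
  define A where "A = C\<^sub>w * (C\<^sub>d + 1)"
  define W where "W = A * Z / (\<tau> * vol)"
  have A: "0 \<le> A" using nonneg by (simp add: A_def)
  have Y: "0 \<le> size1 g / wind b" using B by simp
  then have Z0: "0 \<le> Z" unfolding Z_def by (simp add: add_nonneg_nonneg)
  have tv: "0 < \<tau> * vol" using \<tau>0 by simp
  have "C\<^sub>d * size1 v + size1 g / wind b \<le> (C\<^sub>d + 1) * Z"
  proof -
    have "c * X + Y \<le> (c + 1) * (X + Y)" if "0 \<le> c" "0 \<le> X" "0 \<le> Y" for c X Y :: real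
      using that by (simp add: algebra_simps)
    from this[OF nonneg(1) size1_nonneg Y] show ?thesis unfolding Z_def .
  qed
  then have "C\<^sub>w * (C\<^sub>d * size1 v + size1 g / wind b) \<le> A * Z" unfolding A_def mult.assoc
    using nonneg by (intro mult_left_mono) auto
  then have wb: "\<bar>w x\<bar> * (\<tau> * vol) \<le> A * Z" if "x \<in> body K" for x
    using w_estimate_general[OF \<tau> v s that] by linarith
  then have W: "\<bar>w x\<bar> \<le> W" if "x \<in> body K" for x 
    unfolding W_def using that tv by (subst pos_le_divide_eq) auto
  have W0: "0 \<le> W" unfolding W_def using A Z0 tv by (intro divide_nonneg_pos mult_nonneg_nonneg)
  have "\<bar>z x\<bar> * vol \<le> C\<^sub>z * (size1 v + ?n * W * vol)" by (rule z_estimate[OF s iv W W0 x])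
  then have "\<bar>z x\<bar> * vol * \<tau> \<le> C\<^sub>z * (size1 v + ?n * W * vol) * \<tau>" using \<tau>0 by (intro mult_right_mono) auto
  also have "\<dots> = C\<^sub>z * (size1 v * \<tau> + ?n * (W * (\<tau> * vol)))" by (simp add: algebra_simps)
  also have "W * (\<tau> * vol) = A * Z" unfolding W_def using \<tau>0(1) by simp
  also have "C\<^sub>z * (size1 v * \<tau> + ?n * (A * Z)) \<le> C\<^sub>z * (Z + ?n * (A * Z))"
  proof (intro mult_left_mono add_right_mono nonneg)
    have "size1 v * \<tau> \<le> size1 v * 1" using \<tau>0 by (intro mult_left_mono) auto
    then show "size1 v * \<tau> \<le> Z" unfolding Z_def using Y by linarith
  qed
  finally have zb: "\<bar>z x\<bar> * (\<tau> * vol) \<le> C\<^sub>z * (1 + ?n * A) * Z" by (simp add: algebra_simps)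
  have "\<bar>test_fun b w z x\<bar> \<le> \<bar>sign_bubble b K x\<bar> * \<bar>w x\<bar> + \<bar>bubble K x\<bar> * \<bar>z x\<bar>"
    unfolding test_fun_def abs_mult[symmetric] by (rule abs_triangle_ineq)
  also have "\<dots> \<le> ?n * \<bar>w x\<bar> + 1 * \<bar>z x\<bar>"
    using sign_bubble_bound[OF x] bubble_nonneg[OF x] bubble_le_1[OF x] by (intro add_mono mult_right_mono) auto
  finally have "\<bar>test_fun b w z x\<bar> * (\<tau> * vol) \<le> (?n * \<bar>w x\<bar> + 1 * \<bar>z x\<bar>) * (\<tau> * vol)" using tv by (intro mult_right_mono) auto
  also have "\<dots> = ?n * (\<bar>w x\<bar> * (\<tau> * vol)) + \<bar>z x\<bar> * (\<tau> * vol)" by (simp add: algebra_simps)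
  also have "\<dots> \<le> ?n * (A * Z) + C\<^sub>z * (1 + ?n * A) * Z"
    using wb[OF x] zb by (intro add_mono mult_left_mono) auto
  also have "\<dots> = C\<^sub>u * Z" unfolding C\<^sub>u_def A_def by (simp add: algebra_simps)
  finally show ?thesis unfolding Z_def .
qed

lemma test_fun_estimate_mean_zero:
  assumes k1: "k = 1" and \<tau>: "flux_bounded \<tau> b" and v: "graph_fun b v g" "IK v = 0" and s: "local_solution k b v g w z" and x: "x \<in> body K"
  shows "\<bar>test_fun b w z x\<bar> * (\<tau> * vol) \<le> C\<^sub>u * (size1 g / wind b)"
proof -
  have B: "0 < wind b" and \<tau>0: "0 < \<tau>" using \<tau> by (auto simp: flux_bounded_def)
  let ?n = "real CARD('n option)"
  have z: "z = (\<lambda>x. 0)" using local_solutionD(2)[OF s] k1 poly_space_neg[of "int k - 2" z] by simp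
  have "\<bar>test_fun b w z x\<bar> \<le> ?n * \<bar>w x\<bar>"
    unfolding test_fun_def z by (simp only: abs_mult mult_zero_right add_0_right) (intro mult_right_mono sign_bubble_bound[OF x] abs_ge_zero)
  then have "\<bar>test_fun b w z x\<bar> * (\<tau> * vol) \<le> ?n * \<bar>w x\<bar> * (\<tau> * vol)" using \<tau>0 by (intro mult_right_mono) auto
  also have "\<dots> = ?n * (\<bar>w x\<bar> * (\<tau> * vol))" by simp
  also have "\<dots> \<le> ?n * (C\<^sub>w * (size1 g / wind b))"
    by (intro mult_left_mono w_estimate_mean_zero[OF k1 \<tau> v s x]) auto
  also have "\<dots> = (?n * C\<^sub>w) * (size1 g / wind b)" by simp
  also have "\<dots> \<le> C\<^sub>u * (size1 g / wind b)" by (intro mult_right_mono C\<^sub>u_ge) (use B in simp)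
  finally show ?thesis .
qed

text \<open>\<open>\<Pi>\<^sup>+\<^sup>+ v = m + y\<close>, where \<open>m\<close> is the mean of \<open>v\<close> and \<open>y\<close> has the same bounds as \<open>\<Pi> (v - m)\<close>.\<close>

definition C\<^sub>y :: real where "C\<^sub>y = 2 * C\<^sub>u * (1 + 1 / \<beta>\<^sub>0)"

lemma C\<^sub>y_nonneg: "0 \<le> C\<^sub>y"
  unfolding C\<^sub>y_def using C\<^sub>u_nonneg nonneg by simp

lemma fortin_decomposition:
  assumes \<tau>: "flux_bounded \<tau> b" and v: "graph_fun b v g"
  obtains y where "Pipp_elem k b K v = (\<lambda>x. mean (body K) v + y x)" "y \<in> poly_space (int CARD('n) + int k)"
    "\<And>x. x \<in> body K \<Longrightarrow> \<bar>y x\<bar> * (\<tau> * vol) \<le> C\<^sub>y * (size1 v + size1 g / wind b)"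
    "\<And>x. k = 1 \<Longrightarrow> x \<in> body K \<Longrightarrow> \<bar>y x\<bar> * (\<tau> * vol) \<le> C\<^sub>y * (size1 g / wind b)"
proof -
  define m where "m = mean (body K) v"
  define t where "t = correction k b v"
  let ?v0 = "\<lambda>y. v y - m"
  have B: "0 < wind b" and \<tau>0: "0 < \<tau>" using \<tau> by (auto simp: flux_bounded_def)
  have iv: "integrable (lebesgue_on (body K)) v" using v by (simp add: graph_fun_def)
  note adm = admissible_if_flux_bounded[OF \<tau>]
  have v0: "graph_fun b ?v0 g" by (rule graph_fun_shift[OF v])
  have iv0: "integrable (lebesgue_on (body K)) ?v0" using v0 by (simp add: graph_fun_def)
  have I0: "IK ?v0 = 0" unfolding m_def by (rule IK_minus_mean[OF iv])
  obtain w z where s: "local_solution k b ?v0 g w z" and Pi: "Pi_elem k b K ?v0 = test_fun b w z"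
    using Pi_elem_solution[OF adm v0] .
  let ?u = "test_fun b w z"
  have u: "?u \<in> poly_space (int CARD('n) + int k)"
    using local_solutionD(1,2)[OF s] by (intro test_fun_poly_space) (auto simp: poly_perp_def)
  have pu: "polyf ?u" using u by (rule polyfI)
  have Pip: "Pip_elem k b K v = (\<lambda>x. m + ?u x)" by (rule ext) (simp add: Pip_elem_shift m_def[symmetric] Pi)
  define y where "y x = ?u x + t * bubble K x" for x
  have "Pipp_elem k b K v = (\<lambda>x. m + y x)" by (simp add: Pipp_elem_eq Pip t_def y_def add.assoc)
  moreover have "y \<in> poly_space (int CARD('n) + int k)"
  proof -
    have "bubble K \<in> poly_space (int CARD('n) + int k)" by (rule poly_space_mono[OF _ bubble_poly_space]) (use k in simp)
    then show ?thesis unfolding y_def by (intro poly_space_add u poly_space_cmult)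
  qed
  moreover have yb: "\<bar>y x\<bar> * (\<tau> * vol) \<le> (1 + 1 / \<beta>\<^sub>0) * R"
    if R: "\<And>x. x \<in> body K \<Longrightarrow> \<bar>?u x\<bar> * (\<tau> * vol) \<le> R" and x: "x \<in> body K" for R x
  proof -
    have tv: "0 < \<tau> * vol" using \<tau>0 by simp
    have "\<bar>?u x\<bar> \<le> R / (\<tau> * vol)" if "x \<in> body K" for x using R[OF that] tv by (subst pos_le_divide_eq) auto
    then have "\<bar>IK ?u\<bar> \<le> R / (\<tau> * vol) * vol" by (rule IK_abs_const[OF pu])
    moreover have "t * (\<beta>\<^sub>0 * vol) = - IK ?u"
    proof -
      have "IK (\<lambda>x. v x - Pip_elem k b K v x) = IK (\<lambda>x. ?v0 x - ?u x)" by (simp add: Pip algebra_simps)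
      also have "\<dots> = IK ?v0 - IK ?u" by (rule Bochner_Integration.integral_diff[OF iv0 integrable_polyf[OF pu]])
      finally show ?thesis using nonneg by (simp add: t_def correction_def IK_bubble I0)
    qed
    ultimately have "\<bar>t * (\<beta>\<^sub>0 * vol)\<bar> \<le> R / (\<tau> * vol) * vol" by simp
    then have "(\<bar>t\<bar> * \<beta>\<^sub>0) * vol \<le> R / (\<tau> * vol) * vol" using nonneg by (simp add: abs_mult)
    then have "\<bar>t\<bar> * \<beta>\<^sub>0 \<le> R / (\<tau> * vol)" by (rule mult_right_le_imp_le) simp
    then have "\<bar>t\<bar> * \<beta>\<^sub>0 * (\<tau> * vol) \<le> R" using tv by (simp add: pos_le_divide_eq)
    then have tb: "\<bar>t\<bar> * (\<tau> * vol) \<le> R / \<beta>\<^sub>0" using nonneg by (subst pos_le_divide_eq) (auto simp: algebra_simps)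
    have "\<bar>y x\<bar> \<le> \<bar>?u x\<bar> + \<bar>t\<bar> * \<bar>bubble K x\<bar>" unfolding y_def abs_mult[symmetric] by (rule abs_triangle_ineq)
    also have "\<dots> \<le> \<bar>?u x\<bar> + \<bar>t\<bar> * 1" using bubble_nonneg[OF x] bubble_le_1[OF x] by (intro add_left_mono mult_left_mono) auto
    finally have "\<bar>y x\<bar> * (\<tau> * vol) \<le> (\<bar>?u x\<bar> + \<bar>t\<bar> * 1) * (\<tau> * vol)" using tv by (intro mult_right_mono) auto
    also have "\<dots> = \<bar>?u x\<bar> * (\<tau> * vol) + \<bar>t\<bar> * (\<tau> * vol)" by (simp add: algebra_simps)
    also have "\<dots> \<le> R + R / \<beta>\<^sub>0" using R[OF x] tb by linarith
    finally show ?thesis by (simp add: algebra_simps)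
  qed
  moreover have "\<bar>y x\<bar> * (\<tau> * vol) \<le> C\<^sub>y * (size1 v + size1 g / wind b)" if x: "x \<in> body K" for x
  proof -
    have Y: "0 \<le> size1 g / wind b" using B by simp
    have m0: "\<bar>m\<bar> * vol \<le> size1 v"
      using abs_IK_mult_le[OF polyf_const[of 1] _ iv, of 1] by (simp add: m_def mean_eq size1_def abs_divide)
    have "size1 ?v0 \<le> IK (\<lambda>x. \<bar>v x\<bar> + \<bar>m\<bar>)" unfolding size1_def
    proof (rule integral_mono)
      show "integrable (lebesgue_on (body K)) (\<lambda>x. \<bar>v x - m\<bar>)" using iv0 by (rule integrable_abs)
      show "integrable (lebesgue_on (body K)) (\<lambda>x. \<bar>v x\<bar> + \<bar>m\<bar>)" 
        by (intro Bochner_Integration.integrable_add integrable_abs iv integrable_polyf polyf_const)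
    qed (rule abs_triangle_ineq4)
    also have "\<dots> = size1 v + \<bar>m\<bar> * vol"
      using Bochner_Integration.integral_add[OF integrable_abs[OF iv] integrable_polyf[OF polyf_const[of "\<bar>m\<bar>"]]] IK_const[of "\<bar>m\<bar>"] 
      by (simp add: size1_def)
    finally have s0: "size1 ?v0 \<le> 2 * size1 v" using m0 by linarith
    have "\<bar>?u x\<bar> * (\<tau> * vol) \<le> C\<^sub>u * (2 * (size1 v + size1 g / wind b))" if "x \<in> body K" for x
    proof -
      have "\<bar>?u x\<bar> * (\<tau> * vol) \<le> C\<^sub>u * (size1 ?v0 + size1 g / wind b)" by (rule test_fun_estimate[OF \<tau> v0 s that])
      also have "\<dots> \<le> C\<^sub>u * (2 * (size1 v + size1 g / wind b))"
        by (rule mult_left_mono[OF _ C\<^sub>u_nonneg]) (use s0 Y in argo)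
      finally show ?thesis .
    qed
    from yb[OF this x] show ?thesis unfolding C\<^sub>y_def by (simp only: ac_simps)
  qed
  moreover have "\<bar>y x\<bar> * (\<tau> * vol) \<le> C\<^sub>y * (size1 g / wind b)" if k1: "k = 1" and x: "x \<in> body K" for x
  proof -
    have Y: "0 \<le> size1 g / wind b" using B by simp
    have "\<bar>?u x\<bar> * (\<tau> * vol) \<le> C\<^sub>u * (2 * (size1 g / wind b))" if "x \<in> body K" for x
    proof -
      have "\<bar>?u x\<bar> * (\<tau> * vol) \<le> C\<^sub>u * (size1 g / wind b)" by (rule test_fun_estimate_mean_zero[OF k1 \<tau> v0 I0 s that])
      also have "\<dots> \<le> C\<^sub>u * (2 * (size1 g / wind b))" using Y by (intro mult_left_mono C\<^sub>u_nonneg) linarith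
      finally show ?thesis .
    qed
    from yb[OF this x] show ?thesis unfolding C\<^sub>y_def by (simp only: ac_simps)
  qed
  ultimately show ?thesis using that unfolding m_def by blast
qed

end

section \<open>Lebesgue norms and mesh geometry\<close>

lemma Lr_norm_nonneg [simp]: "0 \<le> Lr_norm q S f"
  by (simp add: Lr_norm_def)

context nondegenerate_simplex
begin

lemma Lr_space_integrable:
  assumes q: "1 < q" and v: "v \<in> Lr_space q (body K)" shows "integrable (lebesgue_on (body K)) v"
proof (rule Bochner_Integration.integrable_bound)
  show "integrable (lebesgue_on (body K)) (\<lambda>x. 1 + \<bar>v x\<bar> powr q)"
    by (rule Bochner_Integration.integrable_add[OF integrable_polyf[OF polyf_const]]) (use v in \<open>simp add: Lr_space_def\<close>)
  show "v \<in> borel_measurable (lebesgue_on (body K))" using v by (simp add: Lr_space_def)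
  show "AE x in lebesgue_on (body K). norm (v x) \<le> norm (1 + \<bar>v x\<bar> powr q)"
  proof (rule AE_I2)
    fix x
    have "\<bar>v x\<bar> \<le> 1 + \<bar>v x\<bar> powr q"
    proof (cases "\<bar>v x\<bar> \<le> 1")
      case True then show ?thesis by (simp add: add_increasing2)
    next
      case False
      then have "\<bar>v x\<bar> powr 1 \<le> \<bar>v x\<bar> powr q" using q by (intro powr_mono) auto
      then show ?thesis using False by simp
    qed
    then show "norm (v x) \<le> norm (1 + \<bar>v x\<bar> powr q)" by simp
  qed
qed

lemma integral_abs_le_Lr_norm:
  assumes q: "1 < q" and v: "v \<in> Lr_space q (body K)"
  shows "IK (\<lambda>x. \<bar>v x\<bar>) \<le> vol powr (1 - 1 / q) * Lr_norm q (body K) v"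
proof -
  define A where "A = IK (\<lambda>x. \<bar>v x\<bar> powr q)"
  have i: "integrable (lebesgue_on (body K)) (\<lambda>x. \<bar>v x\<bar> powr q)" using v by (simp add: Lr_space_def)
  have iv: "integrable (lebesgue_on (body K)) (\<lambda>x. \<bar>v x\<bar>)" using Lr_space_integrable[OF q v] by (rule integrable_abs)
  have A0: "0 \<le> A" unfolding A_def by (rule Bochner_Integration.integral_nonneg) simp
  define p where "p = q / (q - 1)"
  have p: "1 / p + 1 / q = 1" "p > 1" using q by (auto simp: p_def field_simps)
  have young: "IK (\<lambda>x. \<bar>v x\<bar>) \<le> s * (vol / p) + s * (s powr (- q) * A / q)" if s: "s > 0" for s
  proof -
    have pt: "\<bar>v x\<bar> \<le> s * (1 / p) + s * (s powr (- q) / q) * \<bar>v x\<bar> powr q" for x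
    proof -
      have "1 * (\<bar>v x\<bar> / s) \<le> 1 powr p / p + (\<bar>v x\<bar> / s) powr q / q"
        by (rule Youngs_inequality) (use p q s in auto)
      also have "(\<bar>v x\<bar> / s) powr q = \<bar>v x\<bar> powr q * s powr (- q)"
        using s by (simp add: powr_divide powr_minus_divide)
      finally have "s * (\<bar>v x\<bar> / s) \<le> s * (1 / p + \<bar>v x\<bar> powr q * s powr (- q) / q)" using s by (intro mult_left_mono) auto
      then show ?thesis using s by (simp add: distrib_left mult.commute mult.left_commute mult.assoc)
    qed
    have "IK (\<lambda>x. \<bar>v x\<bar>) \<le> IK (\<lambda>x. s * (1 / p) + s * (s powr (- q) / q) * \<bar>v x\<bar> powr q)"
      by (rule integral_mono[OF iv]) (use i pt in \<open>auto intro!: Bochner_Integration.integrable_add integrable_polyf\<close>)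
    also have "\<dots> = IK (\<lambda>x. s * (1 / p)) + IK (\<lambda>x. s * (s powr (- q) / q) * \<bar>v x\<bar> powr q)"
      by (intro Bochner_Integration.integral_add integrable_mult_right i integrable_polyf polyf_const)
    also have "\<dots> = s * (1 / p) * vol + s * (s powr (- q) / q) * A"
      unfolding IK_const A_def by simp
    finally show ?thesis by simp
  qed
  show ?thesis
  proof (cases "A = 0")
    case True
    have "IK (\<lambda>x. \<bar>v x\<bar>) \<le> e" if e: "e > 0" for e
    proof -
      have "p > 0" using p by simp
      then show ?thesis using young[of "e * p / vol"] e True by simp
    qed
    then have "IK (\<lambda>x. \<bar>v x\<bar>) \<le> 0" by (meson field_le_epsilon add_0 dense_ge)
    moreover have "0 \<le> vol powr (1 - 1 / q) * Lr_norm q (body K) v" by simp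
    ultimately show ?thesis by linarith
  next
    case False
    then have Ap: "A > 0" using A0 by simp
    define s where "s = (A / vol) powr (1 / q)"
    have s: "s > 0" using Ap by (simp add: s_def)
    have "s powr (- q) * A = vol" using Ap q by (simp add: s_def powr_powr powr_minus)
    then have "IK (\<lambda>x. \<bar>v x\<bar>) \<le> s * (vol / p) + s * (vol / q)" using young[OF s] by simp
    also have "\<dots> = s * vol * (1 / p + 1 / q)" by (simp add: algebra_simps)
    also have "\<dots> = s * vol" using p by simp
    also have "\<dots> = vol powr (1 - 1 / q) * A powr (1 / q)" 
      using Ap by (simp add: s_def powr_divide powr_diff)
    finally show ?thesis by (simp add: Lr_norm_def A_def)
  qed
qed

lemma Lr_norm_le_sup:
  assumes q: "1 < q" and f: "polyf f" and M: "\<And>x. x \<in> body K \<Longrightarrow> \<bar>f x\<bar> \<le> M"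
  shows "Lr_norm q (body K) f \<le> M * vol powr (1 / q)"
proof -
  obtain x0 where "x0 \<in> body K" using interior_body_nonempty interior_subset by blast
  then have M0: "0 \<le> M" using M[of x0] by linarith
  have "continuous_on UNIV (\<lambda>x. \<bar>f x\<bar> powr q)"
    using q by (intro continuous_on_powr' continuous_on_rabs polyf_continuous f continuous_on_const) auto
  then have i: "integrable (lebesgue_on (body K)) (\<lambda>x. \<bar>f x\<bar> powr q)" by (rule integrable_continuous_body)
  have "IK (\<lambda>x. \<bar>f x\<bar> powr q) \<le> IK (\<lambda>x. M powr q)"
    by (rule integral_mono[OF i integrable_polyf]) (use q M in \<open>auto simp: space_restrict_space intro!: powr_mono2\<close>)
  also have "\<dots> = M powr q * vol" by (rule IK_const)
  finally have "IK (\<lambda>x. \<bar>f x\<bar> powr q) powr (1 / q) \<le> (M powr q * vol) powr (1 / q)"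
    using q by (intro powr_mono2 Bochner_Integration.integral_nonneg) auto
  also have "\<dots> = M * vol powr (1 / q)" using q M0 by (simp add: powr_mult powr_powr)
  finally show ?thesis by (simp add: Lr_norm_def)
qed

lemma Lr_norm_cong_AE:
  assumes "f \<in> borel_measurable (lebesgue_on (body K))" "g \<in> borel_measurable (lebesgue_on (body K))"
    "AE x in lebesgue_on (body K). f x = g x"
  shows "Lr_norm q (body K) f = Lr_norm q (body K) g"
proof -
  have "IK (\<lambda>x. \<bar>f x\<bar> powr q) = IK (\<lambda>x. \<bar>g x\<bar> powr q)"
  proof (rule integral_cong_AE)
    show "(\<lambda>x. \<bar>f x\<bar> powr q) \<in> borel_measurable (lebesgue_on (body K))" "(\<lambda>x. \<bar>g x\<bar> powr q) \<in> borel_measurable (lebesgue_on (body K))"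
      using assms(1,2) by measurable
    show "AE x in lebesgue_on (body K). \<bar>f x\<bar> powr q = \<bar>g x\<bar> powr q" using assms(3) by eventually_elim simp
  qed
  then show ?thesis by (simp add: Lr_norm_def)
qed

lemma Lr_norm_weak_dderiv_polyf:
  assumes "polyf f" shows "Lr_norm q (body K) (weak_dderiv b (body K) f) = Lr_norm q (body K) (dd b f)"
proof -
  have w: "is_weak_dderiv b (body K) f (dd b f)" by (rule is_weak_dderiv_polyf[OF assms body_lebesgue])
  have m: "dd b f \<in> borel_measurable (lebesgue_on (body K))" by (rule polyf_measurable_body[OF polyf_dd[OF assms]])
  show ?thesis
    by (rule Lr_norm_cong_AE[OF m weak_dderiv_measurable[OF w m] weak_dderiv_AE[OF w], symmetric])
qed

lemma W_space_graph_fun: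
  assumes q: "1 < q" and v: "v \<in> W_space q b K"
  shows "graph_fun b v (weak_dderiv b (body K) v)" "v \<in> Lr_space q (body K)" "weak_dderiv b (body K) v \<in> Lr_space q (body K)"
proof -
  obtain g where g: "g \<in> Lr_space q (body K)" "is_weak_dderiv b (body K) v g" using v by (auto simp: W_space_def)
  show vq: "v \<in> Lr_space q (body K)" using v by (simp add: W_space_def)
  have mg: "g \<in> borel_measurable (lebesgue_on (body K))" using g(1) by (simp add: Lr_space_def)
  have m: "weak_dderiv b (body K) v \<in> borel_measurable (lebesgue_on (body K))"
    by (rule weak_dderiv_measurable[OF g(2) mg])
  have "integrable (lebesgue_on (body K)) (\<lambda>x. \<bar>weak_dderiv b (body K) v x\<bar> powr q)"
  proof (rule integrable_cong_AE_imp)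
    show "integrable (lebesgue_on (body K)) (\<lambda>x. \<bar>g x\<bar> powr q)" using g(1) by (simp add: Lr_space_def)
    show "(\<lambda>x. \<bar>weak_dderiv b (body K) v x\<bar> powr q) \<in> borel_measurable (lebesgue_on (body K))" using m by measurable
    show "AE x in lebesgue_on (body K). \<bar>g x\<bar> powr q = \<bar>weak_dderiv b (body K) v x\<bar> powr q"
      using weak_dderiv_AE[OF g(2)] by eventually_elim simp
  qed
  then show wq: "weak_dderiv b (body K) v \<in> Lr_space q (body K)" using m by (simp add: Lr_space_def)
  show "graph_fun b v (weak_dderiv b (body K) v)"
    unfolding graph_fun_def using Lr_space_integrable[OF q vq] Lr_space_integrable[OF q wq] is_weak_dderiv_weak_dderiv[OF g(2)] by blast
qed

lemma vertex_dist_le_diam: "norm (K i - K j) \<le> elem_diam K"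
proof -
  have "bounded (body K)" using compact_body by (rule compact_imp_bounded)
  moreover have "K i \<in> body K" "K j \<in> body K" unfolding body_def by (auto intro: hull_inc)
  ultimately show ?thesis unfolding elem_diam_def using diameter_bounded_bound by (metis dist_norm)
qed

lemma norm_le_wind:
  "norm b \<le> real CARD('n) * elem_diam K * norm (matrix_inv (elem_matrix K) *v b)"
proof -
  let ?c = "matrix_inv (elem_matrix K) *v b"
  have "b = elem_matrix K *v ?c" by (simp add: matrix_vector_mul_assoc matrix_inv_elem)
  also have "\<dots> = (\<Sum>j\<in>UNIV. ?c $ j *\<^sub>R (K (Some j) - K None))"
    by (simp add: vec_eq_iff matrix_vector_mult_def elem_matrix_def mult.commute)
  finally have "norm b \<le> (\<Sum>j\<in>UNIV. norm (?c $ j *\<^sub>R (K (Some j) - K None)))" using norm_sum by metis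
  also have "\<dots> \<le> (\<Sum>j\<in>(UNIV :: 'n set). norm ?c * elem_diam K)"
    unfolding norm_scaleR by (intro sum_mono mult_mono component_le_norm_cart vertex_dist_le_diam) auto
  finally show ?thesis by (simp add: mult.commute mult.left_commute)
qed

lemma matrix_norm_bound: "norm (A *v x) \<le> matrix_norm A * norm x" for A :: "real^'n^'n"
  unfolding matrix_norm_def by (rule onorm[OF matrix_vector_mul_bounded_linear])

lemma matrix_norm_nonneg: "0 \<le> matrix_norm A" for A :: "real^'n^'n"
  unfolding matrix_norm_def by (rule onorm_pos_le[OF matrix_vector_mul_bounded_linear])

lemma elem_diam_le: "elem_diam K \<le> 2 * matrix_norm (elem_matrix K)"
proof -
  have ref: "norm (elem_inv K x) \<le> 1" if x: "x \<in> body K" for x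
  proof -
    have "norm (elem_inv K x) \<le> (\<Sum>i\<in>UNIV. \<bar>elem_inv K x $ i\<bar>)" by (rule norm_le_l1_cart)
    also have "\<dots> = (\<Sum>i\<in>UNIV. bary K (Some i) x)" using x by (simp add: elem_inv_coord body_iff)
    also have "\<dots> = 1 - bary K None x" using bary_sum[of x] by (simp add: sum_option)
    also have "\<dots> \<le> 1" using x by (simp add: body_iff)
    finally show ?thesis .
  qed
  have "body K \<noteq> {}" using interior_body_nonempty interior_subset by blast
  then show ?thesis unfolding elem_diam_def
  proof (intro diameter_le)
    fix x y assume xy: "x \<in> body K" "y \<in> body K"
    have "x - y = elem_map K (elem_inv K x) - elem_map K (elem_inv K y)" by simp
    also have "\<dots> = elem_matrix K *v (elem_inv K x - elem_inv K y)"
      unfolding elem_map_def by (simp only: matrix_vector_mult_diff_distrib add_diff_cancel_right)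
    finally have "norm (x - y) \<le> matrix_norm (elem_matrix K) * norm (elem_inv K x - elem_inv K y)"
      using matrix_norm_bound by simp
    also have "\<dots> \<le> matrix_norm (elem_matrix K) * 2"
    proof (rule mult_left_mono[OF _ matrix_norm_nonneg])
      show "norm (elem_inv K x - elem_inv K y) \<le> 2"
        using norm_triangle_ineq4[of "elem_inv K x" "elem_inv K y"] ref[OF xy(1)] ref[OF xy(2)] by linarith
    qed
    finally show "norm (x - y) \<le> 2 * matrix_norm (elem_matrix K)" by simp
  qed simp
qed

lemma diam_wind_le:
  assumes "matrix_norm (elem_matrix K) * matrix_norm (matrix_inv (elem_matrix K)) \<le> \<kappa>\<^sub>0"
  shows "elem_diam K * norm (matrix_inv (elem_matrix K) *v b) \<le> 2 * \<kappa>\<^sub>0 * norm b"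
proof -
  have "elem_diam K * norm (matrix_inv (elem_matrix K) *v b) 
     \<le> (2 * matrix_norm (elem_matrix K)) * (matrix_norm (matrix_inv (elem_matrix K)) * norm b)"
    by (intro mult_mono elem_diam_le matrix_norm_bound) (auto simp: matrix_norm_nonneg)
  also have "\<dots> = (2 * (matrix_norm (elem_matrix K) * matrix_norm (matrix_inv (elem_matrix K)))) * norm b" by simp
  also have "\<dots> \<le> (2 * \<kappa>\<^sub>0) * norm b" using assms by (intro mult_right_mono) auto
  finally show ?thesis .
qed

lemma flux_lower_bound:
  assumes \<kappa>: "matrix_norm (elem_matrix K) * matrix_norm (matrix_inv (elem_matrix K)) \<le> \<kappa>\<^sub>0" "0 < \<kappa>\<^sub>0"
    and \<theta>: "0 \<le> \<theta>" "\<theta> * norm b \<le> \<bar>b \<bullet> outer_normal K i\<bar>"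
  shows "\<theta> / (2 * \<kappa>\<^sub>0) * norm (matrix_inv (elem_matrix K) *v b) \<le> flux b i"
proof -
  let ?g = "norm (grad_bary K i)" and ?B = "norm (matrix_inv (elem_matrix K) *v b)"
  have g: "?g > 0" using grad_bary_nonzero by simp
  have fl: "\<theta> * norm b * ?g \<le> flux b i"
    using \<theta>(2) g by (simp add: inner_outer_normal flux_def abs_divide field_simps)
  have "1 = grad_bary K i \<bullet> (K i - K (other i))" by (simp add: grad_bary_edge)
  also have "\<dots> \<le> ?g * norm (K i - K (other i))" by (rule norm_cauchy_schwarz)
  also have "\<dots> \<le> ?g * elem_diam K" by (intro mult_left_mono vertex_dist_le_diam) auto
  finally have "?B * 1 \<le> ?B * (?g * elem_diam K)" by (rule mult_left_mono) simp
  also have "\<dots> = ?g * (elem_diam K * ?B)" by simp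
  also have "\<dots> \<le> ?g * (2 * \<kappa>\<^sub>0 * norm b)" by (intro mult_left_mono diam_wind_le[OF \<kappa>(1)]) auto
  finally have "?B / (2 * \<kappa>\<^sub>0) \<le> norm b * ?g" using \<kappa>(2) by (simp add: field_simps)
  then have "\<theta> * (?B / (2 * \<kappa>\<^sub>0)) \<le> \<theta> * (norm b * ?g)" using \<theta>(1) by (rule mult_left_mono)
  then show ?thesis using fl by simp
qed

lemma two_large_fluxes:
  fixes b :: "real^'n"
  defines "m \<equiv> real CARD('n option)"
  shows "\<exists>i j. i \<noteq> j \<and> 1 / m\<^sup>2 * norm (matrix_inv (elem_matrix K) *v b) \<le> flux b i \<and> 1 / m\<^sup>2 * norm (matrix_inv (elem_matrix K) *v b) \<le> flux b j"
proof -
  let ?B = "norm (matrix_inv (elem_matrix K) *v b)"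
  have m: "1 \<le> m" unfolding m_def by simp
  have f0: "0 \<le> flux b i" for i by (simp add: flux_def)
  have "?B \<le> (\<Sum>j\<in>UNIV. \<bar>(matrix_inv (elem_matrix K) *v b) $ j\<bar>)" by (rule norm_le_l1_cart)
  also have "\<dots> = (\<Sum>j\<in>UNIV. flux b (Some j))" by (simp add: flux_def grad_bary_inner ref_grad_inner)
  also have "\<dots> \<le> (\<Sum>i\<in>UNIV. flux b i)" using f0[of None] by (simp add: sum_option)
  finally have S: "?B \<le> (\<Sum>i\<in>UNIV. flux b i)" .
  have "\<exists>i. ?B / m \<le> flux b i"
  proof (rule ccontr)
    assume "\<not> ?thesis"
    then have "(\<Sum>i\<in>(UNIV :: 'n option set). flux b i) < (\<Sum>i\<in>(UNIV :: 'n option set). ?B / m)"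
      by (intro sum_strict_mono) (auto simp: not_le)
    also have "\<dots> = ?B" using m by (simp add: m_def)
    finally show False using S by simp
  qed
  then obtain i where i: "?B / m \<le> flux b i" by blast
  have "(grad_bary K i \<bullet> b) + (\<Sum>j\<in>UNIV - {i}. grad_bary K j \<bullet> b) = 0"
    using grad_bary_sum[of b] sum.remove[of UNIV i "\<lambda>j. grad_bary K j \<bullet> b"] by simp
  then have "flux b i = \<bar>\<Sum>j\<in>UNIV - {i}. grad_bary K j \<bullet> b\<bar>" unfolding flux_def by linarith
  also have "\<dots> \<le> (\<Sum>j\<in>UNIV - {i}. flux b j)" unfolding flux_def by (rule sum_abs)
  finally have S': "flux b i \<le> (\<Sum>j\<in>UNIV - {i}. flux b j)" .
  have ne: "other i \<in> UNIV - {i}" by simp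
  have "\<exists>j. j \<noteq> i \<and> flux b i / m \<le> flux b j"
  proof (rule ccontr)
    assume "\<not> ?thesis"
    then have lt: "flux b j < flux b i / m" if "j \<in> UNIV - {i}" for j using that by (auto simp: not_le)
    have "UNIV - {i} \<noteq> {}" using ne by blast
    then have "(\<Sum>j\<in>UNIV - {i}. flux b j) < (\<Sum>j\<in>UNIV - {i}. flux b i / m)"
      by (intro sum_strict_mono lt) simp
    also have "\<dots> \<le> (\<Sum>j\<in>(UNIV :: 'n option set). flux b i / m)"
      using m f0 by (intro sum_mono2) auto
    also have "\<dots> = flux b i" using m by (simp add: m_def)
    finally show False using S' by simp
  qed
  then obtain j where j: "j \<noteq> i" "flux b i / m \<le> flux b j" by blast
  have "1 / m\<^sup>2 * ?B = ?B / m / m" by (simp add: power2_eq_square)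
  also have "\<dots> \<le> flux b i / m" using i m by (intro divide_right_mono) auto
  finally have 1: "1 / m\<^sup>2 * ?B \<le> flux b i / m" .
  have "flux b i / m \<le> flux b i / 1" using m f0[of i] by (intro divide_left_mono) auto
  then have "1 / m\<^sup>2 * ?B \<le> flux b i" "1 / m\<^sup>2 * ?B \<le> flux b j" using 1 j(2) by linarith+
  then show ?thesis using j(1) by blast
qed

lemma projection_to_perp:
  assumes f: "f \<in> poly_space j"
  obtains f0 where "f0 \<in> poly_space0 j K" "(\<lambda>x. f x + (-1) * f0 x) \<in> poly_perp j K"
proof -
  have sub: "poly_space0 j K \<subseteq> poly_space j" by (auto simp: poly_space0_def)
  have ifs: "inner_function_space (poly_space0 j K) (\<lambda>f g. IK (\<lambda>x. f x * g x))"
    by (rule inner_function_space_subset[OF L2_space sub])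
      (auto simp: poly_space0_def intro: poly_space_add poly_space_cmult)
  have pf: "polyf f" using f by (rule polyfI)
  have "\<exists>f0\<in>poly_space0 j K. \<forall>s\<in>poly_space0 j K. IK (\<lambda>x. s x * f0 x) = IK (\<lambda>x. s x * f x)"
  proof (rule poly_riesz[OF ifs sub])
    fix s s' :: "real^'n \<Rightarrow> real" and r :: real
    assume "s \<in> poly_space0 j K" "s' \<in> poly_space0 j K"
    then have "polyf s" "polyf s'" using sub by (auto intro: polyfI)
    then show "IK (\<lambda>x. (s x + r * s' x) * f x) = IK (\<lambda>x. s x * f x) + r * IK (\<lambda>x. s' x * f x)"
      by (rule IK_lincomb_mult[OF _ _ integrable_polyf[OF pf]])
  qed
  then obtain f0 where f0: "f0 \<in> poly_space0 j K" "\<forall>s\<in>poly_space0 j K. IK (\<lambda>x. s x * f0 x) = IK (\<lambda>x. s x * f x)" by blast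
  have pf0: "polyf f0" using f0(1) sub by (auto intro: polyfI)
  have "(\<lambda>x. f x + (-1) * f0 x) \<in> poly_perp j K"
    unfolding poly_perp_def
  proof (intro CollectI conjI ballI)
    show "(\<lambda>x. f x + (-1) * f0 x) \<in> poly_space j" using f f0(1) sub by (intro poly_space_add poly_space_cmult) auto
    fix s assume s: "s \<in> poly_space0 j K"
    then have ps: "polyf s" using sub by (auto intro: polyfI)
    have "IK (\<lambda>x. (f x + (-1) * f0 x) * s x) = IK (\<lambda>x. f x * s x) + (-1) * IK (\<lambda>x. f0 x * s x)"
      by (rule IK_lincomb_mult[OF pf pf0 integrable_polyf[OF ps]])
    also have "\<dots> = 0" using bspec[OF f0(2) s] by (simp add: mult.commute)
    finally show "pairing (body K) (\<lambda>x. f x + (-1) * f0 x) s = 0" by (simp add: pairing_eq_IK)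
  qed
  then show ?thesis using that f0(1) by blast
qed

lemma D_elem_all_polynomials:
  assumes u: "graph_fun b u g" and D: "\<And>f. f \<in> poly_perp j K \<Longrightarrow> D_elem b K f u = 0" and f: "f \<in> poly_space j"
  shows "D_elem b K f u = 0"
proof -
  obtain f0 where f0: "f0 \<in> poly_space0 j K" "(\<lambda>x. f x + (-1) * f0 x) \<in> poly_perp j K" using projection_to_perp[OF f] .
  have p: "polyf f" "polyf f0" using f f0(1) by (auto simp: poly_space0_def intro: polyfI)
  have iu: "integrable (lebesgue_on (body K)) u" "integrable (lebesgue_on (body K)) g" "is_weak_dderiv b (body K) u g"
    using u by (auto simp: graph_fun_def)
  have "f0 x = 0" if "x \<in> body K" "bary K m x = 0" for x m
    using f0(1) that frontier_body_iff[of x] unfolding poly_space0_def by blast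
  then have "graph_pairing b f0 u g = 0" unfolding graph_pairing_def
    by (intro integration_by_parts[OF p(2) _ iu]) blast
  moreover have "graph_pairing b (\<lambda>x. f x + (-1) * f0 x) u g = 0"
    using D[OF f0(2)] D_elem_eq[OF poly_perp_polyf[OF f0(2)] u] by simp
  ultimately show ?thesis
    using graph_pairing_lincomb_left[OF p iu(1,2), of b "-1"] D_elem_eq[OF p(1) u] by simp
qed

lemma fortin_global_element:
  assumes adm: "admissible k (flux b)" and v: "graph_fun b v g"
  shows "f \<in> poly_space (int k) \<Longrightarrow> D_elem b K f (\<lambda>x. Pipp_elem k b K v x - v x) = 0"
    and "w \<in> poly_space (int k - 1) \<Longrightarrow> pairing (body K) w (weak_dderiv b (body K) (\<lambda>x. Pipp_elem k b K v x - v x)) = 0"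
proof -
  let ?P = "Pipp_elem k b K v"
  have pP: "polyf ?P" by (rule fortin_element(3)[OF adm v])
  have "graph_fun b (\<lambda>x. ?P x + (-1) * v x) (\<lambda>x. dd b ?P x + (-1) * g x)"
    by (rule graph_fun_lincomb[OF graph_fun_polyf[OF pP] v])
  then have u: "graph_fun b (\<lambda>x. ?P x - v x) (\<lambda>x. dd b ?P x - g x)" by simp
  show D: "D_elem b K f (\<lambda>x. ?P x - v x) = 0" if "f \<in> poly_space (int k)" for f
    by (rule D_elem_all_polynomials[OF u fortin_element(4)[OF adm v] that])
  show "pairing (body K) w (weak_dderiv b (body K) (\<lambda>x. ?P x - v x)) = 0" if w: "w \<in> poly_space (int k - 1)"
  proof -
    have "w \<in> poly_space (int k)" using w by (rule poly_space_mono[rotated]) simp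
    then have "D_elem b K w (\<lambda>x. ?P x - v x) = 0" by (rule D)
    moreover have "pairing (body K) (weak_dderiv b (body K) w) (\<lambda>x. ?P x - v x) = pairing (body K) (dd b w) (\<lambda>x. ?P x - v x)"
      unfolding pairing_weak_dderiv(2)[OF polyfI[OF w] u] by (simp add: pairing_eq_IK)
    moreover have "pairing (body K) (dd b w) (\<lambda>x. ?P x - v x) = 0"
      by (rule fortin_element(5)[OF adm v]) (use poly_space_dd[OF w, of b] in simp)
    ultimately show ?thesis by (simp add: D_elem_def)
  qed
qed

end

section \<open>Stability of the Fortin operator\<close>

context stability_constants
begin

definition C\<^sub>P :: real where "C\<^sub>P = 1 + C\<^sub>y"
definition C\<^sub>D :: real where "C\<^sub>D = C\<^sub>d * C\<^sub>y"

lemma C\<^sub>P_nonneg: "0 \<le> C\<^sub>P" and C\<^sub>D_nonneg: "0 \<le> C\<^sub>D"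
  unfolding C\<^sub>P_def C\<^sub>D_def using C\<^sub>y_nonneg nonneg by simp_all

lemma vol_powr: "vol powr (1 - 1 / q) / vol * vol powr (1 / q) = 1"
  by (simp add: powr_diff)

lemma fortin_Lr_estimates:
  assumes q: "1 < q" and \<tau>: "flux_bounded \<tau> b" and v: "v \<in> W_space q b K"
  defines "g \<equiv> weak_dderiv b (body K) v" and "P \<equiv> Pipp_elem k b K v"
  shows "Lr_norm q (body K) P \<le> C\<^sub>P / \<tau> * (Lr_norm q (body K) v + Lr_norm q (body K) g / wind b)"
    and "Lr_norm q (body K) (weak_dderiv b (body K) P) \<le> C\<^sub>D / \<tau> * (wind b * Lr_norm q (body K) v + Lr_norm q (body K) g)"
    and "k = 1 \<Longrightarrow> Lr_norm q (body K) (weak_dderiv b (body K) P) \<le> C\<^sub>D / \<tau> * Lr_norm q (body K) g"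
proof -
  let ?e = "vol powr (1 - 1 / q)"
  have B: "0 < wind b" and \<tau>0: "0 < \<tau>" "\<tau> \<le> 1" using \<tau> by (auto simp: flux_bounded_def)
  have tv: "0 < \<tau> * vol" using \<tau>0 by simp
  have gf: "graph_fun b v g" unfolding g_def by (rule W_space_graph_fun(1)[OF q v])
  have X: "size1 v \<le> ?e * Lr_norm q (body K) v" and G: "size1 g \<le> ?e * Lr_norm q (body K) g"
    unfolding size1_def g_def using W_space_graph_fun(2,3)[OF q v] by (auto intro: integral_abs_le_Lr_norm[OF q])
  define m where "m = mean (body K) v"
  obtain y where y: "P = (\<lambda>x. m + y x)" "y \<in> poly_space (int CARD('n) + int k)"
    and y1: "\<And>x. x \<in> body K \<Longrightarrow> \<bar>y x\<bar> * (\<tau> * vol) \<le> C\<^sub>y * (size1 v + size1 g / wind b)"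
    and y2: "\<And>x. k = 1 \<Longrightarrow> x \<in> body K \<Longrightarrow> \<bar>y x\<bar> * (\<tau> * vol) \<le> C\<^sub>y * (size1 g / wind b)"
    unfolding P_def m_def using fortin_decomposition[OF \<tau> gf] by blast
  have py: "polyf y" using y(2) by (rule polyfI)
  have pP: "polyf P" unfolding y(1) by (intro polyf_add polyf_const py)
  have dP: "dd b P = dd b y" unfolding y(1) using dd_add[OF polyf_const py, of b m] by auto
  have iv: "integrable (lebesgue_on (body K)) v" using gf by (simp add: graph_fun_def)
  have m0: "\<bar>m\<bar> * vol \<le> size1 v"
    using abs_IK_mult_le[OF polyf_const[of 1] _ iv, of 1] by (simp add: m_def mean_eq size1_def abs_divide)
  have Y0: "0 \<le> size1 g / wind b" using B by simp
  have Z: "size1 v + size1 g / wind b \<le> ?e * (Lr_norm q (body K) v + Lr_norm q (body K) g / wind b)"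
  proof -
    have "size1 g / wind b \<le> ?e * Lr_norm q (body K) g / wind b" using G B by (intro divide_right_mono) auto
    then show ?thesis using X by (simp add: distrib_left)
  qed
  have sup: "Lr_norm q (body K) f \<le> c / \<tau> * N" 
    if f: "polyf f" "\<And>x. x \<in> body K \<Longrightarrow> \<bar>f x\<bar> * (\<tau> * vol) \<le> c * (?e * N)" for f c N
  proof -
    have "\<bar>f x\<bar> \<le> c * (?e * N) / (\<tau> * vol)" if "x \<in> body K" for x using f(2)[OF that] tv by (subst pos_le_divide_eq) auto
    then have "Lr_norm q (body K) f \<le> c * (?e * N) / (\<tau> * vol) * vol powr (1 / q)" by (intro Lr_norm_le_sup[OF q f(1)])
    also have "\<dots> = c / \<tau> * N * (?e / vol * vol powr (1 / q))" by simp
    also have "\<dots> = c / \<tau> * N" unfolding vol_powr by simp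
    finally show ?thesis .
  qed
  show "Lr_norm q (body K) P \<le> C\<^sub>P / \<tau> * (Lr_norm q (body K) v + Lr_norm q (body K) g / wind b)"
  proof (rule sup[OF pP])
    fix x assume x: "x \<in> body K"
    have "\<bar>P x\<bar> * (\<tau> * vol) \<le> (\<bar>m\<bar> + \<bar>y x\<bar>) * (\<tau> * vol)" 
      unfolding y(1) using tv by (intro mult_right_mono abs_triangle_ineq) auto
    also have "\<dots> = \<bar>m\<bar> * vol * \<tau> + \<bar>y x\<bar> * (\<tau> * vol)" by (simp add: algebra_simps)
    also have "\<dots> \<le> \<bar>m\<bar> * vol * 1 + \<bar>y x\<bar> * (\<tau> * vol)" using \<tau>0 by (intro add_right_mono mult_left_mono) auto
    also have "\<dots> \<le> (size1 v + size1 g / wind b) + C\<^sub>y * (size1 v + size1 g / wind b)"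
      using m0 y1[OF x] Y0 by linarith
    also have "\<dots> = C\<^sub>P * (size1 v + size1 g / wind b)" unfolding C\<^sub>P_def by (simp only: distrib_right mult_1_left)
    also have "\<dots> \<le> C\<^sub>P * (?e * (Lr_norm q (body K) v + Lr_norm q (body K) g / wind b))" 
      by (rule mult_left_mono[OF Z C\<^sub>P_nonneg])
    finally show "\<bar>P x\<bar> * (\<tau> * vol) \<le> C\<^sub>P * (?e * (Lr_norm q (body K) v + Lr_norm q (body K) g / wind b))" .
  qed
  have dy: "\<bar>dd b P x\<bar> * (\<tau> * vol) \<le> C\<^sub>D * (wind b * R)" 
    if R: "\<And>x. x \<in> body K \<Longrightarrow> \<bar>y x\<bar> * (\<tau> * vol) \<le> C\<^sub>y * R" and x: "x \<in> body K" for R x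
  proof -
    have "\<bar>y x\<bar> \<le> C\<^sub>y * R / (\<tau> * vol)" if "x \<in> body K" for x using R[OF that] tv by (subst pos_le_divide_eq) auto
    then have "\<bar>dd b y x\<bar> \<le> C\<^sub>d * wind b * (C\<^sub>y * R / (\<tau> * vol))"
      unfolding wind_def by (intro dd_bound[OF y(2) _ x])
    then have "\<bar>dd b y x\<bar> * (\<tau> * vol) \<le> C\<^sub>d * wind b * (C\<^sub>y * R / (\<tau> * vol)) * (\<tau> * vol)" using tv by (intro mult_right_mono) auto
    also have "\<dots> = C\<^sub>D * (wind b * R)" using \<tau>0(1) by (simp add: C\<^sub>D_def)
    finally show ?thesis unfolding dP .
  qed
  show "Lr_norm q (body K) (weak_dderiv b (body K) P) \<le> C\<^sub>D / \<tau> * (wind b * Lr_norm q (body K) v + Lr_norm q (body K) g)"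
    unfolding Lr_norm_weak_dderiv_polyf[OF pP]
  proof (rule sup[OF polyf_dd[OF pP]])
    fix x assume x: "x \<in> body K"
    have "\<bar>dd b P x\<bar> * (\<tau> * vol) \<le> C\<^sub>D * (wind b * (size1 v + size1 g / wind b))" by (rule dy[OF y1 x])
    also have "\<dots> \<le> C\<^sub>D * (wind b * (?e * (Lr_norm q (body K) v + Lr_norm q (body K) g / wind b)))"
      using B by (intro mult_left_mono Z C\<^sub>D_nonneg) auto
    also have "wind b * (?e * (Lr_norm q (body K) v + Lr_norm q (body K) g / wind b)) = ?e * (wind b * Lr_norm q (body K) v + Lr_norm q (body K) g)"
      using B by (simp add: field_simps)
    finally show "\<bar>dd b P x\<bar> * (\<tau> * vol) \<le> C\<^sub>D * (?e * (wind b * Lr_norm q (body K) v + Lr_norm q (body K) g))" .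
  qed
  show "Lr_norm q (body K) (weak_dderiv b (body K) P) \<le> C\<^sub>D / \<tau> * Lr_norm q (body K) g" if k1: "k = 1"
    unfolding Lr_norm_weak_dderiv_polyf[OF pP]
  proof (rule sup[OF polyf_dd[OF pP]])
    fix x assume x: "x \<in> body K"
    have "\<bar>dd b P x\<bar> * (\<tau> * vol) \<le> C\<^sub>D * (wind b * (size1 g / wind b))" by (rule dy[OF y2[OF k1] x])
    also have "\<dots> = C\<^sub>D * size1 g" using B by simp
    also have "\<dots> \<le> C\<^sub>D * (?e * Lr_norm q (body K) g)" by (rule mult_left_mono[OF G C\<^sub>D_nonneg])
    finally show "\<bar>dd b P x\<bar> * (\<tau> * vol) \<le> C\<^sub>D * (?e * Lr_norm q (body K) g)" .
  qed
qed

lemma wind_pos: "b \<noteq> 0 \<Longrightarrow> 0 < wind b"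
  using norm_le_wind[of b] unfolding wind_def by (metis mult_zero_right norm_le_zero_iff zero_less_norm_iff norm_zero)

lemma elem_diam_pos: "b \<noteq> 0 \<Longrightarrow> 0 < elem_diam K"
proof -
  have "0 < norm (K (Some undefined) - K None)"
    using grad_bary_edge[of None "Some undefined" None] by auto
  then show ?thesis using vertex_dist_le_diam[of "Some undefined" None] by linarith
qed

lemma inverse_wind_le: 
  assumes "b \<noteq> 0" shows "1 / wind b \<le> real CARD('n) * (elem_diam K / norm b)"
  using norm_le_wind[of b] wind_pos[OF assms] assms unfolding wind_def[symmetric] by (simp add: field_simps)

lemma fortin_Lr_bounds:
  assumes q: "1 < q" and \<tau>: "flux_bounded \<tau> b" and b: "b \<noteq> 0" and v: "v \<in> W_space q b K"
    and \<kappa>: "matrix_norm (elem_matrix K) * matrix_norm (matrix_inv (elem_matrix K)) \<le> \<kappa>\<^sub>0" "0 < \<kappa>\<^sub>0"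
  defines "P \<equiv> Pipp_elem k b K v" and "a \<equiv> elem_diam K / norm b"
  shows "Lr_norm q (body K) P \<le> real CARD('n) * C\<^sub>P / \<tau> * W_norm q b K v"
    and "W_norm q b K P \<le> real CARD('n) * (C\<^sub>P + 2 * \<kappa>\<^sub>0 * C\<^sub>D) / \<tau> * W_norm q b K v"
proof -
  let ?N = "real CARD('n)" and ?v = "Lr_norm q (body K) v" and ?g = "Lr_norm q (body K) (weak_dderiv b (body K) v)"
  have B: "0 < wind b" and \<tau>0: "0 < \<tau>" using \<tau> by (auto simp: flux_bounded_def)
  have N: "1 \<le> ?N" by (simp add: Suc_le_eq)
  have a0: "0 \<le> a" using elem_diam_pos[OF b] by (simp add: a_def)
  have W: "W_norm q b K v = ?v + a * ?g" by (simp add: W_norm_def a_def)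
  have W0: "0 \<le> W_norm q b K v" unfolding W using a0 by simp
  have ag: "?v + ?g / wind b \<le> ?N * W_norm q b K v"
  proof -
    have "?g / wind b = ?g * (1 / wind b)" by simp
    also have "\<dots> \<le> ?g * (?N * a)" unfolding a_def by (intro mult_left_mono inverse_wind_le b) simp
    finally have "?g / wind b \<le> ?N * (a * ?g)" by (simp add: mult.commute mult.left_commute)
    moreover have "1 * ?v \<le> ?N * ?v" using N by (intro mult_right_mono) auto
    ultimately show ?thesis unfolding W by (simp add: distrib_left)
  qed
  have "Lr_norm q (body K) P \<le> C\<^sub>P / \<tau> * (?v + ?g / wind b)"
    unfolding P_def by (rule fortin_Lr_estimates(1)[OF q \<tau> v])
  also have "\<dots> \<le> C\<^sub>P / \<tau> * (?N * W_norm q b K v)"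
    using \<tau>0 C\<^sub>P_nonneg by (intro mult_left_mono ag) auto
  finally show 1: "Lr_norm q (body K) P \<le> ?N * C\<^sub>P / \<tau> * W_norm q b K v" by (simp add: mult.commute mult.left_commute)
  have aB: "a * wind b \<le> 2 * \<kappa>\<^sub>0" 
    using diam_wind_le[OF \<kappa>(1), of b] b unfolding a_def wind_def by (simp add: field_simps)
  have "a * Lr_norm q (body K) (weak_dderiv b (body K) P) \<le> a * (C\<^sub>D / \<tau> * (wind b * ?v + ?g))"
    unfolding P_def by (intro mult_left_mono a0 fortin_Lr_estimates(2)[OF q \<tau> v])
  also have "wind b * ?v + ?g = wind b * (?v + ?g / wind b)" using B by (simp add: field_simps)
  also have "a * (C\<^sub>D / \<tau> * (wind b * (?v + ?g / wind b))) = C\<^sub>D / \<tau> * ((a * wind b) * (?v + ?g / wind b))" by simp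
  also have "\<dots> \<le> C\<^sub>D / \<tau> * ((2 * \<kappa>\<^sub>0) * (?N * W_norm q b K v))"
    using \<tau>0 C\<^sub>D_nonneg B \<kappa>(2) by (intro mult_left_mono mult_mono aB ag) auto
  also have "\<dots> = ?N * (2 * \<kappa>\<^sub>0 * C\<^sub>D) / \<tau> * W_norm q b K v" by simp
  finally have 2: "a * Lr_norm q (body K) (weak_dderiv b (body K) P) \<le> ?N * (2 * \<kappa>\<^sub>0 * C\<^sub>D) / \<tau> * W_norm q b K v" .
  have "W_norm q b K P = Lr_norm q (body K) P + a * Lr_norm q (body K) (weak_dderiv b (body K) P)" by (simp add: W_norm_def a_def)
  also have "\<dots> \<le> ?N * C\<^sub>P / \<tau> * W_norm q b K v + ?N * (2 * \<kappa>\<^sub>0 * C\<^sub>D) / \<tau> * W_norm q b K v" using 1 2 by (rule add_mono)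
  also have "\<dots> = ?N * (C\<^sub>P + 2 * \<kappa>\<^sub>0 * C\<^sub>D) / \<tau> * W_norm q b K v"
    by (simp add: distrib_left add_divide_distrib distrib_right)
  finally show "W_norm q b K P \<le> ?N * (C\<^sub>P + 2 * \<kappa>\<^sub>0 * C\<^sub>D) / \<tau> * W_norm q b K v" .
qed

end

text \<open>The lower bound for the fluxes relative to the pulled-back field; for \<open>k = 1\<close> the two largest
  fluxes suffice, whence no dependence on \<open>\<theta>\<^sub>0\<close>.\<close>

definition flux_const :: "nat \<Rightarrow> real \<Rightarrow> nat \<Rightarrow> real \<Rightarrow> real" where
  "flux_const n \<kappa>\<^sub>0 k \<theta>\<^sub>0 = (if k = 1 then 1 / (real n)\<^sup>2 else min 1 (\<theta>\<^sub>0 / (2 * \<kappa>\<^sub>0)))"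

lemma flux_const_pos: "0 < n \<Longrightarrow> 0 < \<kappa>\<^sub>0 \<Longrightarrow> 0 < \<theta>\<^sub>0 \<Longrightarrow> 0 < flux_const n \<kappa>\<^sub>0 k \<theta>\<^sub>0"
  by (simp add: flux_const_def)

lemma (in stability_constants) flux_bounded_setting:
  assumes \<kappa>: "matrix_norm (elem_matrix K) * matrix_norm (matrix_inv (elem_matrix K)) \<le> \<kappa>\<^sub>0" "0 < \<kappa>\<^sub>0"
    and \<theta>: "0 < \<theta>\<^sub>0" "k = 1 \<or> (\<forall>i. \<bar>b \<bullet> outer_normal K i\<bar> \<ge> \<theta>\<^sub>0 * norm b)" and b: "b \<noteq> 0"
  shows "flux_bounded (flux_const CARD('n option) \<kappa>\<^sub>0 k \<theta>\<^sub>0) b"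
proof -
  let ?t = "flux_const CARD('n option) \<kappa>\<^sub>0 k \<theta>\<^sub>0"
  have B: "0 < wind b" by (rule wind_pos[OF b])
  have t0: "0 < ?t" by (rule flux_const_pos) (use \<kappa> \<theta> in auto)
  have t1: "?t \<le> 1"
  proof (cases "k = 1")
    case True
    have "(1::real) \<le> (real CARD('n option))\<^sup>2" by (intro one_le_power) simp
    then show ?thesis using True by (simp add: flux_const_def)
  qed (simp add: flux_const_def)
  have "if k = 1 then \<exists>i j. i \<noteq> j \<and> ?t * wind b \<le> flux b i \<and> ?t * wind b \<le> flux b j else \<forall>i. ?t * wind b \<le> flux b i"
  proof (cases "k = 1")
    case True
    have "\<exists>i j. i \<noteq> j \<and> ?t * wind b \<le> flux b i \<and> ?t * wind b \<le> flux b j"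
      using two_large_fluxes[of b] True unfolding wind_def flux_const_def by simp
    then show ?thesis using True by simp
  next
    case False
    have "?t * wind b \<le> flux b i" for i
    proof -
      have "?t * wind b \<le> \<theta>\<^sub>0 / (2 * \<kappa>\<^sub>0) * wind b" using False B by (intro mult_right_mono) (auto simp: flux_const_def)
      also have "\<dots> \<le> flux b i" unfolding wind_def using \<theta> False by (intro flux_lower_bound \<kappa>) auto
      finally show ?thesis .
    qed
    then show ?thesis using False by simp
  qed
  then show ?thesis unfolding flux_bounded_def using t0 t1 B by (intro conjI)
qed

lemma fortin_stability:
  assumes k: "1 \<le> k" and q: "1 < q" and \<kappa>: "0 < \<kappa>\<^sub>0"
  shows "\<exists>C\<ge>0. \<forall>(K :: 'n::finite lsimplex) b \<theta>\<^sub>0. nondegenerate_simplex K \<longrightarrow> 0 < \<theta>\<^sub>0 \<longrightarrow> b \<noteq> 0 \<longrightarrow>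
     matrix_norm (elem_matrix K) * matrix_norm (matrix_inv (elem_matrix K)) \<le> \<kappa>\<^sub>0 \<longrightarrow>
     (k = 1 \<or> (\<forall>i. \<bar>b \<bullet> outer_normal K i\<bar> \<ge> \<theta>\<^sub>0 * norm b)) \<longrightarrow>
     (\<forall>v\<in>W_space q b K.
       Lr_norm q (body K) (Pipp_elem k b K v) \<le> C / flux_const CARD('n option) \<kappa>\<^sub>0 k \<theta>\<^sub>0 * W_norm q b K v \<and>
       (k = 1 \<longrightarrow> Lr_norm q (body K) (weak_dderiv b (body K) (Pipp_elem k b K v))
          \<le> C / flux_const CARD('n option) \<kappa>\<^sub>0 k \<theta>\<^sub>0 * Lr_norm q (body K) (weak_dderiv b (body K) v)) \<and>
       W_norm q b K (Pipp_elem k b K v) \<le> C / flux_const CARD('n option) \<kappa>\<^sub>0 k \<theta>\<^sub>0 * W_norm q b K v)"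
proof -
  obtain C\<^sub>d C\<^sub>w C\<^sub>z \<beta>\<^sub>0 where sc: "\<forall>(K :: 'n lsimplex). nondegenerate_simplex K \<longrightarrow> stability_constants K k C\<^sub>d C\<^sub>w C\<^sub>z \<beta>\<^sub>0"
    using stability_constants_exist[OF k] by (elim exE)
  have "stability_constants (ref_simplex :: 'n lsimplex) k C\<^sub>d C\<^sub>w C\<^sub>z \<beta>\<^sub>0" using sc ref_nondegenerate by blast
  then have nn: "0 \<le> C\<^sub>d" "0 \<le> C\<^sub>w" "0 \<le> C\<^sub>z" "0 < \<beta>\<^sub>0" by (auto simp: stability_constants_def stability_constants_axioms_def)
  let ?n = "real CARD('n option)" and ?N = "real CARD('n)"
  define A where "A = ?n * C\<^sub>w * (C\<^sub>d + 1) + C\<^sub>z * (1 + ?n * C\<^sub>w * (C\<^sub>d + 1))"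
  define Y where "Y = 2 * A * (1 + 1 / \<beta>\<^sub>0)"
  have A0: "0 \<le> A" unfolding A_def using nn by simp
  have Y0: "0 \<le> Y" unfolding Y_def using nn A0 by simp
  define C where "C = ?N * ((1 + Y) + 2 * \<kappa>\<^sub>0 * (C\<^sub>d * Y))"
  have C0: "0 \<le> C" unfolding C_def using nn Y0 \<kappa> by simp
  have N: "1 \<le> ?N" by (simp add: Suc_le_eq)
  show ?thesis
  proof (intro exI[of _ "C + C\<^sub>d * Y"] conjI allI impI ballI)
    show "0 \<le> C + C\<^sub>d * Y" using C0 nn Y0 by simp
    fix K :: "'n lsimplex" and b :: "real^'n" and \<theta>\<^sub>0 :: real and v
    assume K: "nondegenerate_simplex K" and \<theta>0: "0 < \<theta>\<^sub>0" and b: "b \<noteq> 0"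
      and \<kappa>K: "matrix_norm (elem_matrix K) * matrix_norm (matrix_inv (elem_matrix K)) \<le> \<kappa>\<^sub>0"
      and \<theta>: "k = 1 \<or> (\<forall>i. \<bar>b \<bullet> outer_normal K i\<bar> \<ge> \<theta>\<^sub>0 * norm b)" and v: "v \<in> W_space q b K"
    interpret stability_constants K k C\<^sub>d C\<^sub>w C\<^sub>z \<beta>\<^sub>0 using sc K by blast
    let ?t = "flux_const CARD('n option) \<kappa>\<^sub>0 k \<theta>\<^sub>0"
    have \<tau>: "flux_bounded ?t b" by (rule flux_bounded_setting[OF \<kappa>K \<kappa> \<theta>0 \<theta> b])
    have t0: "0 < ?t" using \<tau> by (simp add: flux_bounded_def)
    have Cy: "C\<^sub>y = Y" unfolding C\<^sub>y_def C\<^sub>u_def Y_def A_def ..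
    have a0: "0 \<le> elem_diam K / norm b" using elem_diam_pos[OF b] by simp
    have W0: "0 \<le> W_norm q b K v" unfolding W_norm_def using a0 by (intro add_nonneg_nonneg mult_nonneg_nonneg) auto
    have le: "x / ?t * y \<le> (C + C\<^sub>d * Y) / ?t * y" if "x \<le> C + C\<^sub>d * Y" "0 \<le> y" for x y
      using that t0 by (intro mult_right_mono divide_right_mono) auto
    have CdY: "0 \<le> C\<^sub>d * Y" using nn Y0 by simp
    have "?N * C\<^sub>P \<le> C" unfolding C_def C\<^sub>P_def Cy using CdY \<kappa> by (intro mult_left_mono) auto
    then show "Lr_norm q (body K) (Pipp_elem k b K v) \<le> (C + C\<^sub>d * Y) / ?t * W_norm q b K v"
      using fortin_Lr_bounds(1)[OF q \<tau> b v \<kappa>K \<kappa>] le[of "?N * C\<^sub>P" "W_norm q b K v"] W0 CdY by linarith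
    show "Lr_norm q (body K) (weak_dderiv b (body K) (Pipp_elem k b K v))
          \<le> (C + C\<^sub>d * Y) / ?t * Lr_norm q (body K) (weak_dderiv b (body K) v)" if "k = 1"
      using fortin_Lr_estimates(3)[OF q \<tau> v that] le[of "C\<^sub>D" "Lr_norm q (body K) (weak_dderiv b (body K) v)"] C0
      unfolding C\<^sub>D_def Cy by simp
    have "?N * (C\<^sub>P + 2 * \<kappa>\<^sub>0 * C\<^sub>D) = C" unfolding C_def C\<^sub>P_def C\<^sub>D_def Cy ..
    then show "W_norm q b K (Pipp_elem k b K v) \<le> (C + C\<^sub>d * Y) / ?t * W_norm q b K v"
      using fortin_Lr_bounds(2)[OF q \<tau> b v \<kappa>K \<kappa>] le[of C "W_norm q b K v"] W0 CdY by simp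
  qed
qed

lemma settingD:
  assumes "setting k \<kappa>\<^sub>0 \<theta>\<^sub>0 \<Omega> \<T> \<beta>" "K \<in> \<T>"
  shows "nondegenerate_simplex K" "\<beta> K \<noteq> 0"
    "matrix_norm (elem_matrix K) * matrix_norm (matrix_inv (elem_matrix K)) \<le> \<kappa>\<^sub>0"
    "k = 1 \<or> (\<forall>i. \<bar>\<beta> K \<bullet> outer_normal K i\<bar> \<ge> \<theta>\<^sub>0 * norm (\<beta> K))"
  using assms by (auto simp: setting_def conforming_mesh_def advection_field_def intro: nondegenerate_simplex.intro)

lemma setting_admissible:
  assumes "setting k \<kappa>\<^sub>0 \<theta>\<^sub>0 \<Omega> \<T> \<beta>" "K \<in> \<T>" "0 < \<theta>\<^sub>0"
  shows "nondegenerate_simplex.admissible k (nondegenerate_simplex.flux K (\<beta> K))"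
proof -
  interpret nondegenerate_simplex K by (rule settingD(1)[OF assms(1,2)])
  have b: "\<beta> K \<noteq> 0" by (rule settingD(2)[OF assms(1,2)])
  have "k = 1 \<or> (\<forall>i. grad_bary K i \<bullet> \<beta> K \<noteq> 0)"
  proof (cases "k = 1")
    case False
    have "grad_bary K i \<bullet> \<beta> K \<noteq> 0" for i
    proof
      assume "grad_bary K i \<bullet> \<beta> K = 0"
      then have "\<beta> K \<bullet> outer_normal K i = 0" by (simp add: inner_outer_normal)
      moreover have "0 < \<theta>\<^sub>0 * norm (\<beta> K)" using b assms(3) by simp
      ultimately show False using settingD(4)[OF assms(1,2)] False by (metis abs_zero linorder_not_less)
    qed
    then show ?thesis by blast
  qed simp
  then show ?thesis by (rule admissible_flux[OF b])
qed

lemma setting_fortin_local: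
  fixes K :: "'n::finite lsimplex"
  assumes q: "1 < q" and \<theta>: "0 < \<theta>\<^sub>0" and s: "setting k \<kappa>\<^sub>0 \<theta>\<^sub>0 \<Omega> \<T> \<beta>" and K: "K \<in> \<T>"
  shows "v \<in> W_space q (\<beta> K) K \<Longrightarrow> Pipp_elem k (\<beta> K) K v \<in> Vpp k (\<beta> K) K"
    and "v \<in> W_space q (\<beta> K) K \<Longrightarrow> w \<in> poly_perp (int k) K \<Longrightarrow> D_elem (\<beta> K) K w (\<lambda>x. Pipp_elem k (\<beta> K) K v x - v x) = 0"
    and "v \<in> W_space q (\<beta> K) K \<Longrightarrow> z \<in> poly_space (int k - 2) \<Longrightarrow> pairing (body K) z (\<lambda>x. Pipp_elem k (\<beta> K) K v x - v x) = 0"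
    and "v \<in> W_space q (\<beta> K) K \<Longrightarrow> c \<in> poly_space 0 \<Longrightarrow> pairing (body K) c (\<lambda>x. Pipp_elem k (\<beta> K) K v x - v x) = 0"
    and "c \<in> poly_space 0 \<Longrightarrow> Pipp_elem k (\<beta> K) K c = c"
    and "2 \<le> k \<Longrightarrow> v \<in> W_space q (\<beta> K) K \<Longrightarrow> Pipp_elem k (\<beta> K) K v = Pip_elem k (\<beta> K) K v"
    and "2 \<le> k \<Longrightarrow> Vpp k (\<beta> K) K = Vp k (\<beta> K) K"
    and "k = 1 \<Longrightarrow> 2 \<le> CARD('n) \<Longrightarrow> bij_betw (\<lambda>(u, c, t). \<lambda>x. u x + c x + t x)
        (V k (\<beta> K) K \<times> poly_space 0 \<times> span_bubble K) (Vpp k (\<beta> K) K)"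
proof -
  interpret nondegenerate_simplex K by (rule settingD(1)[OF s K])
  have adm: "admissible k (flux (\<beta> K))" by (rule setting_admissible[OF s K \<theta>])
  note el = fortin_element[OF adm W_space_graph_fun(1)[OF q]]
  show "v \<in> W_space q (\<beta> K) K \<Longrightarrow> Pipp_elem k (\<beta> K) K v \<in> Vpp k (\<beta> K) K" by (rule el(2))
  show "v \<in> W_space q (\<beta> K) K \<Longrightarrow> w \<in> poly_perp (int k) K \<Longrightarrow> D_elem (\<beta> K) K w (\<lambda>x. Pipp_elem k (\<beta> K) K v x - v x) = 0" by (rule el(4))
  show "v \<in> W_space q (\<beta> K) K \<Longrightarrow> z \<in> poly_space (int k - 2) \<Longrightarrow> pairing (body K) z (\<lambda>x. Pipp_elem k (\<beta> K) K v x - v x) = 0" by (rule el(5))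
  show "v \<in> W_space q (\<beta> K) K \<Longrightarrow> c \<in> poly_space 0 \<Longrightarrow> pairing (body K) c (\<lambda>x. Pipp_elem k (\<beta> K) K v x - v x) = 0" by (rule el(6))
  show "c \<in> poly_space 0 \<Longrightarrow> Pipp_elem k (\<beta> K) K c = c" by (rule Pipp_elem_const[OF adm])
  show "2 \<le> k \<Longrightarrow> v \<in> W_space q (\<beta> K) K \<Longrightarrow> Pipp_elem k (\<beta> K) K v = Pip_elem k (\<beta> K) K v" by (rule el(7))
  show "2 \<le> k \<Longrightarrow> Vpp k (\<beta> K) K = Vp k (\<beta> K) K" by (rule Vpp_eq_Vp)
  show "bij_betw (\<lambda>(u, c, t). \<lambda>x. u x + c x + t x)
        (V k (\<beta> K) K \<times> poly_space 0 \<times> span_bubble K) (Vpp k (\<beta> K) K)" if "k = 1" "2 \<le> CARD('n)"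
    unfolding that(1) by (rule Vpp_direct_sum[OF settingD(2)[OF s K] that(2)])
qed

lemma fortin_global:
  assumes q: "1 < q" and s: "setting k \<kappa>\<^sub>0 \<theta>\<^sub>0 \<Omega> \<T> \<beta>" and \<theta>: "0 < \<theta>\<^sub>0" and v: "v \<in> W_mesh q \<beta> \<T>" 
    and w: "w \<in> poly_mesh (int k - 1) \<T>" and \<mu>: "\<mu> \<in> Xhat (int k) \<Omega> \<beta> \<T>"
  shows "bform \<beta> \<T> (w, \<mu>) (\<lambda>K x. Pipp_mesh k \<beta> v K x - v K x) = 0"
proof -
  obtain z where z: "z \<in> S_mesh (int k) \<Omega> \<T>" "\<mu> = D_mesh \<beta> \<T> z" using \<mu> by (auto simp: Xhat_def)
  have el: "D_elem (\<beta> K) K (z K) (\<lambda>x. Pipp_mesh k \<beta> v K x - v K x) = 0"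
    "pairing (body K) (w K) (weak_dderiv (\<beta> K) (body K) (\<lambda>x. Pipp_mesh k \<beta> v K x - v K x)) = 0" if K: "K \<in> \<T>" for K
  proof -
    interpret nondegenerate_simplex K by (rule settingD(1)[OF s K])
    have vK: "v K \<in> W_space q (\<beta> K) K" using v K by (auto simp: W_mesh_def)
    have zK: "z K \<in> poly_space (int k)" using z(1) K by (auto simp: S_mesh_def poly_mesh_def)
    have wK: "w K \<in> poly_space (int k - 1)" using w K by (auto simp: poly_mesh_def)
    note g = fortin_global_element[OF setting_admissible[OF s K \<theta>] W_space_graph_fun(1)[OF q vK]]
    show "D_elem (\<beta> K) K (z K) (\<lambda>x. Pipp_mesh k \<beta> v K x - v K x) = 0"
      unfolding Pipp_mesh_def by (rule g(1)[OF zK])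
    show "pairing (body K) (w K) (weak_dderiv (\<beta> K) (body K) (\<lambda>x. Pipp_mesh k \<beta> v K x - v K x)) = 0"
      unfolding Pipp_mesh_def by (rule g(2)[OF wK])
  qed
  then show ?thesis unfolding bform_def z(2) D_mesh_def by simp
qed

lemma W_mesh_norm_le:
  assumes q: "1 < q" and C: "0 \<le> C" and u: "\<And>K. K \<in> \<T> \<Longrightarrow> 0 \<le> W_norm q (\<beta> K) K (u K)" 
    and le: "\<And>K. K \<in> \<T> \<Longrightarrow> W_norm q (\<beta> K) K (u K) \<le> C * W_norm q (\<beta> K) K (v K)"
    and v: "\<And>K. K \<in> \<T> \<Longrightarrow> 0 \<le> W_norm q (\<beta> K) K (v K)"
  shows "W_mesh_norm q \<beta> \<T> u \<le> C * W_mesh_norm q \<beta> \<T> v"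
proof -
  have "(\<Sum>K\<in>\<T>. W_norm q (\<beta> K) K (u K) powr q) \<le> (\<Sum>K\<in>\<T>. C powr q * W_norm q (\<beta> K) K (v K) powr q)"
  proof (rule sum_mono)
    fix K assume K: "K \<in> \<T>"
    have "W_norm q (\<beta> K) K (u K) powr q \<le> (C * W_norm q (\<beta> K) K (v K)) powr q"
      using u[OF K] le[OF K] q by (intro powr_mono2) auto
    then show "W_norm q (\<beta> K) K (u K) powr q \<le> C powr q * W_norm q (\<beta> K) K (v K) powr q"
      using C v[OF K] by (simp add: powr_mult)
  qed
  also have "\<dots> = C powr q * (\<Sum>K\<in>\<T>. W_norm q (\<beta> K) K (v K) powr q)" by (simp add: sum_distrib_left)
  finally have "W_mesh_norm q \<beta> \<T> u \<le> (C powr q * (\<Sum>K\<in>\<T>. W_norm q (\<beta> K) K (v K) powr q)) powr (1 / q)"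
    unfolding W_mesh_norm_def using q by (intro powr_mono2 sum_nonneg) auto
  also have "\<dots> = C * W_mesh_norm q \<beta> \<T> v"
    unfolding W_mesh_norm_def using q C by (simp add: powr_mult powr_powr sum_nonneg)
  finally show ?thesis .
qed

lemma W_norm_nonneg:
  assumes "nondegenerate_simplex K" "b \<noteq> 0" shows "0 \<le> W_norm q b K v"
proof -
  interpret nondegenerate_simplex K by (rule assms(1))
  have "0 \<le> elem_diam K" using vertex_dist_le_diam[of None None] by simp
  then show ?thesis unfolding W_norm_def by (intro add_nonneg_nonneg mult_nonneg_nonneg) auto
qed

lemma weighted_bound:
  fixes a \<sigma> :: real
  assumes "0 < a" "a \<le> \<sigma>" "P \<le> C * (x + a * y)" "D \<le> C * y" "0 \<le> C" "0 \<le> x" "0 \<le> y"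
  shows "inverse \<sigma> * P + D \<le> (2 * C) * (inverse \<sigma> * x + y)"
proof -
  have s: "0 < \<sigma>" using assms by linarith
  have "inverse \<sigma> * P \<le> inverse \<sigma> * (C * (x + a * y))" using assms s by (intro mult_left_mono) auto
  also have "\<dots> = C * (inverse \<sigma> * x + (inverse \<sigma> * a) * y)" by (simp add: algebra_simps)
  also have "\<dots> \<le> C * (inverse \<sigma> * x + 1 * y)"
  proof (intro mult_left_mono add_left_mono mult_right_mono assms)
    show "inverse \<sigma> * a \<le> 1" using s assms(2) by (simp add: field_simps)
  qed
  finally have "inverse \<sigma> * P + D \<le> C * (inverse \<sigma> * x + y) + C * y" using assms(4) by simp
  also have "\<dots> \<le> C * (inverse \<sigma> * x + y) + C * (inverse \<sigma> * x + y)"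
    using assms s by (intro add_left_mono mult_left_mono) auto
  finally show ?thesis by simp
qed

theorem theorem6p4:
  fixes p q \<kappa>\<^sub>0 :: real
  assumes "1 < p" and "q = p / (p - 1)" and "0 < \<kappa>\<^sub>0"
  shows
    "(\<forall>k::nat. \<forall>\<theta>\<^sub>0::real. \<forall>(\<Omega> :: (real^'n::finite) set) \<T> \<beta>.
        1 \<le> k \<longrightarrow> 0 < \<theta>\<^sub>0 \<longrightarrow> \<theta>\<^sub>0 \<le> 1 \<longrightarrow> setting k \<kappa>\<^sub>0 \<theta>\<^sub>0 \<Omega> \<T> \<beta> \<longrightarrow>
        (\<forall>K\<in>\<T>.
           (\<forall>v\<in>W_space q (\<beta> K) K.
              Pipp_elem k (\<beta> K) K v \<in> Vpp k (\<beta> K) K \<and>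
              (\<forall>w\<in>poly_perp (int k) K. D_elem (\<beta> K) K w (\<lambda>x. Pipp_elem k (\<beta> K) K v x - v x) = 0) \<and>
              (\<forall>z\<in>poly_space (int k - 2). pairing (body K) z (\<lambda>x. Pipp_elem k (\<beta> K) K v x - v x) = 0) \<and>
              (\<forall>c\<in>poly_space 0. pairing (body K) c (\<lambda>x. Pipp_elem k (\<beta> K) K v x - v x) = 0)) \<and>
           (\<forall>c\<in>poly_space 0. Pipp_elem k (\<beta> K) K c = c) \<and>
           (2 \<le> k \<longrightarrow>
              (\<forall>v\<in>W_space q (\<beta> K) K. Pipp_elem k (\<beta> K) K v = Pip_elem k (\<beta> K) K v) \<and>
              Vpp k (\<beta> K) K = Vp k (\<beta> K) K) \<and>
           (k = 1 \<longrightarrow> 2 \<le> CARD('n) \<longrightarrow>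
              bij_betw (\<lambda>(u, c, t). \<lambda>x. u x + c x + t x)
                (V k (\<beta> K) K \<times> poly_space 0 \<times> span_bubble K) (Vpp k (\<beta> K) K))) \<and>
        (\<forall>v\<in>W_mesh q \<beta> \<T>. \<forall>w\<in>poly_mesh (int k - 1) \<T>. \<forall>\<mu>\<in>Xhat (int k) \<Omega> \<beta> \<T>.
           bform \<beta> \<T> (w, \<mu>) (\<lambda>K x. Pipp_mesh k \<beta> v K x - v K x) = 0))
     \<and>
     (\<exists>C::real. \<forall>\<theta>\<^sub>0::real. \<forall>(\<Omega> :: (real^'n) set) \<T> \<beta>.
        0 < \<theta>\<^sub>0 \<longrightarrow> \<theta>\<^sub>0 \<le> 1 \<longrightarrow> setting 1 \<kappa>\<^sub>0 \<theta>\<^sub>0 \<Omega> \<T> \<beta> \<longrightarrow>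
        (\<forall>K\<in>\<T>. \<forall>v\<in>W_space q (\<beta> K) K.
           Lr_norm q (body K) (Pipp_elem 1 (\<beta> K) K v)
             \<le> C * (Lr_norm q (body K) v
                     + elem_diam K / norm (\<beta> K) * Lr_norm q (body K) (weak_dderiv (\<beta> K) (body K) v)) \<and>
           Lr_norm q (body K) (weak_dderiv (\<beta> K) (body K) (Pipp_elem 1 (\<beta> K) K v))
             \<le> C * Lr_norm q (body K) (weak_dderiv (\<beta> K) (body K) v)) \<and>
        (\<forall>\<sigma>. (\<forall>K\<in>\<T>. elem_diam K / norm (\<beta> K) \<le> \<sigma> K) \<longrightarrow>
           (\<forall>K\<in>\<T>. \<forall>v\<in>W_space q (\<beta> K) K.
              inverse (\<sigma> K) * Lr_norm q (body K) (Pipp_elem 1 (\<beta> K) K v)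
                + Lr_norm q (body K) (weak_dderiv (\<beta> K) (body K) (Pipp_elem 1 (\<beta> K) K v))
              \<le> C * (inverse (\<sigma> K) * Lr_norm q (body K) v
                      + Lr_norm q (body K) (weak_dderiv (\<beta> K) (body K) v)))))
     \<and>
     (\<exists>C :: nat \<Rightarrow> real \<Rightarrow> real.
        (\<forall>\<theta> \<theta>'. C 1 \<theta> = C 1 \<theta>') \<and>
        (\<forall>k::nat. \<forall>\<theta>\<^sub>0::real. \<forall>(\<Omega> :: (real^'n) set) \<T> \<beta>.
           1 \<le> k \<longrightarrow> 0 < \<theta>\<^sub>0 \<longrightarrow> \<theta>\<^sub>0 \<le> 1 \<longrightarrow> setting k \<kappa>\<^sub>0 \<theta>\<^sub>0 \<Omega> \<T> \<beta> \<longrightarrow>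
           (\<forall>K\<in>\<T>. \<forall>v\<in>W_space q (\<beta> K) K.
              W_norm q (\<beta> K) K (Pipp_elem k (\<beta> K) K v) \<le> C k \<theta>\<^sub>0 * W_norm q (\<beta> K) K v) \<and>
           (\<forall>v\<in>W_mesh q \<beta> \<T>.
              W_mesh_norm q \<beta> \<T> (Pipp_mesh k \<beta> v) \<le> C k \<theta>\<^sub>0 * W_mesh_norm q \<beta> \<T> v)))"
proof -
  have q: "1 < q" using assms(1) unfolding assms(2) by (simp add: less_divide_eq)
  note \<kappa> = assms(3)
  let ?t = "flux_const CARD('n option) \<kappa>\<^sub>0"
  define stab where "stab k C \<longleftrightarrow> 0 \<le> C \<and> (\<forall>(K :: 'n lsimplex) b \<theta>\<^sub>0. nondegenerate_simplex K \<longrightarrow> 0 < \<theta>\<^sub>0 \<longrightarrow> b \<noteq> 0 \<longrightarrow>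
     matrix_norm (elem_matrix K) * matrix_norm (matrix_inv (elem_matrix K)) \<le> \<kappa>\<^sub>0 \<longrightarrow>
     (k = 1 \<or> (\<forall>i. \<bar>b \<bullet> outer_normal K i\<bar> \<ge> \<theta>\<^sub>0 * norm b)) \<longrightarrow>
     (\<forall>v\<in>W_space q b K.
       Lr_norm q (body K) (Pipp_elem k b K v) \<le> C / ?t k \<theta>\<^sub>0 * W_norm q b K v \<and>
       (k = 1 \<longrightarrow> Lr_norm q (body K) (weak_dderiv b (body K) (Pipp_elem k b K v))
          \<le> C / ?t k \<theta>\<^sub>0 * Lr_norm q (body K) (weak_dderiv b (body K) v)) \<and>
       W_norm q b K (Pipp_elem k b K v) \<le> C / ?t k \<theta>\<^sub>0 * W_norm q b K v))" for k C
  have "\<exists>C. 1 \<le> k \<longrightarrow> stab k C" for k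
    using fortin_stability[of k q \<kappa>\<^sub>0, where 'n = 'n] q \<kappa> unfolding stab_def by blast
  then obtain C where C: "\<And>k. 1 \<le> k \<Longrightarrow> stab k (C k)" by metis
  have tpos: "0 < ?t k \<theta>" if "0 < \<theta>" for k \<theta> by (rule flux_const_pos) (use \<kappa> that in auto)
  have bounds: "Lr_norm q (body K) (Pipp_elem k (\<beta> K) K v) \<le> C k / ?t k \<theta>\<^sub>0 * W_norm q (\<beta> K) K v"
      "k = 1 \<Longrightarrow> Lr_norm q (body K) (weak_dderiv (\<beta> K) (body K) (Pipp_elem k (\<beta> K) K v))
          \<le> C k / ?t k \<theta>\<^sub>0 * Lr_norm q (body K) (weak_dderiv (\<beta> K) (body K) v)"
      "W_norm q (\<beta> K) K (Pipp_elem k (\<beta> K) K v) \<le> C k / ?t k \<theta>\<^sub>0 * W_norm q (\<beta> K) K v"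
      "0 \<le> C k / ?t k \<theta>\<^sub>0"
    if "1 \<le> k" "0 < \<theta>\<^sub>0" "setting k \<kappa>\<^sub>0 \<theta>\<^sub>0 \<Omega> \<T> \<beta>" "K \<in> \<T>" "v \<in> W_space q (\<beta> K) K"
    for k \<theta>\<^sub>0 \<Omega> and \<T> :: "'n lsimplex set" and \<beta> K v
  proof -
    note st = C[OF that(1), unfolded stab_def]
    note b = conjunct2[OF st, rule_format, OF settingD(1)[OF that(3,4)] that(2) settingD(2,3,4)[OF that(3,4)] that(5)]
    show "Lr_norm q (body K) (Pipp_elem k (\<beta> K) K v) \<le> C k / ?t k \<theta>\<^sub>0 * W_norm q (\<beta> K) K v"
      "k = 1 \<Longrightarrow> Lr_norm q (body K) (weak_dderiv (\<beta> K) (body K) (Pipp_elem k (\<beta> K) K v))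
          \<le> C k / ?t k \<theta>\<^sub>0 * Lr_norm q (body K) (weak_dderiv (\<beta> K) (body K) v)"
      "W_norm q (\<beta> K) K (Pipp_elem k (\<beta> K) K v) \<le> C k / ?t k \<theta>\<^sub>0 * W_norm q (\<beta> K) K v"
      using b by blast+
    show "0 \<le> C k / ?t k \<theta>\<^sub>0" using conjunct1[OF st] tpos[OF that(2), of k] by simp
  qed
  show ?thesis
  proof (intro conjI, goal_cases)
    case 1
    show ?case
    proof (intro allI impI, goal_cases)
      case (1 k \<theta>\<^sub>0 \<Omega> \<T> \<beta>)
      then show ?case
      proof (intro conjI ballI impI, goal_cases)
        case (1 K v) then show ?case by (intro setting_fortin_local(1)[OF q])
      next
        case (2 K v w) then show ?case by (intro setting_fortin_local(2)[OF q])
      next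
        case (3 K v z) then show ?case by (intro setting_fortin_local(3)[OF q])
      next
        case (4 K v c) then show ?case by (intro setting_fortin_local(4)[OF q])
      next
        case (5 K c) then show ?case by (intro setting_fortin_local(5)[OF q])
      next
        case (6 K v) then show ?case by (intro setting_fortin_local(6)[OF q])
      next
        case (7 K) then show ?case by (intro setting_fortin_local(7)[OF q])
      next
        case (8 K) then show ?case by (intro setting_fortin_local(8)[OF q])
      next
        case (9 v w \<mu>) then show ?case by (intro fortin_global[OF q])
      qed
    qed
  next
    case 2
    define t where "t = 1 / (real CARD('n option))\<^sup>2"
    let ?C = "C 1 / t"
    have tt: "?t 1 \<theta> = t" for \<theta> by (simp add: flux_const_def t_def)
    show ?case
    proof (rule exI[of _ "2 * ?C"], intro allI impI conjI ballI)
      fix \<theta>\<^sub>0 :: real and \<Omega> :: "(real^'n) set" and \<T> \<beta> K v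
      assume \<theta>: "0 < \<theta>\<^sub>0" and s: "setting 1 \<kappa>\<^sub>0 \<theta>\<^sub>0 \<Omega> \<T> \<beta>" and K: "K \<in> \<T>" and v: "v \<in> W_space q (\<beta> K) K"
      let ?v = "Lr_norm q (body K) v" and ?g = "Lr_norm q (body K) (weak_dderiv (\<beta> K) (body K) v)" and ?a = "elem_diam K / norm (\<beta> K)"
      note b = bounds[OF order_refl \<theta> s K v, unfolded tt]
      have W0: "0 \<le> W_norm q (\<beta> K) K v" by (rule W_norm_nonneg[OF settingD(1,2)[OF s K]])
      have "?C * W_norm q (\<beta> K) K v \<le> 2 * ?C * W_norm q (\<beta> K) K v" using b(4) W0 by (intro mult_right_mono) auto
      then show "Lr_norm q (body K) (Pipp_elem 1 (\<beta> K) K v) \<le> 2 * ?C * (?v + ?a * ?g)"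
        using b(1) unfolding W_norm_def by linarith
      have "?C * ?g \<le> 2 * ?C * ?g" using b(4) by (intro mult_right_mono) auto
      then show "Lr_norm q (body K) (weak_dderiv (\<beta> K) (body K) (Pipp_elem 1 (\<beta> K) K v)) \<le> 2 * ?C * ?g"
        using b(2)[OF refl] by linarith
    next
      fix \<theta>\<^sub>0 :: real and \<Omega> :: "(real^'n) set" and \<T> \<beta> \<sigma> K v
      assume \<theta>: "0 < \<theta>\<^sub>0" and s: "setting 1 \<kappa>\<^sub>0 \<theta>\<^sub>0 \<Omega> \<T> \<beta>" and \<sigma>: "\<forall>K\<in>\<T>. elem_diam K / norm (\<beta> K) \<le> \<sigma> K"
        and K: "K \<in> \<T>" and v: "v \<in> W_space q (\<beta> K) K"
      interpret nondegenerate_simplex K by (rule settingD(1)[OF s K])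
      note b = bounds[OF order_refl \<theta> s K v, unfolded tt]
      have "0 < elem_diam K / norm (\<beta> K)"
      proof -
        have "norm (\<beta> K) > 0" using settingD(2)[OF s K] by simp
        moreover have "0 < norm (K (Some undefined) - K None)"
          using grad_bary_edge[of None "Some undefined" None] by auto
        then have "0 < elem_diam K" using vertex_dist_le_diam[of "Some undefined" None] by linarith
        ultimately show ?thesis by simp
      qed
      then show "inverse (\<sigma> K) * Lr_norm q (body K) (Pipp_elem 1 (\<beta> K) K v)
                + Lr_norm q (body K) (weak_dderiv (\<beta> K) (body K) (Pipp_elem 1 (\<beta> K) K v))
              \<le> 2 * ?C * (inverse (\<sigma> K) * Lr_norm q (body K) v
                      + Lr_norm q (body K) (weak_dderiv (\<beta> K) (body K) v))"
        using \<sigma> K b(1,2,4) by (intro weighted_bound[of "elem_diam K / norm (\<beta> K)"]) (auto simp: W_norm_def)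
    qed
  next
    case 3
    let ?D = "\<lambda>k \<theta>. C k / ?t k \<theta>"
    show ?case
    proof (rule exI[of _ ?D], intro conjI allI impI ballI)
      show "?D 1 \<theta> = ?D 1 \<theta>'" for \<theta> \<theta>' by (simp add: flux_const_def)
      fix k :: nat and \<theta>\<^sub>0 :: real and \<Omega> :: "(real^'n) set" and \<T> \<beta>
      assume k: "1 \<le> k" and \<theta>: "0 < \<theta>\<^sub>0" and s: "setting k \<kappa>\<^sub>0 \<theta>\<^sub>0 \<Omega> \<T> \<beta>"
      show "W_norm q (\<beta> K) K (Pipp_elem k (\<beta> K) K v) \<le> ?D k \<theta>\<^sub>0 * W_norm q (\<beta> K) K v" 
        if "K \<in> \<T>" "v \<in> W_space q (\<beta> K) K" for K v
        by (rule bounds(3)[OF k \<theta> s that])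
      fix v assume v: "v \<in> W_mesh q \<beta> \<T>"
      have D0: "0 \<le> ?D k \<theta>\<^sub>0" using C[OF k] tpos[OF \<theta>, of k] by (simp add: stab_def)
      show "W_mesh_norm q \<beta> \<T> (Pipp_mesh k \<beta> v) \<le> ?D k \<theta>\<^sub>0 * W_mesh_norm q \<beta> \<T> v"
      proof (rule W_mesh_norm_le[OF q D0])
        fix K assume K: "K \<in> \<T>"
        show "0 \<le> W_norm q (\<beta> K) K (Pipp_mesh k \<beta> v K)" "0 \<le> W_norm q (\<beta> K) K (v K)"
          by (rule W_norm_nonneg[OF settingD(1,2)[OF s K]])+
        have "v K \<in> W_space q (\<beta> K) K" using v K by (auto simp: W_mesh_def)
        then show "W_norm q (\<beta> K) K (Pipp_mesh k \<beta> v K) \<le> ?D k \<theta>\<^sub>0 * W_norm q (\<beta> K) K (v K)"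
          unfolding Pipp_mesh_def by (rule bounds(3)[OF k \<theta> s K])
      qed
    qed
  qed
qed

end
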